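(* Let $\mathcal{S}$ be a species or a linear species such that $|\mathcal{S}(\emptyset)|=0$ and $|\mathcal{S}(\{1\})|=0$. Let $\mathcal{H}_{\mathcal{S}}$, $\mathcal{H}^r_{\mathcal{S}}$, $\mathcal{H}^e_{\mathcal{S}}$, $\mathcal{H}^{re}_{\mathcal{S}}$, $\mathcal{H}^h_{\mathcal{S}}$ be the weighted species of $\mathcal{S}$-edge-decorated hypertrees, rooted hypertrees, edge-pointed hypertrees, edge-pointed rooted hypertrees and hollow hypertrees. Then the following (isomorphisms of weighted species) hold: $$\mathcal{H}^r_{\mathcal{S}} =X \times \mathcal{H}'_{\mathcal{S}},$$ $$t\, \mathcal{H}^r_{\mathcal{S}} = X + X \times \operatorname{Comm} \circ(t \times \mathcal{H}^h_{\mathcal{S}}),$$ $$\mathcal{H}^h_{\mathcal{S}} = \mathcal{S}' \circ t\, \mathcal{H}^r_{\mathcal{S}},$$ $$\mathcal{H}^e_{\mathcal{S}}= \mathcal{S} \circ t\, \mathcal{H}^r_{\mathcal{S}},$$ $$\mathcal{H}^{re}_{\mathcal{S}} =\mathcal{H}^h_{\mathcal{S}} \times t\, \mathcal{H}^r_{\mathcal{S}} = t^{-1}\, X \times \bigl( X\times(1+\operatorname{Comm})\bigr) \circ (t\,\mathcal{H}^h_{\mathcal{S}}).$$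
   Context: A hypergraph on a finite set $V$ is a pair $(V,E)$ with $E$ a set of subsets of $V$ of cardinality at least two (the edges). A hypertree on $V$ is a hypergraph with $V\neq\emptyset$ in which any two vertices are joined by one and only one walk with distinct edges; equivalently, the bipartite incidence graph (on $V\sqcup E$) is a tree. The one-vertex hypergraph without edges is a hypertree. A rooted hypertree has a distinguished vertex; an edge-pointed hypertree has a distinguished edge; an edge-pointed rooted hypertree has a distinguished edge and a distinguished vertex of that edge. A hollow hypertree on $I$ is a hypertree on $\{\#\}\sqcup I$ such that $\#$ (the gap) belongs to exactly one edge. A species is a functor from finite sets and bijections to finite sets; a linear species is such a functor to vector spaces (cardinalities then mean dimensions). An $\mathcal{S}$-edge-decorated (rooted, ...) hypertree is such a hypertree with, for every edge $e$, a chosen element of $\mathcal{S}(V_e)$, $V_e$ the set of vertices of $e$ including the gap if it lies in $e$ (multilinearly, i.e. $\bigoplus_H\bigotimes_e\mathcal{S}(V_e)$, for linear species). The species $\mathcal{H}^h_{\mathcal S}$ assigns to $I$ the decorated hollow hypertrees on $\{\#\}\sqcup I$. Each hypertree with edge set $E$ has weight $t^{|E|-1}$; multiplying a species by $t^{\pm1}$ multiplies all weights by $t^{\pm1}$. Operations: $F'(I)=F(I\sqcup\{\bullet\})$; $(F+G)(I)=F(I)\sqcup G(I)$; $(F\times G)(I)=\bigsqcup_{I=I_1\sqcup I_2}F(I_1)\times G(I_2)$; $(F\circ G)(I)=\bigsqcup_{\pi}F(\pi)\times\prod_{J\in\pi}G(J)$ over partitions $\pi$ of $I$ into non-empty blocks.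 $X$ is the singleton species ($X(I)=\{I\}$ if $|I|=1$, else $\emptyset$); $\operatorname{Comm}(I)=\{I\}$ if $|I|\ge1$, else $\emptyset$; $1$ is the species with one structure on $\emptyset$ and none otherwise. In the formulas $\circ$ binds more tightly than $\times$. *)

theory Defs
  imports
    Complex_Main
    "HOL-Library.FSet"
    "HOL-Library.FuncSet"
    "HOL-Library.Disjoint_Sets"
    "HOL-Library.Function_Algebras"
    "HOL-Library.Product_Plus"
begin

section \<open>Labels\<close>

text \<open>
  Species are evaluated on finite sets of labels. The labels are the hereditarily finite sets over
  arbitrary atoms, because the operations on species evaluate a species on sets \<open>I \<union> {\<bullet>}\<close> and on
  partitions of \<open>I\<close>, so that finite sets of labels have to be labels themselves.
\<close>

datatype 'a lab = Atom 'a | Block "'a lab fset"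

definition blk :: "'a lab set \<Rightarrow> 'a lab" where
  "blk A = Block (Abs_fset A)"

primrec unblk :: "'a lab \<Rightarrow> 'a lab set" where
  "unblk (Atom a) = {}"
| "unblk (Block A) = fset A"

lemma unblk_blk: "finite A \<Longrightarrow> unblk (blk A) = A"
  by (simp add: blk_def Abs_fset_inverse)

lemma inj_on_blk: "inj_on blk {A. finite A}"
  by (metis inj_onI mem_Collect_eq unblk_blk)

text \<open>
  \<open>blk A\<close> serves as the additional point of \<open>A \<squnion> {\<bullet>}\<close> and of \<open>A \<squnion> {#}\<close>; it is never an element of
  the finite set \<open>A\<close>.
\<close>

lemma blk_notin:
  assumes "finite A"
  shows "blk A \<notin> A"
proof
  assume "blk A \<in> A"
  then have "Block (Abs_fset A) |\<in>| Abs_fset A"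
    using assms by (simp add: blk_def Abs_fset_inverse)
  moreover have "x |\<in>| B \<Longrightarrow> size x < size (Block B)" for x :: "'a lab" and B
    by (auto simp: size_fset_simps less_Suc_eq_le intro!: order.trans[OF _ member_le_sum])
  ultimately show False by blast
qed

definition add_pt :: "'a lab set \<Rightarrow> 'a lab set" where
  "add_pt A = insert (blk A) A"

definition ext_map :: "'a lab set \<Rightarrow> ('a lab \<Rightarrow> 'a lab) \<Rightarrow> 'a lab \<Rightarrow> 'a lab" where
  "ext_map A \<sigma> = (\<lambda>x. if x = blk A then blk (\<sigma> ` A) else \<sigma> x)"

definition blk_map :: "('a lab \<Rightarrow> 'a lab) \<Rightarrow> 'a lab \<Rightarrow> 'a lab" where
  "blk_map \<sigma> x = blk (\<sigma> ` unblk x)"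


section \<open>Hypertrees\<close>

definition hypergraph :: "'v set \<Rightarrow> 'v set set \<Rightarrow> bool" where
  "hypergraph V E \<longleftrightarrow> finite V \<and> (\<forall>e\<in>E. e \<subseteq> V \<and> card e \<ge> 2)"

text \<open>
  A walk from \<open>v\<close> is the list of its steps, each consisting of the edge taken and the vertex reached.
  A step changes the vertex: otherwise a walk could be prolonged by an idle step along
  a further edge, and walks with distinct edges would not be unique even in a tree.
\<close>

fun walk :: "'v set set \<Rightarrow> 'v \<Rightarrow> ('v set \<times> 'v) list \<Rightarrow> 'v \<Rightarrow> bool" where
  "walk E v [] w \<longleftrightarrow> v = w"
| "walk E v ((e, u) # p) w \<longleftrightarrow> e \<in> E \<and> v \<in> e \<and> u \<in> e \<and> v \<noteq> u \<and> walk E u p w"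

definition hypertree :: "'v set \<Rightarrow> 'v set set \<Rightarrow> bool" where
  "hypertree V E \<longleftrightarrow> hypergraph V E \<and> V \<noteq> {} \<and>
     (\<forall>v\<in>V. \<forall>w\<in>V. v \<noteq> w \<longrightarrow> (\<exists>!p. walk E v p w \<and> distinct (map fst p)))"


section \<open>Species and weighted species\<close>

text \<open>
  \<open>tr F I \<sigma>\<close> is the transport \<open>F(I) \<rightarrow> F(\<sigma> ` I)\<close> along the bijection \<open>I \<rightarrow> \<sigma> ` I\<close> given by a function
  \<open>\<sigma>\<close> that is injective on \<open>I\<close>.
\<close>

record ('a, 's) species =
  str :: "'a lab set \<Rightarrow> 's set"
  tr :: "'a lab set \<Rightarrow> ('a lab \<Rightarrow> 'a lab) \<Rightarrow> 's \<Rightarrow> 's"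

definition is_species :: "('a, 's) species \<Rightarrow> bool" where
  "is_species F \<longleftrightarrow> (\<forall>I. finite I \<longrightarrow>
     finite (str F I) \<and>
     (\<forall>s\<in>str F I. tr F I id s = s) \<and>
     (\<forall>\<sigma>. inj_on \<sigma> I \<longrightarrow>
        (\<forall>s\<in>str F I. tr F I \<sigma> s \<in> str F (\<sigma> ` I)) \<and>
        (\<forall>\<tau>. (\<forall>x\<in>I. \<tau> x = \<sigma> x) \<longrightarrow> (\<forall>s\<in>str F I. tr F I \<tau> s = tr F I \<sigma> s)) \<and>
        (\<forall>\<tau>. inj_on \<tau> (\<sigma> ` I) \<longrightarrow>
           (\<forall>s\<in>str F I. tr F I (\<tau> \<circ> \<sigma>) s = tr F (\<sigma> ` I) \<tau> (tr F I \<sigma> s)))))"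

text \<open>The weight of a structure \<open>s\<close> is \<open>t\<close> to the power \<open>wt F s\<close>.\<close>

record ('a, 's) wspecies = "('a, 's) species" +
  wt :: "'s \<Rightarrow> int"

definition weightless :: "('a, 's) species \<Rightarrow> ('a, 's) wspecies" where
  "weightless F = \<lparr>str = str F, tr = tr F, wt = (\<lambda>_. 0)\<rparr>"

definition wiso :: "('a, 's) wspecies \<Rightarrow> ('a, 'r) wspecies \<Rightarrow> bool" (infix \<open>\<cong>\<^sub>w\<close> 50) where
  "F \<cong>\<^sub>w G \<longleftrightarrow> (\<exists>\<phi>. \<forall>I. finite I \<longrightarrow>
     bij_betw (\<phi> I) (str F I) (str G I) \<and>
     (\<forall>s\<in>str F I. wt G (\<phi> I s) = wt F s) \<and>
     (\<forall>\<sigma>. inj_on \<sigma> I \<longrightarrow> (\<forall>s\<in>str F I. \<phi> (\<sigma> ` I) (tr F I \<sigma> s) = tr G I \<sigma> (\<phi> I s))))"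

definition wX :: "('a, 'a lab set) wspecies" where
  "wX = \<lparr>str = (\<lambda>I. if card I = 1 then {I} else {}), tr = (\<lambda>I \<sigma> s. \<sigma> ` s), wt = (\<lambda>_. 0)\<rparr>"

definition wComm :: "('a, 'a lab set) wspecies" where
  "wComm = \<lparr>str = (\<lambda>I. if card I \<ge> 1 then {I} else {}), tr = (\<lambda>I \<sigma> s. \<sigma> ` s), wt = (\<lambda>_. 0)\<rparr>"

definition wOne :: "('a, unit) wspecies" where
  "wOne = \<lparr>str = (\<lambda>I. if I = {} then {()} else {}), tr = (\<lambda>I \<sigma> s. s), wt = (\<lambda>_. 0)\<rparr>"

text \<open>\<open>wshift k F\<close> is \<open>t\<close> to the power \<open>k\<close> times \<open>F\<close>.\<close>

definition wshift :: "int \<Rightarrow> ('a, 's) wspecies \<Rightarrow> ('a, 's) wspecies" where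
  "wshift k F = \<lparr>str = str F, tr = tr F, wt = (\<lambda>s. wt F s + k)\<rparr>"

definition wderiv :: "('a, 's) wspecies \<Rightarrow> ('a, 's) wspecies" where
  "wderiv F = \<lparr>str = (\<lambda>I. str F (add_pt I)), tr = (\<lambda>I \<sigma>. tr F (add_pt I) (ext_map I \<sigma>)), wt = wt F\<rparr>"

definition wsum :: "('a, 's) wspecies \<Rightarrow> ('a, 'r) wspecies \<Rightarrow> ('a, 's + 'r) wspecies"
    (infixl \<open>+\<^sub>w\<close> 65) where
  "F +\<^sub>w G = \<lparr>str = (\<lambda>I. str F I <+> str G I),
     tr = (\<lambda>I \<sigma>. map_sum (tr F I \<sigma>) (tr G I \<sigma>)),
     wt = case_sum (wt F) (wt G)\<rparr>"

definition wprod ::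
    "('a, 's) wspecies \<Rightarrow> ('a, 'r) wspecies \<Rightarrow> ('a, 'a lab set \<times> 'a lab set \<times> 's \<times> 'r) wspecies"
    (infixr \<open>\<times>\<^sub>w\<close> 70) where
  "F \<times>\<^sub>w G = \<lparr>
     str = (\<lambda>I. {(A, B, x, y). A \<union> B = I \<and> A \<inter> B = {} \<and> x \<in> str F A \<and> y \<in> str G B}),
     tr = (\<lambda>I \<sigma> (A, B, x, y). (\<sigma> ` A, \<sigma> ` B, tr F A \<sigma> x, tr G B \<sigma> y)),
     wt = (\<lambda>(A, B, x, y). wt F x + wt G y)\<rparr>"

text \<open>The blocks of a partition are non-empty by the definition of \<^const>\<open>partition_on\<close>.\<close>

definition wcomp ::
    "('a, 's) wspecies \<Rightarrow> ('a, 'r) wspecies \<Rightarrow>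
     ('a, 'a lab set set \<times> 's \<times> ('a lab set \<Rightarrow> 'r)) wspecies" (infixr \<open>\<circ>\<^sub>w\<close> 75) where
  "F \<circ>\<^sub>w G = \<lparr>
     str = (\<lambda>I. {(\<pi>, x, y). partition_on I \<pi> \<and> x \<in> str F (blk ` \<pi>) \<and> y \<in> PiE \<pi> (str G)}),
     tr = (\<lambda>I \<sigma> (\<pi>, x, y).
       (image \<sigma> ` \<pi>,
        tr F (blk ` \<pi>) (blk_map \<sigma>) x,
        \<lambda>K\<in>image \<sigma> ` \<pi>. let J = inv_into I \<sigma> ` K in tr G J \<sigma> (y J))),
     wt = (\<lambda>(\<pi>, x, y). wt F x + (\<Sum>J\<in>\<pi>. wt G (y J)))\<rparr>"


section \<open>Edge-decorated hypertrees\<close>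

text \<open>
  \<open>P I E\<close> is the set of possible pointings of the hypertree \<open>(I, E)\<close>, on which bijections \<open>\<sigma>\<close> of the
  vertices act by \<open>pm \<sigma>\<close>. A structure is a triple of the edge set, the pointing and the decoration.
\<close>

definition decorated ::
    "('a lab set \<Rightarrow> 'a lab set set \<Rightarrow> 'p set) \<Rightarrow> (('a lab \<Rightarrow> 'a lab) \<Rightarrow> 'p \<Rightarrow> 'p) \<Rightarrow> ('a, 's) species \<Rightarrow>
     ('a, 'a lab set set \<times> 'p \<times> ('a lab set \<Rightarrow> 's)) wspecies" where
  "decorated P pm S = \<lparr>
     str = (\<lambda>I. {(E, p, d). hypertree I E \<and> p \<in> P I E \<and> d \<in> PiE E (str S)}),
     tr = (\<lambda>I \<sigma> (E, p, d).
       (image \<sigma> ` E, pm \<sigma> p,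
        \<lambda>e'\<in>image \<sigma> ` E. let e = inv_into I \<sigma> ` e' in tr S e \<sigma> (d e))),
     wt = (\<lambda>(E, p, d). int (card E) - 1)\<rparr>"

definition HT :: "('a, 's) species \<Rightarrow> ('a, 'a lab set set \<times> unit \<times> ('a lab set \<Rightarrow> 's)) wspecies" where
  "HT = decorated (\<lambda>I E. {()}) (\<lambda>\<sigma> p. p)"

definition HT_r :: "('a, 's) species \<Rightarrow> ('a, 'a lab set set \<times> 'a lab \<times> ('a lab set \<Rightarrow> 's)) wspecies" where
  "HT_r = decorated (\<lambda>I E. I) (\<lambda>\<sigma> v. \<sigma> v)"

definition HT_e :: "('a, 's) species \<Rightarrow> ('a, 'a lab set set \<times> 'a lab set \<times> ('a lab set \<Rightarrow> 's)) wspecies" where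
  "HT_e = decorated (\<lambda>I E. E) (\<lambda>\<sigma> e. \<sigma> ` e)"

definition HT_re ::
    "('a, 's) species \<Rightarrow> ('a, 'a lab set set \<times> ('a lab set \<times> 'a lab) \<times> ('a lab set \<Rightarrow> 's)) wspecies" where
  "HT_re = decorated (\<lambda>I E. {(e, v). e \<in> E \<and> v \<in> e}) (\<lambda>\<sigma> (e, v). (\<sigma> ` e, \<sigma> v))"

text \<open>Hollow hypertrees on \<open>I\<close> are hypertrees on \<open>I \<squnion> {#}\<close>, so they are among the structures of \<open>H'(I)\<close>.\<close>

definition HT_h :: "('a, 's) species \<Rightarrow> ('a, 'a lab set set \<times> unit \<times> ('a lab set \<Rightarrow> 's)) wspecies" where
  "HT_h S = (wderiv (HT S))
     \<lparr>str := (\<lambda>I. {(E, p, d) \<in> str (wderiv (HT S)) I. card {e \<in> E. blk I \<in> e} = 1})\<rparr>"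


section \<open>Direct sums and tensor products of vector spaces\<close>

text \<open>
  A vector space over \<open>'k\<close> is given by a scalar multiplication on a type \<open>'v\<close> and a subspace of the
  resulting vector space.
\<close>

definition linear_on :: "('k \<Rightarrow> 'v \<Rightarrow> 'v) \<Rightarrow> ('k \<Rightarrow> 'w \<Rightarrow> 'w) \<Rightarrow> 'v::plus set \<Rightarrow> ('v \<Rightarrow> 'w::plus) \<Rightarrow> bool" where
  "linear_on s1 s2 V f \<longleftrightarrow>
     (\<forall>x\<in>V. \<forall>y\<in>V. f (x + y) = f x + f y) \<and> (\<forall>c. \<forall>x\<in>V. f (s1 c x) = s2 c (f x))"

definition scale_fun :: "('k \<Rightarrow> 'v \<Rightarrow> 'v) \<Rightarrow> 'k \<Rightarrow> ('x \<Rightarrow> 'v) \<Rightarrow> 'x \<Rightarrow> 'v" where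
  "scale_fun sc c f = (\<lambda>x. sc c (f x))"

definition dsum :: "'i set \<Rightarrow> ('i \<Rightarrow> 'v::zero set) \<Rightarrow> ('i \<Rightarrow> 'v) set" where
  "dsum A V = {f. finite {i. f i \<noteq> 0} \<and> (\<forall>i\<in>A. f i \<in> V i) \<and> (\<forall>i. i \<notin> A \<longrightarrow> f i = 0)}"

text \<open>
  Multilinear forms over a field separate the elements of a tensor product. So the tensor product
  of a finite family of vector spaces is realised by functionals on the multilinear forms of the
  family, spanned by the evaluations at the members \<open>x\<close> of the product of the family, which play
  the role of the elementary tensors.
\<close>

definition mforms ::
    "('k::field \<Rightarrow> 'v::ab_group_add \<Rightarrow> 'v) \<Rightarrow> 'j set \<Rightarrow> ('j \<Rightarrow> 'v set) \<Rightarrow> (('j \<Rightarrow> 'v) \<Rightarrow> 'k) set" where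
  "mforms sc J V = {m. \<forall>j\<in>J. \<forall>x\<in>PiE J V. linear_on sc (*) (V j) (\<lambda>u. m (x(j := u)))}"

definition tensor ::
    "('k::field \<Rightarrow> 'v::ab_group_add \<Rightarrow> 'v) \<Rightarrow> 'j set \<Rightarrow> ('j \<Rightarrow> 'v set) \<Rightarrow>
     ((('j \<Rightarrow> 'v) \<Rightarrow> 'k) \<Rightarrow> 'k) set" where
  "tensor sc J V = module.span (scale_fun (*))
     ((\<lambda>x m. if m \<in> mforms sc J V then m x else 0) ` PiE J V)"

text \<open>
  For a bijection \<open>\<rho> : J' \<rightarrow> J\<close> and linear maps \<open>h j : V j \<rightarrow> V' (\<rho>\<inverse> j)\<close>, the induced map from
  \<open>tensor J V\<close> to \<open>tensor J' V'\<close>; it maps the elementary tensor of \<open>x\<close> to that of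
  \<open>\<lambda>j'\<in>J'. h (\<rho> j') (x (\<rho> j'))\<close>.
\<close>

definition tensor_map ::
    "('k::field \<Rightarrow> 'v::ab_group_add \<Rightarrow> 'v) \<Rightarrow> 'j set \<Rightarrow> ('j \<Rightarrow> 'v set) \<Rightarrow> ('j \<Rightarrow> 'j) \<Rightarrow> ('j \<Rightarrow> 'v \<Rightarrow> 'v) \<Rightarrow>
     ((('j \<Rightarrow> 'v) \<Rightarrow> 'k) \<Rightarrow> 'k) \<Rightarrow> (('j \<Rightarrow> 'v) \<Rightarrow> 'k) \<Rightarrow> 'k" where
  "tensor_map sc J' V' \<rho> h T =
     (\<lambda>m. if m \<in> mforms sc J' V' then T (\<lambda>x. m (\<lambda>j'\<in>J'. h (\<rho> j') (x (\<rho> j')))) else 0)"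

definition bforms ::
    "('k::field \<Rightarrow> 'v::ab_group_add \<Rightarrow> 'v) \<Rightarrow> ('k \<Rightarrow> 'w::ab_group_add \<Rightarrow> 'w) \<Rightarrow> 'v set \<Rightarrow> 'w set \<Rightarrow>
     ('v \<Rightarrow> 'w \<Rightarrow> 'k) set" where
  "bforms s1 s2 V W = {m. (\<forall>y\<in>W. linear_on s1 (*) V (\<lambda>x. m x y)) \<and> (\<forall>x\<in>V. linear_on s2 (*) W (m x))}"

definition tensor2 ::
    "('k::field \<Rightarrow> 'v::ab_group_add \<Rightarrow> 'v) \<Rightarrow> ('k \<Rightarrow> 'w::ab_group_add \<Rightarrow> 'w) \<Rightarrow> 'v set \<Rightarrow> 'w set \<Rightarrow>
     (('v \<Rightarrow> 'w \<Rightarrow> 'k) \<Rightarrow> 'k) set" where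
  "tensor2 s1 s2 V W = module.span (scale_fun (*))
     ((\<lambda>(x, y) m. if m \<in> bforms s1 s2 V W then m x y else 0) ` (V \<times> W))"

definition tensor2_map ::
    "('k::field \<Rightarrow> 'v::ab_group_add \<Rightarrow> 'v) \<Rightarrow> ('k \<Rightarrow> 'w::ab_group_add \<Rightarrow> 'w) \<Rightarrow> 'v set \<Rightarrow> 'w set \<Rightarrow>
     ('v \<Rightarrow> 'v) \<Rightarrow> ('w \<Rightarrow> 'w) \<Rightarrow> (('v \<Rightarrow> 'w \<Rightarrow> 'k) \<Rightarrow> 'k) \<Rightarrow> ('v \<Rightarrow> 'w \<Rightarrow> 'k) \<Rightarrow> 'k" where
  "tensor2_map s1 s2 V' W' f g T =
     (\<lambda>m. if m \<in> bforms s1 s2 V' W' then T (\<lambda>x y. m (f x) (g y)) else 0)"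


section \<open>Linear species and weighted linear species\<close>

record ('a, 'k, 'v) lspecies =
  lstr :: "'a lab set \<Rightarrow> 'v set"
  ltr :: "'a lab set \<Rightarrow> ('a lab \<Rightarrow> 'a lab) \<Rightarrow> 'v \<Rightarrow> 'v"
  lscale :: "'k \<Rightarrow> 'v \<Rightarrow> 'v"

definition is_lspecies :: "('a, 'k::field, 'v::ab_group_add) lspecies \<Rightarrow> bool" where
  "is_lspecies F \<longleftrightarrow> vector_space (lscale F) \<and> (\<forall>I. finite I \<longrightarrow>
     module.subspace (lscale F) (lstr F I) \<and>
     (\<forall>v\<in>lstr F I. ltr F I id v = v) \<and>
     (\<forall>\<sigma>. inj_on \<sigma> I \<longrightarrow>
        linear_on (lscale F) (lscale F) (lstr F I) (ltr F I \<sigma>) \<and>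
        (\<forall>v\<in>lstr F I. ltr F I \<sigma> v \<in> lstr F (\<sigma> ` I)) \<and>
        (\<forall>\<tau>. (\<forall>x\<in>I. \<tau> x = \<sigma> x) \<longrightarrow> (\<forall>v\<in>lstr F I. ltr F I \<tau> v = ltr F I \<sigma> v)) \<and>
        (\<forall>\<tau>. inj_on \<tau> (\<sigma> ` I) \<longrightarrow>
           (\<forall>v\<in>lstr F I. ltr F I (\<tau> \<circ> \<sigma>) v = ltr F (\<sigma> ` I) \<tau> (ltr F I \<sigma> v)))))"

text \<open>
  A weighted linear species takes values in graded vector spaces: \<open>gstr F I n\<close> is the component of
  \<open>F(I)\<close> whose weight is \<open>t\<close> to the power \<open>n\<close>.
\<close>

record ('a, 'k, 'v) glspecies =
  gstr :: "'a lab set \<Rightarrow> int \<Rightarrow> 'v set"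
  gtr :: "'a lab set \<Rightarrow> int \<Rightarrow> ('a lab \<Rightarrow> 'a lab) \<Rightarrow> 'v \<Rightarrow> 'v"
  gscale :: "'k \<Rightarrow> 'v \<Rightarrow> 'v"

definition gweightless :: "('a, 'k, 'v::zero) lspecies \<Rightarrow> ('a, 'k, 'v) glspecies" where
  "gweightless F = \<lparr>gstr = (\<lambda>I n. if n = 0 then lstr F I else {0}),
     gtr = (\<lambda>I n \<sigma>. if n = 0 then ltr F I \<sigma> else id), gscale = lscale F\<rparr>"

definition giso ::
    "('a, 'k, 'v::plus) glspecies \<Rightarrow> ('a, 'k, 'w::plus) glspecies \<Rightarrow> bool" (infix \<open>\<cong>\<^sub>g\<close> 50) where
  "F \<cong>\<^sub>g G \<longleftrightarrow> (\<exists>\<phi>. \<forall>I n. finite I \<longrightarrow>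
     bij_betw (\<phi> I n) (gstr F I n) (gstr G I n) \<and>
     linear_on (gscale F) (gscale G) (gstr F I n) (\<phi> I n) \<and>
     (\<forall>\<sigma>. inj_on \<sigma> I \<longrightarrow>
        (\<forall>v\<in>gstr F I n. \<phi> (\<sigma> ` I) n (gtr F I n \<sigma> v) = gtr G I n \<sigma> (\<phi> I n v))))"

text \<open>The weighted linear species with the structures of \<open>F\<close> as basis.\<close>

definition glin :: "('a, 's) wspecies \<Rightarrow> ('a, 'k::field, 's \<Rightarrow> 'k) glspecies" where
  "glin F = \<lparr>
     gstr = (\<lambda>I n. dsum {s \<in> str F I. wt F s = n} (\<lambda>_. UNIV)),
     gtr = (\<lambda>I n \<sigma> f s. if s \<in> str F (\<sigma> ` I) \<and> wt F s = n
                then f (tr F (\<sigma> ` I) (inv_into I \<sigma>) s) else 0),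
     gscale = scale_fun (*)\<rparr>"

definition gX :: "('a, 'k::field, 'a lab set \<Rightarrow> 'k) glspecies" where
  "gX = glin wX"

definition gComm :: "('a, 'k::field, 'a lab set \<Rightarrow> 'k) glspecies" where
  "gComm = glin wComm"

definition gOne :: "('a, 'k::field, unit \<Rightarrow> 'k) glspecies" where
  "gOne = glin wOne"

definition gshift :: "int \<Rightarrow> ('a, 'k, 'v) glspecies \<Rightarrow> ('a, 'k, 'v) glspecies" where
  "gshift k F = \<lparr>gstr = (\<lambda>I n. gstr F I (n - k)), gtr = (\<lambda>I n. gtr F I (n - k)), gscale = gscale F\<rparr>"

definition gderiv :: "('a, 'k, 'v) glspecies \<Rightarrow> ('a, 'k, 'v) glspecies" where
  "gderiv F = \<lparr>gstr = (\<lambda>I. gstr F (add_pt I)),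
     gtr = (\<lambda>I n \<sigma>. gtr F (add_pt I) n (ext_map I \<sigma>)), gscale = gscale F\<rparr>"

definition gsum :: "('a, 'k, 'v) glspecies \<Rightarrow> ('a, 'k, 'w) glspecies \<Rightarrow> ('a, 'k, 'v \<times> 'w) glspecies"
    (infixl \<open>+\<^sub>g\<close> 65) where
  "F +\<^sub>g G = \<lparr>gstr = (\<lambda>I n. gstr F I n \<times> gstr G I n),
     gtr = (\<lambda>I n \<sigma>. map_prod (gtr F I n \<sigma>) (gtr G I n \<sigma>)),
     gscale = (\<lambda>c. map_prod (gscale F c) (gscale G c))\<rparr>"

text \<open>
  An index \<open>(A, B, a, b)\<close> stands for the summand formed by the tensor product of the component of
  \<open>F(A)\<close> of degree \<open>a\<close> and that of \<open>G(B)\<close> of degree \<open>b\<close>.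
\<close>

definition prod_idx :: "'a lab set \<Rightarrow> int \<Rightarrow> ('a lab set \<times> 'a lab set \<times> int \<times> int) set" where
  "prod_idx I n = {(A, B, a, b). A \<union> B = I \<and> A \<inter> B = {} \<and> a + b = n}"

definition gprod ::
    "('a, 'k::field, 'v::ab_group_add) glspecies \<Rightarrow> ('a, 'k, 'w::ab_group_add) glspecies \<Rightarrow>
     ('a, 'k, 'a lab set \<times> 'a lab set \<times> int \<times> int \<Rightarrow> ('v \<Rightarrow> 'w \<Rightarrow> 'k) \<Rightarrow> 'k) glspecies"
    (infixr \<open>\<times>\<^sub>g\<close> 70) where
  "F \<times>\<^sub>g G = \<lparr>
     gstr = (\<lambda>I n. dsum (prod_idx I n)
       (\<lambda>(A, B, a, b). tensor2 (gscale F) (gscale G) (gstr F A a) (gstr G B b))),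
     gtr = (\<lambda>I n \<sigma> f (A', B', a, b).
       if (A', B', a, b) \<in> prod_idx (\<sigma> ` I) n
       then let A = inv_into I \<sigma> ` A'; B = inv_into I \<sigma> ` B'
            in tensor2_map (gscale F) (gscale G) (gstr F A' a) (gstr G B' b)
                 (gtr F A a \<sigma>) (gtr G B b \<sigma>) (f (A, B, a, b))
       else 0),
     gscale = scale_fun (scale_fun (*))\<rparr>"

text \<open>
  An index \<open>(\<pi>, a, b)\<close> stands for the summand formed by the tensor product of the component of
  \<open>F(\<pi>)\<close> of degree \<open>a\<close> and those of the \<open>G(J)\<close>, \<open>J \<in> \<pi>\<close>, of degree \<open>b J\<close>.
\<close>

definition comp_idx :: "'a lab set \<Rightarrow> int \<Rightarrow> ('a lab set set \<times> int \<times> ('a lab set \<Rightarrow> int)) set" where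
  "comp_idx I n = {(\<pi>, a, b). partition_on I \<pi> \<and> b \<in> PiE \<pi> (\<lambda>_. UNIV) \<and> a + (\<Sum>J\<in>\<pi>. b J) = n}"

definition gcomp ::
    "('a, 'k::field, 'v::ab_group_add) glspecies \<Rightarrow> ('a, 'k, 'w::ab_group_add) glspecies \<Rightarrow>
     ('a, 'k, 'a lab set set \<times> int \<times> ('a lab set \<Rightarrow> int) \<Rightarrow>
        ('v \<Rightarrow> ((('a lab set \<Rightarrow> 'w) \<Rightarrow> 'k) \<Rightarrow> 'k) \<Rightarrow> 'k) \<Rightarrow> 'k) glspecies"
    (infixr \<open>\<circ>\<^sub>g\<close> 75) where
  "F \<circ>\<^sub>g G = \<lparr>
     gstr = (\<lambda>I n. dsum (comp_idx I n)
       (\<lambda>(\<pi>, a, b). tensor2 (gscale F) (scale_fun (*))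
          (gstr F (blk ` \<pi>) a) (tensor (gscale G) \<pi> (\<lambda>J. gstr G J (b J))))),
     gtr = (\<lambda>I n \<sigma> f (\<pi>', a, b').
       if (\<pi>', a, b') \<in> comp_idx (\<sigma> ` I) n
       then let \<tau> = inv_into I \<sigma>; \<pi> = image \<tau> ` \<pi>'; b = (\<lambda>J\<in>\<pi>. b' (\<sigma> ` J))
            in tensor2_map (gscale F) (scale_fun (*))
                 (gstr F (blk ` \<pi>') a) (tensor (gscale G) \<pi>' (\<lambda>K. gstr G K (b' K)))
                 (gtr F (blk ` \<pi>) a (blk_map \<sigma>))
                 (tensor_map (gscale G) \<pi>' (\<lambda>K. gstr G K (b' K)) (image \<tau>) (\<lambda>J. gtr G J (b J) \<sigma>))
                 (f (\<pi>, a, b))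
       else 0),
     gscale = scale_fun (scale_fun (*))\<rparr>"


section \<open>Hypertrees with edges decorated by a linear species\<close>

definition deco_idx ::
    "('a lab set \<Rightarrow> 'a lab set set \<Rightarrow> 'p set) \<Rightarrow> 'a lab set \<Rightarrow> int \<Rightarrow> ('a lab set set \<times> 'p) set" where
  "deco_idx P I n = {(E, p). hypertree I E \<and> p \<in> P I E \<and> int (card E) - 1 = n}"

definition gdecorated ::
    "('a lab set \<Rightarrow> 'a lab set set \<Rightarrow> 'p set) \<Rightarrow> (('a lab \<Rightarrow> 'a lab) \<Rightarrow> 'p \<Rightarrow> 'p) \<Rightarrow>
     ('a, 'k::field, 'v::ab_group_add) lspecies \<Rightarrow>
     ('a, 'k, 'a lab set set \<times> 'p \<Rightarrow> (('a lab set \<Rightarrow> 'v) \<Rightarrow> 'k) \<Rightarrow> 'k) glspecies" where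
  "gdecorated P pm S = \<lparr>
     gstr = (\<lambda>I n. dsum (deco_idx P I n) (\<lambda>(E, p). tensor (lscale S) E (lstr S))),
     gtr = (\<lambda>I n \<sigma> f (E', p').
       if (E', p') \<in> deco_idx P (\<sigma> ` I) n
       then let \<tau> = inv_into I \<sigma>
            in tensor_map (lscale S) E' (lstr S) (image \<tau>) (\<lambda>e. ltr S e \<sigma>) (f (image \<tau> ` E', pm \<tau> p'))
       else 0),
     gscale = scale_fun (scale_fun (*))\<rparr>"

definition gHT :: "('a, 'k::field, 'v::ab_group_add) lspecies \<Rightarrow>
    ('a, 'k, 'a lab set set \<times> unit \<Rightarrow> (('a lab set \<Rightarrow> 'v) \<Rightarrow> 'k) \<Rightarrow> 'k) glspecies" where
  "gHT = gdecorated (\<lambda>I E. {()}) (\<lambda>\<sigma> p. p)"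

definition gHT_r :: "('a, 'k::field, 'v::ab_group_add) lspecies \<Rightarrow>
    ('a, 'k, 'a lab set set \<times> 'a lab \<Rightarrow> (('a lab set \<Rightarrow> 'v) \<Rightarrow> 'k) \<Rightarrow> 'k) glspecies" where
  "gHT_r = gdecorated (\<lambda>I E. I) (\<lambda>\<sigma> v. \<sigma> v)"

definition gHT_e :: "('a, 'k::field, 'v::ab_group_add) lspecies \<Rightarrow>
    ('a, 'k, 'a lab set set \<times> 'a lab set \<Rightarrow> (('a lab set \<Rightarrow> 'v) \<Rightarrow> 'k) \<Rightarrow> 'k) glspecies" where
  "gHT_e = gdecorated (\<lambda>I E. E) (\<lambda>\<sigma> e. \<sigma> ` e)"

definition gHT_re :: "('a, 'k::field, 'v::ab_group_add) lspecies \<Rightarrow>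
    ('a, 'k, 'a lab set set \<times> 'a lab set \<times> 'a lab \<Rightarrow> (('a lab set \<Rightarrow> 'v) \<Rightarrow> 'k) \<Rightarrow> 'k) glspecies" where
  "gHT_re = gdecorated (\<lambda>I E. {(e, v). e \<in> E \<and> v \<in> e}) (\<lambda>\<sigma> (e, v). (\<sigma> ` e, \<sigma> v))"

definition gHT_h :: "('a, 'k::field, 'v::ab_group_add) lspecies \<Rightarrow>
    ('a, 'k, 'a lab set set \<times> unit \<Rightarrow> (('a lab set \<Rightarrow> 'v) \<Rightarrow> 'k) \<Rightarrow> 'k) glspecies" where
  "gHT_h S = (gderiv (gHT S))
     \<lparr>gstr := (\<lambda>I n. {f \<in> gstr (gderiv (gHT S)) I n.
        \<forall>E p. f (E, p) \<noteq> 0 \<longrightarrow> card {e \<in> E. blk I \<in> e} = 1})\<rparr>"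

end

(*
  Cutting a hypertree at a vertex v yields a set of hypertrees in which v lies on exactly one edge,
  that is, of hollow hypertrees with gap v. Removing an edge yields one rooted hypertree for every
  vertex of the edge, the roots being the vertices of the edge. Both cuts are inverted by gluing,
  and both keep the edges together with their vertices up to a bijection.
  Hence they are compatible with every decoration of the edges: a decorated species is determined by
  its undecorated structures together with the label sets of their edges, where a decoration is
  an element of a product over the edges in the case of species, and of a tensor product in the case
  of linear species. In the linear case all constructions are recognised by the universal property
  of a direct sum of tensor products, so that the bijections of the set case carry over.
*)

theory Submission
  imports Defs
begin


section \<open>Hypertrees and connectedness\<close>

text \<open>Every hypertree weighs \<open>t\<close> to its number of edges minus one, so every shape
  in play weighs its number of edges plus a constant. Multiplying rooted and hollow hypertrees by
  \<open>t\<close> makes the constant 0, which allows any number of them to enter a composition, and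
  the factor \<open>t\<close> to the power -1 in the last formula restores the constant -1. Equality
  of weights thus reduces to a bijection of edges. The cuts do not leave the labels of an edge
  alone: a vertex may become a gap, a root the block that it represents. An equivalence of shapes
  therefore carries a bijection between the labels of corresponding edges, natural like all the
  rest. The vanishing of \<open>S\<close> on sets with at most one element makes \<open>S\<close> a
  species of single edges with at least two vertices, so that grafting along an
  \<open>S\<close>-structure yields a hypergraph. Both sides of the last equation are compared with
  edge-pointed rooted hypertrees: cut at the root, one of these is a set of pieces with a
  distinguished piece, the one that contains the pointed edge.\<close>

definition adj :: "'v set set \<Rightarrow> ('v \<times> 'v) set" where
  "adj E = {(u, w). \<exists>e\<in>E. u \<in> e \<and> w \<in> e}"

abbreviation conn :: "'v set set \<Rightarrow> 'v \<Rightarrow> 'v \<Rightarrow> bool" where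
  "conn E u w \<equiv> (u, w) \<in> (adj E)\<^sup>*"

lemma adjI: "e \<in> E \<Longrightarrow> u \<in> e \<Longrightarrow> w \<in> e \<Longrightarrow> (u, w) \<in> adj E"
  by (auto simp: adj_def)

lemma conn_edge: "e \<in> E \<Longrightarrow> u \<in> e \<Longrightarrow> w \<in> e \<Longrightarrow> conn E u w"
  by (blast intro: adjI)

lemma conn_sym: "conn E u w \<Longrightarrow> conn E w u"
proof -
  have "sym (adj E)"
    by (auto simp: adj_def sym_def)
  then show "conn E u w \<Longrightarrow> conn E w u"
    by (meson sym_rtrancl symE)
qed

lemma conn_mono: "conn E u w \<Longrightarrow> E \<subseteq> F \<Longrightarrow> conn F u w"
  by (rule rtrancl_mono[THEN subsetD, of "adj E"]) (auto simp: adj_def)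

text \<open>Most connectedness arguments below take this form: \<open>p\<close> collapses everything
  outside a piece to the vertex at which the piece is attached, and only the effect of
  \<open>p\<close> on single edges has to be examined.\<close>

lemma conn_retract:
  assumes "conn E u w"
    and "\<And>e x y. e \<in> E \<Longrightarrow> x \<in> e \<Longrightarrow> y \<in> e \<Longrightarrow> conn F (p x) (p y)"
  shows "conn F (p u) (p w)"
  using assms(1)
proof induction
  case (step y z)
  then obtain e where "e \<in> E" "y \<in> e" "z \<in> e"
    by (auto simp: adj_def)
  with step.IH assms(2) show ?case
    by (meson rtrancl_trans)
qed auto

lemma conn_closed:
  assumes "conn E u w" "u \<in> J" "\<And>e. e \<in> E \<Longrightarrow> e \<inter> J \<noteq> {} \<Longrightarrow> e \<subseteq> J"
  shows "w \<in> J"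
  using assms(1,2)
proof induction
  case (step y z)
  then show ?case
    using assms(3) by (fastforce simp: adj_def)
qed auto

lemma conn_restrict:
  assumes "conn E u w" "u \<in> J" "\<And>e. e \<in> E \<Longrightarrow> e \<inter> J \<noteq> {} \<Longrightarrow> e \<subseteq> J"
  shows "conn {e \<in> E. e \<subseteq> J} u w"
  using assms(1)
proof induction
  case (step y z)
  then obtain e where e: "e \<in> E" "y \<in> e" "z \<in> e"
    by (auto simp: adj_def)
  have "y \<in> J"
    using step.hyps(1) assms(2,3) by (rule conn_closed)
  with e assms(3)[of e] have "(y, z) \<in> adj {e \<in> E. e \<subseteq> J}"
    by (auto simp: adj_def)
  with step.IH show ?case
    by (rule rtrancl_into_rtrancl)
qed auto

lemma conn_first_hit:
  assumes "conn E w u" "u \<in> e"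
  shows "\<exists>u'\<in>e. conn (E - {e}) w u'"
  using assms
proof (induction rule: converse_rtrancl_induct)
  case (step y z)
  then obtain f where f: "f \<in> E" "y \<in> f" "z \<in> f"
    by (auto simp: adj_def)
  show ?case
  \<comment> \<open>A step along \<open>e\<close> itself starts at a vertex of \<open>e\<close>, and
    \<open>y\<close> is the hit; any other step survives in \<open>E - {e}\<close> and prolongs the
    connection found from \<open>z\<close>.\<close>
  proof (cases "f = e")
    case False
    then have "(y, z) \<in> adj (E - {e})"
      using f by (auto simp: adj_def)
    then show ?thesis
      using step by (meson converse_rtrancl_into_rtrancl)
  qed (use f in auto)
qed auto

section \<open>Walks with distinct edges\<close>

lemma walk_append: "walk E v (p @ q) w \<longleftrightarrow> (\<exists>z. walk E v p z \<and> walk E z q w)"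
  by (induction p arbitrary: v) auto

lemma walk_conn: "walk E v p w \<Longrightarrow> set (map fst p) \<subseteq> F \<Longrightarrow> conn F v w"
proof (induction p arbitrary: v)
  case (Cons s p)
  obtain e u where "s = (e, u)"
    by fastforce
  with Cons show ?case
    by (auto intro: converse_rtrancl_into_rtrancl[OF adjI])
qed simp

lemma walk_edges: "walk E v p w \<Longrightarrow> set (map fst p) \<subseteq> E"
  by (induction E v p w rule: walk.induct) auto

text \<open>If the new edge \<open>e\<close> is already used by the walk, the walk is entered behind
  that use, since \<open>e\<close> leads there directly. A step without change of vertex is dropped,
  as \<open>walk\<close> forbids it.\<close>

lemma conn_walk: "conn E u w \<Longrightarrow> \<exists>p. walk E u p w \<and> distinct (map fst p)"
proof (induction rule: converse_rtrancl_induct)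
  case base
  show ?case by (rule exI[of _ "[]"]) simp
next
  case (step u v)
  then obtain e p where e: "e \<in> E" "u \<in> e" "v \<in> e" and p: "walk E v p w" "distinct (map fst p)"
    by (auto simp: adj_def)
  show ?case
  proof (cases "e \<in> set (map fst p)")
    case False
    show ?thesis
    proof (cases "u = v")
      case False
      with e p \<open>e \<notin> set (map fst p)\<close> show ?thesis
        by (intro exI[of _ "(e, v) # p"]) auto
    qed (use p in auto)
  next
    case True
    then obtain y where "(e, y) \<in> set p"
      by auto
    then obtain p1 p2 where eq: "p = p1 @ (e, y) # p2"
      by (meson split_list)
    then have y: "y \<in> e" "walk E y p2 w" "distinct (map fst p2)" "e \<notin> set (map fst p2)"
      using p by (auto simp: walk_append)
    show ?thesis
    proof (cases "u = y")
      case False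
      with e y show ?thesis
        by (intro exI[of _ "(e, y) # p2"]) auto
    qed (use y in auto)
  qed
qed

text \<open>Acyclicity in the form that no edge can be bypassed. For hypergraphs this also excludes
  two distinct edges with two common vertices.\<close>

definition bridges :: "'v set set \<Rightarrow> bool" where
  "bridges E \<longleftrightarrow> (\<forall>e\<in>E. \<forall>u\<in>e. \<forall>w\<in>e. u \<noteq> w \<longrightarrow> \<not> conn (E - {e}) u w)"

text \<open>The rest of a closed walk would connect the two ends of its first step without using the
  edge of that step.\<close>

lemma bridges_no_closed_walk:
  assumes "bridges E" "walk E v p v" "distinct (map fst p)"
  shows "p = []"
proof (cases p)
  case (Cons s q)
  obtain e u where s: "s = (e, u)"
    by fastforce
  have "conn (E - {e}) u v"
    using assms(2,3) Cons s walk_edges[of E u q v] by (intro walk_conn[of E u q]) auto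
  then have "conn (E - {e}) v u"
    by (rule conn_sym)
  moreover have "e \<in> E" "v \<in> e" "u \<in> e" "v \<noteq> u"
    using assms(2) Cons s by auto
  ultimately show ?thesis
    using assms(1) unfolding bridges_def by blast
qed auto

text \<open>The first edge \<open>e\<close> of \<open>p\<close> occurs in \<open>q\<close>, as
  otherwise \<open>q\<close> and the rest of \<open>p\<close> would bypass it. Up to
  \<open>e\<close>, the walk \<open>q\<close> joins two vertices of \<open>e\<close> without using
  \<open>e\<close>, so it is closed and hence empty; by the same argument both walks leave
  \<open>e\<close> at the same vertex.\<close>

lemma bridges_unique_walk:
  assumes "bridges E"
  shows "walk E v p w \<Longrightarrow> distinct (map fst p) \<Longrightarrow> walk E v q w \<Longrightarrow> distinct (map fst q) \<Longrightarrow> p = q"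
proof (induction p arbitrary: v q)
  case Nil
  then show ?case
    using bridges_no_closed_walk[OF assms, of v q] by auto
next
  case (Cons s p)
  obtain e u where s: "s = (e, u)"
    by fastforce
  have sep: "\<not> conn (E - {e}) x y" if "x \<in> e" "y \<in> e" "x \<noteq> y" for x y
    using assms that Cons.prems(1) s unfolding bridges_def by auto
  have p: "walk E u p w" "distinct (map fst p)" "e \<notin> set (map fst p)" "v \<in> e" "u \<in> e" "v \<noteq> u"
    using Cons.prems s by auto
  have pc: "conn (E - {e}) u w"
    using p walk_edges[OF p(1)] by (intro walk_conn[OF p(1)]) auto
  show ?case
  proof (cases "e \<in> set (map fst q)")
    case False
    have "conn (E - {e}) v w"
      using False walk_edges[OF Cons.prems(3)] by (intro walk_conn[OF Cons.prems(3)]) auto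
    then show ?thesis
      using sep[OF p(4,5,6)] conn_sym[OF pc] by (meson rtrancl_trans)
  next
    case True
    then obtain y where "(e, y) \<in> set q"
      by auto
    then obtain q1 q2 where q: "q = q1 @ (e, y) # q2"
      by (meson split_list)
    then obtain z where z: "walk E v q1 z" "z \<in> e" "y \<in> e" "walk E y q2 w"
      using Cons.prems(3) by (auto simp: walk_append)
    have d: "distinct (map fst q1)" "distinct (map fst q2)" "e \<notin> set (map fst q1)" "e \<notin> set (map fst q2)"
      using Cons.prems(4) q by auto
    have "conn (E - {e}) v z"
      using d walk_edges[OF z(1)] by (intro walk_conn[OF z(1)]) auto
    then have "v = z"
      using sep[OF p(4) z(2)] by blast
    then have "q1 = []"
      using bridges_no_closed_walk[OF assms, of v q1] z d by auto
    have "conn (E - {e}) y w"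
      using d walk_edges[OF z(4)] by (intro walk_conn[OF z(4)]) auto
    then have "conn (E - {e}) u y"
      using pc conn_sym[of y w] by (meson rtrancl_trans)
    then have "u = y"
      using sep[OF p(5) z(3)] by blast
    with Cons.IH[OF p(1,2), of q2] z d \<open>q1 = []\<close> q s show ?thesis
      by simp
  qed
qed

text \<open>A bypass of \<open>e\<close> would yield a second walk besides the one-step walk along
  \<open>e\<close>; conversely, bridges force walks to coincide. Connectedness and bridges replace
  walks from here on, because retractions allow both to be checked edge by edge.\<close>

lemma hypertree_iff:
  "hypertree V E \<longleftrightarrow>
     hypergraph V E \<and> V \<noteq> {} \<and> (\<forall>u\<in>V. \<forall>w\<in>V. conn E u w) \<and> bridges E"
proof (intro iffI conjI)
  assume ht: "hypertree V E"
  then show "hypergraph V E" "V \<noteq> {}"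
    by (auto simp: hypertree_def)
  have uniq: "\<exists>!p. walk E u p w \<and> distinct (map fst p)" if "u \<in> V" "w \<in> V" "u \<noteq> w" for u w
    using ht that by (auto simp: hypertree_def)
  show "\<forall>u\<in>V. \<forall>w\<in>V. conn E u w"
    using uniq walk_conn walk_edges by (metis rtrancl.rtrancl_refl)
  show "bridges E"
    unfolding bridges_def
  proof (intro ballI impI notI)
    fix e u w
    assume e: "e \<in> E" "u \<in> e" "w \<in> e" "u \<noteq> w" and c: "conn (E - {e}) u w"
    then have uw: "u \<in> V" "w \<in> V"
      using ht by (auto simp: hypertree_def hypergraph_def)
    obtain p where p: "walk (E - {e}) u p w" "distinct (map fst p)"
      using conn_walk[OF c] by blast
    have "walk E v q w" if "walk (E - {e}) v q w" for v q
      using that by (induction q arbitrary: v) auto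
    then have "walk E u p w"
      using p by blast
    moreover have "walk E u [(e, w)] w \<and> distinct (map fst [(e, w)])"
      using e by simp
    ultimately have "p = [(e, w)]"
      using uniq[OF uw e(4)] p(2) by blast
    then show False
      using walk_edges[OF p(1)] by auto
  qed
next
  assume *: "hypergraph V E \<and> V \<noteq> {} \<and> (\<forall>u\<in>V. \<forall>w\<in>V. conn E u w) \<and> bridges E"
  have "\<exists>!p. walk E v p w \<and> distinct (map fst p)" if "v \<in> V" "w \<in> V" for v w
  proof (rule ex_ex1I)
    show "\<exists>p. walk E v p w \<and> distinct (map fst p)"
      using * that by (intro conn_walk) blast
    show "p = q" if "walk E v p w \<and> distinct (map fst p)" "walk E v q w \<and> distinct (map fst q)" for p q
      using * that bridges_unique_walk[of E v p w q] by blast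
  qed
  with * show "hypertree V E"
    unfolding hypertree_def by blast
qed

lemma hypertree_edge:
  assumes "hypertree V E" "e \<in> E"
  shows "e \<subseteq> V" "card e \<ge> 2" "finite e" "\<exists>x\<in>e. x \<noteq> v"
proof -
  show "e \<subseteq> V" "card e \<ge> 2"
    using assms by (auto simp: hypertree_def hypergraph_def)
  then show "finite e"
    by (metis card.infinite not_numeral_le_zero)
  show "\<exists>x\<in>e. x \<noteq> v"
  proof (rule ccontr)
    assume "\<not> ?thesis"
    then have "e \<subseteq> {v}"
      by auto
    then have "card e \<le> 1"
      using card_mono[of "{v}" e] by simp
    with \<open>card e \<ge> 2\<close> show False
      by simp
  qed
qed

lemma hypertree_finite:
  assumes "hypertree V E"
  shows "finite V" "finite E" "V \<noteq> {}"
proof -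
  show "finite V" "V \<noteq> {}"
    using assms by (auto simp: hypertree_def hypergraph_def)
  moreover have "E \<subseteq> Pow V"
    using hypertree_edge(1)[OF assms] by blast
  ultimately show "finite E"
    by (meson finite_Pow_iff finite_subset)
qed

lemma hypertree_conn: "hypertree V E \<Longrightarrow> u \<in> V \<Longrightarrow> w \<in> V \<Longrightarrow> conn E u w"
  by (simp add: hypertree_iff)

text \<open>Both \<sigma> and its inverse on \<open>V\<close> map edges to edges, so
  \<open>conn_retract\<close> applies in either direction.\<close>

lemma conn_image:
  assumes "inj_on \<sigma> V" "\<forall>e\<in>E. e \<subseteq> V" "u \<in> V" "w \<in> V"
  shows "conn (image \<sigma> ` E) (\<sigma> u) (\<sigma> w) \<longleftrightarrow> conn E u w"
proof
  assume "conn E u w"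
  then show "conn (image \<sigma> ` E) (\<sigma> u) (\<sigma> w)"
    by (rule conn_retract) (blast intro: conn_edge)
next
  assume "conn (image \<sigma> ` E) (\<sigma> u) (\<sigma> w)"
  then have "conn E (inv_into V \<sigma> (\<sigma> u)) (inv_into V \<sigma> (\<sigma> w))"
  proof (rule conn_retract)
    fix e' x y
    assume "e' \<in> image \<sigma> ` E" "x \<in> e'" "y \<in> e'"
    then obtain e a b where "e \<in> E" "a \<in> e" "b \<in> e" "x = \<sigma> a" "y = \<sigma> b"
      by blast
    moreover from this have "a \<in> V" "b \<in> V"
      using assms(2) by blast+
    ultimately show "conn E (inv_into V \<sigma> x) (inv_into V \<sigma> y)"
      using assms(1) by (simp add: conn_edge)
  qed
  then show "conn E u w"
    using assms by simp
qed

lemma hypertree_image: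
  assumes "hypertree V E" "inj_on \<sigma> V"
  shows "hypertree (\<sigma> ` V) (image \<sigma> ` E)"
proof -
  have sub: "\<forall>e\<in>E. e \<subseteq> V"
    using hypertree_edge(1)[OF assms(1)] by blast
  have injE: "inj_on (image \<sigma>) E"
    using inj_on_image_Pow[OF assms(2)] by (rule inj_on_subset) (use sub in blast)
  have "card (\<sigma> ` e) \<ge> 2" if "e \<in> E" for e
    using that sub assms hypertree_edge(2)[OF assms(1)] by (metis card_image inj_on_subset)
  then have "hypergraph (\<sigma> ` V) (image \<sigma> ` E)"
    using hypertree_finite[OF assms(1)] sub by (auto simp: hypergraph_def)
  moreover have "bridges (image \<sigma> ` E)"
    unfolding bridges_def
  proof (intro ballI impI)
    fix e' x y
    assume "e' \<in> image \<sigma> ` E" "x \<in> e'" "y \<in> e'" "x \<noteq> y"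
    then obtain e a b where e: "e \<in> E" "a \<in> e" "b \<in> e" "x = \<sigma> a" "y = \<sigma> b" "e' = \<sigma> ` e" "a \<noteq> b"
      by blast
    \<comment> \<open>Removing an edge commutes with taking images because distinct edges have
      distinct images.\<close>
    have "image \<sigma> ` E - {e'} = image \<sigma> ` (E - {e})"
      using e injE by (auto simp: inj_on_def)
    moreover have "\<not> conn (E - {e}) a b"
      using e assms(1) by (auto simp: hypertree_iff bridges_def)
    moreover have "a \<in> V" "b \<in> V" "\<forall>f\<in>E - {e}. f \<subseteq> V"
      using e(1-3) sub by blast+
    ultimately show "\<not> conn (image \<sigma> ` E - {e'}) x y"
      using conn_image[OF assms(2), of "E - {e}" a b] e(4,5) by simp
  qed
  ultimately show ?thesis
    using assms sub conn_image[OF assms(2) sub] by (auto simp: hypertree_iff)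
qed

section \<open>Multilinear maps and tensor products\<close>

lemma vector_space_field: "vector_space ((*) :: 'k::field \<Rightarrow> 'k \<Rightarrow> 'k)"
  by unfold_locales (auto simp: algebra_simps)

lemma vector_space_scale_fun: "vector_space sc \<Longrightarrow> vector_space (scale_fun sc)"
  unfolding vector_space_def scale_fun_def by (auto simp: fun_eq_iff)

lemma vector_space_map_prod:
  "vector_space s1 \<Longrightarrow> vector_space s2 \<Longrightarrow> vector_space (\<lambda>c. map_prod (s1 c) (s2 c))"
  unfolding vector_space_def by auto

section \<open>Linear maps on subspaces\<close>

lemma linear_onI:
  assumes "\<And>x y. x \<in> V \<Longrightarrow> y \<in> V \<Longrightarrow> f (x + y) = f x + f y"
    and "\<And>c x. x \<in> V \<Longrightarrow> f (s1 c x) = s2 c (f x)"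
  shows "linear_on s1 s2 V f"
  using assms by (auto simp: linear_on_def)

lemma linear_on_add: "linear_on s1 s2 V f \<Longrightarrow> x \<in> V \<Longrightarrow> y \<in> V \<Longrightarrow> f (x + y) = f x + f y"
  by (simp add: linear_on_def)

lemma linear_on_scale: "linear_on s1 s2 V f \<Longrightarrow> x \<in> V \<Longrightarrow> f (s1 c x) = s2 c (f x)"
  by (simp add: linear_on_def)

lemma linear_on_zero:
  assumes "vector_space s1" "vector_space s2" "linear_on s1 s2 V f" "0 \<in> V"
  shows "f 0 = 0"
proof -
  interpret v1: vector_space s1 by fact
  interpret v2: vector_space s2 by fact
  have "f (s1 0 0) = s2 0 (f 0)"
    using assms by (intro linear_on_scale)
  then show ?thesis
    by simp
qed

text \<open>\<open>linear_on\<close> evaluates the map at sums and multiples of elements of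
  \<open>V\<close>; closure of \<open>V\<close> under both makes agreement on \<open>V\<close> cover
  these values as well.\<close>

lemma linear_on_cong:
  assumes "linear_on s1 s2 V f" "\<And>x. x \<in> V \<Longrightarrow> f x = g x"
    and "\<And>x y. x \<in> V \<Longrightarrow> y \<in> V \<Longrightarrow> x + y \<in> V" "\<And>c x. x \<in> V \<Longrightarrow> s1 c x \<in> V"
  shows "linear_on s1 s2 V g"
proof (rule linear_onI)
  show "g (x + y) = g x + g y" if "x \<in> V" "y \<in> V" for x y
    using linear_on_add[OF assms(1) that] assms(2)[OF that(1)] assms(2)[OF that(2)]
      assms(2)[OF assms(3)[OF that]] by simp
  show "g (s1 c x) = s2 c (g x)" if "x \<in> V" for c x
    using linear_on_scale[OF assms(1) that] assms(2)[OF that] assms(2)[OF assms(4)[OF that]] by simp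
qed

lemma linear_on_comp:
  assumes "linear_on s1 s2 V f" "linear_on s2 s3 W g" "f ` V \<subseteq> W"
  shows "linear_on s1 s3 V (\<lambda>x. g (f x))"
proof (rule linear_onI)
  show "g (f (x + y)) = g (f x) + g (f y)" if "x \<in> V" "y \<in> V" for x y
    using that assms(3) linear_on_add[OF assms(1) that] linear_on_add[OF assms(2), of "f x" "f y"] by auto
  show "g (f (s1 c x)) = s3 c (g (f x))" if "x \<in> V" for c x
    using that assms(3) linear_on_scale[OF assms(1) that] linear_on_scale[OF assms(2), of "f x"] by auto
qed

lemma linear_on_plus:
  assumes "vector_space s2" "linear_on s1 s2 V f" "linear_on s1 s2 V g"
  shows "linear_on s1 s2 V (\<lambda>x. f x + g x)"
proof -
  interpret vector_space s2 by fact
  show ?thesis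
    using assms(2,3) by (auto simp: linear_on_def scale_right_distrib)
qed

lemma linear_on_times:
  assumes "vector_space s2" "linear_on s1 s2 V f"
  shows "linear_on s1 s2 V (\<lambda>x. s2 c (f x))"
proof -
  interpret vector_space s2 by fact
  show ?thesis
    using assms(2) by (auto simp: linear_on_def scale_right_distrib scale_left_commute)
qed

text \<open>The vectors of the span at which the two maps agree form a subspace containing
  \<open>B\<close>. The intersection with the span is taken because the maps are linear only
  there.\<close>

lemma linear_on_span_eq:
  assumes "vector_space s1" "vector_space s2"
    and "linear_on s1 s2 (module.span s1 B) f" "linear_on s1 s2 (module.span s1 B) g"
    and "\<And>b. b \<in> B \<Longrightarrow> f b = g b" "v \<in> module.span s1 B"
  shows "f v = g v"
proof -
  interpret v1: vector_space s1 by fact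
  have "v1.subspace {v \<in> v1.span B. f v = g v}"
    using linear_on_zero[OF assms(1-3)] linear_on_zero[OF assms(1,2,4)]
    by (intro v1.subspaceI)
      (auto simp: v1.span_zero v1.span_add v1.span_scale linear_on_add[OF assms(3)]
        linear_on_add[OF assms(4)] linear_on_scale[OF assms(3)] linear_on_scale[OF assms(4)])
  then have "v1.span B \<subseteq> {v \<in> v1.span B. f v = g v}"
    using assms(5) by (intro v1.span_minimal) (auto simp: v1.span_base)
  then show ?thesis
    using assms(6) by blast
qed

lemma linear_on_span_into:
  assumes "vector_space s1" "vector_space s2" "linear_on s1 s2 (module.span s1 B) f"
    and "module.subspace s2 W" "\<And>b. b \<in> B \<Longrightarrow> f b \<in> W" "v \<in> module.span s1 B"
  shows "f v \<in> W"
proof -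
  interpret v1: vector_space s1 by fact
  interpret v2: vector_space s2 by fact
  have "v1.subspace {v \<in> v1.span B. f v \<in> W}"
    using linear_on_zero[OF assms(1-3)] assms(4)
    by (intro v1.subspaceI)
      (auto simp: v1.span_zero v1.span_add v1.span_scale linear_on_add[OF assms(3)]
        linear_on_scale[OF assms(3)] v2.subspace_0 v2.subspace_add v2.subspace_scale)
  then have "v1.span B \<subseteq> {v \<in> v1.span B. f v \<in> W}"
    using assms(5) by (intro v1.span_minimal) (auto simp: v1.span_base)
  then show ?thesis
    using assms(6) by blast
qed

text \<open>A nonzero vector is independent by itself, so some functional takes the value 1 at it.
  This is what makes scalar-valued forms sufficient in the universal property of
  \<open>model\<close>.\<close>

lemma functional_separates:
  fixes sc :: "'k::field \<Rightarrow> 'v::ab_group_add \<Rightarrow> 'v"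
  assumes "vector_space sc" "w \<noteq> 0"
  obtains g where "linear_on sc (*) UNIV g" "g w \<noteq> 0"
proof -
  interpret vector_space_pair sc "(*) :: 'k \<Rightarrow> 'k \<Rightarrow> 'k"
    using assms(1) vector_space_field by (simp add: vector_space_pair_def)
  have "vs1.independent {w}"
    using assms(2) by simp
  from linear_independent_extend[OF this, of "\<lambda>_. 1"] obtain g
    where g: "Vector_Spaces.linear sc (*) g" "g w = 1"
    by auto
  have "linear_on sc (*) UNIV g"
    using linear_add[OF g(1)] linear_scale[OF g(1)] by (intro linear_onI)
  with g(2) that show ?thesis
    by simp
qed

section \<open>Multilinear maps\<close>

definition mlin ::
    "('k::field \<Rightarrow> 'u::ab_group_add \<Rightarrow> 'u) \<Rightarrow> ('k \<Rightarrow> 'w::ab_group_add \<Rightarrow> 'w) \<Rightarrow> 'j set \<Rightarrow> ('j \<Rightarrow> 'u set) \<Rightarrow>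
     (('j \<Rightarrow> 'u) \<Rightarrow> 'w) \<Rightarrow> bool" where
  "mlin lsc sc J U f \<longleftrightarrow> (\<forall>j\<in>J. \<forall>x\<in>PiE J U. linear_on lsc sc (U j) (\<lambda>u. f (x(j := u))))"

lemma mforms_iff: "m \<in> mforms lsc J U \<longleftrightarrow> mlin lsc (*) J U m"
  by (simp add: mforms_def mlin_def)

lemma PiE_upd: "x \<in> PiE J U \<Longrightarrow> j \<in> J \<Longrightarrow> u \<in> U j \<Longrightarrow> x(j := u) \<in> PiE J U"
  by (auto simp: PiE_iff extensional_def)

lemma mlin_comp:
  assumes "mlin lsc s1 J U f" "linear_on s1 s2 V g" "f ` PiE J U \<subseteq> V"
  shows "mlin lsc s2 J U (\<lambda>x. g (f x))"
  unfolding mlin_def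
proof (intro ballI)
  fix j x
  assume "j \<in> J" "x \<in> PiE J U"
  moreover from this have "(\<lambda>u. f (x(j := u))) ` U j \<subseteq> V"
    using assms(3) by (auto dest: PiE_upd)
  ultimately show "linear_on lsc s2 (U j) (\<lambda>u. g (f (x(j := u))))"
    using assms(1) by (intro linear_on_comp[OF _ assms(2)]) (auto simp: mlin_def)
qed

lemma mlin_cong:
  assumes "mlin lsc sc J U f" "\<And>x. x \<in> PiE J U \<Longrightarrow> f x = g x"
    and "vector_space lsc" "\<And>j. j \<in> J \<Longrightarrow> module.subspace lsc (U j)"
  shows "mlin lsc sc J U g"
  unfolding mlin_def
proof (intro ballI)
  fix j x
  assume jx: "j \<in> J" "x \<in> PiE J U"
  interpret vector_space lsc by fact
  show "linear_on lsc sc (U j) (\<lambda>u. g (x(j := u)))"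
  proof (rule linear_on_cong)
    show "linear_on lsc sc (U j) (\<lambda>u. f (x(j := u)))"
      using assms(1) jx by (simp add: mlin_def)
    show "f (x(j := u)) = g (x(j := u))" if "u \<in> U j" for u
      using assms(2) PiE_upd[OF jx(2,1) that] by blast
  qed (use assms(4)[OF jx(1)] in \<open>auto simp: subspace_add subspace_scale\<close>)
qed

section \<open>Models: direct sums of tensor products by their universal property\<close>

text \<open>
  \<open>model lsc sc V K J U \<tau>\<close> expresses, by its universal property, that \<open>V\<close> is the direct sum over \<open>k \<in> K\<close>
  of the tensor products of the spaces \<open>U k j\<close>, \<open>j \<in> J k\<close>, with elementary tensors \<open>\<tau> k x\<close>. Over
  a field it suffices to demand that multilinear forms factor.
\<close>

definition gens :: "'i set \<Rightarrow> ('i \<Rightarrow> 'j set) \<Rightarrow> ('i \<Rightarrow> 'j \<Rightarrow> 'u set) \<Rightarrow> ('i \<Rightarrow> ('j \<Rightarrow> 'u) \<Rightarrow> 'w) \<Rightarrow> 'w set" where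
  "gens K J U \<tau> = (\<Union>k\<in>K. \<tau> k ` PiE (J k) (U k))"

definition model ::
    "('k::field \<Rightarrow> 'u::ab_group_add \<Rightarrow> 'u) \<Rightarrow> ('k \<Rightarrow> 'w::ab_group_add \<Rightarrow> 'w) \<Rightarrow> 'w set \<Rightarrow>
     'i set \<Rightarrow> ('i \<Rightarrow> 'j set) \<Rightarrow> ('i \<Rightarrow> 'j \<Rightarrow> 'u set) \<Rightarrow> ('i \<Rightarrow> ('j \<Rightarrow> 'u) \<Rightarrow> 'w) \<Rightarrow> bool" where
  "model lsc sc V K J U \<tau> \<longleftrightarrow>
     V = module.span sc (gens K J U \<tau>) \<and>
     (\<forall>k\<in>K. mlin lsc sc (J k) (U k) (\<tau> k)) \<and>
     (\<forall>c. (\<forall>k\<in>K. c k \<in> mforms lsc (J k) (U k)) \<longrightarrow>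
        (\<exists>f. linear_on sc (*) V f \<and> (\<forall>k\<in>K. \<forall>x\<in>PiE (J k) (U k). f (\<tau> k x) = c k x)))"

lemma model_span: "model lsc sc V K J U \<tau> \<Longrightarrow> V = module.span sc (gens K J U \<tau>)"
  by (simp add: model_def)

lemma model_mlin: "model lsc sc V K J U \<tau> \<Longrightarrow> k \<in> K \<Longrightarrow> mlin lsc sc (J k) (U k) (\<tau> k)"
  by (simp add: model_def)

lemma model_extend:
  assumes "model lsc sc V K J U \<tau>" "\<And>k. k \<in> K \<Longrightarrow> c k \<in> mforms lsc (J k) (U k)"
  shows "\<exists>f. linear_on sc (*) V f \<and> (\<forall>k\<in>K. \<forall>x\<in>PiE (J k) (U k). f (\<tau> k x) = c k x)"
  using assms unfolding model_def by blast

lemma model_subspace: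
  assumes "vector_space sc" "model lsc sc V K J U \<tau>"
  shows "module.subspace sc V"
proof -
  interpret vector_space sc by fact
  show ?thesis
    using model_span[OF assms(2)] by simp
qed

lemma model_in:
  assumes "vector_space sc" "model lsc sc V K J U \<tau>" "k \<in> K" "x \<in> PiE (J k) (U k)"
  shows "\<tau> k x \<in> V"
proof -
  interpret vector_space sc by fact
  show ?thesis
    unfolding model_span[OF assms(2)] by (rule span_base) (use assms(3,4) in \<open>auto simp: gens_def\<close>)
qed

lemma model_eqI:
  assumes "vector_space sc" "vector_space s2" "model lsc sc V K J U \<tau>"
    and "linear_on sc s2 V f" "linear_on sc s2 V g"
    and "\<And>k x. k \<in> K \<Longrightarrow> x \<in> PiE (J k) (U k) \<Longrightarrow> f (\<tau> k x) = g (\<tau> k x)" "v \<in> V"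
  shows "f v = g v"
proof (rule linear_on_span_eq[OF assms(1,2), of "gens K J U \<tau>"])
  show "f b = g b" if "b \<in> gens K J U \<tau>" for b
    using that assms(6) unfolding gens_def by blast
qed (use assms(4,5,7) model_span[OF assms(3)] in simp_all)

text \<open>A basis \<open>B\<close> chosen among the elementary tensors defines the map. That it
  respects all elementary tensors, and not only those in \<open>B\<close>, is tested with
  functionals on the target: composed with \<open>\<tau>'\<close> they are multilinear forms, which
  factor through the source.\<close>

lemma model_map:
  fixes lsc :: "'k::field \<Rightarrow> 'u::ab_group_add \<Rightarrow> 'u" and sc :: "'k \<Rightarrow> 'v::ab_group_add \<Rightarrow> 'v"
    and sc' :: "'k \<Rightarrow> 'w::ab_group_add \<Rightarrow> 'w"
  assumes vs: "vector_space sc" "vector_space sc'"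
    and M: "model lsc sc V K J U \<tau>" and M': "model lsc sc' V' K J U \<tau>'"
  shows "\<exists>\<phi>. linear_on sc sc' V \<phi> \<and> (\<forall>v\<in>V. \<phi> v \<in> V') \<and>
    (\<forall>k\<in>K. \<forall>x\<in>PiE (J k) (U k). \<phi> (\<tau> k x) = \<tau>' k x)"
proof -
  interpret vector_space_pair sc sc'
    using vs by (simp add: vector_space_pair_def)
  obtain B where B: "B \<subseteq> gens K J U \<tau>" "vs1.independent B" "gens K J U \<tau> \<subseteq> vs1.span B"
    by (rule vs1.maximal_independent_subset)
  \<comment> \<open>A vector of \<open>B\<close> may be an elementary tensor in several ways. One of
    them is chosen here, and the argument for arbitrary \<open>\<tau> k x\<close> shows that the
    choice does not matter.\<close>
  have "\<exists>w. \<exists>k\<in>K. \<exists>x\<in>PiE (J k) (U k). b = \<tau> k x \<and> w = \<tau>' k x" if "b \<in> B" for b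
    using subsetD[OF B(1) that] unfolding gens_def by blast
  then obtain h where h: "\<And>b. b \<in> B \<Longrightarrow> \<exists>k\<in>K. \<exists>x\<in>PiE (J k) (U k). b = \<tau> k x \<and> h b = \<tau>' k x"
    by metis
  obtain \<phi> where \<phi>: "Vector_Spaces.linear sc sc' \<phi>" "\<And>b. b \<in> B \<Longrightarrow> \<phi> b = h b"
    using linear_independent_extend[OF B(2), of h] by auto
  have lin: "linear_on sc sc' A \<phi>" for A
    using linear_add[OF \<phi>(1)] linear_scale[OF \<phi>(1)] by (intro linear_onI)
  have VB: "V = vs1.span B"
    using B(1,3) model_span[OF M] vs1.span_minimal[OF B(3)] vs1.span_mono[OF B(1)] by auto
  have into: "\<phi> v \<in> V'" if "v \<in> V" for v
  proof (rule linear_on_span_into[OF vs lin model_subspace[OF vs(2) M'], of B])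
    show "\<phi> b \<in> V'" if "b \<in> B" for b
      using h[OF that] \<phi>(2)[OF that] model_in[OF vs(2) M'] by auto
    show "v \<in> vs1.span B"
      using that VB by simp
  qed
  have "\<phi> (\<tau> k x) = \<tau>' k x" if k: "k \<in> K" "x \<in> PiE (J k) (U k)" for k x
  proof (rule ccontr)
    assume "\<phi> (\<tau> k x) \<noteq> \<tau>' k x"
    then have "\<phi> (\<tau> k x) - \<tau>' k x \<noteq> 0"
      by simp
    then obtain g where g: "linear_on sc' (*) UNIV g" "g (\<phi> (\<tau> k x) - \<tau>' k x) \<noteq> 0"
      by (rule functional_separates[OF vs(2)])
    have "\<exists>f. linear_on sc (*) V f \<and> (\<forall>k\<in>K. \<forall>x\<in>PiE (J k) (U k). f (\<tau> k x) = g (\<tau>' k x))"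
      using model_mlin[OF M'] by (intro model_extend[OF M]) (simp add: mforms_iff mlin_comp[OF _ g(1)])
    then obtain f where f: "linear_on sc (*) V f"
      "\<And>k x. k \<in> K \<Longrightarrow> x \<in> PiE (J k) (U k) \<Longrightarrow> f (\<tau> k x) = g (\<tau>' k x)"
      by blast
    \<comment> \<open>\<open>f\<close> and the composite of \<open>\<phi>\<close> and
      \<open>g\<close> agree on \<open>B\<close> by the choice of \<open>h\<close>, hence on all of
      \<open>V\<close>.\<close>
    have "f (\<tau> k x) = g (\<phi> (\<tau> k x))"
    proof (rule linear_on_span_eq[OF vs(1) vector_space_field, of B])
      show "linear_on sc (*) (vs1.span B) f"
        using f(1) VB by simp
      show "linear_on sc (*) (vs1.span B) (\<lambda>v. g (\<phi> v))"
        by (rule linear_on_comp[OF lin g(1)]) simp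
      show "f b = g (\<phi> b)" if "b \<in> B" for b
        using h[OF that] f(2) \<phi>(2)[OF that] by auto
      show "\<tau> k x \<in> vs1.span B"
        using model_in[OF vs(1) M] k VB by blast
    qed
    then have "g (\<tau>' k x) = g (\<phi> (\<tau> k x))"
      using f(2) k by simp
    moreover have "g (\<phi> (\<tau> k x)) = g (\<phi> (\<tau> k x) - \<tau>' k x) + g (\<tau>' k x)"
      using linear_on_add[OF g(1), of "\<phi> (\<tau> k x) - \<tau>' k x" "\<tau>' k x"] by simp
    ultimately show False
      using g(2) by simp
  qed
  with lin into show ?thesis
    by (intro exI[of _ \<phi>]) auto
qed

text \<open>The maps given by \<open>model_map\<close> in both directions are mutually inverse,
  because their composites fix the elementary tensors, which span.\<close>

lemma model_iso:
  assumes vs: "vector_space sc" "vector_space sc'"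
    and M: "model lsc sc V K J U \<tau>" and M': "model lsc sc' V' K J U \<tau>'"
  shows "\<exists>\<phi>. linear_on sc sc' V \<phi> \<and> bij_betw \<phi> V V' \<and>
    (\<forall>k\<in>K. \<forall>x\<in>PiE (J k) (U k). \<phi> (\<tau> k x) = \<tau>' k x)"
proof -
  from model_map[OF vs M M'] obtain \<phi> where \<phi>: "linear_on sc sc' V \<phi>" "\<forall>v\<in>V. \<phi> v \<in> V'"
    "\<forall>k\<in>K. \<forall>x\<in>PiE (J k) (U k). \<phi> (\<tau> k x) = \<tau>' k x"
    by auto
  from model_map[OF vs(2,1) M' M] obtain \<psi> where \<psi>: "linear_on sc' sc V' \<psi>" "\<forall>v\<in>V'. \<psi> v \<in> V"
    "\<forall>k\<in>K. \<forall>x\<in>PiE (J k) (U k). \<psi> (\<tau>' k x) = \<tau> k x"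
    by auto
  have id: "linear_on s s A (\<lambda>v. v)" for s A
    by (simp add: linear_on_def)
  have "\<psi> (\<phi> v) = v" if "v \<in> V" for v
  proof (rule model_eqI[OF vs(1,1) M _ id _ that])
    show "linear_on sc sc V (\<lambda>v. \<psi> (\<phi> v))"
      using \<phi>(2) by (intro linear_on_comp[OF \<phi>(1) \<psi>(1)]) auto
  qed (use \<phi>(3) \<psi>(3) in simp)
  moreover have "\<phi> (\<psi> v) = v" if "v \<in> V'" for v
  proof (rule model_eqI[OF vs(2,2) M' _ id _ that])
    show "linear_on sc' sc' V' (\<lambda>v. \<phi> (\<psi> v))"
      using \<psi>(2) by (intro linear_on_comp[OF \<psi>(1) \<phi>(1)]) auto
  qed (use \<phi>(3) \<psi>(3) in simp)
  ultimately have "bij_betw \<phi> V V'"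
    using \<phi>(2) \<psi>(2) by (intro bij_betw_byWitness[of _ \<psi>]) auto
  with \<phi> show ?thesis
    by (intro exI[of _ \<phi>]) auto
qed

text \<open>The space \<open>V\<close> stays the same; only the naming of the summands, of the
  factors and of the elementary tensors changes. The general results on sums and tensor products
  produce nested indices, which are replaced by the structures of a shape in this way.\<close>

lemma model_reindex:
  assumes "model lsc sc V K0 J0 U0 \<tau>0" "bij_betw h K K0"
    and "\<And>k. k \<in> K \<Longrightarrow> J k = J0 (h k)"
    and "\<And>k j. k \<in> K \<Longrightarrow> j \<in> J k \<Longrightarrow> U k j = U0 (h k) j"
    and "\<And>k x. k \<in> K \<Longrightarrow> x \<in> PiE (J k) (U k) \<Longrightarrow> \<tau> k x = \<tau>0 (h k) x"
    and "vector_space lsc" "\<And>k j. k \<in> K \<Longrightarrow> j \<in> J k \<Longrightarrow> module.subspace lsc (U k j)"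
  shows "model lsc sc V K J U \<tau>"
proof -
  have hK: "h k \<in> K0" if "k \<in> K" for k
    using that assms(2) by (auto dest: bij_betwE)
  have PiE_eq: "PiE (J k) (U k) = PiE (J0 (h k)) (U0 (h k))" if "k \<in> K" for k
    unfolding assms(3)[OF that] using assms(4)[OF that] assms(3)[OF that] by (intro PiE_cong) simp
  have mlin_eq: "mlin lsc s (J k) (U k) f \<longleftrightarrow> mlin lsc s (J0 (h k)) (U0 (h k)) f" if "k \<in> K" for k f
    and s :: "'a \<Rightarrow> 'z::ab_group_add \<Rightarrow> 'z"
    using PiE_eq[OF that] assms(3,4)[OF that] by (simp add: mlin_def)
  have "gens K J U \<tau> = (\<Union>k\<in>K. \<tau>0 (h k) ` PiE (J0 (h k)) (U0 (h k)))"
    unfolding gens_def using assms(5) PiE_eq by (intro SUP_cong refl image_cong) auto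
  also have "\<dots> = gens K0 J0 U0 \<tau>0"
    unfolding gens_def using assms(2) by (auto simp: bij_betw_def)
  finally have "V = module.span sc (gens K J U \<tau>)"
    using model_span[OF assms(1)] by simp
  moreover have "mlin lsc sc (J k) (U k) (\<tau> k)" if "k \<in> K" for k
  proof (rule mlin_cong[OF _ _ assms(6) assms(7)[OF that]])
    show "mlin lsc sc (J k) (U k) (\<tau>0 (h k))"
      using model_mlin[OF assms(1) hK[OF that]] mlin_eq[OF that] by blast
  qed (use assms(5)[OF that] in simp_all)
  moreover have "\<exists>f. linear_on sc (*) V f \<and> (\<forall>k\<in>K. \<forall>x\<in>PiE (J k) (U k). f (\<tau> k x) = c k x)"
    if c: "\<forall>k\<in>K. c k \<in> mforms lsc (J k) (U k)" for c
  proof -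
    have inv: "inv_into K h (h k) = k" if "k \<in> K" for k
      using assms(2) that by (simp add: bij_betw_def)
    have inv': "inv_into K h k0 \<in> K" "h (inv_into K h k0) = k0" if "k0 \<in> K0" for k0
      using assms(2) that by (auto simp: bij_betw_def intro: inv_into_into f_inv_into_f)
    have "c (inv_into K h k0) \<in> mforms lsc (J0 k0) (U0 k0)" if "k0 \<in> K0" for k0
      using c inv'[OF that] mlin_eq[OF inv'(1)[OF that]] by (metis mforms_iff)
    from model_extend[OF assms(1) this] obtain f where "linear_on sc (*) V f"
      "\<forall>k0\<in>K0. \<forall>x\<in>PiE (J0 k0) (U0 k0). f (\<tau>0 k0 x) = c (inv_into K h k0) x"
      by blast
    then show ?thesis
      using inv hK PiE_eq assms(5) by (intro exI[of _ f]) auto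
  qed
  ultimately show ?thesis
    unfolding model_def by blast
qed

section \<open>Tensor products realised by functionals on forms\<close>

definition elem ::
    "('k::field \<Rightarrow> 'v::ab_group_add \<Rightarrow> 'v) \<Rightarrow> 'j set \<Rightarrow> ('j \<Rightarrow> 'v set) \<Rightarrow> ('j \<Rightarrow> 'v) \<Rightarrow> (('j \<Rightarrow> 'v) \<Rightarrow> 'k) \<Rightarrow> 'k" where
  "elem lsc J V x = (\<lambda>m. if m \<in> mforms lsc J V then m x else 0)"

definition elem2 ::
    "('k::field \<Rightarrow> 'v::ab_group_add \<Rightarrow> 'v) \<Rightarrow> ('k \<Rightarrow> 'w::ab_group_add \<Rightarrow> 'w) \<Rightarrow> 'v set \<Rightarrow> 'w set \<Rightarrow>
     'v \<Rightarrow> 'w \<Rightarrow> ('v \<Rightarrow> 'w \<Rightarrow> 'k) \<Rightarrow> 'k" where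
  "elem2 s1 s2 V W x y = (\<lambda>m. if m \<in> bforms s1 s2 V W then m x y else 0)"

lemma tensor_elem: "tensor lsc J V = module.span (scale_fun (*)) (elem lsc J V ` PiE J V)"
  by (simp add: tensor_def elem_def)

lemma tensor2_elem2:
  "tensor2 s1 s2 V W = module.span (scale_fun (*)) ((\<lambda>(x, y). elem2 s1 s2 V W x y) ` (V \<times> W))"
  by (simp add: tensor2_def elem2_def)

lemma mlin_elem: "mlin lsc (scale_fun (*)) J V (elem lsc J V)"
  unfolding mlin_def
proof (intro ballI linear_onI)
  fix j x u w
  assume "j \<in> J" "x \<in> PiE J V" and u: "u \<in> V j"
  then have lin: "linear_on lsc (*) (V j) (\<lambda>u. m (x(j := u)))" if "m \<in> mforms lsc J V" for m
    using that by (simp add: mforms_def)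
  show "elem lsc J V (x(j := lsc c u)) = scale_fun (*) c (elem lsc J V (x(j := u)))" for c
    using linear_on_scale[OF lin u] by (auto simp: elem_def scale_fun_def)
  show "elem lsc J V (x(j := u + w)) = elem lsc J V (x(j := u)) + elem lsc J V (x(j := w))" if "w \<in> V j"
    using linear_on_add[OF lin u that] by (auto simp: elem_def fun_eq_iff)
qed

lemma linear_on_elem2:
  shows "y \<in> W \<Longrightarrow> linear_on s1 (scale_fun (*)) V (\<lambda>x. elem2 s1 s2 V W x y)"
    and "x \<in> V \<Longrightarrow> linear_on s2 (scale_fun (*)) W (elem2 s1 s2 V W x)"
  by (auto simp: linear_on_def elem2_def bforms_def scale_fun_def fun_eq_iff)

text \<open>The elements of \<open>tensor\<close> are functionals on forms, so a multilinear form
  \<open>c\<close> factors through the evaluation of these functionals at \<open>c\<close>. The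
  one-element index set says that there is a single summand.\<close>

lemma model_tensor: "model lsc (scale_fun (*)) (tensor lsc J V) {k} (\<lambda>_. J) (\<lambda>_. V) (\<lambda>_. elem lsc J V)"
  unfolding model_def
proof (intro conjI allI impI)
  show "tensor lsc J V = module.span (scale_fun (*)) (gens {k} (\<lambda>_. J) (\<lambda>_. V) (\<lambda>_. elem lsc J V))"
    by (simp add: tensor_elem gens_def)
  show "\<exists>f. linear_on (scale_fun (*)) (*) (tensor lsc J V) f \<and>
      (\<forall>k\<in>{k}. \<forall>x\<in>PiE J V. f (elem lsc J V x) = c k x)"
    if "\<forall>k\<in>{k}. c k \<in> mforms lsc J V" for c
    using that by (intro exI[of _ "\<lambda>T. T (c k)"]) (auto simp: elem_def linear_on_def scale_fun_def)
qed (simp add: mlin_elem)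

lemma case_sum_in_PiE:
  "y \<in> PiE J U \<Longrightarrow> z \<in> PiE J' U' \<Longrightarrow> case_sum y z \<in> PiE (J <+> J') (case_sum U U')"
  by (auto simp: PiE_iff extensional_def split: sum.splits)

lemma restrict_Inl: "x \<in> PiE (J <+> J') (case_sum U U') \<Longrightarrow> (\<lambda>j\<in>J. x (Inl j)) \<in> PiE J U"
  by (force simp: PiE_iff)

lemma restrict_Inr: "x \<in> PiE (J <+> J') (case_sum U U') \<Longrightarrow> (\<lambda>j\<in>J'. x (Inr j)) \<in> PiE J' U'"
  by (force simp: PiE_iff)

lemma case_sum_restrict:
  assumes "x \<in> PiE (J <+> J') (case_sum U U')"
  shows "case_sum (\<lambda>j\<in>J. x (Inl j)) (\<lambda>j\<in>J'. x (Inr j)) = x"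
proof
  fix i
  show "case_sum (\<lambda>j\<in>J. x (Inl j)) (\<lambda>j\<in>J'. x (Inr j)) i = x i"
    using assms by (cases i) (auto simp: PiE_iff extensional_def)
qed

lemma restrict_case_sum:
  "y \<in> PiE J U \<Longrightarrow> (\<lambda>j\<in>J. case_sum y z (Inl j)) = y"
  "z \<in> PiE J' U' \<Longrightarrow> (\<lambda>j\<in>J'. case_sum y z (Inr j)) = z"
  by (auto simp: PiE_iff extensional_def fun_eq_iff)

lemma case_sum_upd:
  "case_sum (y(j := u)) z = (case_sum y z)(Inl j := u)"
  "case_sum y (z(j' := w)) = (case_sum y z)(Inr j' := w)"
  by (auto simp: fun_eq_iff split: sum.splits)

text \<open>
  A family of forms on the combined factors is first extended in the left factors, with the right
  ones as parameters; the result is again multilinear in the right factors.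
\<close>

lemma bilinear_extend:
  fixes lsc :: "'k::field \<Rightarrow> 'u::ab_group_add \<Rightarrow> 'u" and s1 :: "'k \<Rightarrow> 'v::ab_group_add \<Rightarrow> 'v"
    and s2 :: "'k \<Rightarrow> 'w::ab_group_add \<Rightarrow> 'w"
  assumes vs: "vector_space s1" "vector_space s2"
    and M: "model lsc s1 V K J U \<tau>" and M': "model lsc s2 W K' J' U' \<tau>'"
    and c: "\<And>k k'. k \<in> K \<Longrightarrow> k' \<in> K' \<Longrightarrow>
      c k k' \<in> mforms lsc (J k <+> J' k') (case_sum (U k) (U' k'))"
    and sub': "\<And>k' j. k' \<in> K' \<Longrightarrow> j \<in> J' k' \<Longrightarrow> module.subspace lsc (U' k' j)"
    and lsc: "vector_space lsc"
  shows "\<exists>b\<in>bforms s1 s2 V W. \<forall>k\<in>K. \<forall>k'\<in>K'. \<forall>x\<in>PiE (J k) (U k). \<forall>x'\<in>PiE (J' k') (U' k').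
    b (\<tau> k x) (\<tau>' k' x') = c k k' (case_sum x x')"
proof -
  have cl: "linear_on lsc (*) (U k j) (\<lambda>u. c k k' (case_sum (x(j := u)) x'))"
    if "k \<in> K" "k' \<in> K'" "x \<in> PiE (J k) (U k)" "x' \<in> PiE (J' k') (U' k')" "j \<in> J k" for k k' x x' j
    using bspec[OF bspec[OF CollectD[OF c[OF that(1,2), unfolded mforms_def]]] case_sum_in_PiE[OF that(3,4)], of "Inl j"] that(5)
    by (simp add: case_sum_upd InlI)
  have cr: "linear_on lsc (*) (U' k' j') (\<lambda>u. c k k' (case_sum x (x'(j' := u))))"
    if "k \<in> K" "k' \<in> K'" "x \<in> PiE (J k) (U k)" "x' \<in> PiE (J' k') (U' k')" "j' \<in> J' k'" for k k' x x' j'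
    using bspec[OF bspec[OF CollectD[OF c[OF that(1,2), unfolded mforms_def]]] case_sum_in_PiE[OF that(3,4)], of "Inr j'"] that(5)
    by (simp add: case_sum_upd InrI)
  have "\<forall>k'\<in>K'. \<forall>x'\<in>PiE (J' k') (U' k'). \<exists>f. linear_on s1 (*) V f \<and>
      (\<forall>k\<in>K. \<forall>x\<in>PiE (J k) (U k). f (\<tau> k x) = c k k' (case_sum x x'))"
    using cl by (intro ballI model_extend[OF M]) (simp add: mforms_def)
  then obtain f where f: "\<And>k' x'. k' \<in> K' \<Longrightarrow> x' \<in> PiE (J' k') (U' k') \<Longrightarrow> linear_on s1 (*) V (f k' x')"
    "\<And>k k' x x'. k' \<in> K' \<Longrightarrow> x' \<in> PiE (J' k') (U' k') \<Longrightarrow> k \<in> K \<Longrightarrow> x \<in> PiE (J k) (U k) \<Longrightarrow>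
      f k' x' (\<tau> k x) = c k k' (case_sum x x')"
    by metis
  \<comment> \<open>Multilinearity in the right factors is known where \<open>v\<close> is an
    elementary tensor. Both sides of the required equations are linear in \<open>v\<close>, so it
    holds on all of \<open>V\<close>.\<close>
  have fm: "(\<lambda>x'. f k' x' v) \<in> mforms lsc (J' k') (U' k')" if v: "v \<in> V" and k': "k' \<in> K'" for v k'
    unfolding mforms_def
  proof (intro CollectI ballI linear_onI)
    fix j x' u
    assume j: "j \<in> J' k'" and x': "x' \<in> PiE (J' k') (U' k')" and u: "u \<in> U' k' j"
    interpret lsc: vector_space lsc by fact
    note upd = PiE_upd[OF x' j]
    show "f k' (x'(j := u + w)) v = f k' (x'(j := u)) v + f k' (x'(j := w)) v" if w: "w \<in> U' k' j" for w
    proof -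
      have uw: "u + w \<in> U' k' j"
        using sub'[OF k' j] u w by (rule lsc.subspace_add)
      show ?thesis
        by (rule model_eqI[OF vs(1) vector_space_field M f(1)[OF k' upd[OF uw]]
              linear_on_plus[OF vector_space_field f(1)[OF k' upd[OF u]] f(1)[OF k' upd[OF w]]] _ v])
          (simp add: f(2) k' upd u w uw linear_on_add[OF cr[OF _ k' _ x' j] u w])
    qed
    show "f k' (x'(j := lsc r u)) v = r * f k' (x'(j := u)) v" for r
    proof -
      have ru: "lsc r u \<in> U' k' j"
        using sub'[OF k' j] u by (rule lsc.subspace_scale)
      show ?thesis
        by (rule model_eqI[OF vs(1) vector_space_field M f(1)[OF k' upd[OF ru]]
              linear_on_times[OF vector_space_field f(1)[OF k' upd[OF u]]] _ v])
          (simp add: f(2) k' upd u ru linear_on_scale[OF cr[OF _ k' _ x' j] u])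
    qed
  qed
  have "\<forall>v\<in>V. \<exists>g. linear_on s2 (*) W g \<and>
      (\<forall>k'\<in>K'. \<forall>x'\<in>PiE (J' k') (U' k'). g (\<tau>' k' x') = f k' x' v)"
    using fm by (intro ballI model_extend[OF M'])
  then obtain g where g: "\<And>v. v \<in> V \<Longrightarrow> linear_on s2 (*) W (g v)"
    "\<And>v k' x'. v \<in> V \<Longrightarrow> k' \<in> K' \<Longrightarrow> x' \<in> PiE (J' k') (U' k') \<Longrightarrow> g v (\<tau>' k' x') = f k' x' v"
    by metis
  interpret s1: vector_space s1 by fact
  note V = s1.subspace_add[OF model_subspace[OF vs(1) M]] s1.subspace_scale[OF model_subspace[OF vs(1) M]]
  \<comment> \<open>Each \<open>g v\<close> is determined by its values on the elementary tensors of
    \<open>W\<close>, and these depend linearly on \<open>v\<close>.\<close>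
  have "linear_on s1 (*) V (\<lambda>v. g v w)" if w: "w \<in> W" for w
  proof (rule linear_onI)
    fix v v'
    assume v: "v \<in> V"
    show "g (v + v') w = g v w + g v' w" if v': "v' \<in> V"
      by (rule model_eqI[OF vs(2) vector_space_field M' g(1)[OF V(1)[OF v v']]
            linear_on_plus[OF vector_space_field g(1)[OF v] g(1)[OF v']] _ w])
        (simp add: g(2) V v v' linear_on_add[OF f(1) v v'])
    show "g (s1 r v) w = r * g v w" for r
      by (rule model_eqI[OF vs(2) vector_space_field M' g(1)[OF V(2)[OF v]]
            linear_on_times[OF vector_space_field g(1)[OF v]] _ w])
        (simp add: g(2) V v linear_on_scale[OF f(1) v])
  qed
  then have "g \<in> bforms s1 s2 V W"
    using g(1) by (simp add: bforms_def)
  then show ?thesis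
    using f(2) g(2) model_in[OF vs(1) M] by (intro bexI[of _ g]) auto
qed

text \<open>The tensor product distributes over direct sums: a summand of the product is a pair of
  summands, whose two families of factors are joined over the disjoint union of their
  positions.\<close>

lemma model_tensor2:
  assumes vs: "vector_space s1" "vector_space s2"
    and M: "model lsc s1 V K J U \<tau>" and M': "model lsc s2 W K' J' U' \<tau>'"
    and sub': "\<And>k' j. k' \<in> K' \<Longrightarrow> j \<in> J' k' \<Longrightarrow> module.subspace lsc (U' k' j)"
    and lsc: "vector_space lsc"
  shows "model lsc (scale_fun (*)) (tensor2 s1 s2 V W) (K \<times> K')
    (\<lambda>(k, k'). J k <+> J' k') (\<lambda>(k, k'). case_sum (U k) (U' k'))
    (\<lambda>(k, k') x. elem2 s1 s2 V W (\<tau> k (\<lambda>j\<in>J k. x (Inl j))) (\<tau>' k' (\<lambda>j\<in>J' k'. x (Inr j))))"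
    (is "model _ ?sc _ _ ?J ?U ?\<tau>")
  unfolding model_def
proof (intro conjI allI impI)
  interpret vector_space "scale_fun (*) :: 'a \<Rightarrow> (('b \<Rightarrow> 'c \<Rightarrow> 'a) \<Rightarrow> 'a) \<Rightarrow> (('b \<Rightarrow> 'c \<Rightarrow> 'a) \<Rightarrow> 'a)"
    by (intro vector_space_scale_fun vector_space_field)
  let ?G = "gens (K \<times> K') ?J ?U ?\<tau>"
  have gen: "elem2 s1 s2 V W (\<tau> k x) (\<tau>' k' x') \<in> ?G"
    if "k \<in> K" "k' \<in> K'" "x \<in> PiE (J k) (U k)" "x' \<in> PiE (J' k') (U' k')" for k k' x x'
    unfolding gens_def using that case_sum_in_PiE[OF that(3,4)]
    by (intro UN_I[of "(k, k')"] image_eqI[of _ _ "case_sum x x'"]) (simp_all add: restrict_case_sum)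
  \<comment> \<open>Spanning is shown one argument at a time: with an elementary tensor on the
    right, \<open>elem2\<close> is linear in the left argument; afterwards the right argument is
    released in the same way.\<close>
  have left: "elem2 s1 s2 V W v (\<tau>' k' x') \<in> span ?G"
    if k': "k' \<in> K'" "x' \<in> PiE (J' k') (U' k')" and v: "v \<in> V" for v k' x'
  proof (rule linear_on_span_into[OF vs(1) vector_space_axioms, of "gens K J U \<tau>"
        "\<lambda>v. elem2 s1 s2 V W v (\<tau>' k' x')"])
    show "elem2 s1 s2 V W b (\<tau>' k' x') \<in> span ?G" if "b \<in> gens K J U \<tau>" for b
      using that gen[OF _ k'(1) _ k'(2)] by (auto simp: gens_def[of K] intro!: span_base)
  qed (use model_span[OF M] v linear_on_elem2(1)[OF model_in[OF vs(2) M' k']] in auto)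
  have both: "elem2 s1 s2 V W v w \<in> span ?G" if v: "v \<in> V" and w: "w \<in> W" for v w
  proof (rule linear_on_span_into[OF vs(2) vector_space_axioms, of "gens K' J' U' \<tau>'" "elem2 s1 s2 V W v"])
    show "elem2 s1 s2 V W v b \<in> span ?G" if "b \<in> gens K' J' U' \<tau>'" for b
      using that left[OF _ _ v] by (auto simp: gens_def[of K'])
  qed (use model_span[OF M'] w linear_on_elem2(2)[OF v] in auto)
  show "tensor2 s1 s2 V W = span ?G"
    unfolding tensor2_elem2 span_eq
  proof
    show "(\<lambda>(x, y). elem2 s1 s2 V W x y) ` (V \<times> W) \<subseteq> span ?G"
      using both by auto
    have "?G \<subseteq> (\<lambda>(x, y). elem2 s1 s2 V W x y) ` (V \<times> W)"
    proof
      fix T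
      assume "T \<in> ?G"
      then obtain k k' x where k: "k \<in> K" "k' \<in> K'" "x \<in> PiE (J k <+> J' k') (case_sum (U k) (U' k'))"
        and T: "T = elem2 s1 s2 V W (\<tau> k (\<lambda>j\<in>J k. x (Inl j))) (\<tau>' k' (\<lambda>j\<in>J' k'. x (Inr j)))"
        by (auto simp: gens_def)
      show "T \<in> (\<lambda>(x, y). elem2 s1 s2 V W x y) ` (V \<times> W)"
        using T model_in[OF vs(1) M k(1) restrict_Inl[OF k(3)]] model_in[OF vs(2) M' k(2) restrict_Inr[OF k(3)]]
        by (intro image_eqI[of _ _ "(\<tau> k (\<lambda>j\<in>J k. x (Inl j)), \<tau>' k' (\<lambda>j\<in>J' k'. x (Inr j)))"])
          (simp_all only: prod.case mem_Sigma_iff simp_thms)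
    qed
    then show "?G \<subseteq> span ((\<lambda>(x, y). elem2 s1 s2 V W x y) ` (V \<times> W))"
      using span_superset by (rule subset_trans)
  qed
next
  show "\<forall>kk\<in>K \<times> K'. mlin lsc ?sc (?J kk) (?U kk) (?\<tau> kk)"
    unfolding mlin_def
  proof (intro ballI)
    fix kk j x
    assume kk: "kk \<in> K \<times> K'" and j: "j \<in> ?J kk" and x: "x \<in> PiE (?J kk) (?U kk)"
    obtain k k' where kk': "kk = (k, k')" "k \<in> K" "k' \<in> K'"
      using kk by auto
    define y y' where "y = (\<lambda>j\<in>J k. x (Inl j))" "y' = (\<lambda>j\<in>J' k'. x (Inr j))"
    have y: "y \<in> PiE (J k) (U k)" "y' \<in> PiE (J' k') (U' k')"
      unfolding y_y'_def using x restrict_Inl[of x "J k" "J' k'"] restrict_Inr[of x "J k" "J' k'"]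
      by (simp_all only: kk'(1) prod.case)
    show "linear_on lsc ?sc (?U kk j) (\<lambda>u. ?\<tau> kk (x(j := u)))"
    proof (cases j)
      case (Inl i)
      have i: "i \<in> J k"
        using j Inl kk' by auto
      have eq: "(\<lambda>j\<in>J k. (x(Inl i := u)) (Inl j)) = y(i := u)" "(\<lambda>j\<in>J' k'. (x(Inl i := u)) (Inr j)) = y'" for u
        using i by (auto simp: y_y'_def fun_eq_iff)
      have "linear_on lsc s1 (U k i) (\<lambda>u. \<tau> k (y(i := u)))"
        using model_mlin[OF M kk'(2)] i y(1) by (simp add: mlin_def)
      from linear_on_comp[OF this linear_on_elem2(1)[of "\<tau>' k' y'" W s1 V s2]]
      have "linear_on lsc ?sc (U k i) (\<lambda>u. elem2 s1 s2 V W (\<tau> k (y(i := u))) (\<tau>' k' y'))"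
        using model_in[OF vs(1) M kk'(2) PiE_upd[OF y(1) i]] model_in[OF vs(2) M' kk'(3) y(2)]
        by (auto simp: image_subset_iff)
      then show ?thesis
        by (simp only: kk'(1) Inl prod.case eq sum.case)
    next
      case (Inr i)
      have i: "i \<in> J' k'"
        using j Inr kk' by auto
      have eq: "(\<lambda>j\<in>J k. (x(Inr i := u)) (Inl j)) = y" "(\<lambda>j\<in>J' k'. (x(Inr i := u)) (Inr j)) = y'(i := u)" for u
        using i by (auto simp: y_y'_def fun_eq_iff)
      have "linear_on lsc s2 (U' k' i) (\<lambda>u. \<tau>' k' (y'(i := u)))"
        using model_mlin[OF M' kk'(3)] i y(2) by (simp add: mlin_def)
      from linear_on_comp[OF this linear_on_elem2(2)[of "\<tau> k y" V s2 W s1]]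
      have "linear_on lsc ?sc (U' k' i) (\<lambda>u. elem2 s1 s2 V W (\<tau> k y) (\<tau>' k' (y'(i := u))))"
        using model_in[OF vs(1) M kk'(2) y(1)] model_in[OF vs(2) M' kk'(3) PiE_upd[OF y(2) i]]
        by (auto simp: image_subset_iff)
      then show ?thesis
        by (simp only: kk'(1) Inr prod.case eq sum.case)
    qed
  qed
next
  fix c
  assume "\<forall>kk\<in>K \<times> K'. c kk \<in> mforms lsc (?J kk) (?U kk)"
  then have "\<And>k k'. k \<in> K \<Longrightarrow> k' \<in> K' \<Longrightarrow>
      c (k, k') \<in> mforms lsc (J k <+> J' k') (case_sum (U k) (U' k'))"
    by auto
  from bilinear_extend[OF vs M M' this sub' lsc] obtain b where b: "b \<in> bforms s1 s2 V W"
    "\<And>k k' x x'. k \<in> K \<Longrightarrow> k' \<in> K' \<Longrightarrow> x \<in> PiE (J k) (U k) \<Longrightarrow> x' \<in> PiE (J' k') (U' k') \<Longrightarrow>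
      b (\<tau> k x) (\<tau>' k' x') = c (k, k') (case_sum x x')"
    by blast
  show "\<exists>f. linear_on ?sc (*) (tensor2 s1 s2 V W) f \<and>
      (\<forall>kk\<in>K \<times> K'. \<forall>x\<in>PiE (?J kk) (?U kk). f (?\<tau> kk x) = c kk x)"
  proof (intro exI[of _ "\<lambda>T. T b"] conjI ballI)
    show "linear_on ?sc (*) (tensor2 s1 s2 V W) (\<lambda>T. T b)"
      by (auto simp: linear_on_def scale_fun_def)
    fix kk x
    assume kk: "kk \<in> K \<times> K'" and x: "x \<in> PiE (?J kk) (?U kk)"
    obtain k k' where kk': "kk = (k, k')" "k \<in> K" "k' \<in> K'"
      using kk by auto
    have x': "x \<in> PiE (J k <+> J' k') (case_sum (U k) (U' k'))"
      using x kk' by simp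
    show "?\<tau> kk x b = c kk x"
      using b(2)[OF kk'(2,3) restrict_Inl[OF x'] restrict_Inr[OF x']] b(1) kk'
      by (simp add: elem2_def case_sum_restrict[OF x'])
  qed
qed

section \<open>Tensor products of finite families\<close>

lemma subspace_preimage:
  assumes "vector_space s1" "vector_space s2" "linear_on s1 s2 V f"
    and "module.subspace s1 V" "module.subspace s2 W"
  shows "module.subspace s1 {v \<in> V. f v \<in> W}"
proof -
  interpret v1: vector_space s1 by fact
  interpret v2: vector_space s2 by fact
  show ?thesis
    using linear_on_zero[OF assms(1-3) v1.subspace_0[OF assms(4)]] assms(4,5)
    by (intro v1.subspaceI)
      (auto simp: v1.subspace_0 v1.subspace_add v1.subspace_scale linear_on_add[OF assms(3)]
        linear_on_scale[OF assms(3)] v2.subspace_0 v2.subspace_add v2.subspace_scale)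
qed

text \<open>Induction over the set \<open>A\<close> of positions that may hold arbitrary vectors,
  the others still holding generators. Releasing one more position is a span argument, since the
  vectors admissible there form a subspace.\<close>

lemma PiE_span_induct:
  assumes "vector_space sc" "finite I" "\<And>j. j \<in> I \<Longrightarrow> V j = module.span sc (X j)"
    and base: "\<And>x. x \<in> PiE I X \<Longrightarrow> P x"
    and sub: "\<And>x j. j \<in> I \<Longrightarrow> x \<in> PiE I V \<Longrightarrow> module.subspace sc {u \<in> V j. P (x(j := u))}"
    and "x \<in> PiE I V"
  shows "P x"
proof -
  interpret vector_space sc by fact
  have "\<forall>x\<in>PiE I V. (\<forall>j\<in>I - A. x j \<in> X j) \<longrightarrow> P x" if "finite A" "A \<subseteq> I" for A
    using that
  proof (induction A rule: finite_induct)
    case empty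
    then show ?case
      using base by (auto simp: PiE_iff)
  next
    case (insert a A)
    show ?case
    proof (intro ballI impI)
      fix x
      assume x: "x \<in> PiE I V" and X: "\<forall>j\<in>I - insert a A. x j \<in> X j"
      have a: "a \<in> I" "V a = span (X a)"
        using insert.prems assms(3) by auto
      have "P (x(a := u))" if "u \<in> X a" for u
      proof -
        have "x(a := u) \<in> PiE I V"
          using PiE_upd[OF x a(1)] a(2) span_base[OF that] by blast
        then show ?thesis
          using insert.IH insert.prems X that by auto
      qed
      then have "X a \<subseteq> {u \<in> V a. P (x(a := u))}"
        using a(2) span_superset by auto
      then have "V a \<subseteq> {u \<in> V a. P (x(a := u))}"
        unfolding a(2) by (rule span_minimal) (use sub[OF a(1) x] a(2) in simp)
      moreover have "x a \<in> V a"
        using x a(1) by auto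
      ultimately have "P (x(a := x a))"
        by blast
      then show "P x"
        by simp
    qed
  qed
  from this[of I] assms(2,6) show ?thesis
    by auto
qed

text \<open>The factors are added one at a time. The last hypothesis extends in a single factor
  only, while all others hold generators. When a factor \<open>i\<close> is added, the induction
  hypothesis provides a form \<open>m g\<close> in the old factors for each generator name
  \<open>g\<close> of the new one, and the values \<open>m g v\<close> remain to be extended
  linearly from the vectors \<open>t i g\<close> to \<open>V i\<close>.\<close>

lemma multilinear_extend:
  fixes sc :: "'k::field \<Rightarrow> 'w::ab_group_add \<Rightarrow> 'w" and X :: "'j \<Rightarrow> 'g set"
  assumes vs: "vector_space sc" and "finite I"
    and "\<And>j. j \<in> I \<Longrightarrow> V j = module.span sc (t j ` X j)"
    and "\<And>j x. j \<in> I \<Longrightarrow> x \<in> PiE (I - {j}) X \<Longrightarrow>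
      \<exists>f. linear_on sc (*) (V j) f \<and> (\<forall>g\<in>X j. f (t j g) = c (x(j := g)))"
  shows "\<exists>m\<in>mforms sc I V. \<forall>x\<in>PiE I X. m (\<lambda>j\<in>I. t j (x j)) = c x"
  using assms(2-)
proof (induction I arbitrary: c rule: finite_induct)
  case empty
  show ?case
    by (intro bexI[of _ "\<lambda>_. c (\<lambda>_. undefined)"]) (auto simp: mforms_def)
next
  case (insert i I)
  interpret vector_space sc by fact
  have V: "V j = span (t j ` X j)" if "j \<in> insert i I" for j
    using insert.prems(1) that by blast
  have subV: "subspace (V j)" if "j \<in> insert i I" for j
    using V[OF that] by simp
  have "\<exists>m\<in>mforms sc I V. \<forall>x\<in>PiE I X. m (\<lambda>j\<in>I. t j (x j)) = c (x(i := g))" if g: "g \<in> X i" for g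
  proof (rule insert.IH)
    show "V j = span (t j ` X j)" if "j \<in> I" for j
      using V that by blast
    fix j x
    assume j: "j \<in> I" and x: "x \<in> PiE (I - {j}) X"
    have ij: "i \<noteq> j"
      using j insert.hyps by blast
    then have "x(i := g) \<in> PiE (insert i I - {j}) X"
      using x g by (auto simp: PiE_iff extensional_def)
    from insert.prems(2)[OF insertI2[OF j] this]
    show "\<exists>f. linear_on sc (*) (V j) f \<and> (\<forall>g'\<in>X j. f (t j g') = c ((x(j := g'))(i := g)))"
      unfolding fun_upd_twist[OF ij] .
  qed
  then obtain m where m: "\<And>g. g \<in> X i \<Longrightarrow> m g \<in> mforms sc I V"
    "\<And>g x. g \<in> X i \<Longrightarrow> x \<in> PiE I X \<Longrightarrow> m g (\<lambda>j\<in>I. t j (x j)) = c (x(i := g))"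
    by metis
  have mlin: "linear_on sc (*) (V j) (\<lambda>u. m g (v(j := u)))" if "g \<in> X i" "j \<in> I" "v \<in> PiE I V" for g j v
    using m(1)[OF that(1)] that(2,3) by (auto simp: mforms_def)
  \<comment> \<open>For \<open>v\<close> made of generators this is the hypothesis. The property is
    preserved under linear combinations in each position of \<open>v\<close>, because
    \<open>m g\<close> is multilinear and functionals can be added and scaled.\<close>
  have "\<exists>f. linear_on sc (*) (V i) f \<and> (\<forall>g\<in>X i. f (t i g) = m g v)" if v: "v \<in> PiE I V" for v
  proof (rule PiE_span_induct[OF vs insert.hyps(1) V _ _ v])
    fix v
    assume v: "v \<in> PiE I (\<lambda>j. t j ` X j)"
    then have "\<forall>j\<in>I. \<exists>g\<in>X j. v j = t j g"
      by (auto simp: PiE_iff)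
    then obtain x where x: "\<And>j. j \<in> I \<Longrightarrow> x j \<in> X j \<and> v j = t j (x j)"
      by metis
    have rx: "restrict x I \<in> PiE I X" and vx: "v = (\<lambda>j\<in>I. t j (restrict x I j))"
      using x v by (auto simp: PiE_iff extensional_def fun_eq_iff)
    have "restrict x I \<in> PiE (insert i I - {i}) X"
      using rx insert.hyps(2) by simp
    note ext = insert.prems(2)[OF insertI1 this]
    have "m g v = c ((restrict x I)(i := g))" if "g \<in> X i" for g
      using m(2)[OF that rx] unfolding vx .
    with ext show "\<exists>f. linear_on sc (*) (V i) f \<and> (\<forall>g\<in>X i. f (t i g) = m g v)"
      by (simp only: cong: ball_cong)
  next
    fix v j
    assume j: "j \<in> I" and v: "v \<in> PiE I V"
    have Vj: "subspace (V j)"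
      using subV j by blast
    let ?Q = "\<lambda>u. \<exists>f. linear_on sc (*) (V i) f \<and> (\<forall>g\<in>X i. f (t i g) = m g (v(j := u)))"
    show "subspace {u \<in> V j. ?Q u}"
    proof (rule subspaceI)
      have "m g (v(j := 0)) = 0" if "g \<in> X i" for g
        using linear_on_zero[OF vs vector_space_field mlin[OF that j v]] subspace_0[OF Vj] by simp
      then show "0 \<in> {u \<in> V j. ?Q u}"
        using subspace_0[OF Vj] by (auto intro!: exI[of _ "\<lambda>_. 0"] linear_onI)
    next
      fix u w
      assume "u \<in> {u \<in> V j. ?Q u}" "w \<in> {u \<in> V j. ?Q u}"
      then obtain f f' where f: "u \<in> V j" "linear_on sc (*) (V i) f" "\<forall>g\<in>X i. f (t i g) = m g (v(j := u))"
        and f': "w \<in> V j" "linear_on sc (*) (V i) f'" "\<forall>g\<in>X i. f' (t i g) = m g (v(j := w))"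
        by blast
      have "?Q (u + w)"
        using f(3) f'(3) linear_on_add[OF mlin[OF _ j v] f(1) f'(1)]
        by (intro exI[of _ "\<lambda>x. f x + f' x"] conjI linear_on_plus[OF vector_space_field f(2) f'(2)]) simp
      then show "u + w \<in> {u \<in> V j. ?Q u}"
        using subspace_add[OF Vj f(1) f'(1)] by blast
    next
      fix r u
      assume "u \<in> {u \<in> V j. ?Q u}"
      then obtain f where f: "u \<in> V j" "linear_on sc (*) (V i) f" "\<forall>g\<in>X i. f (t i g) = m g (v(j := u))"
        by blast
      have "?Q (sc r u)"
        using f(3) linear_on_scale[OF mlin[OF _ j v] f(1)]
        by (intro exI[of _ "\<lambda>x. r * f x"] conjI linear_on_times[OF vector_space_field f(2)]) simp
      then show "sc r u \<in> {u \<in> V j. ?Q u}"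
        using subspace_scale[OF Vj f(1)] by blast
    qed
  qed simp
  then obtain F where F: "\<And>v. v \<in> PiE I V \<Longrightarrow> linear_on sc (*) (V i) (F v)"
    "\<And>v g. v \<in> PiE I V \<Longrightarrow> g \<in> X i \<Longrightarrow> F v (t i g) = m g v"
    by metis
  \<comment> \<open>\<open>F v\<close> is controlled only for \<open>v\<close> in the product over
    \<open>I\<close>; the restriction provides such a family by dropping the coordinate
    \<open>i\<close>.\<close>
  let ?m = "\<lambda>v. F (restrict v I) (v i)"
  have "?m \<in> mforms sc (insert i I) V"
    unfolding mforms_def
  proof (intro CollectI ballI)
    fix j v
    assume j: "j \<in> insert i I" and v: "v \<in> PiE (insert i I) V"
    have rv: "restrict v I \<in> PiE I V" and vi: "v i \<in> V i"
      using v by (auto simp: PiE_iff)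
    show "linear_on sc (*) (V j) (\<lambda>u. F (restrict (v(j := u)) I) ((v(j := u)) i))"
    proof (cases "j = i")
      case True
      have "restrict (v(i := u)) I = restrict v I" for u
        using insert.hyps(2) by (auto simp: fun_eq_iff)
      then show ?thesis
        using F(1)[OF rv] True by simp
    next
      case False
      then have jI: "j \<in> I"
        using j by blast
      let ?v = "\<lambda>u. (restrict v I)(j := u)"
      have eq: "restrict (v(j := u)) I = ?v u" "(v(j := u)) i = v i" for u
        using jI False by (auto simp: fun_eq_iff)
      have vu: "?v u \<in> PiE I V" if "u \<in> V j" for u
        using PiE_upd[OF rv jI that] .
      \<comment> \<open>For linearity in an old factor \<open>j\<close>, identities between
        functionals on \<open>V i\<close> are compared on the generators of \<open>V i\<close>,
        where \<open>F\<close> is given by the multilinear \<open>m g\<close>.\<close>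
      have eqI: "f x = h x" if "linear_on sc (*) (V i) f" "linear_on sc (*) (V i) h"
        "\<And>g. g \<in> X i \<Longrightarrow> f (t i g) = h (t i g)" "x \<in> V i" for f h and x :: 'w
      proof (rule linear_on_span_eq[OF vs vector_space_field, of "t i ` X i"])
        show "f b = h b" if "b \<in> t i ` X i" for b
          using that \<open>\<And>g. g \<in> X i \<Longrightarrow> f (t i g) = h (t i g)\<close> by blast
      qed (use that(1,2,4) V[of i] in simp_all)
      show ?thesis
        unfolding eq
      proof (rule linear_onI)
        fix u
        assume u: "u \<in> V j"
        show "F (?v (u + w)) (v i) = F (?v u) (v i) + F (?v w) (v i)" if w: "w \<in> V j" for w
        proof -
          have uw: "u + w \<in> V j"
            using subspace_add[OF subV[OF j] u w] .
          have "linear_on sc (*) (V i) (\<lambda>x. F (?v u) x + F (?v w) x)"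
            by (intro linear_on_plus[OF vector_space_field] F(1) vu u w)
          from eqI[OF F(1)[OF vu[OF uw]] this _ vi] show ?thesis
            by (simp only: F(2)[OF vu[OF uw]] F(2)[OF vu[OF u]] F(2)[OF vu[OF w]]
                linear_on_add[OF mlin[OF _ jI rv] u w])
        qed
        show "F (?v (sc r u)) (v i) = r * F (?v u) (v i)" for r
        proof -
          have ru: "sc r u \<in> V j"
            using subspace_scale[OF subV[OF j] u] .
          have "linear_on sc (*) (V i) (\<lambda>x. r * F (?v u) x)"
            by (intro linear_on_times[OF vector_space_field] F(1) vu u)
          from eqI[OF F(1)[OF vu[OF ru]] this _ vi] show ?thesis
            by (simp only: F(2)[OF vu[OF ru]] F(2)[OF vu[OF u]]
                linear_on_scale[OF mlin[OF _ jI rv] u])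
        qed
      qed
    qed
  qed
  moreover have "?m (\<lambda>j\<in>insert i I. t j (x j)) = c x" if x: "x \<in> PiE (insert i I) X" for x
  proof -
    have rx: "restrict x I \<in> PiE I X" and xi: "x i \<in> X i"
      using x by (auto simp: PiE_iff)
    have eq: "restrict (\<lambda>j\<in>insert i I. t j (x j)) I = (\<lambda>j\<in>I. t j (restrict x I j))"
      by (auto simp: fun_eq_iff)
    have in_V: "(\<lambda>j\<in>I. t j (restrict x I j)) \<in> PiE I V"
      using rx V span_base by (auto simp: PiE_iff)
    have "(restrict x I)(i := x i) = x"
      using x by (auto simp: fun_eq_iff PiE_iff extensional_def)
    then show ?thesis
      using m(2)[OF xi rx] F(2)[OF in_V xi] unfolding eq by simp
  qed
  ultimately show ?case
    by (intro bexI[of _ ?m] ballI)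
qed

lemma gensI: "k \<in> K \<Longrightarrow> x \<in> PiE (J k) (U k) \<Longrightarrow> \<tau> k x \<in> gens K J U \<tau>"
  by (auto simp: gens_def)

lemma gensE:
  assumes "v \<in> gens K J U \<tau>"
  obtains k x where "k \<in> K" "x \<in> PiE (J k) (U k)" "v = \<tau> k x"
  using assms by (auto simp: gens_def)

text \<open>Distributivity for finitely many factors, each of which is itself a direct sum of tensor
  products: a summand is a choice \<open>y\<close> of one summand in every factor, and its positions
  are the pairs of a factor \<open>i\<close> and a position of the summand
  \<open>y i\<close>.\<close>

lemma model_multi_tensor:
  fixes lsc :: "'k::field \<Rightarrow> 'u::ab_group_add \<Rightarrow> 'u" and sc :: "'k \<Rightarrow> 'w::ab_group_add \<Rightarrow> 'w"
    and J :: "'s \<Rightarrow> 'e set" and I :: "'i set"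
  assumes vs: "vector_space sc" and fin: "finite I"
    and M: "\<And>i. i \<in> I \<Longrightarrow> model lsc sc (V i) (K i) J U (\<tau> i)"
  shows "model lsc (scale_fun (*)) (tensor sc I V) (PiE I K) (\<lambda>y. SIGMA i:I. J (y i))
    (\<lambda>y (i, e). U (y i) e)
    (\<lambda>y x. elem sc I V (\<lambda>i\<in>I. \<tau> i (y i) (\<lambda>e\<in>J (y i). x (i, e))))"
    (is "model _ ?sc _ _ ?J ?U ?\<tau>")
  unfolding model_def
proof (intro conjI allI impI)
  let ?G = "gens (PiE I K) ?J ?U ?\<tau>"
  interpret vector_space "?sc :: 'k \<Rightarrow> ((('i \<Rightarrow> 'w) \<Rightarrow> 'k) \<Rightarrow> 'k) \<Rightarrow> ((('i \<Rightarrow> 'w) \<Rightarrow> 'k) \<Rightarrow> 'k)"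
    by (intro vector_space_scale_fun vector_space_field)
  have fibre: "(\<lambda>e\<in>J (y i). x (i, e)) \<in> PiE (J (y i)) (U (y i))"
    if "x \<in> PiE (?J y) (?U y)" "i \<in> I" for x y i
    using that by (force simp: PiE_iff)
  have arg: "(\<lambda>i\<in>I. \<tau> i (y i) (\<lambda>e\<in>J (y i). x (i, e))) \<in> PiE I V"
    if "y \<in> PiE I K" "x \<in> PiE (?J y) (?U y)" for x y
    unfolding restrict_PiE_iff
    using PiE_mem[OF that(1)] by (intro ballI model_in[OF vs M] fibre[OF that(2)])
  have all: "elem sc I V v \<in> span ?G" if v: "v \<in> PiE I V" for v
  proof (rule PiE_span_induct[OF vs fin model_span[OF M] _ _ v, of "\<lambda>v. elem sc I V v \<in> span ?G"])
    fix v
    assume v: "v \<in> PiE I (\<lambda>i. gens (K i) J U (\<tau> i))"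
    then have "\<forall>i\<in>I. \<exists>k z. k \<in> K i \<and> z \<in> PiE (J k) (U k) \<and> v i = \<tau> i k z"
      by (fastforce simp: PiE_iff gens_def)
    then obtain y z where yz: "\<And>i. i \<in> I \<Longrightarrow> y i \<in> K i \<and> z i \<in> PiE (J (y i)) (U (y i)) \<and> v i = \<tau> i (y i) (z i)"
      by metis
    \<comment> \<open>The choices made for the single factors are assembled into one index and one
      family over pairs; the restrictions make both extensional, as \<open>PiE\<close>
      demands.\<close>
    let ?y = "restrict y I" and ?x = "\<lambda>(i, e)\<in>?J (restrict y I). z i e"
    have "(\<lambda>e\<in>J (?y i). ?x (i, e)) = z i" if "i \<in> I" for i
      using yz[OF that] that by (auto simp: fun_eq_iff PiE_iff extensional_def)
    then have eq: "\<tau> i (?y i) (\<lambda>e\<in>J (?y i). ?x (i, e)) = v i" if "i \<in> I" for i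
      using yz[OF that] that by (simp only: restrict_apply')
    have "v = (\<lambda>i\<in>I. \<tau> i (?y i) (\<lambda>e\<in>J (?y i). ?x (i, e)))"
    proof
      fix i
      show "v i = (\<lambda>i\<in>I. \<tau> i (?y i) (\<lambda>e\<in>J (?y i). ?x (i, e))) i"
        using eq[of i] PiE_arb[OF v, of i] by (cases "i \<in> I") (simp_all only: restrict_def if_True if_False simp_thms)
    qed
    moreover have "?y \<in> PiE I K"
      using yz by auto
    moreover have "?x \<in> PiE (?J ?y) (?U ?y)"
      using yz by (auto simp: PiE_iff)
    ultimately have "elem sc I V v \<in> ?G"
      unfolding gens_def by blast
    then show "elem sc I V v \<in> span ?G"
      by (rule span_base)
  next
    fix v i
    assume i: "i \<in> I" and v: "v \<in> PiE I V"
    have "linear_on sc ?sc (V i) (\<lambda>u. elem sc I V (v(i := u)))"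
      using mlin_elem[of sc I V] i v by (simp add: mlin_def)
    then show "module.subspace sc {u \<in> V i. elem sc I V (v(i := u)) \<in> span ?G}"
      by (rule subspace_preimage[OF vs vector_space_axioms _ model_subspace[OF vs M[OF i]] subspace_span])
  qed
  show "tensor sc I V = span ?G"
    unfolding tensor_elem span_eq
  proof
    show "elem sc I V ` PiE I V \<subseteq> span ?G"
      using all by blast
    have "?G \<subseteq> elem sc I V ` PiE I V"
      using arg unfolding gens_def by blast
    then show "?G \<subseteq> span (elem sc I V ` PiE I V)"
      using span_superset by (rule subset_trans)
  qed
  show "\<forall>y\<in>PiE I K. mlin lsc ?sc (?J y) (?U y) (?\<tau> y)"
    unfolding mlin_def
  proof (intro ballI)
    fix y p x
    assume y: "y \<in> PiE I K" and p: "p \<in> ?J y" and x: "x \<in> PiE (?J y) (?U y)"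
    obtain i e where ie: "p = (i, e)" "i \<in> I" "e \<in> J (y i)"
      using p by blast
    have yi: "y i \<in> K i"
      using y ie(2) by auto
    let ?v = "\<lambda>i\<in>I. \<tau> i (y i) (\<lambda>e\<in>J (y i). x (i, e))" and ?z = "\<lambda>e\<in>J (y i). x (i, e)"
    have eq0: "(\<lambda>e'\<in>J (y i'). (x((i, e) := u)) (i', e')) = (if i' = i then ?z(e := u) else (\<lambda>e\<in>J (y i'). x (i', e)))" for i' u
      using ie(3) by (auto simp: fun_eq_iff)
    have eq: "(\<lambda>i'\<in>I. \<tau> i' (y i') (\<lambda>e'\<in>J (y i'). (x(p := u)) (i', e'))) = ?v(i := \<tau> i (y i) (?z(e := u)))" for u
      unfolding ie(1) eq0 using ie(2) by (intro ext) simp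
    have z: "?z \<in> PiE (J (y i)) (U (y i))"
      by (rule fibre[OF x ie(2)])
    have "linear_on lsc sc (U (y i) e) (\<lambda>u. \<tau> i (y i) (?z(e := u)))"
      using model_mlin[OF M[OF ie(2)] yi] z ie(3) by (simp add: mlin_def)
    moreover have "linear_on sc ?sc (V i) (\<lambda>w. elem sc I V (?v(i := w)))"
      using mlin_elem[of sc I V] arg[OF y x] ie(2) unfolding mlin_def by blast
    moreover have "(\<lambda>u. \<tau> i (y i) (?z(e := u))) ` U (y i) e \<subseteq> V i"
      using model_in[OF vs M[OF ie(2)] yi PiE_upd[OF z ie(3)]] by blast
    ultimately have "linear_on lsc ?sc (U (y i) e) (\<lambda>u. elem sc I V (?v(i := \<tau> i (y i) (?z(e := u)))))"
      by (rule linear_on_comp)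
    then show "linear_on lsc ?sc (?U y p) (\<lambda>u. ?\<tau> y (x(p := u)))"
      unfolding eq by (simp only: ie(1) prod.case)
  qed
  fix c
  assume c: "\<forall>y\<in>PiE I K. c y \<in> mforms lsc (?J y) (?U y)"
  \<comment> \<open>A generator of \<open>V i\<close> is named by a summand \<open>k\<close>
    together with a family \<open>z\<close>. A family of such names is the same as an index with one
    family over pairs; \<open>?y\<close> and \<open>?x\<close> perform this regrouping.\<close>
  let ?X = "\<lambda>i. SIGMA k:K i. PiE (J k) (U k)" and ?t = "\<lambda>i (k, z). \<tau> i k z"
  let ?y = "\<lambda>g. \<lambda>i\<in>I. fst (g i)"
  let ?x = "\<lambda>g. \<lambda>(i, e)\<in>?J (?y g). snd (g i) e"
  have "\<exists>m\<in>mforms sc I V. \<forall>g\<in>PiE I ?X. m (\<lambda>i\<in>I. ?t i (g i)) = c (?y g) (?x g)"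
  proof (rule multilinear_extend[OF vs fin])
    show "V i = module.span sc (?t i ` ?X i)" if "i \<in> I" for i
    proof -
      have "?t i ` ?X i = gens (K i) J U (\<tau> i)"
        by (force simp: gens_def)
      then show ?thesis
        using model_span[OF M[OF that]] by simp
    qed
    fix i g
    assume i: "i \<in> I" and g: "g \<in> PiE (I - {i}) ?X"
    \<comment> \<open>With the names in all other factors fixed, \<open>c\<close> is a family of
      multilinear forms in the positions of the factor \<open>i\<close> alone, and the model of
      \<open>V i\<close> extends it.\<close>
    let ?c = "\<lambda>k z. c (?y (g(i := (k, z)))) (?x (g(i := (k, z))))"
    have "?c k \<in> mforms lsc (J k) (U k)" if k: "k \<in> K i" for k
      unfolding mforms_def
    proof (intro CollectI ballI)
      fix e z
      assume e: "e \<in> J k" and z: "z \<in> PiE (J k) (U k)"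
      have y: "?y (g(i := (k, z'))) = (?y g)(i := k)" for z'
        using i by (auto simp: fun_eq_iff)
      let ?k = "(?y g)(i := k)"
      have gi: "fst (g i') \<in> K i'" "snd (g i') \<in> PiE (J (fst (g i'))) (U (fst (g i')))" if "i' \<in> I" "i' \<noteq> i" for i'
        using PiE_mem[OF g, of i'] that by auto
      have kK: "?k \<in> PiE I K"
        using gi(1) i k by (auto simp: PiE_iff extensional_def)
      have x: "?x (g(i := (k, z(e := u)))) = (?x (g(i := (k, z))))((i, e) := u)" for u
        unfolding y using i e by (auto simp: fun_eq_iff)
      have "?x (g(i := (k, z))) \<in> PiE (?J ?k) (?U ?k)"
        unfolding y using PiE_mem[OF gi(2)] PiE_mem[OF z] i by (auto simp: PiE_iff)
      moreover have "(i, e) \<in> ?J ?k"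
        using i e by auto
      ultimately have "linear_on lsc (*) (?U ?k (i, e)) (\<lambda>u. c ?k ((?x (g(i := (k, z))))((i, e) := u)))"
        using bspec[OF c kK] unfolding mforms_def by blast
      then show "linear_on lsc (*) (U k e) (\<lambda>u. ?c k (z(e := u)))"
        unfolding x unfolding y by simp
    qed
    then have "\<exists>f. linear_on sc (*) (V i) f \<and> (\<forall>k\<in>K i. \<forall>z\<in>PiE (J k) (U k). f (\<tau> i k z) = ?c k z)"
      by (intro model_extend[OF M[OF i], of ?c])
    then show "\<exists>f. linear_on sc (*) (V i) f \<and>
        (\<forall>kz\<in>?X i. f (?t i kz) = c (?y (g(i := kz))) (?x (g(i := kz))))"
      unfolding split_paired_Ball_Sigma prod.case .
  qed
  then obtain m where m: "m \<in> mforms sc I V" "\<And>g. g \<in> PiE I ?X \<Longrightarrow> m (\<lambda>i\<in>I. ?t i (g i)) = c (?y g) (?x g)"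
    by blast
  show "\<exists>f. linear_on ?sc (*) (tensor sc I V) f \<and>
      (\<forall>y\<in>PiE I K. \<forall>x\<in>PiE (?J y) (?U y). f (?\<tau> y x) = c y x)"
  proof (intro exI[of _ "\<lambda>T. T m"] conjI ballI)
    show "linear_on ?sc (*) (tensor sc I V) (\<lambda>T. T m)"
      by (auto simp: linear_on_def scale_fun_def)
    fix y x
    assume y: "y \<in> PiE I K" and x: "x \<in> PiE (?J y) (?U y)"
    let ?g = "\<lambda>i\<in>I. (y i, \<lambda>e\<in>J (y i). x (i, e))"
    have "?g \<in> PiE I ?X"
      using y fibre[OF x] by (auto simp: PiE_mem simp del: restrict_PiE_iff)
    note mg = m(2)[OF this]
    have tg: "(\<lambda>i\<in>I. ?t i (?g i)) = (\<lambda>i\<in>I. \<tau> i (y i) (\<lambda>e\<in>J (y i). x (i, e)))"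
      by (auto simp: fun_eq_iff)
    have yg: "?y ?g = y"
      using y by (auto simp: fun_eq_iff PiE_iff extensional_def)
    have xg: "?x ?g = x"
      unfolding yg using x by (auto simp: fun_eq_iff PiE_iff extensional_def)
    have "m (\<lambda>i\<in>I. \<tau> i (y i) (\<lambda>e\<in>J (y i). x (i, e))) = c y x"
      using mg unfolding tg unfolding xg unfolding yg .
    then show "?\<tau> y x m = c y x"
      using m(1) by (simp add: elem_def)
  qed
qed

section \<open>Direct sums\<close>

definition single :: "'i \<Rightarrow> 'w \<Rightarrow> 'i \<Rightarrow> 'w::zero" where
  "single i v = (\<lambda>k. if k = i then v else 0)"

lemma linear_on_single:
  assumes "vector_space sc"
  shows "linear_on sc (scale_fun sc) V (single i)"
proof -
  interpret vector_space sc by fact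
  show ?thesis
    by (auto simp: linear_on_def single_def scale_fun_def fun_eq_iff)
qed

text \<open>Finite support makes every element a finite sum of vectors \<open>single i v\<close>,
  and functionals on the summands are added up over the support.\<close>

lemma model_dsum:
  fixes sc :: "'k::field \<Rightarrow> 'w::ab_group_add \<Rightarrow> 'w" and A :: "'i set"
  assumes vs: "vector_space sc"
    and M: "\<And>i. i \<in> A \<Longrightarrow> model lsc sc (V i) (K i) (J i) (U i) (\<tau> i)"
  shows "model lsc (scale_fun sc) (dsum A V) (SIGMA i:A. K i) (\<lambda>(i, k). J i k) (\<lambda>(i, k). U i k)
    (\<lambda>(i, k) x. single i (\<tau> i k x))"
    (is "model _ _ _ ?K ?J ?U ?\<tau>")
  unfolding model_def
proof (intro conjI allI impI)
  interpret s: vector_space sc by fact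
  interpret vector_space "scale_fun sc :: 'k \<Rightarrow> ('i \<Rightarrow> 'w) \<Rightarrow> ('i \<Rightarrow> 'w)"
    by (rule vector_space_scale_fun[OF vs])
  note subV = model_subspace[OF vs M]
  let ?G = "gens ?K ?J ?U ?\<tau>"
  have sum: "finite {i. (f + g) i \<noteq> 0}" if "finite {i. f i \<noteq> 0}" "finite {i. g i \<noteq> 0}" for f g :: "'i \<Rightarrow> 'w"
    by (rule finite_subset[OF _ finite_UnI[OF that]]) auto
  have scaled: "finite {i. scale_fun sc r f i \<noteq> 0}" if "finite {i. f i \<noteq> 0}" for r and f :: "'i \<Rightarrow> 'w"
    by (rule finite_subset[OF _ that]) (auto simp: scale_fun_def)
  have sub: "subspace (dsum A V)"
    by (rule subspaceI) (use sum scaled in \<open>auto simp: dsum_def scale_fun_def s.subspace_0[OF subV]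
          s.subspace_add[OF subV] s.subspace_scale[OF subV]\<close>)
  have "?G \<subseteq> dsum A V"
    using model_in[OF vs M] s.subspace_0[OF subV] by (force simp: gens_def dsum_def single_def)
  moreover have "f \<in> span ?G" if f: "f \<in> dsum A V" for f
  proof -
    have "single i v \<in> span ?G" if i: "i \<in> A" and v: "v \<in> V i" for i v
    proof (rule linear_on_span_into[OF vs vector_space_axioms linear_on_single[OF vs] subspace_span])
      show "v \<in> s.span (gens (K i) (J i) (U i) (\<tau> i))"
        using v model_span[OF M[OF i]] by simp
      show "single i b \<in> span ?G" if "b \<in> gens (K i) (J i) (U i) (\<tau> i)" for b
        using that i by (intro span_base) (force simp: gens_def)
    qed
    moreover have "f i = 0 \<or> i \<in> A" "i \<in> A \<Longrightarrow> f i \<in> V i" for i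
      using f by (auto simp: dsum_def)
    ultimately have "(\<Sum>i\<in>{i. f i \<noteq> 0}. single i (f i)) \<in> span ?G"
      by (intro span_sum) auto
    moreover have "(\<Sum>i\<in>{i. f i \<noteq> 0}. single i (f i)) = f"
    proof
      fix k
      have fin: "finite {i. f i \<noteq> 0}"
        using f by (simp add: dsum_def)
      have "(\<Sum>i\<in>{i. f i \<noteq> 0}. single i (f i)) k = (\<Sum>i\<in>{i. f i \<noteq> 0}. if k = i then f i else 0)"
        using fin by (induction rule: finite_induct) (simp_all add: single_def)
      also have "\<dots> = f k"
        using fin by (simp add: sum.delta)
      finally show "(\<Sum>i\<in>{i. f i \<noteq> 0}. single i (f i)) k = f k" .
    qed
    ultimately show ?thesis
      by simp
  qed
  ultimately show "dsum A V = span ?G"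
    using sub span_minimal by blast
  show "\<forall>p\<in>?K. mlin lsc (scale_fun sc) (?J p) (?U p) (?\<tau> p)"
  proof
    fix p
    assume "p \<in> ?K"
    then obtain i k where p: "p = (i, k)" "i \<in> A" "k \<in> K i"
      by blast
    have "mlin lsc (scale_fun sc) (J i k) (U i k) (\<lambda>x. single i (\<tau> i k x))"
      using model_mlin[OF M[OF p(2)] p(3)] linear_on_single[OF vs] by (rule mlin_comp) auto
    then show "mlin lsc (scale_fun sc) (?J p) (?U p) (?\<tau> p)"
      by (simp add: p)
  qed
  fix c
  assume c: "\<forall>p\<in>?K. c p \<in> mforms lsc (?J p) (?U p)"
  have "\<forall>i\<in>A. \<exists>f. linear_on sc (*) (V i) f \<and> (\<forall>k\<in>K i. \<forall>x\<in>PiE (J i k) (U i k). f (\<tau> i k x) = c (i, k) x)"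
    using c by (intro ballI model_extend[OF M]) auto
  then obtain F where F: "\<And>i. i \<in> A \<Longrightarrow> linear_on sc (*) (V i) (F i)"
    "\<And>i k x. i \<in> A \<Longrightarrow> k \<in> K i \<Longrightarrow> x \<in> PiE (J i k) (U i k) \<Longrightarrow> F i (\<tau> i k x) = c (i, k) x"
    by metis
  have F0: "F i 0 = 0" if "i \<in> A" for i
    using linear_on_zero[OF vs vector_space_field F(1)[OF that] s.subspace_0[OF subV[OF that]]] .
  let ?f = "\<lambda>f. \<Sum>i\<in>{i. f i \<noteq> 0}. F i (f i)"
  \<comment> \<open>The support of a sum or of a multiple may shrink. Since every \<open>F i\<close>
    vanishes at 0, the sum may be taken over a larger finite set, and one set serves both
    summands.\<close>
  have f_eq: "?f f = (\<Sum>i\<in>B. F i (f i))" if "f \<in> dsum A V" "finite B" "{i. f i \<noteq> 0} \<subseteq> B" "B \<subseteq> A" for f B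
    using that F0 by (intro sum.mono_neutral_left) auto
  show "\<exists>f. linear_on (scale_fun sc) (*) (dsum A V) f \<and> (\<forall>p\<in>?K. \<forall>x\<in>PiE (?J p) (?U p). f (?\<tau> p x) = c p x)"
  proof (intro exI[of _ ?f] conjI ballI linear_onI)
    fix f
    assume f: "f \<in> dsum A V"
    then have ff: "finite {i. f i \<noteq> 0}" "{i. f i \<noteq> 0} \<subseteq> A" "\<And>i. i \<in> A \<Longrightarrow> f i \<in> V i"
      by (auto simp: dsum_def)
    show "?f (f + g) = ?f f + ?f g" if g: "g \<in> dsum A V" for g
    proof -
      have gg: "finite {i. g i \<noteq> 0}" "{i. g i \<noteq> 0} \<subseteq> A" "\<And>i. i \<in> A \<Longrightarrow> g i \<in> V i"
        using g by (auto simp: dsum_def)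
      let ?B = "{i. f i \<noteq> 0} \<union> {i. g i \<noteq> 0}"
      have B: "finite ?B" "?B \<subseteq> A"
        using ff gg by auto
      have "?f (f + g) = (\<Sum>i\<in>?B. F i ((f + g) i))"
        by (rule f_eq[OF subspace_add[OF sub f g] B(1) _ B(2)]) auto
      also have "\<dots> = (\<Sum>i\<in>?B. F i (f i) + F i (g i))"
        using B(2) linear_on_add[OF F(1)] ff(3) gg(3) by (intro sum.cong) (auto simp: subset_iff)
      also have "\<dots> = ?f f + ?f g"
        using f_eq[OF f B(1) _ B(2)] f_eq[OF g B(1) _ B(2)] by (simp add: sum.distrib)
      finally show ?thesis .
    qed
    show "?f (scale_fun sc r f) = r * ?f f" for r
    proof -
      have "?f (scale_fun sc r f) = (\<Sum>i\<in>{i. f i \<noteq> 0}. F i (scale_fun sc r f i))"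
        by (rule f_eq[OF subspace_scale[OF sub f] ff(1) _ ff(2)]) (auto simp: scale_fun_def)
      also have "\<dots> = (\<Sum>i\<in>{i. f i \<noteq> 0}. r * F i (f i))"
        using ff(2,3) linear_on_scale[OF F(1)] by (intro sum.cong) (auto simp: scale_fun_def subset_iff)
      finally show ?thesis
        by (simp add: sum_distrib_left)
    qed
  next
    fix p x
    assume "p \<in> ?K" and x: "x \<in> PiE (?J p) (?U p)"
    then obtain i k where p: "p = (i, k)" "i \<in> A" "k \<in> K i"
      by blast
    have "?\<tau> p x \<in> dsum A V"
      using subsetD[OF \<open>?G \<subseteq> dsum A V\<close> gensI[of p ?K x ?J ?U ?\<tau>, OF \<open>p \<in> ?K\<close> x]] .
    then have "?f (?\<tau> p x) = (\<Sum>j\<in>{i}. F j (?\<tau> p x j))"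
      by (rule f_eq) (use p in \<open>auto simp: single_def\<close>)
    also have "\<dots> = F i (\<tau> i k x)"
      by (simp add: p single_def)
    finally have "?f (?\<tau> p x) = F i (\<tau> i k x)" .
    then show "?f (?\<tau> p x) = c p x"
      using F(2) p x by simp
  qed
qed

text \<open>Every pair is the sum of \<open>(v, 0)\<close> and \<open>(0, w)\<close>, and a
  functional on the product is the sum of functionals on the two spaces.\<close>

lemma model_prod:
  assumes vs: "vector_space s1" "vector_space s2"
    and M: "model lsc s1 V K J U \<tau>" and M': "model lsc s2 W K' J' U' \<tau>'"
  shows "model lsc (\<lambda>c. map_prod (s1 c) (s2 c)) (V \<times> W) (K <+> K') (case_sum J J') (case_sum U U')
    (case_sum (\<lambda>k x. (\<tau> k x, 0)) (\<lambda>k x. (0, \<tau>' k x)))"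
    (is "model _ ?sc _ ?K ?J ?U ?\<tau>")
  unfolding model_def
proof (intro conjI allI impI)
  interpret v1: vector_space s1 by fact
  interpret v2: vector_space s2 by fact
  interpret vector_space ?sc
    by (rule vector_space_map_prod[OF vs])
  note sub1 = model_subspace[OF vs(1) M] and sub2 = model_subspace[OF vs(2) M']
  note zero = v1.subspace_0[OF sub1] v2.subspace_0[OF sub2]
  have lin: "linear_on s1 ?sc A (\<lambda>v. (v, 0))" "linear_on s2 ?sc B (\<lambda>w. (0, w))" for A B
    by (simp_all add: linear_on_def zero_prod_def)
  let ?G = "gens ?K ?J ?U ?\<tau>"
  have sub: "subspace (V \<times> W)"
    by (rule subspaceI) (auto simp: zero zero_prod_def v1.subspace_add[OF sub1] v2.subspace_add[OF sub2]
        v1.subspace_scale[OF sub1] v2.subspace_scale[OF sub2])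
  have "?G \<subseteq> V \<times> W"
    using model_in[OF vs(1) M] model_in[OF vs(2) M'] zero by (force simp: gens_def)
  moreover have "(v, w) \<in> span ?G" if v: "v \<in> V" and w: "w \<in> W" for v w
  proof -
    have "(v, 0) \<in> span ?G"
    proof (rule linear_on_span_into[OF vs(1) vector_space_axioms lin(1) subspace_span])
      show "(b, 0) \<in> span ?G" if "b \<in> gens K J U \<tau>" for b
        using that
      proof (rule gensE)
        fix k x
        assume "k \<in> K" "x \<in> PiE (J k) (U k)" "b = \<tau> k x"
        with gensI[of "Inl k" ?K x ?J ?U ?\<tau>] show ?thesis
          by (simp add: InlI span_base)
      qed
    qed (use v model_span[OF M] in simp)
    moreover have "(0, w) \<in> span ?G"
    proof (rule linear_on_span_into[OF vs(2) vector_space_axioms lin(2) subspace_span])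
      show "(0, b) \<in> span ?G" if "b \<in> gens K' J' U' \<tau>'" for b
        using that
      proof (rule gensE)
        fix k x
        assume "k \<in> K'" "x \<in> PiE (J' k) (U' k)" "b = \<tau>' k x"
        with gensI[of "Inr k" ?K x ?J ?U ?\<tau>] show ?thesis
          by (simp add: InrI span_base)
      qed
    qed (use w model_span[OF M'] in simp)
    ultimately have "(v, 0) + (0, w) \<in> span ?G"
      by (rule span_add)
    then show ?thesis
      by simp
  qed
  ultimately show "V \<times> W = span ?G"
    using sub span_minimal[of ?G "V \<times> W"] by auto
  show "\<forall>k\<in>?K. mlin lsc ?sc (?J k) (?U k) (?\<tau> k)"
    using mlin_comp[OF model_mlin[OF M] lin(1)[of UNIV]] mlin_comp[OF model_mlin[OF M'] lin(2)[of UNIV]]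
    by (auto elim!: PlusE)
  fix c
  assume c: "\<forall>k\<in>?K. c k \<in> mforms lsc (?J k) (?U k)"
  have "\<And>k. k \<in> K \<Longrightarrow> c (Inl k) \<in> mforms lsc (J k) (U k)"
    using bspec[OF c InlI] by simp
  from model_extend[OF M this] obtain f where f: "linear_on s1 (*) V f"
    "\<And>k x. k \<in> K \<Longrightarrow> x \<in> PiE (J k) (U k) \<Longrightarrow> f (\<tau> k x) = c (Inl k) x"
    by blast
  have "\<And>k. k \<in> K' \<Longrightarrow> c (Inr k) \<in> mforms lsc (J' k) (U' k)"
    using bspec[OF c InrI] by simp
  from model_extend[OF M' this] obtain g where g: "linear_on s2 (*) W g"
    "\<And>k x. k \<in> K' \<Longrightarrow> x \<in> PiE (J' k) (U' k) \<Longrightarrow> g (\<tau>' k x) = c (Inr k) x"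
    by blast
  have z: "f 0 = 0" "g 0 = 0"
    using linear_on_zero[OF vs(1) vector_space_field f(1) zero(1)]
      linear_on_zero[OF vs(2) vector_space_field g(1) zero(2)] by auto
  show "\<exists>h. linear_on ?sc (*) (V \<times> W) h \<and> (\<forall>k\<in>?K. \<forall>x\<in>PiE (?J k) (?U k). h (?\<tau> k x) = c k x)"
  proof (intro exI[of _ "\<lambda>(v, w). f v + g w"] conjI ballI)
    show "linear_on ?sc (*) (V \<times> W) (\<lambda>(v, w). f v + g w)"
      by (auto simp: linear_on_def linear_on_add[OF f(1)] linear_on_add[OF g(1)]
          linear_on_scale[OF f(1)] linear_on_scale[OF g(1)] distrib_left)
    fix k x
    assume "k \<in> ?K" "x \<in> PiE (?J k) (?U k)"
    then show "(case ?\<tau> k x of (v, w) \<Rightarrow> f v + g w) = c k x"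
      using f(2) g(2) z by (auto elim!: PlusE)
  qed
qed

section \<open>Shapes\<close>

text \<open>The laws of \<open>is_species\<close> apart from the finiteness of the sets of
  structures, so that they also hold for the underlying sets of a linear species.\<close>

definition functorial :: "('a, 's) species \<Rightarrow> bool" where
  "functorial F \<longleftrightarrow> (\<forall>I. finite I \<longrightarrow>
     (\<forall>s\<in>str F I. tr F I id s = s) \<and>
     (\<forall>\<sigma>. inj_on \<sigma> I \<longrightarrow>
        (\<forall>s\<in>str F I. tr F I \<sigma> s \<in> str F (\<sigma> ` I)) \<and>
        (\<forall>\<tau>. (\<forall>x\<in>I. \<tau> x = \<sigma> x) \<longrightarrow> (\<forall>s\<in>str F I. tr F I \<tau> s = tr F I \<sigma> s)) \<and>
        (\<forall>\<tau>. inj_on \<tau> (\<sigma> ` I) \<longrightarrow>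
           (\<forall>s\<in>str F I. tr F I (\<tau> \<circ> \<sigma>) s = tr F (\<sigma> ` I) \<tau> (tr F I \<sigma> s)))))"

lemma is_species_functorial:
  assumes "is_species F"
  shows "functorial F"
  unfolding functorial_def
proof (intro allI impI, goal_cases)
  case (1 I)
  show ?case
    using assms[unfolded is_species_def, THEN spec, THEN mp, OF 1, THEN conjunct2] .
qed

lemma
  assumes "functorial F" "finite I"
  shows functorial_in: "inj_on \<sigma> I \<Longrightarrow> s \<in> str F I \<Longrightarrow> tr F I \<sigma> s \<in> str F (\<sigma> ` I)"
    and functorial_cong: "inj_on \<sigma> I \<Longrightarrow> s \<in> str F I \<Longrightarrow> (\<And>x. x \<in> I \<Longrightarrow> \<tau> x = \<sigma> x) \<Longrightarrow>
      tr F I \<tau> s = tr F I \<sigma> s"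
    and functorial_comp: "inj_on \<sigma> I \<Longrightarrow> inj_on \<tau> (\<sigma> ` I) \<Longrightarrow> s \<in> str F I \<Longrightarrow>
      tr F (\<sigma> ` I) \<tau> (tr F I \<sigma> s) = tr F I (\<tau> \<circ> \<sigma>) s"
    and functorial_id: "s \<in> str F I \<Longrightarrow> (\<And>x. x \<in> I \<Longrightarrow> \<tau> x = x) \<Longrightarrow> tr F I \<tau> s = s"
proof -
  note F = assms(1)[unfolded functorial_def, THEN spec, THEN mp, OF assms(2)]
  note F\<sigma> = F[THEN conjunct2, THEN spec, THEN mp]
  show "tr F I \<sigma> s \<in> str F (\<sigma> ` I)" if "inj_on \<sigma> I" "s \<in> str F I"
    using F\<sigma>[OF that(1), THEN conjunct1, THEN bspec, OF that(2)] .
  show cong: "tr F I \<tau> s = tr F I \<sigma> s" if "inj_on \<sigma> I" "s \<in> str F I" "\<And>x. x \<in> I \<Longrightarrow> \<tau> x = \<sigma> x" for \<sigma> \<tau> s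
    by (rule F\<sigma>[OF that(1), THEN conjunct2, THEN conjunct1, THEN spec, THEN mp, THEN bspec, OF ballI that(2)])
      (rule that(3))
  show "tr F (\<sigma> ` I) \<tau> (tr F I \<sigma> s) = tr F I (\<tau> \<circ> \<sigma>) s"
    if "inj_on \<sigma> I" "inj_on \<tau> (\<sigma> ` I)" "s \<in> str F I"
    using F\<sigma>[OF that(1), THEN conjunct2, THEN conjunct2, THEN spec, THEN mp, OF that(2), THEN bspec, OF that(3)]
    by (rule sym)
  show "tr F I \<tau> s = s" if "s \<in> str F I" "\<And>x. x \<in> I \<Longrightarrow> \<tau> x = x"
    using cong[of id s \<tau>] that F[THEN conjunct1, THEN bspec, OF that(1)] by simp
qed

lemma functorial_inv:
  assumes "functorial F" "finite I" "inj_on \<sigma> I" "s \<in> str F I"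
  shows "tr F (\<sigma> ` I) (inv_into I \<sigma>) (tr F I \<sigma> s) = s"
  using assms by (subst functorial_comp) (auto intro!: functorial_id inj_on_inv_into)

lemma functorial_bij:
  assumes "functorial F" "finite A" "bij_betw f A B"
  shows "bij_betw (tr F A f) (str F A) (str F B)"
proof (rule bij_betw_byWitness[of _ "tr F B (inv_into A f)"])
  have B: "B = f ` A" "inj_on f A"
    using assms(3) by (auto simp: bij_betw_def)
  have inv: "inj_on (inv_into A f) B" "inv_into A f ` B = A"
    using bij_betw_inv_into[OF assms(3)] by (auto simp: bij_betw_def)
  show "\<forall>s\<in>str F A. tr F B (inv_into A f) (tr F A f s) = s"
    using functorial_inv[OF assms(1,2) B(2)] B(1) by simp
  show "tr F A f ` str F A \<subseteq> str F B"
    using functorial_in[OF assms(1,2) B(2)] B(1) by auto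
  have "tr F B (inv_into A f) t \<in> str F (inv_into A f ` B)" if "t \<in> str F B" for t
    using assms(1,2) B(1) inv(1) that by (intro functorial_in) auto
  then show "tr F B (inv_into A f) ` str F B \<subseteq> str F A"
    using inv(2) by auto
  show "\<forall>t\<in>str F B. tr F A f (tr F B (inv_into A f) t) = t"
  proof
    fix t
    assume t: "t \<in> str F B"
    have "tr F (inv_into A f ` B) f (tr F B (inv_into A f) t) = tr F B (f \<circ> inv_into A f) t"
      using assms(1,2) B t inv by (intro functorial_comp) auto
    also have "\<dots> = t"
      using assms(1,2) B t by (intro functorial_id) (auto simp: f_inv_into_f)
    finally show "tr F A f (tr F B (inv_into A f) t) = t"
      using inv(2) by simp
  qed
qed

text \<open>One operation for two purposes: with \<open>\<epsilon>\<close> and \<open>l\<close>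
  coming from a bijection of the vertices it is the transport of decorations (\<open>dpush\<close>),
  with those of an equivalence of shapes it carries decorations from one shape to the other
  (\<open>epush\<close>).\<close>

definition push ::
    "('a, 's) species \<Rightarrow> 'e set \<Rightarrow> ('e \<Rightarrow> 'a lab set) \<Rightarrow> ('e \<Rightarrow> 'f) \<Rightarrow> ('e \<Rightarrow> 'a lab \<Rightarrow> 'a lab) \<Rightarrow>
     ('e \<Rightarrow> 's) \<Rightarrow> 'f \<Rightarrow> 's" where
  "push F J D \<epsilon> l d = (\<lambda>j'\<in>\<epsilon> ` J. let j = inv_into J \<epsilon> j' in tr F (D j) (l j) (d j))"

lemma push_apply: "inj_on \<epsilon> J \<Longrightarrow> j \<in> J \<Longrightarrow> push F J D \<epsilon> l d (\<epsilon> j) = tr F (D j) (l j) (d j)"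
  by (simp add: push_def)

lemma push_eqI:
  assumes "bij_betw \<epsilon> J J'" "d' \<in> PiE J' V" "\<And>j. j \<in> J \<Longrightarrow> d' (\<epsilon> j) = tr F (D j) (l j) (d j)"
  shows "push F J D \<epsilon> l d = d'"
proof
  fix i
  have J': "\<epsilon> ` J = J'" "inj_on \<epsilon> J"
    using assms(1) by (auto simp: bij_betw_def)
  show "push F J D \<epsilon> l d i = d' i"
  proof (cases "i \<in> J'")
    case True
    then obtain j where "j \<in> J" "i = \<epsilon> j"
      using J'(1) by blast
    then show ?thesis
      using assms(3) push_apply[OF J'(2)] by metis
  next
    case False
    then show ?thesis
      using J'(1) PiE_arb[OF assms(2)] by (simp add: push_def)
  qed
qed

lemma push_bij:
  assumes F: "functorial F" and \<epsilon>: "bij_betw \<epsilon> J J'"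
    and l: "\<And>j. j \<in> J \<Longrightarrow> finite (D j) \<and> bij_betw (l j) (D j) (D' (\<epsilon> j))"
  shows "bij_betw (push F J D \<epsilon> l) (PiE J (\<lambda>j. str F (D j))) (PiE J' (\<lambda>j. str F (D' j)))"
proof -
  have J': "J' = \<epsilon> ` J" "inj_on \<epsilon> J"
    using \<epsilon> by (auto simp: bij_betw_def)
  have b: "bij_betw (tr F (D j) (l j)) (str F (D j)) (str F (D' (\<epsilon> j)))" if "j \<in> J" for j
    using functorial_bij[OF F] l[OF that] by blast
  have into: "push F J D \<epsilon> l d \<in> PiE J' (\<lambda>j. str F (D' j))" if d: "d \<in> PiE J (\<lambda>j. str F (D j))" for d
  proof -
    have "push F J D \<epsilon> l d (\<epsilon> j) \<in> str F (D' (\<epsilon> j))" if "j \<in> J" for j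
      using push_apply[OF J'(2) that, of F D l d] bij_betwE[OF b[OF that]] PiE_mem[OF d that] by simp
    then show ?thesis
      by (auto simp: J' push_def PiE_iff)
  qed
  show ?thesis
  proof (intro bij_betw_imageI)
    show "inj_on (push F J D \<epsilon> l) (PiE J (\<lambda>j. str F (D j)))"
    proof (rule inj_onI)
      fix d d'
      assume d: "d \<in> PiE J (\<lambda>j. str F (D j))" "d' \<in> PiE J (\<lambda>j. str F (D j))"
        and eq: "push F J D \<epsilon> l d = push F J D \<epsilon> l d'"
      show "d = d'"
      proof (rule PiE_ext[OF d])
        fix j
        assume j: "j \<in> J"
        have "tr F (D j) (l j) (d j) = tr F (D j) (l j) (d' j)"
          using push_apply[OF J'(2) j, of F D l] fun_cong[OF eq, of "\<epsilon> j"] by simp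
        then show "d j = d' j"
          using b[OF j] PiE_mem[OF d(1) j] PiE_mem[OF d(2) j] by (auto simp: bij_betw_def dest: inj_onD)
      qed
    qed
    show "push F J D \<epsilon> l ` PiE J (\<lambda>j. str F (D j)) = PiE J' (\<lambda>j. str F (D' j))"
    proof (intro equalityI subsetI)
      fix e
      assume e: "e \<in> PiE J' (\<lambda>j. str F (D' j))"
      have ej: "e (\<epsilon> j) \<in> tr F (D j) (l j) ` str F (D j)" if "j \<in> J" for j
        using b[OF that] PiE_mem[OF e, of "\<epsilon> j"] J' that by (auto simp: bij_betw_def)
      define d where "d = (\<lambda>j\<in>J. inv_into (str F (D j)) (tr F (D j) (l j)) (e (\<epsilon> j)))"
      have "d \<in> PiE J (\<lambda>j. str F (D j))"
        unfolding d_def using ej by (auto intro!: inv_into_into)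
      moreover have "push F J D \<epsilon> l d = e"
        using ej by (intro push_eqI[OF \<epsilon> e]) (simp add: d_def f_inv_into_f)
      ultimately show "e \<in> push F J D \<epsilon> l ` PiE J (\<lambda>j. str F (D j))"
        by blast
    qed (use into in auto)
  qed
qed

lemma push_in:
  assumes "functorial F" "bij_betw \<epsilon> J J'"
    and "\<And>j. j \<in> J \<Longrightarrow> finite (D j) \<and> bij_betw (l j) (D j) (D' (\<epsilon> j))" "d \<in> PiE J (\<lambda>j. str F (D j))"
  shows "push F J D \<epsilon> l d \<in> PiE J' (\<lambda>j. str F (D' j))"
  by (rule bspec[OF bij_betwE[OF push_bij[of F \<epsilon> J J' D l D', OF assms(1-3)]] assms(4)])

text \<open>Two routes that agree on the edges and on the labels of each edge agree on decorations,
  by functoriality of \<open>F\<close>. The naturality of the isomorphisms below rests on this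
  square.\<close>

lemma push_push:
  assumes F: "functorial F"
    and \<epsilon>: "bij_betw \<epsilon>1 J J1" "bij_betw \<epsilon>2 J1 J3" "bij_betw \<epsilon>1' J J2" "bij_betw \<epsilon>2' J2 J3"
    and l1: "\<And>j. j \<in> J \<Longrightarrow> finite (D j) \<and> bij_betw (l1 j) (D j) (D1 (\<epsilon>1 j))"
    and l2: "\<And>j. j \<in> J1 \<Longrightarrow> finite (D1 j) \<and> bij_betw (l2 j) (D1 j) (D3 (\<epsilon>2 j))"
    and l1': "\<And>j. j \<in> J \<Longrightarrow> finite (D j) \<and> bij_betw (l1' j) (D j) (D2 (\<epsilon>1' j))"
    and l2': "\<And>j. j \<in> J2 \<Longrightarrow> finite (D2 j) \<and> bij_betw (l2' j) (D2 j) (D3 (\<epsilon>2' j))"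
    and comm: "\<And>j. j \<in> J \<Longrightarrow> \<epsilon>2 (\<epsilon>1 j) = \<epsilon>2' (\<epsilon>1' j)"
    and lcomm: "\<And>j x. j \<in> J \<Longrightarrow> x \<in> D j \<Longrightarrow> l2 (\<epsilon>1 j) (l1 j x) = l2' (\<epsilon>1' j) (l1' j x)"
    and d: "d \<in> PiE J (\<lambda>j. str F (D j))"
  shows "push F J1 D1 \<epsilon>2 l2 (push F J D \<epsilon>1 l1 d) = push F J2 D2 \<epsilon>2' l2' (push F J D \<epsilon>1' l1' d)"
proof -
  have inj: "inj_on \<epsilon>1 J" "inj_on \<epsilon>2 J1" "inj_on \<epsilon>1' J" "inj_on \<epsilon>2' J2"
    using \<epsilon> by (auto simp: bij_betw_def)
  have "push F J2 D2 \<epsilon>2' l2' (push F J D \<epsilon>1' l1' d) \<in> PiE J3 (\<lambda>j. str F (D3 j))"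
    by (rule push_in[OF F \<epsilon>(4) l2' push_in[OF F \<epsilon>(3) l1' d]])
  then show ?thesis
  proof (rule push_eqI[OF \<epsilon>(2)])
    fix i
    assume "i \<in> J1"
    then obtain j where i: "i = \<epsilon>1 j" and j: "j \<in> J"
      using \<epsilon>(1) by (auto simp: bij_betw_def)
    have j12: "\<epsilon>1 j \<in> J1" "\<epsilon>1' j \<in> J2"
      using j \<epsilon> by (auto dest: bij_betwE)
    have img: "D1 (\<epsilon>1 j) = l1 j ` D j" "D2 (\<epsilon>1' j) = l1' j ` D j" and fin: "finite (D j)"
      and inj': "inj_on (l1 j) (D j)" "inj_on (l1' j) (D j)"
        "inj_on (l2 (\<epsilon>1 j)) (D1 (\<epsilon>1 j))" "inj_on (l2' (\<epsilon>1' j)) (D2 (\<epsilon>1' j))"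
      using l1[OF j] l1'[OF j] l2[OF j12(1)] l2'[OF j12(2)] by (auto simp: bij_betw_def)
    have dj: "d j \<in> str F (D j)"
      using PiE_mem[OF d j] .
    have "push F J2 D2 \<epsilon>2' l2' (push F J D \<epsilon>1' l1' d) (\<epsilon>2 i) =
        tr F (D2 (\<epsilon>1' j)) (l2' (\<epsilon>1' j)) (tr F (D j) (l1' j) (d j))"
      using comm[OF j] i by (simp add: push_apply[OF inj(4) j12(2)] push_apply[OF inj(3) j])
    also have "\<dots> = tr F (D j) (l2' (\<epsilon>1' j) \<circ> l1' j) (d j)"
      unfolding img by (rule functorial_comp[OF F fin inj'(2) inj'(4)[unfolded img] dj])
    also have "\<dots> = tr F (D j) (l2 (\<epsilon>1 j) \<circ> l1 j) (d j)"
      using inj'(3) inj'(1) by (intro functorial_cong[OF F fin _ dj]) (auto simp: lcomm[OF j] img intro: comp_inj_on)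
    also have "\<dots> = tr F (D1 (\<epsilon>1 j)) (l2 (\<epsilon>1 j)) (tr F (D j) (l1 j) (d j))"
      unfolding img by (rule functorial_comp[OF F fin inj'(1) inj'(3)[unfolded img] dj, symmetric])
    finally show "push F J2 D2 \<epsilon>2' l2' (push F J D \<epsilon>1' l1' d) (\<epsilon>2 i) =
        tr F (D1 i) (l2 i) (push F J D \<epsilon>1 l1 d i)"
      using i by (simp add: push_apply[OF inj(1) j])
  qed
qed

section \<open>Shapes, their decorations and the species that they realise\<close>

text \<open>
  A shape describes undecorated structures: \<open>ed s\<close> are the edges of the structure \<open>s\<close>, the edge \<open>e\<close> is
  to be decorated on the set \<open>lb s e\<close>, and a bijection \<open>\<sigma>\<close> acts on edges by \<open>et\<close> and on their elements
  by \<open>lt\<close>. The decorations may come from a species or from a linear species, so each isomorphism has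
  to be constructed only once.
\<close>

record ('a, 's, 'e) shape =
  sp :: "('a, 's) wspecies"
  ed :: "'s \<Rightarrow> 'e set"
  lb :: "'s \<Rightarrow> 'e \<Rightarrow> 'a lab set"
  et :: "'a lab set \<Rightarrow> ('a lab \<Rightarrow> 'a lab) \<Rightarrow> 's \<Rightarrow> 'e \<Rightarrow> 'e"
  lt :: "'a lab set \<Rightarrow> ('a lab \<Rightarrow> 'a lab) \<Rightarrow> 's \<Rightarrow> 'e \<Rightarrow> 'a lab \<Rightarrow> 'a lab"

definition is_shape :: "('a, 's, 'e) shape \<Rightarrow> bool" where
  "is_shape M \<longleftrightarrow> (\<forall>I. finite I \<longrightarrow> (\<forall>s\<in>str (sp M) I.
     finite (ed M s) \<and> (\<forall>j\<in>ed M s. finite (lb M s j)) \<and>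
     (\<forall>\<sigma>. inj_on \<sigma> I \<longrightarrow>
       tr (sp M) I \<sigma> s \<in> str (sp M) (\<sigma> ` I) \<and> wt (sp M) (tr (sp M) I \<sigma> s) = wt (sp M) s \<and>
       bij_betw (et M I \<sigma> s) (ed M s) (ed M (tr (sp M) I \<sigma> s)) \<and>
       (\<forall>j\<in>ed M s. bij_betw (lt M I \<sigma> s j) (lb M s j) (lb M (tr (sp M) I \<sigma> s) (et M I \<sigma> s j))))))"

lemma is_shapeD:
  assumes "is_shape M" "finite I" "s \<in> str (sp M) I"
  shows "finite (ed M s)" "j \<in> ed M s \<Longrightarrow> finite (lb M s j)"
    and "inj_on \<sigma> I \<Longrightarrow> tr (sp M) I \<sigma> s \<in> str (sp M) (\<sigma> ` I)"
    and "inj_on \<sigma> I \<Longrightarrow> wt (sp M) (tr (sp M) I \<sigma> s) = wt (sp M) s"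
    and "inj_on \<sigma> I \<Longrightarrow> bij_betw (et M I \<sigma> s) (ed M s) (ed M (tr (sp M) I \<sigma> s))"
    and "inj_on \<sigma> I \<Longrightarrow> j \<in> ed M s \<Longrightarrow>
      bij_betw (lt M I \<sigma> s j) (lb M s j) (lb M (tr (sp M) I \<sigma> s) (et M I \<sigma> s j))"
  using assms by (auto simp: is_shape_def)

definition decs :: "('a, 's) species \<Rightarrow> ('a, 'r, 'e) shape \<Rightarrow> 'r \<Rightarrow> ('e \<Rightarrow> 's) set" where
  "decs F M s = PiE (ed M s) (\<lambda>j. str F (lb M s j))"

definition dpush ::
    "('a, 's) species \<Rightarrow> ('a, 'r, 'e) shape \<Rightarrow> 'a lab set \<Rightarrow> ('a lab \<Rightarrow> 'a lab) \<Rightarrow> 'r \<Rightarrow> ('e \<Rightarrow> 's) \<Rightarrow> 'e \<Rightarrow> 's"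
  where "dpush F M I \<sigma> s = push F (ed M s) (lb M s) (et M I \<sigma> s) (lt M I \<sigma> s)"

lemma dpush_in:
  assumes "is_shape M" "functorial F" "finite I" "s \<in> str (sp M) I" "inj_on \<sigma> I" "d \<in> decs F M s"
  shows "dpush F M I \<sigma> s d \<in> decs F M (tr (sp M) I \<sigma> s)"
  using assms(6) is_shapeD[OF assms(1,3,4)] assms(5) unfolding dpush_def decs_def
  by (intro push_in[OF assms(2)]) auto

lemma dpush_eqI:
  assumes "is_shape M" "finite I" "s \<in> str (sp M) I" "inj_on \<sigma> I" "d' \<in> decs F M (tr (sp M) I \<sigma> s)"
    and "\<And>j. j \<in> ed M s \<Longrightarrow> d' (et M I \<sigma> s j) = tr F (lb M s j) (lt M I \<sigma> s j) (d j)"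
  shows "dpush F M I \<sigma> s d = d'"
  unfolding dpush_def
  by (rule push_eqI[OF is_shapeD(5)[OF assms(1-4)] assms(5)[unfolded decs_def] assms(6)])

lemma dpush_apply:
  assumes "is_shape M" "finite I" "s \<in> str (sp M) I" "inj_on \<sigma> I" "j \<in> ed M s"
  shows "dpush F M I \<sigma> s d (et M I \<sigma> s j) = tr F (lb M s j) (lt M I \<sigma> s j) (d j)"
  unfolding dpush_def using is_shapeD(5)[OF assms(1-4)] assms(5)
  by (intro push_apply) (auto simp: bij_betw_def)

text \<open>\<open>\<beta>\<close> presents the structures of \<open>G\<close> as pairs of an
  undecorated structure and a decoration; the particular encoding of a decorated species enters only
  through such a presentation.\<close>

definition realises ::
    "('a, 's) species \<Rightarrow> ('a, 'g) wspecies \<Rightarrow> ('a, 'r, 'e) shape \<Rightarrow> ('a lab set \<Rightarrow> 'r \<Rightarrow> ('e \<Rightarrow> 's) \<Rightarrow> 'g) \<Rightarrow> bool"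
  where "realises F G M \<beta> \<longleftrightarrow> (\<forall>I. finite I \<longrightarrow>
     bij_betw (\<lambda>(s, d). \<beta> I s d) (SIGMA s:str (sp M) I. decs F M s) (str G I) \<and>
     (\<forall>s\<in>str (sp M) I. \<forall>d\<in>decs F M s. wt G (\<beta> I s d) = wt (sp M) s \<and>
        (\<forall>\<sigma>. inj_on \<sigma> I \<longrightarrow> tr G I \<sigma> (\<beta> I s d) = \<beta> (\<sigma> ` I) (tr (sp M) I \<sigma> s) (dpush F M I \<sigma> s d))))"

lemma realisesD:
  assumes "realises F G M \<beta>" "finite I"
  shows "bij_betw (\<lambda>(s, d). \<beta> I s d) (SIGMA s:str (sp M) I. decs F M s) (str G I)"
    and "s \<in> str (sp M) I \<Longrightarrow> d \<in> decs F M s \<Longrightarrow> wt G (\<beta> I s d) = wt (sp M) s"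
    and "s \<in> str (sp M) I \<Longrightarrow> d \<in> decs F M s \<Longrightarrow> inj_on \<sigma> I \<Longrightarrow>
      tr G I \<sigma> (\<beta> I s d) = \<beta> (\<sigma> ` I) (tr (sp M) I \<sigma> s) (dpush F M I \<sigma> s d)"
  using assms by (auto simp: realises_def)

lemma realises_in:
  assumes "realises F G M \<beta>" "finite I" "s \<in> str (sp M) I" "d \<in> decs F M s"
  shows "\<beta> I s d \<in> str G I"
  using bij_betwE[OF realisesD(1)[OF assms(1,2)]] assms(3,4) by fastforce

lemma realises_iso:
  assumes M: "is_shape M" "functorial F" and G: "realises F G M \<beta>" and H: "realises F H M \<gamma>"
  shows "G \<cong>\<^sub>w H"
proof -
  let ?S = "\<lambda>I. SIGMA s:str (sp M) I. decs F M s"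
  define \<phi> where "\<phi> I = (\<lambda>(s, d). \<gamma> I s d) \<circ> inv_into (?S I) (\<lambda>(s, d). \<beta> I s d)" for I
  have \<phi>: "\<phi> I (\<beta> I s d) = \<gamma> I s d" if "finite I" "s \<in> str (sp M) I" "d \<in> decs F M s" for I s d
  proof -
    have "inv_into (?S I) (\<lambda>(s, d). \<beta> I s d) (\<beta> I s d) = (s, d)"
      using bij_betw_inv_into_left[OF realisesD(1)[OF G that(1)], of "(s, d)"] that by simp
    then show ?thesis
      by (simp add: \<phi>_def)
  qed
  show ?thesis
    unfolding wiso_def
  proof (intro exI[of _ \<phi>] allI impI conjI ballI)
    fix I :: "'a lab set"
    assume I: "finite I"
    show "bij_betw (\<phi> I) (str G I) (str H I)"
      unfolding \<phi>_def by (intro bij_betw_trans[OF bij_betw_inv_into] realisesD(1) G H I)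
    fix g
    assume "g \<in> str G I"
    then have "g \<in> (\<lambda>(s, d). \<beta> I s d) ` ?S I"
      using realisesD(1)[OF G I] by (simp add: bij_betw_def)
    then obtain s d where s: "s \<in> str (sp M) I" "d \<in> decs F M s" and g: "g = \<beta> I s d"
      by (auto simp: image_iff)
    show "wt H (\<phi> I g) = wt G g"
      using realisesD(2)[OF G I s] realisesD(2)[OF H I s] \<phi>[OF I s] g by simp
    fix \<sigma> :: "'a lab \<Rightarrow> 'a lab"
    assume \<sigma>: "inj_on \<sigma> I"
    have "\<phi> (\<sigma> ` I) (tr G I \<sigma> g) = \<phi> (\<sigma> ` I) (\<beta> (\<sigma> ` I) (tr (sp M) I \<sigma> s) (dpush F M I \<sigma> s d))"
      using realisesD(3)[OF G I s \<sigma>] g by simp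
    also have "\<dots> = \<gamma> (\<sigma> ` I) (tr (sp M) I \<sigma> s) (dpush F M I \<sigma> s d)"
      using is_shapeD(3)[OF M(1) I s(1) \<sigma>] dpush_in[OF M I s(1) \<sigma> s(2)] I by (intro \<phi>) auto
    also have "\<dots> = tr H I \<sigma> (\<phi> I g)"
      using realisesD(3)[OF H I s \<sigma>] g \<phi>[OF I s] by simp
    finally show "\<phi> (\<sigma> ` I) (tr G I \<sigma> g) = tr H I \<sigma> (\<phi> I g)" .
  qed
qed

text \<open>Bijections of the labels are data of their own: corresponding edges may carry different
  labels, such as a gap against a vertex, or a block against the root of the hypertree on
  it.\<close>

definition sequiv :: "('a, 's, 'e) shape \<Rightarrow> ('a, 'r, 'f) shape \<Rightarrow>
    ('a lab set \<Rightarrow> 's \<Rightarrow> 'r) \<Rightarrow> ('a lab set \<Rightarrow> 's \<Rightarrow> 'e \<Rightarrow> 'f) \<Rightarrow> ('a lab set \<Rightarrow> 's \<Rightarrow> 'e \<Rightarrow> 'a lab \<Rightarrow> 'a lab) \<Rightarrow> bool"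
  where "sequiv M N \<phi> \<epsilon> l \<longleftrightarrow> (\<forall>I. finite I \<longrightarrow>
     bij_betw (\<phi> I) (str (sp M) I) (str (sp N) I) \<and>
     (\<forall>s\<in>str (sp M) I.
        wt (sp N) (\<phi> I s) = wt (sp M) s \<and>
        bij_betw (\<epsilon> I s) (ed M s) (ed N (\<phi> I s)) \<and>
        (\<forall>j\<in>ed M s. bij_betw (l I s j) (lb M s j) (lb N (\<phi> I s) (\<epsilon> I s j))) \<and>
        (\<forall>\<sigma>. inj_on \<sigma> I \<longrightarrow>
           \<phi> (\<sigma> ` I) (tr (sp M) I \<sigma> s) = tr (sp N) I \<sigma> (\<phi> I s) \<and>
           (\<forall>j\<in>ed M s.
              \<epsilon> (\<sigma> ` I) (tr (sp M) I \<sigma> s) (et M I \<sigma> s j) = et N I \<sigma> (\<phi> I s) (\<epsilon> I s j) \<and>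
              (\<forall>x\<in>lb M s j. l (\<sigma> ` I) (tr (sp M) I \<sigma> s) (et M I \<sigma> s j) (lt M I \<sigma> s j x) =
                 lt N I \<sigma> (\<phi> I s) (\<epsilon> I s j) (l I s j x))))))"

definition epush ::
    "('a, 't) species \<Rightarrow> ('a, 's, 'e) shape \<Rightarrow> ('a lab set \<Rightarrow> 's \<Rightarrow> 'e \<Rightarrow> 'f) \<Rightarrow>
     ('a lab set \<Rightarrow> 's \<Rightarrow> 'e \<Rightarrow> 'a lab \<Rightarrow> 'a lab) \<Rightarrow> 'a lab set \<Rightarrow> 's \<Rightarrow> ('e \<Rightarrow> 't) \<Rightarrow> 'f \<Rightarrow> 't"
  where "epush F M \<epsilon> l I s = push F (ed M s) (lb M s) (\<epsilon> I s) (l I s)"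

lemma sequivD:
  assumes "sequiv M N \<phi> \<epsilon> l" "finite I"
  shows "bij_betw (\<phi> I) (str (sp M) I) (str (sp N) I)"
    and "s \<in> str (sp M) I \<Longrightarrow> wt (sp N) (\<phi> I s) = wt (sp M) s"
    and "s \<in> str (sp M) I \<Longrightarrow> bij_betw (\<epsilon> I s) (ed M s) (ed N (\<phi> I s))"
    and "s \<in> str (sp M) I \<Longrightarrow> j \<in> ed M s \<Longrightarrow> bij_betw (l I s j) (lb M s j) (lb N (\<phi> I s) (\<epsilon> I s j))"
    and "s \<in> str (sp M) I \<Longrightarrow> inj_on \<sigma> I \<Longrightarrow> \<phi> (\<sigma> ` I) (tr (sp M) I \<sigma> s) = tr (sp N) I \<sigma> (\<phi> I s)"
    and "s \<in> str (sp M) I \<Longrightarrow> inj_on \<sigma> I \<Longrightarrow> j \<in> ed M s \<Longrightarrow>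
      \<epsilon> (\<sigma> ` I) (tr (sp M) I \<sigma> s) (et M I \<sigma> s j) = et N I \<sigma> (\<phi> I s) (\<epsilon> I s j)"
    and "s \<in> str (sp M) I \<Longrightarrow> inj_on \<sigma> I \<Longrightarrow> j \<in> ed M s \<Longrightarrow> x \<in> lb M s j \<Longrightarrow>
      l (\<sigma> ` I) (tr (sp M) I \<sigma> s) (et M I \<sigma> s j) (lt M I \<sigma> s j x) = lt N I \<sigma> (\<phi> I s) (\<epsilon> I s j) (l I s j x)"
  using assms by (simp_all add: sequiv_def)

lemma epush_bij:
  assumes "sequiv M N \<phi> \<epsilon> l" "is_shape M" "functorial F" "finite I" "s \<in> str (sp M) I"
  shows "bij_betw (epush F M \<epsilon> l I s) (decs F M s) (decs F N (\<phi> I s))"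
  unfolding epush_def decs_def
  using sequivD(3,4)[OF assms(1,4,5)] is_shapeD(2)[OF assms(2,4,5)] by (intro push_bij[OF assms(3)]) auto

text \<open>This is \<open>push_push\<close> for the square formed by the equivalence and the action
  of \<sigma>.\<close>

lemma epush_dpush:
  assumes eq: "sequiv M N \<phi> \<epsilon> l" and M: "is_shape M" and N: "is_shape N" and F: "functorial F"
    and I: "finite I" and s: "s \<in> str (sp M) I" and \<sigma>: "inj_on \<sigma> I" and d: "d \<in> decs F M s"
  shows "dpush F N I \<sigma> (\<phi> I s) (epush F M \<epsilon> l I s d) =
    epush F M \<epsilon> l (\<sigma> ` I) (tr (sp M) I \<sigma> s) (dpush F M I \<sigma> s d)"
proof -
  note Md = is_shapeD[OF M I s]
  have \<phi>s: "\<phi> I s \<in> str (sp N) I"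
    using sequivD(1)[OF eq I] s by (auto dest: bij_betwE)
  note Nd = is_shapeD[OF N I \<phi>s]
  have I': "finite (\<sigma> ` I)"
    using I by simp
  note s' = Md(3)[OF \<sigma>]
  note M'd = is_shapeD[OF M I' s']
  note nat = sequivD(5)[OF eq I s \<sigma>]
  show ?thesis
    unfolding dpush_def epush_def
  proof (rule push_push[OF F])
    show "bij_betw (\<epsilon> I s) (ed M s) (ed N (\<phi> I s))"
      by (rule sequivD(3)[OF eq I s])
    show "bij_betw (et N I \<sigma> (\<phi> I s)) (ed N (\<phi> I s)) (ed N (tr (sp N) I \<sigma> (\<phi> I s)))"
      by (rule Nd(5)[OF \<sigma>])
    show "bij_betw (et M I \<sigma> s) (ed M s) (ed M (tr (sp M) I \<sigma> s))"
      by (rule Md(5)[OF \<sigma>])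
    show "bij_betw (\<epsilon> (\<sigma> ` I) (tr (sp M) I \<sigma> s)) (ed M (tr (sp M) I \<sigma> s)) (ed N (tr (sp N) I \<sigma> (\<phi> I s)))"
      using sequivD(3)[OF eq I' s'] nat by simp
    show "d \<in> PiE (ed M s) (\<lambda>j. str F (lb M s j))"
      using d by (simp add: decs_def)
    show "finite (lb M s j) \<and> bij_betw (l I s j) (lb M s j) (lb N (\<phi> I s) (\<epsilon> I s j))" if "j \<in> ed M s" for j
      using Md(2)[OF that] sequivD(4)[OF eq I s that] by blast
    show "finite (lb N (\<phi> I s) j) \<and> bij_betw (lt N I \<sigma> (\<phi> I s) j) (lb N (\<phi> I s) j)
        (lb N (tr (sp N) I \<sigma> (\<phi> I s)) (et N I \<sigma> (\<phi> I s) j))" if "j \<in> ed N (\<phi> I s)" for j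
      using Nd(2)[OF that] Nd(6)[OF \<sigma> that] by blast
    show "finite (lb M s j) \<and> bij_betw (lt M I \<sigma> s j) (lb M s j)
        (lb M (tr (sp M) I \<sigma> s) (et M I \<sigma> s j))" if "j \<in> ed M s" for j
      using Md(2)[OF that] Md(6)[OF \<sigma> that] by blast
    show "finite (lb M (tr (sp M) I \<sigma> s) j) \<and> bij_betw (l (\<sigma> ` I) (tr (sp M) I \<sigma> s) j)
        (lb M (tr (sp M) I \<sigma> s) j) (lb N (tr (sp N) I \<sigma> (\<phi> I s)) (\<epsilon> (\<sigma> ` I) (tr (sp M) I \<sigma> s) j))"
      if "j \<in> ed M (tr (sp M) I \<sigma> s)" for j
      using M'd(2)[OF that] sequivD(4)[OF eq I' s' that] nat by simp
  qed (simp_all add: sequivD(6,7)[OF eq I s \<sigma>])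
qed

lemma bij_betw_Sigma:
  assumes "bij_betw f A B" "\<And>x. x \<in> A \<Longrightarrow> bij_betw (g x) (C x) (D (f x))"
  shows "bij_betw (\<lambda>(x, y). (f x, g x y)) (SIGMA x:A. C x) (SIGMA x:B. D x)"
proof (rule bij_betw_imageI)
  show "inj_on (\<lambda>(x, y). (f x, g x y)) (SIGMA x:A. C x)"
  proof (rule inj_onI, clarify, intro conjI)
    fix x y x' y'
    assume x: "x \<in> A" "x' \<in> A" "y \<in> C x" "y' \<in> C x'" and eq: "f x = f x'" "g x y = g x' y'"
    show "x = x'"
      using assms(1) eq(1) x(1,2) by (auto simp: bij_betw_def dest: inj_onD)
    then show "y = y'"
      using assms(2)[OF x(1)] eq(2) x(3,4) by (auto simp: bij_betw_def dest: inj_onD)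
  qed
  have g: "g x ` C x = D (f x)" if "x \<in> A" for x
    using assms(2)[OF that] by (simp add: bij_betw_def)
  have f: "f ` A = B"
    using assms(1) by (simp add: bij_betw_def)
  show "(\<lambda>(x, y). (f x, g x y)) ` (SIGMA x:A. C x) = (SIGMA x:B. D x)"
  proof (intro equalityI subsetI; clarify)
    fix x y
    assume "x \<in> B" "y \<in> D x"
    then obtain a where a: "a \<in> A" "x = f a"
      using f by blast
    then obtain c where "c \<in> C a" "y = g a c"
      using g[OF a(1)] \<open>y \<in> D x\<close> by blast
    with a show "(x, y) \<in> (\<lambda>(x, y). (f x, g x y)) ` (SIGMA x:A. C x)"
      by (intro image_eqI[of _ _ "(a, c)"]) auto
  qed (use f g in auto)
qed

lemma realises_sequiv:
  assumes eq: "sequiv M N \<phi> \<epsilon> l" and M: "is_shape M" and N: "is_shape N" and F: "functorial F"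
    and H: "realises F H N \<beta>"
  shows "realises F H M (\<lambda>I s d. \<beta> I (\<phi> I s) (epush F M \<epsilon> l I s d))"
  unfolding realises_def
proof (intro allI impI conjI ballI)
  fix I :: "'a lab set"
  assume I: "finite I"
  let ?f = "\<lambda>(s, d). (\<phi> I s, epush F M \<epsilon> l I s d)"
  have "bij_betw ?f (SIGMA s:str (sp M) I. decs F M s) (SIGMA s:str (sp N) I. decs F N s)"
    by (rule bij_betw_Sigma[of "\<phi> I" _ _ "epush F M \<epsilon> l I", OF sequivD(1)[OF eq I] epush_bij[OF eq M F I]])
  from bij_betw_trans[OF this realisesD(1)[OF H I]]
  show "bij_betw (\<lambda>(s, d). \<beta> I (\<phi> I s) (epush F M \<epsilon> l I s d)) (SIGMA s:str (sp M) I. decs F M s) (str H I)"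
    by (simp add: comp_def case_prod_unfold)
  fix s d
  assume s: "s \<in> str (sp M) I" and d: "d \<in> decs F M s"
  have \<phi>s: "\<phi> I s \<in> str (sp N) I" and ed: "epush F M \<epsilon> l I s d \<in> decs F N (\<phi> I s)"
    using sequivD(1)[OF eq I] epush_bij[OF eq M F I s] s d by (auto dest: bij_betwE)
  show "wt H (\<beta> I (\<phi> I s) (epush F M \<epsilon> l I s d)) = wt (sp M) s"
    using realisesD(2)[OF H I \<phi>s ed] sequivD(2)[OF eq I s] by simp
  fix \<sigma> :: "'a lab \<Rightarrow> 'a lab"
  assume \<sigma>: "inj_on \<sigma> I"
  show "tr H I \<sigma> (\<beta> I (\<phi> I s) (epush F M \<epsilon> l I s d)) = \<beta> (\<sigma> ` I) (\<phi> (\<sigma> ` I) (tr (sp M) I \<sigma> s))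
      (epush F M \<epsilon> l (\<sigma> ` I) (tr (sp M) I \<sigma> s) (dpush F M I \<sigma> s d))"
    using realisesD(3)[OF H I \<phi>s ed \<sigma>] sequivD(5)[OF eq I s \<sigma>]
      epush_dpush[OF eq M N F I s \<sigma> d] by simp
qed

lemma is_shapeI:
  assumes "\<And>I s. finite I \<Longrightarrow> s \<in> str (sp M) I \<Longrightarrow> finite (ed M s)"
    and "\<And>I s j. finite I \<Longrightarrow> s \<in> str (sp M) I \<Longrightarrow> j \<in> ed M s \<Longrightarrow> finite (lb M s j)"
    and "\<And>I s \<sigma>. finite I \<Longrightarrow> s \<in> str (sp M) I \<Longrightarrow> inj_on \<sigma> I \<Longrightarrow> tr (sp M) I \<sigma> s \<in> str (sp M) (\<sigma> ` I)"
    and "\<And>I s \<sigma>. finite I \<Longrightarrow> s \<in> str (sp M) I \<Longrightarrow> inj_on \<sigma> I \<Longrightarrow> wt (sp M) (tr (sp M) I \<sigma> s) = wt (sp M) s"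
    and "\<And>I s \<sigma>. finite I \<Longrightarrow> s \<in> str (sp M) I \<Longrightarrow> inj_on \<sigma> I \<Longrightarrow>
      bij_betw (et M I \<sigma> s) (ed M s) (ed M (tr (sp M) I \<sigma> s))"
    and "\<And>I s \<sigma> j. finite I \<Longrightarrow> s \<in> str (sp M) I \<Longrightarrow> inj_on \<sigma> I \<Longrightarrow> j \<in> ed M s \<Longrightarrow>
      bij_betw (lt M I \<sigma> s j) (lb M s j) (lb M (tr (sp M) I \<sigma> s) (et M I \<sigma> s j))"
  shows "is_shape M"
  unfolding is_shape_def using assms by simp

text \<open>The edges of a part sit inside those of the whole by \<open>i\<close>, and those of the
  transported part by \<open>i'\<close>. In this way the transport of a decoration of a product or
  composite is resolved into transports on its parts.\<close>

lemma dpush_restrict: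
  assumes M: "is_shape M" "finite I" "s \<in> str (sp M) I" "inj_on \<sigma> I"
    and M': "is_shape M'" "finite I'" "s' \<in> str (sp M') I'" "inj_on \<sigma>' I'"
    and F: "functorial F" and d: "d \<in> decs F M s"
    and i: "\<And>j. j \<in> ed M' s' \<Longrightarrow> i j \<in> ed M s" "\<And>j. j \<in> ed M' s' \<Longrightarrow> lb M s (i j) = lb M' s' j"
      "\<And>j. j \<in> ed M' s' \<Longrightarrow> et M I \<sigma> s (i j) = i' (et M' I' \<sigma>' s' j)"
      "\<And>j. j \<in> ed M' s' \<Longrightarrow> lt M I \<sigma> s (i j) = lt M' I' \<sigma>' s' j"
    and i': "\<And>j. j \<in> ed M' (tr (sp M') I' \<sigma>' s') \<Longrightarrow> i' j \<in> ed M (tr (sp M) I \<sigma> s)"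
      "\<And>j. j \<in> ed M' (tr (sp M') I' \<sigma>' s') \<Longrightarrow> lb M (tr (sp M) I \<sigma> s) (i' j) = lb M' (tr (sp M') I' \<sigma>' s') j"
  shows "dpush F M' I' \<sigma>' s' (\<lambda>j\<in>ed M' s'. d (i j)) =
    (\<lambda>j\<in>ed M' (tr (sp M') I' \<sigma>' s'). dpush F M I \<sigma> s d (i' j))"
proof (rule dpush_eqI[OF M'])
  have D: "dpush F M I \<sigma> s d \<in> decs F M (tr (sp M) I \<sigma> s)"
    using dpush_in[OF M(1) F M(2-4) d] .
  have "dpush F M I \<sigma> s d (i' j) \<in> str F (lb M' (tr (sp M') I' \<sigma>' s') j)"
    if "j \<in> ed M' (tr (sp M') I' \<sigma>' s')" for j
    using PiE_mem[OF D[unfolded decs_def] i'(1)[OF that]] i'(2)[OF that] by simp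
  then show "(\<lambda>j\<in>ed M' (tr (sp M') I' \<sigma>' s'). dpush F M I \<sigma> s d (i' j)) \<in> decs F M' (tr (sp M') I' \<sigma>' s')"
    by (simp add: decs_def)
  fix j
  assume j: "j \<in> ed M' s'"
  have "et M' I' \<sigma>' s' j \<in> ed M' (tr (sp M') I' \<sigma>' s')"
    using is_shapeD(5)[OF M'] j by (auto dest: bij_betwE)
  then show "(\<lambda>j\<in>ed M' (tr (sp M') I' \<sigma>' s'). dpush F M I \<sigma> s d (i' j)) (et M' I' \<sigma>' s' j) =
      tr F (lb M' s' j) (lt M' I' \<sigma>' s' j) ((\<lambda>j\<in>ed M' s'. d (i j)) j)"
    using dpush_apply[OF M i(1)[OF j], of F d] i(2,3,4)[OF j] j by simp
qed

lemma realises_inj: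
  assumes "realises F G M \<beta>" "finite I" "s \<in> str (sp M) I" "d \<in> decs F M s"
    "s' \<in> str (sp M) I" "d' \<in> decs F M s'" "\<beta> I s d = \<beta> I s' d'"
  shows "s = s'" "d = d'"
  using inj_onD[OF bij_betw_imp_inj_on[OF realisesD(1)[OF assms(1,2)]], of "(s, d)" "(s', d')"] assms(3-)
  by auto

lemma realises_surj:
  assumes "realises F G M \<beta>" "finite I" "g \<in> str G I"
  shows "\<exists>s\<in>str (sp M) I. \<exists>d\<in>decs F M s. g = \<beta> I s d"
proof -
  have "g \<in> (\<lambda>(s, d). \<beta> I s d) ` (SIGMA s:str (sp M) I. decs F M s)"
    using realisesD(1)[OF assms(1,2)] assms(3) by (simp add: bij_betw_def)
  then show ?thesis
    by (auto simp: image_iff)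
qed

lemma realisesI:
  assumes "\<And>I s d. finite I \<Longrightarrow> s \<in> str (sp M) I \<Longrightarrow> d \<in> decs F M s \<Longrightarrow> \<beta> I s d \<in> str G I"
    and "\<And>I s d s' d'. finite I \<Longrightarrow> s \<in> str (sp M) I \<Longrightarrow> d \<in> decs F M s \<Longrightarrow> s' \<in> str (sp M) I \<Longrightarrow>
      d' \<in> decs F M s' \<Longrightarrow> \<beta> I s d = \<beta> I s' d' \<Longrightarrow> s = s' \<and> d = d'"
    and "\<And>I g. finite I \<Longrightarrow> g \<in> str G I \<Longrightarrow> \<exists>s\<in>str (sp M) I. \<exists>d\<in>decs F M s. g = \<beta> I s d"
    and "\<And>I s d. finite I \<Longrightarrow> s \<in> str (sp M) I \<Longrightarrow> d \<in> decs F M s \<Longrightarrow> wt G (\<beta> I s d) = wt (sp M) s"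
    and "\<And>I s d \<sigma>. finite I \<Longrightarrow> s \<in> str (sp M) I \<Longrightarrow> d \<in> decs F M s \<Longrightarrow> inj_on \<sigma> I \<Longrightarrow>
      tr G I \<sigma> (\<beta> I s d) = \<beta> (\<sigma> ` I) (tr (sp M) I \<sigma> s) (dpush F M I \<sigma> s d)"
  shows "realises F G M \<beta>"
  unfolding realises_def
proof (intro allI impI conjI ballI)
  fix I :: "'a lab set"
  assume I: "finite I"
  show "bij_betw (\<lambda>(s, d). \<beta> I s d) (SIGMA s:str (sp M) I. decs F M s) (str G I)"
  proof (rule bij_betw_imageI)
    show "inj_on (\<lambda>(s, d). \<beta> I s d) (SIGMA s:str (sp M) I. decs F M s)"
      using assms(2)[OF I] by (fastforce intro!: inj_onI)
    show "(\<lambda>(s, d). \<beta> I s d) ` (SIGMA s:str (sp M) I. decs F M s) = str G I"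
      using assms(1)[OF I] assms(3)[OF I] by (auto simp: image_iff)
  qed
qed (use assms(4,5) in auto)

section \<open>Operations on shapes\<close>

definition splain :: "('a, 's) wspecies \<Rightarrow> ('a, 's, 'e) shape" where
  "splain G = \<lparr>sp = G, ed = (\<lambda>_. {}), lb = (\<lambda>_ _. {}), et = (\<lambda>_ _ _ e. e), lt = (\<lambda>_ _ _ _ x. x)\<rparr>"

definition sshift :: "int \<Rightarrow> ('a, 's, 'e) shape \<Rightarrow> ('a, 's, 'e) shape" where
  "sshift k M = M\<lparr>sp := wshift k (sp M)\<rparr>"

definition sderiv :: "('a, 's, 'e) shape \<Rightarrow> ('a, 's, 'e) shape" where
  "sderiv M = \<lparr>sp = wderiv (sp M), ed = ed M, lb = lb M,
     et = (\<lambda>I \<sigma>. et M (add_pt I) (ext_map I \<sigma>)), lt = (\<lambda>I \<sigma>. lt M (add_pt I) (ext_map I \<sigma>))\<rparr>"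

definition ssum :: "('a, 's, 'e) shape \<Rightarrow> ('a, 'r, 'e) shape \<Rightarrow> ('a, 's + 'r, 'e) shape" where
  "ssum M N = \<lparr>sp = sp M +\<^sub>w sp N, ed = case_sum (ed M) (ed N), lb = case_sum (lb M) (lb N),
     et = (\<lambda>I \<sigma>. case_sum (et M I \<sigma>) (et N I \<sigma>)), lt = (\<lambda>I \<sigma>. case_sum (lt M I \<sigma>) (lt N I \<sigma>))\<rparr>"

definition sprod :: "('a, 's, 'e) shape \<Rightarrow> ('a, 'r, 'f) shape \<Rightarrow>
    ('a, 'a lab set \<times> 'a lab set \<times> 's \<times> 'r, 'e + 'f) shape" where
  "sprod M N = \<lparr>sp = sp M \<times>\<^sub>w sp N,
     ed = (\<lambda>(A, B, x, y). ed M x <+> ed N y),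
     lb = (\<lambda>(A, B, x, y). case_sum (lb M x) (lb N y)),
     et = (\<lambda>I \<sigma> (A, B, x, y). map_sum (et M A \<sigma> x) (et N B \<sigma> y)),
     lt = (\<lambda>I \<sigma> (A, B, x, y). case_sum (lt M A \<sigma> x) (lt N B \<sigma> y))\<rparr>"

definition scomp :: "('a, 's, 'e) shape \<Rightarrow> ('a, 'r, 'f) shape \<Rightarrow>
    ('a, 'a lab set set \<times> 's \<times> ('a lab set \<Rightarrow> 'r), 'e + 'a lab set \<times> 'f) shape" where
  "scomp M N = \<lparr>sp = sp M \<circ>\<^sub>w sp N,
     ed = (\<lambda>(\<pi>, x, y). ed M x <+> (SIGMA J:\<pi>. ed N (y J))),
     lb = (\<lambda>(\<pi>, x, y). case_sum (lb M x) (\<lambda>(J, f). lb N (y J) f)),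
     et = (\<lambda>I \<sigma> (\<pi>, x, y). map_sum (et M (blk ` \<pi>) (blk_map \<sigma>) x) (\<lambda>(J, f). (\<sigma> ` J, et N J \<sigma> (y J) f))),
     lt = (\<lambda>I \<sigma> (\<pi>, x, y). case_sum (lt M (blk ` \<pi>) (blk_map \<sigma>) x) (\<lambda>(J, f). lt N J \<sigma> (y J) f))\<rparr>"

lemma is_shape_splain:
  assumes "\<And>I s \<sigma>. finite I \<Longrightarrow> s \<in> str G I \<Longrightarrow> inj_on \<sigma> I \<Longrightarrow> tr G I \<sigma> s \<in> str G (\<sigma> ` I)"
    and "\<And>I s \<sigma>. finite I \<Longrightarrow> s \<in> str G I \<Longrightarrow> inj_on \<sigma> I \<Longrightarrow> wt G (tr G I \<sigma> s) = wt G s"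
  shows "is_shape (splain G)"
  using assms by (intro is_shapeI) (auto simp: splain_def bij_betw_def)

lemma decs_splain: "decs F (splain G) s = {\<lambda>_. undefined}"
  by (simp add: decs_def splain_def)

lemma realises_splain: "realises F G (splain G) (\<lambda>I s d. s)"
  by (rule realisesI) (simp_all add: decs_splain, simp_all add: splain_def)

lemma is_shape_sshift: "is_shape M \<Longrightarrow> is_shape (sshift k M)"
  by (simp add: is_shape_def sshift_def wshift_def)

lemma realises_sshift: "realises F G M \<beta> \<Longrightarrow> realises F (wshift k G) (sshift k M) \<beta>"
  by (simp add: realises_def sshift_def wshift_def decs_def dpush_def)

lemma ext_map_simps:
  "ext_map I \<sigma> (blk I) = blk (\<sigma> ` I)"
  "finite I \<Longrightarrow> x \<in> I \<Longrightarrow> ext_map I \<sigma> x = \<sigma> x"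
  using blk_notin[of I] by (auto simp: ext_map_def)

lemma ext_map_image: "finite I \<Longrightarrow> ext_map I \<sigma> ` add_pt I = add_pt (\<sigma> ` I)"
  by (simp add: add_pt_def ext_map_simps cong: image_cong)

text \<open>The added point goes to the added point of the image set, which by
  \<open>blk_notin\<close> is no element of that set.\<close>

lemma inj_on_ext_map:
  assumes "finite I" "inj_on \<sigma> I"
  shows "inj_on (ext_map I \<sigma>) (add_pt I)"
proof -
  have "inj_on (ext_map I \<sigma>) I"
    using assms ext_map_simps(2)[OF assms(1)] by (simp cong: inj_on_cong)
  moreover have "ext_map I \<sigma> ` I = \<sigma> ` I"
    using ext_map_simps(2)[OF assms(1)] by (simp cong: image_cong)
  ultimately show ?thesis
    using blk_notin[of I] blk_notin[of "\<sigma> ` I"] assms(1)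
    by (simp add: add_pt_def inj_on_insert ext_map_simps(1))
qed

lemma finite_add_pt: "finite (add_pt I) \<longleftrightarrow> finite I"
  by (simp add: add_pt_def)

lemma is_shape_sderiv:
  assumes "is_shape M"
  shows "is_shape (sderiv M)"
  unfolding is_shape_def
proof (intro allI impI ballI)
  fix I s
  assume I: "finite I" and "s \<in> str (sp (sderiv M)) I"
  then have s: "s \<in> str (sp M) (add_pt I)"
    by (simp add: sderiv_def wderiv_def)
  note Md = is_shapeD[OF assms finite_add_pt[THEN iffD2, OF I] s]
  show "finite (ed (sderiv M) s) \<and> (\<forall>j\<in>ed (sderiv M) s. finite (lb (sderiv M) s j)) \<and>
     (\<forall>\<sigma>. inj_on \<sigma> I \<longrightarrow>
       tr (sp (sderiv M)) I \<sigma> s \<in> str (sp (sderiv M)) (\<sigma> ` I) \<and>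
       wt (sp (sderiv M)) (tr (sp (sderiv M)) I \<sigma> s) = wt (sp (sderiv M)) s \<and>
       bij_betw (et (sderiv M) I \<sigma> s) (ed (sderiv M) s) (ed (sderiv M) (tr (sp (sderiv M)) I \<sigma> s)) \<and>
       (\<forall>j\<in>ed (sderiv M) s. bij_betw (lt (sderiv M) I \<sigma> s j) (lb (sderiv M) s j)
          (lb (sderiv M) (tr (sp (sderiv M)) I \<sigma> s) (et (sderiv M) I \<sigma> s j))))"
    using Md(1,2) Md(3-6)[OF inj_on_ext_map[OF I]] ext_map_image[OF I]
    by (simp add: sderiv_def wderiv_def)
qed

lemma realises_sderiv:
  assumes "realises F G M \<beta>"
  shows "realises F (wderiv G) (sderiv M) (\<lambda>I. \<beta> (add_pt I))"
  unfolding realises_def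
proof (intro allI impI)
  fix I :: "'a lab set"
  assume I: "finite I"
  then show "bij_betw (\<lambda>(s, d). \<beta> (add_pt I) s d) (SIGMA s:str (sp (sderiv M)) I. decs F (sderiv M) s) (str (wderiv G) I) \<and>
    (\<forall>s\<in>str (sp (sderiv M)) I. \<forall>d\<in>decs F (sderiv M) s. wt (wderiv G) (\<beta> (add_pt I) s d) = wt (sp (sderiv M)) s \<and>
      (\<forall>\<sigma>. inj_on \<sigma> I \<longrightarrow> tr (wderiv G) I \<sigma> (\<beta> (add_pt I) s d) =
        \<beta> (add_pt (\<sigma> ` I)) (tr (sp (sderiv M)) I \<sigma> s) (dpush F (sderiv M) I \<sigma> s d)))"
    using realisesD[OF assms finite_add_pt[THEN iffD2, OF I]] inj_on_ext_map[OF I] ext_map_image[OF I]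
    by (simp add: sderiv_def wderiv_def decs_def dpush_def)
qed

lemma is_shape_ssum:
  assumes "is_shape M" "is_shape N"
  shows "is_shape (ssum M N)"
  using is_shapeD[OF assms(1)] is_shapeD[OF assms(2)]
  by (intro is_shapeI) (auto simp: ssum_def wsum_def elim!: PlusE)

lemma realises_ssum:
  assumes G: "realises F G M \<beta>" and H: "realises F H N \<gamma>"
  shows "realises F (G +\<^sub>w H) (ssum M N)
    (\<lambda>I s d. case s of Inl x \<Rightarrow> Inl (\<beta> I x d) | Inr y \<Rightarrow> Inr (\<gamma> I y d))"
proof -
  have decs: "decs F (ssum M N) (Inl x) = decs F M x" "decs F (ssum M N) (Inr y) = decs F N y" for x y
    by (simp_all add: decs_def ssum_def)
  have dpush: "dpush F (ssum M N) I \<sigma> (Inl x) = dpush F M I \<sigma> x"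
    "dpush F (ssum M N) I \<sigma> (Inr y) = dpush F N I \<sigma> y" for I \<sigma> x y
    by (simp_all add: dpush_def ssum_def)
  have str: "str (sp (ssum M N)) I = str (sp M) I <+> str (sp N) I" for I
    by (simp add: ssum_def wsum_def)
  have tr: "tr (sp (ssum M N)) I \<sigma> (Inl x) = Inl (tr (sp M) I \<sigma> x)"
    "tr (sp (ssum M N)) I \<sigma> (Inr y) = Inr (tr (sp N) I \<sigma> y)"
    "tr (G +\<^sub>w H) I \<sigma> (Inl g) = Inl (tr G I \<sigma> g)" "tr (G +\<^sub>w H) I \<sigma> (Inr h) = Inr (tr H I \<sigma> h)"
    for I \<sigma> x y g h
    by (simp_all add: ssum_def wsum_def)
  have wt: "wt (sp (ssum M N)) (Inl x) = wt (sp M) x" "wt (sp (ssum M N)) (Inr y) = wt (sp N) y"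
    "wt (G +\<^sub>w H) (Inl g) = wt G g" "wt (G +\<^sub>w H) (Inr h) = wt H h" for x y g h
    by (simp_all add: ssum_def wsum_def)
  show ?thesis
  proof (rule realisesI, goal_cases)
    case (1 I s d)
    then show ?case
      using realises_in[OF G] realises_in[OF H]
      by (auto simp: str decs wsum_def elim!: PlusE)
  next
    case (2 I s d s' d')
    then show ?case
      using realises_inj[OF G] realises_inj[OF H] by (auto simp: str decs elim!: PlusE)
  next
    case (3 I g)
    then have "g \<in> str G I <+> str H I"
      by (simp add: wsum_def)
    then show ?case
    proof (rule PlusE)
      fix x
      assume x: "x \<in> str G I" "g = Inl x"
      then obtain s d where "s \<in> str (sp M) I" "d \<in> decs F M s" "x = \<beta> I s d"
        using realises_surj[OF G 3(1)] by blast
      then show ?thesis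
        using x by (intro bexI[of _ "Inl s"] bexI[of _ d]) (auto simp: str decs InlI)
    next
      fix x
      assume x: "x \<in> str H I" "g = Inr x"
      then obtain s d where "s \<in> str (sp N) I" "d \<in> decs F N s" "x = \<gamma> I s d"
        using realises_surj[OF H 3(1)] by blast
      then show ?thesis
        using x by (intro bexI[of _ "Inr s"] bexI[of _ d]) (auto simp: str decs InrI)
    qed
  next
    case (4 I s d)
    then show ?case
      using realisesD(2)[OF G] realisesD(2)[OF H]
      by (auto simp: str decs wt elim!: PlusE)
  next
    case (5 I s d \<sigma>)
    then show ?case
      using realisesD(3)[OF G] realisesD(3)[OF H]
      by (auto simp: str decs dpush tr elim!: PlusE)
  qed
qed

lemma bij_betw_map_sum:
  assumes "bij_betw f A B" "bij_betw g C D"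
  shows "bij_betw (map_sum f g) (A <+> C) (B <+> D)"
proof (rule bij_betw_imageI)
  show "inj_on (map_sum f g) (A <+> C)"
    using assms[THEN bij_betw_imp_inj_on] by (auto intro!: inj_onI elim!: PlusE dest: inj_onD)
  show "map_sum f g ` (A <+> C) = B <+> D"
    using assms by (auto simp: bij_betw_def Plus_def image_Un image_image)
qed

lemma mem_str_sprod:
  "(A, B, x, y) \<in> str (sp (sprod M N)) I \<longleftrightarrow>
     A \<union> B = I \<and> A \<inter> B = {} \<and> x \<in> str (sp M) A \<and> y \<in> str (sp N) B"
  by (simp add: sprod_def wprod_def)

lemma tr_sprod: "tr (sp (sprod M N)) I \<sigma> (A, B, x, y) = (\<sigma> ` A, \<sigma> ` B, tr (sp M) A \<sigma> x, tr (sp N) B \<sigma> y)"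
  by (simp add: sprod_def wprod_def)

lemma wt_sprod: "wt (sp (sprod M N)) (A, B, x, y) = wt (sp M) x + wt (sp N) y"
  by (simp add: sprod_def wprod_def)

lemma sprod_fields:
  "ed (sprod M N) (A, B, x, y) = ed M x <+> ed N y"
  "lb (sprod M N) (A, B, x, y) = case_sum (lb M x) (lb N y)"
  "et (sprod M N) I \<sigma> (A, B, x, y) = map_sum (et M A \<sigma> x) (et N B \<sigma> y)"
  "lt (sprod M N) I \<sigma> (A, B, x, y) = case_sum (lt M A \<sigma> x) (lt N B \<sigma> y)"
  by (simp_all add: sprod_def)

lemma sprod_parts:
  assumes "finite I" "inj_on \<sigma> I" "A \<union> B = I" "A \<inter> B = {}"
  shows "finite A" "finite B" "inj_on \<sigma> A" "inj_on \<sigma> B" "\<sigma> ` A \<inter> \<sigma> ` B = {}"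
  using assms by (auto intro: inj_on_subset dest: inj_onD)

lemma is_shape_sprod:
  assumes M: "is_shape M" and N: "is_shape N"
  shows "is_shape (sprod M N)"
proof (rule is_shapeI, goal_cases)
  case (1 I s)
  then show ?case
    using is_shapeD(1)[OF M] is_shapeD(1)[OF N] by (cases s) (auto simp: mem_str_sprod sprod_fields)
next
  case (2 I s j)
  then show ?case
    using is_shapeD(2)[OF M] is_shapeD(2)[OF N] by (cases s) (auto simp: mem_str_sprod sprod_fields elim!: PlusE)
next
  case (3 I s \<sigma>)
  obtain A B x y where s: "s = (A, B, x, y)"
    by (cases s)
  then show ?case
    using 3 sprod_parts[OF 3(1,3), of A B] is_shapeD(3)[OF M, of A x \<sigma>] is_shapeD(3)[OF N, of B y \<sigma>]
    by (simp add: mem_str_sprod tr_sprod flip: image_Un)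
next
  case (4 I s \<sigma>)
  obtain A B x y where s: "s = (A, B, x, y)"
    by (cases s)
  then show ?case
    using 4 sprod_parts[OF 4(1,3), of A B] is_shapeD(4)[OF M, of A x \<sigma>] is_shapeD(4)[OF N, of B y \<sigma>]
    by (simp add: mem_str_sprod tr_sprod wt_sprod)
next
  case (5 I s \<sigma>)
  obtain A B x y where s: "s = (A, B, x, y)"
    by (cases s)
  then show ?case
    using 5 sprod_parts[OF 5(1,3), of A B] is_shapeD(5)[OF M, of A x \<sigma>] is_shapeD(5)[OF N, of B y \<sigma>]
    by (simp add: mem_str_sprod tr_sprod sprod_fields bij_betw_map_sum)
next
  case (6 I s \<sigma> j)
  obtain A B x y where s: "s = (A, B, x, y)"
    by (cases s)
  then show ?case
    using 6 sprod_parts[OF 6(1,3), of A B] is_shapeD(6)[OF M, of A x \<sigma>] is_shapeD(6)[OF N, of B y \<sigma>]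
    by (auto simp: mem_str_sprod tr_sprod sprod_fields elim!: PlusE)
qed

lemma dpush_sprod:
  assumes M: "is_shape M" and N: "is_shape N" and F: "functorial F"
    and I: "finite I" and s: "(A, B, x, y) \<in> str (sp (sprod M N)) I" and \<sigma>: "inj_on \<sigma> I"
    and d: "d \<in> decs F (sprod M N) (A, B, x, y)"
  shows "dpush F M A \<sigma> x (\<lambda>j\<in>ed M x. d (Inl j)) =
      (\<lambda>j\<in>ed M (tr (sp M) A \<sigma> x). dpush F (sprod M N) I \<sigma> (A, B, x, y) d (Inl j))"
    and "dpush F N B \<sigma> y (\<lambda>j\<in>ed N y. d (Inr j)) =
      (\<lambda>j\<in>ed N (tr (sp N) B \<sigma> y). dpush F (sprod M N) I \<sigma> (A, B, x, y) d (Inr j))"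
proof -
  note AB = s[unfolded mem_str_sprod]
  note fin = sprod_parts[OF I \<sigma>, of A B]
  show "dpush F M A \<sigma> x (\<lambda>j\<in>ed M x. d (Inl j)) =
      (\<lambda>j\<in>ed M (tr (sp M) A \<sigma> x). dpush F (sprod M N) I \<sigma> (A, B, x, y) d (Inl j))"
    using AB fin
    by (intro dpush_restrict[OF is_shape_sprod[OF M N] I s \<sigma> M _ _ _ F d]) (auto simp: sprod_fields tr_sprod)
  show "dpush F N B \<sigma> y (\<lambda>j\<in>ed N y. d (Inr j)) =
      (\<lambda>j\<in>ed N (tr (sp N) B \<sigma> y). dpush F (sprod M N) I \<sigma> (A, B, x, y) d (Inr j))"
    using AB fin
    by (intro dpush_restrict[OF is_shape_sprod[OF M N] I s \<sigma> N _ _ _ F d]) (auto simp: sprod_fields tr_sprod)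
qed

lemma decs_sprod:
  "decs F (sprod M N) (A, B, x, y) =
     PiE (ed M x <+> ed N y) (case_sum (\<lambda>j. str F (lb M x j)) (\<lambda>j. str F (lb N y j)))"
  unfolding decs_def sprod_fields by (rule PiE_cong) (auto elim!: PlusE)

text \<open>A family over a disjoint union of edge sets is a pair of families, so decorating a
  product means decorating both factors.\<close>

lemma realises_sprod:
  assumes M: "is_shape M" and N: "is_shape N" and F: "functorial F"
    and G: "realises F G M \<beta>" and H: "realises F H N \<gamma>"
  shows "realises F (G \<times>\<^sub>w H) (sprod M N)
    (\<lambda>I (A, B, x, y) d. (A, B, \<beta> A x (\<lambda>j\<in>ed M x. d (Inl j)), \<gamma> B y (\<lambda>j\<in>ed N y. d (Inr j))))"
proof (rule realisesI, goal_cases)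
  case (1 I s d)
  obtain A B x y where s: "s = (A, B, x, y)"
    by (cases s)
  note AB = 1(2)[unfolded s mem_str_sprod]
  note d = 1(3)[unfolded s decs_sprod]
  have "finite A" "finite B"
    using AB 1(1) by auto
  then show ?case
    using AB realises_in[OF G, of A x] realises_in[OF H, of B y] restrict_Inl[OF d] restrict_Inr[OF d]
    by (simp add: s wprod_def decs_def)
next
  case (2 I s d s' d')
  obtain A B x y where s: "s = (A, B, x, y)"
    by (cases s)
  obtain A' B' x' y' where s': "s' = (A', B', x', y')"
    by (cases s')
  note AB = 2(2)[unfolded s mem_str_sprod] and AB' = 2(4)[unfolded s' mem_str_sprod]
  note d = 2(3)[unfolded s decs_sprod] and d' = 2(5)[unfolded s' decs_sprod]
  have fin: "finite A" "finite B"
    using AB 2(1) by auto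
  have eq: "A' = A" "B' = B" "\<beta> A x (\<lambda>j\<in>ed M x. d (Inl j)) = \<beta> A x' (\<lambda>j\<in>ed M x'. d' (Inl j))"
    "\<gamma> B y (\<lambda>j\<in>ed N y. d (Inr j)) = \<gamma> B y' (\<lambda>j\<in>ed N y'. d' (Inr j))"
    using 2(6) by (auto simp: s s')
  have mem: "x \<in> str (sp M) A" "x' \<in> str (sp M) A" "y \<in> str (sp N) B" "y' \<in> str (sp N) B"
    using AB AB' eq(1,2) by auto
  have x: "x = x'" "(\<lambda>j\<in>ed M x. d (Inl j)) = (\<lambda>j\<in>ed M x'. d' (Inl j))"
    by (rule realises_inj[OF G fin(1) mem(1) restrict_Inl[OF d, folded decs_def]
          mem(2) restrict_Inl[OF d', folded decs_def] eq(3)])+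
  have y: "y = y'" "(\<lambda>j\<in>ed N y. d (Inr j)) = (\<lambda>j\<in>ed N y'. d' (Inr j))"
    by (rule realises_inj[OF H fin(2) mem(3) restrict_Inr[OF d, folded decs_def]
          mem(4) restrict_Inr[OF d', folded decs_def] eq(4)])+
  have "d = d'"
    using case_sum_restrict[OF d] case_sum_restrict[OF d'] x(2) y(2) by simp
  then show ?case
    using eq x y s s' by simp
next
  case (3 I g)
  obtain A B u v where g: "g = (A, B, u, v)"
    by (cases g)
  have AB: "A \<union> B = I" "A \<inter> B = {}" "u \<in> str G A" "v \<in> str H B"
    using 3(2) by (auto simp: g wprod_def)
  then have fin: "finite A" "finite B"
    using 3(1) by auto
  obtain x d where x: "x \<in> str (sp M) A" "d \<in> decs F M x" "u = \<beta> A x d"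
    using realises_surj[OF G fin(1) AB(3)] by blast
  obtain y e where y: "y \<in> str (sp N) B" "e \<in> decs F N y" "v = \<gamma> B y e"
    using realises_surj[OF H fin(2) AB(4)] by blast
  have "case_sum d e \<in> decs F (sprod M N) (A, B, x, y)"
    unfolding decs_sprod using x(2) y(2) by (intro case_sum_in_PiE) (auto simp: decs_def)
  then show ?case
    using AB x y restrict_case_sum(1)[OF x(2)[unfolded decs_def]] restrict_case_sum(2)[OF y(2)[unfolded decs_def]]
    by (intro bexI[of _ "(A, B, x, y)"] bexI[of _ "case_sum d e"]) (auto simp: g mem_str_sprod)
next
  case (4 I s d)
  obtain A B x y where s: "s = (A, B, x, y)"
    by (cases s)
  note AB = 4(2)[unfolded s mem_str_sprod]
  note d = 4(3)[unfolded s decs_sprod]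
  have "finite A" "finite B"
    using AB 4(1) by auto
  then show ?case
    using AB realisesD(2)[OF G, of A x] realisesD(2)[OF H, of B y] restrict_Inl[OF d] restrict_Inr[OF d]
    unfolding s wt_sprod by (simp add: wprod_def decs_def)
next
  case (5 I s d \<sigma>)
  obtain A B x y where s: "s = (A, B, x, y)"
    by (cases s)
  note AB = 5(2)[unfolded s mem_str_sprod]
  note d = 5(3)[unfolded s decs_sprod]
  note fin = sprod_parts[OF 5(1,4), of A B]
  note dp = dpush_sprod[OF M N F 5(1) 5(2)[unfolded s] 5(4) 5(3)[unfolded s]]
  have "tr G A \<sigma> (\<beta> A x (\<lambda>j\<in>ed M x. d (Inl j))) = \<beta> (\<sigma> ` A) (tr (sp M) A \<sigma> x) (dpush F M A \<sigma> x (\<lambda>j\<in>ed M x. d (Inl j)))"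
    using AB fin restrict_Inl[OF d] by (intro realisesD(3)[OF G]) (auto simp: decs_def)
  moreover have "tr H B \<sigma> (\<gamma> B y (\<lambda>j\<in>ed N y. d (Inr j))) = \<gamma> (\<sigma> ` B) (tr (sp N) B \<sigma> y) (dpush F N B \<sigma> y (\<lambda>j\<in>ed N y. d (Inr j)))"
    using AB fin restrict_Inr[OF d] by (intro realisesD(3)[OF H]) (auto simp: decs_def)
  ultimately show ?case
    unfolding s tr_sprod prod.case dp[symmetric] by (simp add: wprod_def)
qed

section \<open>Composition of shapes\<close>

lemma partition_facts:
  assumes "partition_on I \<pi>" "finite I"
  shows "finite \<pi>" "J \<in> \<pi> \<Longrightarrow> finite J" "J \<in> \<pi> \<Longrightarrow> J \<subseteq> I" "J \<in> \<pi> \<Longrightarrow> J \<noteq> {}"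
    and "inj_on blk \<pi>" "J \<in> \<pi> \<Longrightarrow> unblk (blk J) = J"
proof -
  show sub: "J \<subseteq> I" if "J \<in> \<pi>" for J
    using assms(1) that by (auto simp: partition_on_def)
  then show fin: "finite J" if "J \<in> \<pi>" for J
    using assms(2) that finite_subset by blast
  show "J \<noteq> {}" if "J \<in> \<pi>" for J
    using assms(1) that by (auto simp: partition_on_def)
  show "finite \<pi>"
    using assms by (rule finite_elements[rotated])
  show "inj_on blk \<pi>"
    by (rule inj_on_subset[OF inj_on_blk]) (use fin in blast)
  show "unblk (blk J) = J" if "J \<in> \<pi>" for J
    using fin[OF that] by (rule unblk_blk)
qed

lemma partition_image:
  assumes "partition_on I \<pi>" "finite I" "inj_on \<sigma> I"
  shows "partition_on (\<sigma> ` I) (image \<sigma> ` \<pi>)" "inj_on (image \<sigma>) \<pi>"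
    and "J \<in> \<pi> \<Longrightarrow> inj_on \<sigma> J" "J \<in> \<pi> \<Longrightarrow> inv_into I \<sigma> ` \<sigma> ` J = J"
    and "J \<in> \<pi> \<Longrightarrow> blk_map \<sigma> (blk J) = blk (\<sigma> ` J)"
    and "blk_map \<sigma> ` blk ` \<pi> = blk ` image \<sigma> ` \<pi>" "inj_on (blk_map \<sigma>) (blk ` \<pi>)"
proof -
  note p = partition_facts[OF assms(1,2)]
  show p': "partition_on (\<sigma> ` I) (image \<sigma> ` \<pi>)"
  proof -
    have "image \<sigma> ` \<pi> - {{}} = image \<sigma> ` \<pi>"
      using p(4) by auto
    then show ?thesis
      using partition_on_inj_image[OF assms(1,3)] by simp
  qed
  show inj: "inj_on (image \<sigma>) \<pi>"
    by (rule inj_on_subset[OF inj_on_image_Pow[OF assms(3)]]) (use p(3) in blast)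
  show "inj_on \<sigma> J" "inv_into I \<sigma> ` \<sigma> ` J = J" if "J \<in> \<pi>" for J
    using inj_on_subset[OF assms(3) p(3)[OF that]] inv_into_image_cancel[OF assms(3) p(3)[OF that]] by auto
  show bm: "blk_map \<sigma> (blk J) = blk (\<sigma> ` J)" if "J \<in> \<pi>" for J
    using p(6)[OF that] by (simp add: blk_map_def)
  then show "blk_map \<sigma> ` blk ` \<pi> = blk ` image \<sigma> ` \<pi>"
    by (simp add: image_image)
  have "inj_on blk (image \<sigma> ` \<pi>)"
    using partition_facts(5)[OF p'] assms(2) by simp
  then have "inj_on (\<lambda>J. blk (\<sigma> ` J)) \<pi>"
    using inj comp_inj_on[OF inj] by (simp add: comp_def)
  then have "inj_on (blk_map \<sigma> \<circ> blk) \<pi>"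
    using bm by (simp cong: inj_on_cong)
  then show "inj_on (blk_map \<sigma>) (blk ` \<pi>)"
    using p(5) comp_inj_on_iff[of blk \<pi> "blk_map \<sigma>"] by simp
qed

text \<open>The third component of the transport in \<open>wcomp\<close>, isolated so that it can be
  evaluated on one image block at a time.\<close>

definition ftr :: "('a, 'r, 'm) species_scheme \<Rightarrow> 'a lab set \<Rightarrow> ('a lab \<Rightarrow> 'a lab) \<Rightarrow> 'a lab set set \<Rightarrow>
    ('a lab set \<Rightarrow> 'r) \<Rightarrow> 'a lab set \<Rightarrow> 'r" where
  "ftr G I \<sigma> \<pi> y = (\<lambda>K\<in>image \<sigma> ` \<pi>. let J = inv_into I \<sigma> ` K in tr G J \<sigma> (y J))"

lemma ftr_apply:
  assumes "partition_on I \<pi>" "finite I" "inj_on \<sigma> I" "J \<in> \<pi>"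
  shows "ftr G I \<sigma> \<pi> y (\<sigma> ` J) = tr G J \<sigma> (y J)"
  using assms(4) partition_image(4)[OF assms] by (simp add: ftr_def)

lemma ftr_eqI:
  assumes "partition_on I \<pi>" "finite I" "inj_on \<sigma> I" "z \<in> extensional (image \<sigma> ` \<pi>)"
    and "\<And>J. J \<in> \<pi> \<Longrightarrow> tr G J \<sigma> (y J) = z (\<sigma> ` J)"
  shows "ftr G I \<sigma> \<pi> y = z"
proof (rule extensionalityI[OF _ assms(4)])
  show "ftr G I \<sigma> \<pi> y \<in> extensional (image \<sigma> ` \<pi>)"
    by (simp add: ftr_def)
  show "ftr G I \<sigma> \<pi> y K = z K" if "K \<in> image \<sigma> ` \<pi>" for K
    using that by (auto simp: assms(5) ftr_apply[OF assms(1-3)])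
qed

lemma mem_str_scomp:
  "(\<pi>, x, y) \<in> str (sp (scomp M N)) I \<longleftrightarrow>
     partition_on I \<pi> \<and> x \<in> str (sp M) (blk ` \<pi>) \<and> y \<in> PiE \<pi> (str (sp N))"
  by (simp add: scomp_def wcomp_def)

lemma tr_wcomp:
  "tr (G \<circ>\<^sub>w H) I \<sigma> (\<pi>, x, y) = (image \<sigma> ` \<pi>, tr G (blk ` \<pi>) (blk_map \<sigma>) x, ftr H I \<sigma> \<pi> y)"
  by (simp add: wcomp_def ftr_def)

lemma tr_scomp:
  "tr (sp (scomp M N)) I \<sigma> (\<pi>, x, y) =
     (image \<sigma> ` \<pi>, tr (sp M) (blk ` \<pi>) (blk_map \<sigma>) x, ftr (sp N) I \<sigma> \<pi> y)"
  by (simp add: scomp_def tr_wcomp)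

lemma wt_wcomp: "wt (G \<circ>\<^sub>w H) (\<pi>, x, y) = wt G x + (\<Sum>J\<in>\<pi>. wt H (y J))"
  by (simp add: wcomp_def)

lemma wt_scomp: "wt (sp (scomp M N)) (\<pi>, x, y) = wt (sp M) x + (\<Sum>J\<in>\<pi>. wt (sp N) (y J))"
  by (simp add: scomp_def wcomp_def)

lemma scomp_fields:
  "ed (scomp M N) (\<pi>, x, y) = ed M x <+> (SIGMA J:\<pi>. ed N (y J))"
  "lb (scomp M N) (\<pi>, x, y) = case_sum (lb M x) (\<lambda>(J, f). lb N (y J) f)"
  "et (scomp M N) I \<sigma> (\<pi>, x, y) =
     map_sum (et M (blk ` \<pi>) (blk_map \<sigma>) x) (\<lambda>(J, f). (\<sigma> ` J, et N J \<sigma> (y J) f))"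
  "lt (scomp M N) I \<sigma> (\<pi>, x, y) =
     case_sum (lt M (blk ` \<pi>) (blk_map \<sigma>) x) (\<lambda>(J, f). lt N J \<sigma> (y J) f)"
  by (simp_all add: scomp_def)

lemma is_shape_scomp:
  fixes M :: "('a, 's, 'e) shape" and N :: "('a, 'r, 'f) shape"
  assumes M: "is_shape M" and N: "is_shape N"
  shows "is_shape (scomp M N)"
  unfolding is_shape_def
proof (intro allI impI ballI)
  fix I and s
  assume I: "finite I" and s: "s \<in> str (sp (scomp M N)) I"
  obtain \<pi> x y where s_eq: "s = (\<pi>, x, y)"
    by (cases s)
  have \<pi>: "partition_on I \<pi>" and x: "x \<in> str (sp M) (blk ` \<pi>)" and yP: "y \<in> PiE \<pi> (str (sp N))"
    using s by (simp_all add: s_eq mem_str_scomp)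
  have y: "y J \<in> str (sp N) J" if "J \<in> \<pi>" for J
    using PiE_mem[OF yP that] .
  note p = partition_facts[OF \<pi> I]
  have fin: "finite (blk ` \<pi>)"
    using p(1) by simp
  note Mx = is_shapeD[OF M fin x]
  note Ny = is_shapeD[OF N p(2) y]
  have "finite (ed (scomp M N) s)" "\<forall>j\<in>ed (scomp M N) s. finite (lb (scomp M N) s j)"
    using Mx(1,2) Ny(1,2) p(1) by (auto simp: s_eq scomp_fields elim!: PlusE)
  moreover have "tr (sp (scomp M N)) I \<sigma> s \<in> str (sp (scomp M N)) (\<sigma> ` I) \<and>
      wt (sp (scomp M N)) (tr (sp (scomp M N)) I \<sigma> s) = wt (sp (scomp M N)) s \<and>
      bij_betw (et (scomp M N) I \<sigma> s) (ed (scomp M N) s) (ed (scomp M N) (tr (sp (scomp M N)) I \<sigma> s)) \<and>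
      (\<forall>j\<in>ed (scomp M N) s. bij_betw (lt (scomp M N) I \<sigma> s j) (lb (scomp M N) s j)
        (lb (scomp M N) (tr (sp (scomp M N)) I \<sigma> s) (et (scomp M N) I \<sigma> s j)))"
    if \<sigma>: "inj_on \<sigma> I" for \<sigma>
  proof (intro conjI)
    note q = partition_image[OF \<pi> I \<sigma>]
    note f = ftr_apply[OF \<pi> I \<sigma>, of _ "sp N" y]
    have fP: "ftr (sp N) I \<sigma> \<pi> y \<in> PiE (image \<sigma> ` \<pi>) (str (sp N))"
    proof (rule PiE_I)
      fix K
      assume "K \<in> image \<sigma> ` \<pi>"
      then obtain J where "J \<in> \<pi>" "K = \<sigma> ` J"
        by blast
      then show "ftr (sp N) I \<sigma> \<pi> y K \<in> str (sp N) K"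
        using f Ny(3) q(3) by auto
    qed (simp add: ftr_def)
    show "tr (sp (scomp M N)) I \<sigma> s \<in> str (sp (scomp M N)) (\<sigma> ` I)"
      using q(1) fP Mx(3)[OF q(7)] q(6) by (simp add: s_eq tr_scomp mem_str_scomp)
    have "(\<Sum>K\<in>image \<sigma> ` \<pi>. wt (sp N) (ftr (sp N) I \<sigma> \<pi> y K)) = (\<Sum>J\<in>\<pi>. wt (sp N) (y J))"
      using q(2,3) f Ny(4) by (simp add: sum.reindex)
    then show "wt (sp (scomp M N)) (tr (sp (scomp M N)) I \<sigma> s) = wt (sp (scomp M N)) s"
      using Mx(4)[OF q(7)] by (simp add: s_eq tr_scomp wt_scomp)
    have "bij_betw (image \<sigma>) \<pi> (image \<sigma> ` \<pi>)"
      using q(2) by (simp add: bij_betw_def)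
    then have "bij_betw (\<lambda>(J, f). (\<sigma> ` J, et N J \<sigma> (y J) f)) (SIGMA J:\<pi>. ed N (y J))
        (SIGMA K:image \<sigma> ` \<pi>. ed N (ftr (sp N) I \<sigma> \<pi> y K))"
    proof (rule bij_betw_Sigma)
      show "bij_betw (et N J \<sigma> (y J)) (ed N (y J)) (ed N (ftr (sp N) I \<sigma> \<pi> y (\<sigma> ` J)))" if "J \<in> \<pi>" for J
        using Ny(5)[OF that that q(3)[OF that]] f[OF that] by simp
    qed
    then show "bij_betw (et (scomp M N) I \<sigma> s) (ed (scomp M N) s) (ed (scomp M N) (tr (sp (scomp M N)) I \<sigma> s))"
      using Mx(5)[OF q(7)] by (simp add: s_eq tr_scomp scomp_fields bij_betw_map_sum)
    show "\<forall>j\<in>ed (scomp M N) s. bij_betw (lt (scomp M N) I \<sigma> s j) (lb (scomp M N) s j)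
        (lb (scomp M N) (tr (sp (scomp M N)) I \<sigma> s) (et (scomp M N) I \<sigma> s j))"
      using Mx(6)[OF q(7)] Ny(6)[OF _ _ q(3)] f by (auto simp: s_eq tr_scomp scomp_fields elim!: PlusE)
  qed
  ultimately show "finite (ed (scomp M N) s) \<and> (\<forall>j\<in>ed (scomp M N) s. finite (lb (scomp M N) s j)) \<and>
     (\<forall>\<sigma>. inj_on \<sigma> I \<longrightarrow> tr (sp (scomp M N)) I \<sigma> s \<in> str (sp (scomp M N)) (\<sigma> ` I) \<and>
       wt (sp (scomp M N)) (tr (sp (scomp M N)) I \<sigma> s) = wt (sp (scomp M N)) s \<and>
       bij_betw (et (scomp M N) I \<sigma> s) (ed (scomp M N) s) (ed (scomp M N) (tr (sp (scomp M N)) I \<sigma> s)) \<and>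
       (\<forall>j\<in>ed (scomp M N) s. bij_betw (lt (scomp M N) I \<sigma> s j) (lb (scomp M N) s j)
         (lb (scomp M N) (tr (sp (scomp M N)) I \<sigma> s) (et (scomp M N) I \<sigma> s j))))"
    by blast
qed

lemma decs_scomp:
  "decs F (scomp M N) (\<pi>, x, y) = PiE (ed M x <+> (SIGMA J:\<pi>. ed N (y J)))
     (case_sum (\<lambda>j. str F (lb M x j)) (\<lambda>(J, f). str F (lb N (y J) f)))"
  unfolding decs_def scomp_fields by (rule PiE_cong) (auto elim!: PlusE)

lemma decs_scomp_parts:
  assumes "d \<in> decs F (scomp M N) (\<pi>, x, y)"
  shows "(\<lambda>j\<in>ed M x. d (Inl j)) \<in> decs F M x"
    and "J \<in> \<pi> \<Longrightarrow> (\<lambda>f\<in>ed N (y J). d (Inr (J, f))) \<in> decs F N (y J)"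
proof -
  note d = assms[unfolded decs_scomp]
  show "(\<lambda>j\<in>ed M x. d (Inl j)) \<in> decs F M x"
    using restrict_Inl[OF d] by (simp add: decs_def)
  show "(\<lambda>f\<in>ed N (y J). d (Inr (J, f))) \<in> decs F N (y J)" if "J \<in> \<pi>"
    using PiE_mem[OF restrict_Inr[OF d], of "(J, _)"] that by (auto simp: decs_def)
qed

lemma dpush_scomp:
  assumes M: "is_shape M" and N: "is_shape N" and F: "functorial F"
    and I: "finite I" and s: "(\<pi>, x, y) \<in> str (sp (scomp M N)) I" and \<sigma>: "inj_on \<sigma> I"
    and d: "d \<in> decs F (scomp M N) (\<pi>, x, y)"
  shows "dpush F M (blk ` \<pi>) (blk_map \<sigma>) x (\<lambda>j\<in>ed M x. d (Inl j)) =
      (\<lambda>j\<in>ed M (tr (sp M) (blk ` \<pi>) (blk_map \<sigma>) x). dpush F (scomp M N) I \<sigma> (\<pi>, x, y) d (Inl j))"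
    and "J \<in> \<pi> \<Longrightarrow> dpush F N J \<sigma> (y J) (\<lambda>f\<in>ed N (y J). d (Inr (J, f))) =
      (\<lambda>f\<in>ed N (tr (sp N) J \<sigma> (y J)). dpush F (scomp M N) I \<sigma> (\<pi>, x, y) d (Inr (\<sigma> ` J, f)))"
proof -
  have \<pi>: "partition_on I \<pi>" and x: "x \<in> str (sp M) (blk ` \<pi>)" and y: "\<And>J. J \<in> \<pi> \<Longrightarrow> y J \<in> str (sp N) J"
    using s by (auto simp: mem_str_scomp)
  note p = partition_facts[OF \<pi> I] and q = partition_image[OF \<pi> I \<sigma>]
  note f = ftr_apply[OF \<pi> I \<sigma>, of _ "sp N" y]
  have fin: "finite (blk ` \<pi>)"
    using p(1) by simp
  show "dpush F M (blk ` \<pi>) (blk_map \<sigma>) x (\<lambda>j\<in>ed M x. d (Inl j)) =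
      (\<lambda>j\<in>ed M (tr (sp M) (blk ` \<pi>) (blk_map \<sigma>) x). dpush F (scomp M N) I \<sigma> (\<pi>, x, y) d (Inl j))"
    by (rule dpush_restrict[OF is_shape_scomp[OF M N] I s \<sigma> M fin x q(7) F d])
      (auto simp: scomp_fields tr_scomp)
  show "dpush F N J \<sigma> (y J) (\<lambda>f\<in>ed N (y J). d (Inr (J, f))) =
      (\<lambda>f\<in>ed N (tr (sp N) J \<sigma> (y J)). dpush F (scomp M N) I \<sigma> (\<pi>, x, y) d (Inr (\<sigma> ` J, f)))"
    if "J \<in> \<pi>" for J
    using that f[OF that]
    by (intro dpush_restrict[OF is_shape_scomp[OF M N] I s \<sigma> N p(2)[OF that] y[OF that] q(3)[OF that] F d])
      (auto simp: scomp_fields tr_scomp)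
qed

text \<open>A decoration splits into one for the outer structure and one for the inner structure of
  every block, as the edges of the composite are those of the outer structure together with the
  pairs of a block and an edge over it.\<close>

lemma realises_scomp:
  assumes M: "is_shape M" and N: "is_shape N" and F: "functorial F"
    and G: "realises F G M \<beta>" and H: "realises F H N \<gamma>"
  shows "realises F (G \<circ>\<^sub>w H) (scomp M N)
    (\<lambda>I (\<pi>, x, y) d. (\<pi>, \<beta> (blk ` \<pi>) x (\<lambda>j\<in>ed M x. d (Inl j)),
       \<lambda>J\<in>\<pi>. \<gamma> J (y J) (\<lambda>f\<in>ed N (y J). d (Inr (J, f)))))"
proof (rule realisesI, goal_cases)
  case (1 I s d)
  obtain \<pi> x y where s: "s = (\<pi>, x, y)"
    by (cases s)
  have \<pi>: "partition_on I \<pi>" and x: "x \<in> str (sp M) (blk ` \<pi>)" and y: "\<And>J. J \<in> \<pi> \<Longrightarrow> y J \<in> str (sp N) J"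
    using 1(2) by (auto simp: s mem_str_scomp)
  note p = partition_facts[OF \<pi> 1(1)]
  note d = decs_scomp_parts[OF 1(3)[unfolded s]]
  have "\<gamma> J (y J) (\<lambda>f\<in>ed N (y J). d (Inr (J, f))) \<in> str H J" if "J \<in> \<pi>" for J
    by (rule realises_in[OF H p(2) y d(2)]) fact+
  moreover have "\<beta> (blk ` \<pi>) x (\<lambda>j\<in>ed M x. d (Inl j)) \<in> str G (blk ` \<pi>)"
    by (rule realises_in[OF G _ x d(1)]) (use p(1) in simp)
  ultimately show ?case
    using \<pi> by (simp add: s wcomp_def)
next
  case (2 I s d s' d')
  obtain \<pi> x y where s: "s = (\<pi>, x, y)"
    by (cases s)
  obtain \<pi>' x' y' where s': "s' = (\<pi>', x', y')"
    by (cases s')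
  have \<pi>: "partition_on I \<pi>" and x: "x \<in> str (sp M) (blk ` \<pi>)" and y: "y \<in> PiE \<pi> (str (sp N))"
    using 2(2) by (auto simp: s mem_str_scomp)
  have [simp]: "\<pi>' = \<pi>"
    using 2(6) by (simp add: s s')
  have x': "x' \<in> str (sp M) (blk ` \<pi>)" and y': "y' \<in> PiE \<pi> (str (sp N))"
    using 2(4) by (auto simp: s' mem_str_scomp)
  note p = partition_facts[OF \<pi> 2(1)]
  note d = decs_scomp_parts[OF 2(3)[unfolded s]] and d' = decs_scomp_parts[OF 2(5)[unfolded s']]
  have fin: "finite (blk ` \<pi>)"
    using p(1) by simp
  have "\<beta> (blk ` \<pi>) x (\<lambda>j\<in>ed M x. d (Inl j)) = \<beta> (blk ` \<pi>) x' (\<lambda>j\<in>ed M x'. d' (Inl j))"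
    using 2(6) by (simp add: s s')
  note xx = realises_inj[OF G fin x d(1) x' d'(1) this]
  have yy: "y J = y' J" "(\<lambda>f\<in>ed N (y J). d (Inr (J, f))) = (\<lambda>f\<in>ed N (y' J). d' (Inr (J, f)))"
    if J: "J \<in> \<pi>" for J
  proof -
    have "(\<lambda>J\<in>\<pi>. \<gamma> J (y J) (\<lambda>f\<in>ed N (y J). d (Inr (J, f)))) J =
        (\<lambda>J\<in>\<pi>. \<gamma> J (y' J) (\<lambda>f\<in>ed N (y' J). d' (Inr (J, f)))) J"
      using 2(6) by (simp only: s s' prod.case prod.inject \<open>\<pi>' = \<pi>\<close>)
    then have eq: "\<gamma> J (y J) (\<lambda>f\<in>ed N (y J). d (Inr (J, f))) = \<gamma> J (y' J) (\<lambda>f\<in>ed N (y' J). d' (Inr (J, f)))"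
      using J by (simp only: restrict_apply')
    have J': "J \<in> \<pi>'"
      using J by simp
    note r = realises_inj[OF H p(2)[OF J] PiE_mem[OF y J] d(2)[OF J] PiE_mem[OF y' J] d'(2)[OF J'] eq]
    show "y J = y' J" "(\<lambda>f\<in>ed N (y J). d (Inr (J, f))) = (\<lambda>f\<in>ed N (y' J). d' (Inr (J, f)))"
      by (rule r)+
  qed
  have yeq: "y = y'"
    using PiE_ext[OF y y'] yy(1) by blast
  have "d = d'"
  proof (rule PiE_ext[OF 2(3)[unfolded s decs_def scomp_fields]])
    show "d' \<in> (\<Pi>\<^sub>E j\<in>ed M x <+> (SIGMA J:\<pi>. ed N (y J)).
        str F (case_sum (lb M x) (\<lambda>(J, f). lb N (y J) f) j))"
      using 2(5) unfolding s' decs_def scomp_fields xx(1) yeq \<open>\<pi>' = \<pi>\<close> .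
    fix j
    assume "j \<in> ed M x <+> (SIGMA J:\<pi>. ed N (y J))"
    then show "d j = d' j"
    proof (rule PlusE)
      fix i
      assume "i \<in> ed M x" "j = Inl i"
      then show ?thesis
        using fun_cong[OF xx(2), of i] xx(1) by simp
    next
      fix i
      assume "i \<in> (SIGMA J:\<pi>. ed N (y J))" "j = Inr i"
      then show ?thesis
        using fun_cong[OF yy(2), of "fst i" "snd i"] yeq by auto
    qed
  qed
  then show ?case
    using xx(1) yeq by (simp add: s s')
next
  case (3 I g)
  obtain \<pi> u v where g: "g = (\<pi>, u, v)"
    by (cases g)
  have \<pi>: "partition_on I \<pi>" and u: "u \<in> str G (blk ` \<pi>)" and v: "v \<in> PiE \<pi> (str H)"
    using 3(2) by (auto simp: g wcomp_def)
  note p = partition_facts[OF \<pi> 3(1)]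
  have fin: "finite (blk ` \<pi>)"
    using p(1) by simp
  obtain x d where x: "x \<in> str (sp M) (blk ` \<pi>)" "d \<in> decs F M x" "u = \<beta> (blk ` \<pi>) x d"
    using realises_surj[OF G fin u] by blast
  have "\<forall>J\<in>\<pi>. \<exists>y e. y \<in> str (sp N) J \<and> e \<in> decs F N y \<and> v J = \<gamma> J y e"
    using realises_surj[OF H p(2) PiE_mem[OF v]] by blast
  then obtain y e where y: "\<And>J. J \<in> \<pi> \<Longrightarrow> y J \<in> str (sp N) J \<and> e J \<in> decs F N (y J) \<and> v J = \<gamma> J (y J) (e J)"
    by metis
  \<comment> \<open>Inner structures and decorations are chosen block by block and then restricted,
    since \<open>wcomp\<close> and \<open>decs\<close> work with extensional functions.\<close>
  let ?y = "restrict y \<pi>" and ?d = "case_sum d (\<lambda>(J, f)\<in>SIGMA J:\<pi>. ed N (y J). e J f)"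
  have "e J f \<in> str F (lb N (y J) f)" if "J \<in> \<pi>" "f \<in> ed N (y J)" for J f
    using y[OF that(1)] PiE_mem[OF _ that(2)] by (auto simp: decs_def)
  then have "(\<lambda>(J, f)\<in>SIGMA J:\<pi>. ed N (y J). e J f)
      \<in> PiE (SIGMA J:\<pi>. ed N (y J)) (\<lambda>(J, f). str F (lb N (y J) f))"
    by (simp only: restrict_PiE_iff) auto
  moreover have "PiE (SIGMA J:\<pi>. ed N (y J)) (\<lambda>(J, f). str F (lb N (y J) f)) =
      PiE (SIGMA J:\<pi>. ed N (?y J)) (\<lambda>(J, f). str F (lb N (?y J) f))"
    by (auto simp: PiE_def Pi_def extensional_def)
  ultimately have "?d \<in> decs F (scomp M N) (\<pi>, x, ?y)"
    unfolding decs_scomp using x(2) by (intro case_sum_in_PiE) (simp_all add: decs_def)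
  moreover have "(\<pi>, x, ?y) \<in> str (sp (scomp M N)) I"
    using \<pi> x(1) y by (simp add: mem_str_scomp)
  moreover have "(\<lambda>j\<in>ed M x. ?d (Inl j)) = d"
    using restrict_case_sum(1)[OF x(2)[unfolded decs_def]] .
  moreover have "(\<lambda>f\<in>ed N (y J). ?d (Inr (J, f))) = e J" if "J \<in> \<pi>" for J
  proof
    fix f
    show "(\<lambda>f\<in>ed N (y J). ?d (Inr (J, f))) f = e J f"
      using that y[OF that] PiE_arb[of "e J" "ed N (y J)"] by (auto simp: decs_def)
  qed
  then have "(\<lambda>J\<in>\<pi>. \<gamma> J (?y J) (\<lambda>f\<in>ed N (?y J). ?d (Inr (J, f)))) = v"
  proof -
    assume *: "\<And>J. J \<in> \<pi> \<Longrightarrow> (\<lambda>f\<in>ed N (y J). ?d (Inr (J, f))) = e J"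
    show ?thesis
    proof (rule extensionalityI)
      show "v \<in> extensional \<pi>"
        using v by (simp add: PiE_iff)
      fix J
      assume J: "J \<in> \<pi>"
      show "(\<lambda>J\<in>\<pi>. \<gamma> J (?y J) (\<lambda>f\<in>ed N (?y J). ?d (Inr (J, f)))) J = v J"
        using *[OF J] y[OF J] J by (simp only: restrict_apply')
    qed simp
  qed
  ultimately show ?case
    using x(3) by (intro bexI[of _ "(\<pi>, x, ?y)"] bexI[of _ ?d]) (simp_all only: g prod.case)
next
  case (4 I s d)
  obtain \<pi> x y where s: "s = (\<pi>, x, y)"
    by (cases s)
  have \<pi>: "partition_on I \<pi>" and x: "x \<in> str (sp M) (blk ` \<pi>)" and y: "\<And>J. J \<in> \<pi> \<Longrightarrow> y J \<in> str (sp N) J"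
    using 4(2) by (auto simp: s mem_str_scomp)
  note p = partition_facts[OF \<pi> 4(1)]
  note d = decs_scomp_parts[OF 4(3)[unfolded s]]
  have "wt H (\<gamma> J (y J) (\<lambda>f\<in>ed N (y J). d (Inr (J, f)))) = wt (sp N) (y J)" if "J \<in> \<pi>" for J
    by (rule realisesD(2)[OF H p(2) y d(2)]) fact+
  moreover have "wt G (\<beta> (blk ` \<pi>) x (\<lambda>j\<in>ed M x. d (Inl j))) = wt (sp M) x"
    by (rule realisesD(2)[OF G _ x d(1)]) (use p(1) in simp)
  ultimately show ?case
    unfolding s prod.case wt_wcomp wt_scomp by (intro arg_cong2[of _ _ _ _ "(+)"] sum.cong) simp_all
next
  case (5 I s d \<sigma>)
  obtain \<pi> x y where s: "s = (\<pi>, x, y)"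
    by (cases s)
  have \<pi>: "partition_on I \<pi>" and x: "x \<in> str (sp M) (blk ` \<pi>)" and y: "\<And>J. J \<in> \<pi> \<Longrightarrow> y J \<in> str (sp N) J"
    using 5(2) by (auto simp: s mem_str_scomp)
  note p = partition_facts[OF \<pi> 5(1)] and q = partition_image[OF \<pi> 5(1,4)]
  note d = decs_scomp_parts[OF 5(3)[unfolded s]]
  note dp = dpush_scomp[OF M N F 5(1) 5(2)[unfolded s] 5(4) 5(3)[unfolded s]]
  note f = ftr_apply[OF \<pi> 5(1,4), of _ "sp N" y]
  have fin: "finite (blk ` \<pi>)"
    using p(1) by simp
  have "ftr H I \<sigma> \<pi> (\<lambda>J\<in>\<pi>. \<gamma> J (y J) (\<lambda>f\<in>ed N (y J). d (Inr (J, f)))) =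
      (\<lambda>K\<in>image \<sigma> ` \<pi>. \<gamma> K (ftr (sp N) I \<sigma> \<pi> y K)
        (\<lambda>f\<in>ed N (ftr (sp N) I \<sigma> \<pi> y K). dpush F (scomp M N) I \<sigma> (\<pi>, x, y) d (Inr (K, f))))"
  proof (rule ftr_eqI[OF \<pi> 5(1,4)])
    fix J
    assume J: "J \<in> \<pi>"
    have "tr H J \<sigma> (\<gamma> J (y J) (\<lambda>f\<in>ed N (y J). d (Inr (J, f)))) =
        \<gamma> (\<sigma> ` J) (tr (sp N) J \<sigma> (y J)) (dpush F N J \<sigma> (y J) (\<lambda>f\<in>ed N (y J). d (Inr (J, f))))"
      by (rule realisesD(3)[OF H p(2)[OF J] y[OF J] d(2)[OF J] q(3)[OF J]])
    then show "tr H J \<sigma> ((\<lambda>J\<in>\<pi>. \<gamma> J (y J) (\<lambda>f\<in>ed N (y J). d (Inr (J, f)))) J) =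
        (\<lambda>K\<in>image \<sigma> ` \<pi>. \<gamma> K (ftr (sp N) I \<sigma> \<pi> y K)
          (\<lambda>f\<in>ed N (ftr (sp N) I \<sigma> \<pi> y K). dpush F (scomp M N) I \<sigma> (\<pi>, x, y) d (Inr (K, f)))) (\<sigma> ` J)"
      unfolding dp(2)[OF J] using J by (simp only: restrict_apply' imageI f)
  qed simp
  moreover have "tr G (blk ` \<pi>) (blk_map \<sigma>) (\<beta> (blk ` \<pi>) x (\<lambda>j\<in>ed M x. d (Inl j))) =
      \<beta> (blk ` image \<sigma> ` \<pi>) (tr (sp M) (blk ` \<pi>) (blk_map \<sigma>) x)
        (dpush F M (blk ` \<pi>) (blk_map \<sigma>) x (\<lambda>j\<in>ed M x. d (Inl j)))"
    using realisesD(3)[OF G fin x d(1) q(7)] q(6) by simp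
  ultimately show ?case
    unfolding s prod.case tr_wcomp tr_scomp dp(1) by simp
qed

section \<open>Shapes of pointed and of hollow hypertrees\<close>

definition hshape ::
    "('a lab set \<Rightarrow> ('a lab set set \<times> 'p) set) \<Rightarrow> ('a lab set \<Rightarrow> ('a lab \<Rightarrow> 'a lab) \<Rightarrow> 'a lab \<Rightarrow> 'a lab) \<Rightarrow>
     (('a lab \<Rightarrow> 'a lab) \<Rightarrow> 'p \<Rightarrow> 'p) \<Rightarrow> ('a, 'a lab set set \<times> 'p, 'a lab set) shape" where
  "hshape K ex pm = \<lparr>
     sp = \<lparr>str = K, tr = (\<lambda>I \<sigma> (E, p). (image (ex I \<sigma>) ` E, pm (ex I \<sigma>) p)), wt = (\<lambda>(E, p). int (card E) - 1)\<rparr>,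
     ed = fst, lb = (\<lambda>_ e. e), et = (\<lambda>I \<sigma> _. image (ex I \<sigma>)), lt = (\<lambda>I \<sigma> _ _. ex I \<sigma>)\<rparr>"

text \<open>
  \<open>Y I\<close> is the vertex set of the hypertrees in \<open>K I\<close>, on which a bijection \<open>\<sigma>\<close> of \<open>I\<close> acts by \<open>ex I \<sigma>\<close>.
\<close>

definition hshape_ok ::
    "('a lab set \<Rightarrow> ('a lab set set \<times> 'p) set) \<Rightarrow> ('a lab set \<Rightarrow> 'a lab set) \<Rightarrow>
     ('a lab set \<Rightarrow> ('a lab \<Rightarrow> 'a lab) \<Rightarrow> 'a lab \<Rightarrow> 'a lab) \<Rightarrow> (('a lab \<Rightarrow> 'a lab) \<Rightarrow> 'p \<Rightarrow> 'p) \<Rightarrow> bool" where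
  "hshape_ok K Y ex pm \<longleftrightarrow> (\<forall>I. finite I \<longrightarrow>
     (\<forall>E p. (E, p) \<in> K I \<longrightarrow> hypertree (Y I) E) \<and>
     (\<forall>\<sigma>. inj_on \<sigma> I \<longrightarrow> inj_on (ex I \<sigma>) (Y I) \<and>
        (\<forall>E p. (E, p) \<in> K I \<longrightarrow> (image (ex I \<sigma>) ` E, pm (ex I \<sigma>) p) \<in> K (\<sigma> ` I))))"

lemma hshape_okD:
  assumes "hshape_ok K Y ex pm" "finite I"
  shows "(E, p) \<in> K I \<Longrightarrow> hypertree (Y I) E"
    and "inj_on \<sigma> I \<Longrightarrow> inj_on (ex I \<sigma>) (Y I)"
    and "inj_on \<sigma> I \<Longrightarrow> (E, p) \<in> K I \<Longrightarrow> (image (ex I \<sigma>) ` E, pm (ex I \<sigma>) p) \<in> K (\<sigma> ` I)"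
  using assms unfolding hshape_ok_def by blast+

lemma hypertree_image_edges:
  assumes "hypertree V E" "inj_on \<sigma> V"
  shows "inj_on (image \<sigma>) E" "e \<in> E \<Longrightarrow> inj_on \<sigma> e" "e \<in> E \<Longrightarrow> inv_into V \<sigma> ` \<sigma> ` e = e"
    "card (image \<sigma> ` E) = card E"
proof -
  show "inj_on (image \<sigma>) E"
    by (rule inj_on_subset[OF inj_on_image_Pow[OF assms(2)]]) (use hypertree_edge(1)[OF assms(1)] in blast)
  then show "card (image \<sigma> ` E) = card E"
    by (rule card_image)
  show "inj_on \<sigma> e" "inv_into V \<sigma> ` \<sigma> ` e = e" if "e \<in> E"
    using hypertree_edge(1)[OF assms(1) that] assms(2) by (auto intro: inj_on_subset simp: inv_into_image_cancel)
qed

lemma is_shape_hshape: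
  assumes ok: "hshape_ok K Y ex pm"
  shows "is_shape (hshape K ex pm)"
proof (rule is_shapeI, goal_cases)
  case (1 I s)
  then show ?case
    using hypertree_finite(2)[OF hshape_okD(1)[OF ok 1(1), of "fst s" "snd s"]] by (simp add: hshape_def)
next
  case (2 I s j)
  then show ?case
    using hypertree_edge(3)[OF hshape_okD(1)[OF ok 2(1), of "fst s" "snd s"]] by (simp add: hshape_def)
next
  case (3 I s \<sigma>)
  then show ?case
    using hshape_okD(3)[OF ok 3(1,3), of "fst s" "snd s"] by (simp add: hshape_def case_prod_unfold)
next
  case (4 I s \<sigma>)
  then show ?case
    using hypertree_image_edges(4)[OF hshape_okD(1)[OF ok 4(1), of "fst s" "snd s"] hshape_okD(2)[OF ok 4(1,3)]]
    by (simp add: hshape_def case_prod_unfold)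
next
  case (5 I s \<sigma>)
  then show ?case
    using hypertree_image_edges(1)[OF hshape_okD(1)[OF ok 5(1), of "fst s" "snd s"] hshape_okD(2)[OF ok 5(1,3)]]
    by (simp add: hshape_def case_prod_unfold bij_betw_def)
next
  case (6 I s \<sigma> j)
  then show ?case
    using hypertree_image_edges(2)[OF hshape_okD(1)[OF ok 6(1), of "fst s" "snd s"] hshape_okD(2)[OF ok 6(1,3)]]
    by (simp add: hshape_def case_prod_unfold bij_betw_def)
qed

lemma dpush_hshape:
  assumes ok: "hshape_ok K Y ex pm" and I: "finite I" and s: "(E, p) \<in> K I" and \<sigma>: "inj_on \<sigma> I"
  shows "dpush F (hshape K ex pm) I \<sigma> (E, p) d =
    (\<lambda>e'\<in>image (ex I \<sigma>) ` E. let e = inv_into (Y I) (ex I \<sigma>) ` e' in tr F e (ex I \<sigma>) (d e))"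
proof
  fix e'
  note ht = hshape_okD(1)[OF ok I s] and inj = hshape_okD(2)[OF ok I \<sigma>]
  note he = hypertree_image_edges[OF ht inj]
  show "dpush F (hshape K ex pm) I \<sigma> (E, p) d e' =
      (\<lambda>e'\<in>image (ex I \<sigma>) ` E. let e = inv_into (Y I) (ex I \<sigma>) ` e' in tr F e (ex I \<sigma>) (d e)) e'"
  proof (cases "e' \<in> image (ex I \<sigma>) ` E")
    case True
    then obtain e where e: "e \<in> E" "e' = ex I \<sigma> ` e"
      by blast
    then show ?thesis
      using he(1) he(3)[OF e(1)] by (simp add: dpush_def push_def hshape_def inv_into_f_f)
  qed (simp add: dpush_def push_def hshape_def)
qed

lemma decs_hshape: "decs F (hshape K ex pm) (E, p) = PiE E (str F)"
  by (simp add: decs_def hshape_def)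

lemma realises_hshape:
  assumes ok: "hshape_ok K Y ex pm"
    and str: "\<And>I. finite I \<Longrightarrow> str G I = {(E, p, d). (E, p) \<in> K I \<and> d \<in> PiE E (str F)}"
    and wt: "\<And>E p d. wt G (E, p, d) = int (card E) - 1"
    and tr: "\<And>I \<sigma> E p d. tr G I \<sigma> (E, p, d) = (image (ex I \<sigma>) ` E, pm (ex I \<sigma>) p,
      \<lambda>e'\<in>image (ex I \<sigma>) ` E. let e = inv_into (Y I) (ex I \<sigma>) ` e' in tr F e (ex I \<sigma>) (d e))"
  shows "realises F G (hshape K ex pm) (\<lambda>I (E, p) d. (E, p, d))"
proof -
  have K: "str (sp (hshape K ex pm)) = K"
    by (simp add: hshape_def)
  show ?thesis
  proof (rule realisesI, unfold K, goal_cases)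
    case (5 I s d \<sigma>)
    obtain E p where s: "s = (E, p)"
      by (cases s)
    show ?case
      using dpush_hshape[OF ok 5(1) 5(2)[unfolded s] 5(4), of F d] unfolding s prod.case tr
      by (simp add: hshape_def)
  next
    case (4 I s d)
    then show ?case
      by (simp add: case_prod_unfold wt) (simp add: hshape_def case_prod_unfold)
  next
    case (3 I g)
    obtain E p d where g: "g = (E, p, d)"
      by (cases g)
    then show ?case
      using 3 by (intro bexI[of _ "(E, p)"] bexI[of _ d]) (auto simp: str decs_hshape)
  qed (auto simp: str decs_hshape)
qed

definition sHT :: "('a lab set \<Rightarrow> 'a lab set set \<Rightarrow> 'p set) \<Rightarrow> (('a lab \<Rightarrow> 'a lab) \<Rightarrow> 'p \<Rightarrow> 'p) \<Rightarrow>
    ('a, 'a lab set set \<times> 'p, 'a lab set) shape" where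
  "sHT P pm = hshape (\<lambda>I. {(E, p). hypertree I E \<and> p \<in> P I E}) (\<lambda>I \<sigma>. \<sigma>) pm"

definition equivariant :: "('a lab set \<Rightarrow> 'a lab set set \<Rightarrow> 'p set) \<Rightarrow> (('a lab \<Rightarrow> 'a lab) \<Rightarrow> 'p \<Rightarrow> 'p) \<Rightarrow> bool"
  where "equivariant P pm \<longleftrightarrow> (\<forall>I E \<sigma> p. hypertree I E \<and> p \<in> P I E \<longrightarrow> pm \<sigma> p \<in> P (\<sigma> ` I) (image \<sigma> ` E))"

lemma hshape_ok_sHT:
  "equivariant P pm \<Longrightarrow> hshape_ok (\<lambda>I. {(E, p). hypertree I E \<and> p \<in> P I E}) (\<lambda>I. I) (\<lambda>I \<sigma>. \<sigma>) pm"
  using hypertree_image by (auto simp: hshape_ok_def equivariant_def)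

lemma is_shape_sHT: "equivariant P pm \<Longrightarrow> is_shape (sHT P pm)"
  unfolding sHT_def by (rule is_shape_hshape[OF hshape_ok_sHT])

lemma realises_sHT:
  assumes "equivariant P pm"
  shows "realises F (decorated P pm F) (sHT P pm) (\<lambda>I (E, p) d. (E, p, d))"
  unfolding sHT_def by (rule realises_hshape[OF hshape_ok_sHT[OF assms]]) (auto simp: decorated_def)

definition hollow :: "'a lab set \<Rightarrow> ('a lab set set \<times> unit) set" where
  "hollow I = {(E, p). hypertree (add_pt I) E \<and> card {e \<in> E. blk I \<in> e} = 1}"

definition sHTh :: "('a, 'a lab set set \<times> unit, 'a lab set) shape" where
  "sHTh = hshape hollow ext_map (\<lambda>\<sigma> p. p)"

text \<open>\<open>ext_map\<close> takes gap to gap and is injective, so an edge contains the gap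
  exactly if its image contains the new gap.\<close>

lemma hshape_ok_hollow: "hshape_ok hollow add_pt ext_map (\<lambda>\<sigma> p. p)"
  unfolding hshape_ok_def
proof (intro allI impI conjI)
  fix I :: "'a lab set" and E and p :: unit
  assume I: "finite I"
  show "(E, p) \<in> hollow I \<Longrightarrow> hypertree (add_pt I) E"
    by (simp add: hollow_def)
  fix \<sigma> :: "'a lab \<Rightarrow> 'a lab"
  assume \<sigma>: "inj_on \<sigma> I"
  show inj: "inj_on (ext_map I \<sigma>) (add_pt I)"
    by (rule inj_on_ext_map[OF I \<sigma>])
  assume E: "(E, p) \<in> hollow I"
  then have ht: "hypertree (add_pt I) E" and c: "card {e \<in> E. blk I \<in> e} = 1"
    by (auto simp: hollow_def)
  have "blk (\<sigma> ` I) \<in> ext_map I \<sigma> ` e \<longleftrightarrow> blk I \<in> e" if "e \<in> E" for e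
    using inj_on_image_mem_iff[OF inj, of "blk I" e] hypertree_edge(1)[OF ht that]
    by (simp add: ext_map_simps(1) add_pt_def)
  then have "{e \<in> image (ext_map I \<sigma>) ` E. blk (\<sigma> ` I) \<in> e} = image (ext_map I \<sigma>) ` {e \<in> E. blk I \<in> e}"
    by auto
  moreover have "inj_on (image (ext_map I \<sigma>)) {e \<in> E. blk I \<in> e}"
    using hypertree_image_edges(1)[OF ht inj] by (rule inj_on_subset) blast
  ultimately have "card {e \<in> image (ext_map I \<sigma>) ` E. blk (\<sigma> ` I) \<in> e} = 1"
    using c by (simp add: card_image)
  then show "(image (ext_map I \<sigma>) ` E, p) \<in> hollow (\<sigma> ` I)"
    using hypertree_image[OF ht inj] ext_map_image[OF I] by (simp add: hollow_def)
qed

lemma is_shape_sHTh: "is_shape sHTh"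
  unfolding sHTh_def by (rule is_shape_hshape[OF hshape_ok_hollow])

lemma realises_sHTh: "realises F (HT_h F) sHTh (\<lambda>I (E, p) d. (E, p, d))"
  unfolding sHTh_def
  by (rule realises_hshape[OF hshape_ok_hollow])
    (auto simp: HT_h_def HT_def wderiv_def decorated_def hollow_def)

text \<open>The shape of \<open>S\<close> itself: a single edge whose labels are all of
  \<open>I\<close>. The bound 2 is the one required of hypergraph edges; through it, composition
  with \<open>S\<close> becomes the grafting of hypertrees onto an edge.\<close>

definition sset :: "('a, 'a lab set, unit) shape" where
  "sset = \<lparr>sp = \<lparr>str = (\<lambda>I. if card I \<ge> 2 then {I} else {}), tr = (\<lambda>I \<sigma> s. \<sigma> ` s), wt = (\<lambda>_. 0)\<rparr>,
     ed = (\<lambda>_. {()}), lb = (\<lambda>s _. s), et = (\<lambda>_ _ _ e. e), lt = (\<lambda>I \<sigma> _ _. \<sigma>)\<rparr>"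

lemma is_shape_sset: "is_shape sset"
  by (rule is_shapeI) (auto simp: sset_def bij_betw_def card_image split: if_splits)

text \<open>The vanishing of \<open>S\<close> on small sets enters here: a structure on fewer than
  two elements would have no counterpart in \<open>sset\<close>.\<close>

lemma realises_sset:
  assumes F: "functorial F" and small: "\<And>I. finite I \<Longrightarrow> card I < 2 \<Longrightarrow> str F I = {}"
  shows "realises F (weightless F) sset (\<lambda>I s d. d ())"
proof (rule realisesI, goal_cases)
  case (1 I s d)
  then show ?case
    by (auto simp: sset_def weightless_def decs_def split: if_splits)
next
  case (2 I s d s' d')
  then show ?case
    by (auto simp: sset_def decs_def PiE_iff extensional_def fun_eq_iff split: if_splits)
next
  case (3 I g)
  then have "card I \<ge> 2"
    using small by (force simp: weightless_def)
  then show ?case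
    using 3 by (intro bexI[of _ I] bexI[of _ "\<lambda>_\<in>{()}. g"]) (auto simp: sset_def weightless_def decs_def)
next
  case (4 I s d)
  then show ?case
    by (simp add: sset_def weightless_def)
next
  case (5 I s d \<sigma>)
  have "dpush F sset I \<sigma> s d () = tr F I \<sigma> (d ())"
    using dpush_apply[OF is_shape_sset 5(1,2,4), of "()" F d] 5(2) by (auto simp: sset_def split: if_splits)
  then show ?case
    by (simp add: weightless_def)
qed

lemma is_shape_splain_wX: "is_shape (splain wX)"
  by (rule is_shape_splain) (auto simp: wX_def card_image split: if_splits)

lemma is_shape_splain_wComm: "is_shape (splain wComm)"
  by (rule is_shape_splain) (auto simp: wComm_def card_image split: if_splits)

lemma is_shape_splain_wOne: "is_shape (splain wOne)"
  by (rule is_shape_splain) (auto simp: wOne_def split: if_splits)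

section \<open>Shapes and linear species\<close>

text \<open>Forgetting linearity leaves a functorial family of sets, to which \<open>push\<close>,
  \<open>decs\<close> and their lemmas apply.\<close>

definition lsp :: "('a, 'k, 'v) lspecies \<Rightarrow> ('a, 'v) species" where
  "lsp L = \<lparr>str = lstr L, tr = ltr L\<rparr>"

lemma lsp_simps [simp]: "str (lsp L) = lstr L" "tr (lsp L) = ltr L"
  by (simp_all add: lsp_def)

lemma
  assumes "is_lspecies L"
  shows lspecies_vector_space: "vector_space (lscale L)"
    and lspecies_subspace: "finite I \<Longrightarrow> module.subspace (lscale L) (lstr L I)"
    and lspecies_linear: "finite I \<Longrightarrow> inj_on \<sigma> I \<Longrightarrow> linear_on (lscale L) (lscale L) (lstr L I) (ltr L I \<sigma>)"
    and lspecies_functorial: "functorial (lsp L)"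
proof -
  note L = assms[unfolded is_lspecies_def]
  note LI = L[THEN conjunct2, THEN spec, THEN mp]
  note L\<sigma> = LI[THEN conjunct2, THEN conjunct2, THEN spec, THEN mp]
  show "vector_space (lscale L)"
    using L by blast
  show "module.subspace (lscale L) (lstr L I)" if "finite I"
    using LI[OF that] by blast
  show "linear_on (lscale L) (lscale L) (lstr L I) (ltr L I \<sigma>)" if "finite I" "inj_on \<sigma> I"
    using L\<sigma>[OF that] by blast
  show "functorial (lsp L)"
    unfolding functorial_def lsp_simps
  proof (intro allI impI)
    fix I :: "'a lab set"
    assume I: "finite I"
    show "(\<forall>s\<in>lstr L I. ltr L I id s = s) \<and> (\<forall>\<sigma>. inj_on \<sigma> I \<longrightarrow>
        (\<forall>s\<in>lstr L I. ltr L I \<sigma> s \<in> lstr L (\<sigma> ` I)) \<and>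
        (\<forall>\<tau>. (\<forall>x\<in>I. \<tau> x = \<sigma> x) \<longrightarrow> (\<forall>s\<in>lstr L I. ltr L I \<tau> s = ltr L I \<sigma> s)) \<and>
        (\<forall>\<tau>. inj_on \<tau> (\<sigma> ` I) \<longrightarrow>
          (\<forall>s\<in>lstr L I. ltr L I (\<tau> \<circ> \<sigma>) s = ltr L (\<sigma> ` I) \<tau> (ltr L I \<sigma> s))))"
    proof (intro conjI allI impI)
      show "\<forall>s\<in>lstr L I. ltr L I id s = s"
        by (rule LI[OF I, THEN conjunct2, THEN conjunct1])
      fix \<sigma> :: "'a lab \<Rightarrow> 'a lab"
      assume \<sigma>: "inj_on \<sigma> I"
      note * = L\<sigma>[OF I \<sigma>, THEN conjunct2]
      show "\<forall>s\<in>lstr L I. ltr L I \<sigma> s \<in> lstr L (\<sigma> ` I)"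
        by (rule *[THEN conjunct1])
      show "\<forall>s\<in>lstr L I. ltr L I \<tau> s = ltr L I \<sigma> s" if "\<forall>x\<in>I. \<tau> x = \<sigma> x" for \<tau>
        by (rule *[THEN conjunct2, THEN conjunct1, THEN spec, THEN mp, OF that])
      show "\<forall>s\<in>lstr L I. ltr L I (\<tau> \<circ> \<sigma>) s = ltr L (\<sigma> ` I) \<tau> (ltr L I \<sigma> s)" if "inj_on \<tau> (\<sigma> ` I)" for \<tau>
        by (rule *[THEN conjunct2, THEN conjunct2, THEN spec, THEN mp, OF that])
    qed
  qed
qed

text \<open>The linear counterpart of \<open>realises\<close>: decorations become arguments of
  elementary tensors. Transport is described on elementary tensors, which determines it because it
  is linear and these span.\<close>

definition lrealises ::
    "('a, 'k::field, 'v::ab_group_add) lspecies \<Rightarrow> ('a, 'k, 'w::ab_group_add) glspecies \<Rightarrow>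
     ('a, 's, 'e) shape \<Rightarrow> ('a lab set \<Rightarrow> 's \<Rightarrow> ('e \<Rightarrow> 'v) \<Rightarrow> 'w) \<Rightarrow> bool" where
  "lrealises L G M \<tau> \<longleftrightarrow> vector_space (gscale G) \<and> (\<forall>I n. finite I \<longrightarrow>
     model (lscale L) (gscale G) (gstr G I n) {s \<in> str (sp M) I. wt (sp M) s = n} (ed M)
       (\<lambda>s j. lstr L (lb M s j)) (\<tau> I) \<and>
     (\<forall>\<sigma>. inj_on \<sigma> I \<longrightarrow>
        linear_on (gscale G) (gscale G) (gstr G I n) (gtr G I n \<sigma>) \<and>
        (\<forall>s\<in>str (sp M) I. wt (sp M) s = n \<longrightarrow> (\<forall>d\<in>decs (lsp L) M s.
           gtr G I n \<sigma> (\<tau> I s d) = \<tau> (\<sigma> ` I) (tr (sp M) I \<sigma> s) (dpush (lsp L) M I \<sigma> s d)))))"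

lemma lrealisesD:
  assumes "lrealises L G M \<tau>"
  shows "vector_space (gscale G)"
    and "finite I \<Longrightarrow> model (lscale L) (gscale G) (gstr G I n) {s \<in> str (sp M) I. wt (sp M) s = n} (ed M)
       (\<lambda>s j. lstr L (lb M s j)) (\<tau> I)"
    and "finite I \<Longrightarrow> inj_on \<sigma> I \<Longrightarrow> linear_on (gscale G) (gscale G) (gstr G I n) (gtr G I n \<sigma>)"
    and "finite I \<Longrightarrow> inj_on \<sigma> I \<Longrightarrow> s \<in> str (sp M) I \<Longrightarrow> wt (sp M) s = n \<Longrightarrow> d \<in> decs (lsp L) M s \<Longrightarrow>
      gtr G I n \<sigma> (\<tau> I s d) = \<tau> (\<sigma> ` I) (tr (sp M) I \<sigma> s) (dpush (lsp L) M I \<sigma> s d)"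
  using assms by (simp_all add: lrealises_def)

lemma lrealises_mem:
  assumes "lrealises L G M \<tau>" "finite I" "s \<in> str (sp M) I" "wt (sp M) s = n" "d \<in> decs (lsp L) M s"
  shows "\<tau> I s d \<in> gstr G I n"
  using assms(3-5)
  by (intro model_in[OF lrealisesD(1)[OF assms(1)] lrealisesD(2)[OF assms(1,2)]]) (auto simp: decs_def)

text \<open>Membership is checked on elementary tensors, which go to elementary tensors of the same
  weight.\<close>

lemma lrealises_gtr:
  assumes L: "is_lspecies L" and M: "is_shape M" and G: "lrealises L G M \<tau>"
    and I: "finite I" and \<sigma>: "inj_on \<sigma> I" and v: "v \<in> gstr G I n"
  shows "gtr G I n \<sigma> v \<in> gstr G (\<sigma> ` I) n"
proof -
  note V = lrealisesD(1)[OF G] and m = lrealisesD(2)[OF G I, of n]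
  have I': "finite (\<sigma> ` I)"
    using I by simp
  let ?B = "gens {s \<in> str (sp M) I. wt (sp M) s = n} (ed M) (\<lambda>s j. lstr L (lb M s j)) (\<tau> I)"
  show ?thesis
  proof (rule linear_on_span_into[OF V V, of ?B "gtr G I n \<sigma>"])
    show "linear_on (gscale G) (gscale G) (module.span (gscale G) ?B) (gtr G I n \<sigma>)"
      using lrealisesD(3)[OF G I \<sigma>, of n] model_span[OF m] by simp
    show "module.subspace (gscale G) (gstr G (\<sigma> ` I) n)"
      by (rule model_subspace[OF V lrealisesD(2)[OF G I']])
    show "v \<in> module.span (gscale G) ?B"
      using v model_span[OF m] by simp
    fix b
    assume "b \<in> ?B"
    then obtain s d where s: "s \<in> str (sp M) I" "wt (sp M) s = n" and d: "d \<in> decs (lsp L) M s"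
      and b: "b = \<tau> I s d"
      by (auto simp: decs_def elim!: gensE)
    have "gtr G I n \<sigma> b = \<tau> (\<sigma> ` I) (tr (sp M) I \<sigma> s) (dpush (lsp L) M I \<sigma> s d)"
      unfolding b by (rule lrealisesD(4)[OF G I \<sigma> s d])
    also have "\<dots> \<in> gstr G (\<sigma> ` I) n"
      using is_shapeD(3,4)[OF M I s(1) \<sigma>] s(2)
      by (intro lrealises_mem[OF G I'] dpush_in[OF M lspecies_functorial[OF L] I s(1) \<sigma> d]) auto
    finally show "gtr G I n \<sigma> b \<in> gstr G (\<sigma> ` I) n" .
  qed
qed

lemma lrealises_iso:
  assumes L: "is_lspecies L" and M: "is_shape M" and G: "lrealises L G M \<tau>" and H: "lrealises L H M \<tau>'"
  shows "G \<cong>\<^sub>g H"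
proof -
  note V = lrealisesD(1)[OF G] and W = lrealisesD(1)[OF H]
  let ?P = "\<lambda>I n \<phi>. linear_on (gscale G) (gscale H) (gstr G I n) \<phi> \<and> bij_betw \<phi> (gstr G I n) (gstr H I n) \<and>
    (\<forall>s\<in>{s \<in> str (sp M) I. wt (sp M) s = n}. \<forall>d\<in>PiE (ed M s) (\<lambda>j. lstr L (lb M s j)). \<phi> (\<tau> I s d) = \<tau>' I s d)"
  \<comment> \<open>An isomorphism is chosen for each \<open>I\<close> and \<open>n\<close>
    independently. Naturality survives, since every choice is prescribed on the elementary
    tensors.\<close>
  define \<phi> where "\<phi> I n = (SOME \<phi>. ?P I n \<phi>)" for I n
  have P: "?P I n (\<phi> I n)" if "finite I" for I n
    unfolding \<phi>_def
    by (rule someI_ex[OF model_iso[OF V W lrealisesD(2)[OF G that] lrealisesD(2)[OF H that]]])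
  have \<phi>: "linear_on (gscale G) (gscale H) (gstr G I n) (\<phi> I n)" "bij_betw (\<phi> I n) (gstr G I n) (gstr H I n)"
    if "finite I" for I n
    using P[OF that] by blast+
  have \<phi>\<tau>: "\<phi> I n (\<tau> I s d) = \<tau>' I s d"
    if "finite I" "s \<in> str (sp M) I" "wt (sp M) s = n" "d \<in> decs (lsp L) M s" for I n s d
    using P[OF that(1), of n] that(2-4) by (simp add: decs_def)
  show ?thesis
    unfolding giso_def
  proof (intro exI[of _ \<phi>] allI impI conjI ballI)
    fix I :: "'a lab set" and n
    assume I: "finite I"
    show "bij_betw (\<phi> I n) (gstr G I n) (gstr H I n)"
      "linear_on (gscale G) (gscale H) (gstr G I n) (\<phi> I n)"
      using \<phi>[OF I] by blast+
    fix \<sigma> :: "'a lab \<Rightarrow> 'a lab" and v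
    assume \<sigma>: "inj_on \<sigma> I" and v: "v \<in> gstr G I n"
    have I': "finite (\<sigma> ` I)"
      using I by simp
    show "\<phi> (\<sigma> ` I) n (gtr G I n \<sigma> v) = gtr H I n \<sigma> (\<phi> I n v)"
    proof (rule model_eqI[OF V W lrealisesD(2)[OF G I] _ _ _ v])
      show "linear_on (gscale G) (gscale H) (gstr G I n) (\<lambda>v. \<phi> (\<sigma> ` I) n (gtr G I n \<sigma> v))"
        by (rule linear_on_comp[OF lrealisesD(3)[OF G I \<sigma>] \<phi>(1)[OF I']])
          (use lrealises_gtr[OF L M G I \<sigma>] in blast)
      show "linear_on (gscale G) (gscale H) (gstr G I n) (\<lambda>v. gtr H I n \<sigma> (\<phi> I n v))"
        by (rule linear_on_comp[OF \<phi>(1)[OF I] lrealisesD(3)[OF H I \<sigma>]])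
          (use \<phi>(2)[OF I, of n] in \<open>simp add: bij_betw_def\<close>)
      fix s d
      assume "s \<in> {s \<in> str (sp M) I. wt (sp M) s = n}" and "d \<in> PiE (ed M s) (\<lambda>j. lstr L (lb M s j))"
      then have s: "s \<in> str (sp M) I" "wt (sp M) s = n" and d: "d \<in> decs (lsp L) M s"
        by (auto simp: decs_def)
      have "\<phi> (\<sigma> ` I) n (gtr G I n \<sigma> (\<tau> I s d)) = \<tau>' (\<sigma> ` I) (tr (sp M) I \<sigma> s) (dpush (lsp L) M I \<sigma> s d)"
        unfolding lrealisesD(4)[OF G I \<sigma> s d] using is_shapeD(3,4)[OF M I s(1) \<sigma>] s(2)
        by (intro \<phi>\<tau>[OF I'] dpush_in[OF M lspecies_functorial[OF L] I s(1) \<sigma> d]) auto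
      then show "\<phi> (\<sigma> ` I) n (gtr G I n \<sigma> (\<tau> I s d)) = gtr H I n \<sigma> (\<phi> I n (\<tau> I s d))"
        using lrealisesD(4)[OF H I \<sigma> s d] \<phi>\<tau>[OF I s d] by simp
    qed
  qed
qed

text \<open>In contrast to \<open>model_reindex\<close>, the arguments of the elementary tensors
  change as well, by bijections \<open>P k\<close>. Multilinear maps are pulled back along
  \<open>P k\<close>, and forms have to come from forms on the other side.\<close>

lemma model_transport:
  assumes m: "model lsc sc V K0 J0 U0 \<tau>0" and h: "bij_betw h K K0"
    and P: "\<And>k. k \<in> K \<Longrightarrow> bij_betw (P k) (PiE (J k) (U k)) (PiE (J0 (h k)) (U0 (h k)))"
    and fwd: "\<And>k f. k \<in> K \<Longrightarrow> mlin lsc sc (J0 (h k)) (U0 (h k)) f \<Longrightarrow> mlin lsc sc (J k) (U k) (\<lambda>x. f (P k x))"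
    and bwd: "\<And>k c. k \<in> K \<Longrightarrow> c \<in> mforms lsc (J k) (U k) \<Longrightarrow>
      \<exists>c0\<in>mforms lsc (J0 (h k)) (U0 (h k)). \<forall>x\<in>PiE (J k) (U k). c0 (P k x) = c x"
  shows "model lsc sc V K J U (\<lambda>k x. \<tau>0 (h k) (P k x))"
  unfolding model_def
proof (intro conjI allI impI ballI)
  have hK: "h ` K = K0" and inj: "inj_on h K"
    using h by (auto simp: bij_betw_def)
  have PK: "P k ` PiE (J k) (U k) = PiE (J0 (h k)) (U0 (h k))" if "k \<in> K" for k
    using P[OF that] by (simp add: bij_betw_def)
  have "gens K J U (\<lambda>k x. \<tau>0 (h k) (P k x)) = (\<Union>k\<in>K. \<tau>0 (h k) ` P k ` PiE (J k) (U k))"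
    by (simp add: gens_def image_image)
  also have "\<dots> = (\<Union>k\<in>K. \<tau>0 (h k) ` PiE (J0 (h k)) (U0 (h k)))"
    using PK by simp
  also have "\<dots> = gens K0 J0 U0 \<tau>0"
    unfolding hK[symmetric] gens_def by simp
  finally show "V = module.span sc (gens K J U (\<lambda>k x. \<tau>0 (h k) (P k x)))"
    using model_span[OF m] by simp
  show "mlin lsc sc (J k) (U k) (\<lambda>x. \<tau>0 (h k) (P k x))" if "k \<in> K" for k
    using hK that by (intro fwd model_mlin[OF m]) auto
  fix c
  assume c: "\<forall>k\<in>K. c k \<in> mforms lsc (J k) (U k)"
  have "\<forall>k\<in>K. \<exists>c0. c0 \<in> mforms lsc (J0 (h k)) (U0 (h k)) \<and> (\<forall>x\<in>PiE (J k) (U k). c0 (P k x) = c k x)"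
  proof
    fix k
    assume k: "k \<in> K"
    show "\<exists>c0. c0 \<in> mforms lsc (J0 (h k)) (U0 (h k)) \<and> (\<forall>x\<in>PiE (J k) (U k). c0 (P k x) = c k x)"
      using bwd[OF k bspec[OF c k]] by auto
  qed
  then obtain c0 where c0: "\<And>k. k \<in> K \<Longrightarrow> c0 k \<in> mforms lsc (J0 (h k)) (U0 (h k))"
    "\<And>k x. k \<in> K \<Longrightarrow> x \<in> PiE (J k) (U k) \<Longrightarrow> c0 k (P k x) = c k x"
    by metis
  have "c0 (inv_into K h k0) \<in> mforms lsc (J0 k0) (U0 k0)" if "k0 \<in> K0" for k0
    using c0(1)[of "inv_into K h k0"] that hK inv_into_into[of k0 h K] f_inv_into_f[of k0 h K] by simp
  from model_extend[OF m, of "\<lambda>k0. c0 (inv_into K h k0)", OF this]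
  obtain f where f: "linear_on sc (*) V f"
    "\<forall>k0\<in>K0. \<forall>x\<in>PiE (J0 k0) (U0 k0). f (\<tau>0 k0 x) = c0 (inv_into K h k0) x"
    by blast
  have "f (\<tau>0 (h k) (P k x)) = c k x" if "k \<in> K" "x \<in> PiE (J k) (U k)" for k x
  proof -
    have "h k \<in> K0" "P k x \<in> PiE (J0 (h k)) (U0 (h k))"
      using imageI[OF that(1), of h] hK imageI[OF that(2), of "P k"] PK[OF that(1)] by simp_all
    then have "f (\<tau>0 (h k) (P k x)) = c0 (inv_into K h (h k)) (P k x)"
      using f(2) by blast
    then show ?thesis
      using inj that c0(2) by simp
  qed
  with f(1) show "\<exists>f. linear_on sc (*) V f \<and> (\<forall>k\<in>K. \<forall>x\<in>PiE (J k) (U k). f (\<tau>0 (h k) (P k x)) = c k x)"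
    by blast
qed

lemma push_upd:
  assumes "inj_on \<epsilon> J" "j \<in> J"
  shows "push F J D \<epsilon> l (d(j := u)) = (push F J D \<epsilon> l d)(\<epsilon> j := tr F (D j) (l j) u)"
proof
  fix i
  show "push F J D \<epsilon> l (d(j := u)) i = ((push F J D \<epsilon> l d)(\<epsilon> j := tr F (D j) (l j) u)) i"
  proof (cases "i \<in> \<epsilon> ` J")
    case True
    then obtain k where "k \<in> J" "i = \<epsilon> k"
      by blast
    then show ?thesis
      using assms by (auto simp: push_apply inj_on_eq_iff)
  next
    case False
    then show ?thesis
      using assms(2) by (auto simp: push_def)
  qed
qed

text \<open>Changing one argument of \<open>push\<close> changes one entry of the result through a
  linear transport map, so multilinearity is inherited.\<close>

lemma mlin_push:
  assumes L: "is_lspecies L" and \<epsilon>: "bij_betw \<epsilon> J J'"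
    and l: "\<And>j. j \<in> J \<Longrightarrow> finite (D j) \<and> bij_betw (l j) (D j) (D' (\<epsilon> j))"
    and f: "mlin (lscale L) sc J' (\<lambda>j. lstr L (D' j)) f"
  shows "mlin (lscale L) sc J (\<lambda>j. lstr L (D j)) (\<lambda>d. f (push (lsp L) J D \<epsilon> l d))"
  unfolding mlin_def
proof (intro ballI)
  fix j d
  assume j: "j \<in> J" and d: "d \<in> PiE J (\<lambda>j. lstr L (D j))"
  note F = lspecies_functorial[OF L]
  have fin: "finite (D j)" and b: "bij_betw (l j) (D j) (D' (\<epsilon> j))" and inj: "inj_on (l j) (D j)"
    using l[OF j] by (auto simp: bij_betw_def)
  have inj\<epsilon>: "inj_on \<epsilon> J" and \<epsilon>j: "\<epsilon> j \<in> J'"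
    using \<epsilon> j by (auto simp: bij_betw_def)
  have "push (lsp L) J D \<epsilon> l d \<in> PiE J' (\<lambda>j. lstr L (D' j))"
    using push_in[of "lsp L" \<epsilon> J J' D l D' d, OF F \<epsilon> l] d by simp
  then have "linear_on (lscale L) sc (lstr L (D' (\<epsilon> j))) (\<lambda>u. f ((push (lsp L) J D \<epsilon> l d)(\<epsilon> j := u)))"
    using f \<epsilon>j by (simp add: mlin_def)
  from linear_on_comp[OF lspecies_linear[OF L fin inj] this]
  show "linear_on (lscale L) sc (lstr L (D j)) (\<lambda>u. f (push (lsp L) J D \<epsilon> l (d(j := u))))"
    using functorial_bij[OF F fin b] by (simp add: push_upd[OF inj\<epsilon> j] bij_betw_def)
qed

text \<open>Composition with \<open>push\<close> along the inverse bijections turns a form on the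
  source into one on the target.\<close>

lemma push_inverse:
  assumes L: "is_lspecies L" and \<epsilon>: "bij_betw \<epsilon> J J'"
    and l: "\<And>j. j \<in> J \<Longrightarrow> finite (D j) \<and> bij_betw (l j) (D j) (D' (\<epsilon> j))"
    and c: "c \<in> mforms (lscale L) J (\<lambda>j. lstr L (D j))"
  shows "\<exists>c0\<in>mforms (lscale L) J' (\<lambda>j. lstr L (D' j)). \<forall>d\<in>PiE J (\<lambda>j. lstr L (D j)).
    c0 (push (lsp L) J D \<epsilon> l d) = c d"
proof -
  note F = lspecies_functorial[OF L]
  have J': "J' = \<epsilon> ` J" and inj: "inj_on \<epsilon> J"
    using \<epsilon> by (auto simp: bij_betw_def)
  let ?\<delta> = "inv_into J \<epsilon>"
  let ?m = "\<lambda>i. inv_into (D (?\<delta> i)) (l (?\<delta> i))"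
  let ?q = "push (lsp L) J' D' ?\<delta> ?m"
  have \<delta>: "bij_betw ?\<delta> J' J"
    using \<epsilon> by (rule bij_betw_inv_into)
  have m: "finite (D' i) \<and> bij_betw (?m i) (D' i) (D (?\<delta> i))" if "i \<in> J'" for i
    using that l[of "?\<delta> i"] inj unfolding J' by (auto intro: bij_betw_inv_into dest: bij_betw_finite)
  have "mlin (lscale L) (*) J' (\<lambda>j. lstr L (D' j)) (\<lambda>e. c (?q e))"
    using c by (intro mlin_push[of L ?\<delta> J' J D' ?m D, OF L \<delta> m]) (simp_all add: mforms_iff)
  moreover have "?q (push (lsp L) J D \<epsilon> l d) = d" if d: "d \<in> PiE J (\<lambda>j. lstr L (D j))" for d
  proof (rule push_eqI[OF \<delta> d])
    fix i
    assume "i \<in> J'"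
    then obtain j where j: "j \<in> J" "i = \<epsilon> j"
      using J' by blast
    have "finite (D j)" "inj_on (l j) (D j)" "D' (\<epsilon> j) = l j ` D j"
      using l[OF j(1)] by (auto simp: bij_betw_def)
    then have "ltr L (D' (\<epsilon> j)) (inv_into (D j) (l j)) (ltr L (D j) (l j) (d j)) = d j"
      using functorial_inv[OF F, of "D j" "l j" "d j"] PiE_mem[OF d j(1)] by simp
    then show "d (?\<delta> i) = tr (lsp L) (D' i) (?m i) (push (lsp L) J D \<epsilon> l d i)"
      using j inj by (simp add: push_apply)
  qed
  ultimately show ?thesis
    by (intro bexI[of _ "\<lambda>e. c (?q e)"]) (auto simp: mforms_iff)
qed

lemma lrealises_sequiv:
  assumes L: "is_lspecies L" and eq: "sequiv M N \<phi> \<epsilon> l" and M: "is_shape M" and N: "is_shape N"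
    and H: "lrealises L H N \<tau>"
  shows "lrealises L H M (\<lambda>I s d. \<tau> I (\<phi> I s) (epush (lsp L) M \<epsilon> l I s d))"
  unfolding lrealises_def
proof (intro allI impI conjI ballI)
  note F = lspecies_functorial[OF L]
  show "vector_space (gscale H)"
    by (rule lrealisesD(1)[OF H])
  fix I :: "'a lab set" and n
  assume I: "finite I"
  let ?K = "{s \<in> str (sp M) I. wt (sp M) s = n}"
  note \<phi> = sequivD(1,2)[OF eq I]
  show "model (lscale L) (gscale H) (gstr H I n) ?K (ed M) (\<lambda>s j. lstr L (lb M s j))
      (\<lambda>s d. \<tau> I (\<phi> I s) (epush (lsp L) M \<epsilon> l I s d))"
  proof (rule model_transport[OF lrealisesD(2)[OF H I, of n]])
    show "bij_betw (\<phi> I) ?K {s \<in> str (sp N) I. wt (sp N) s = n}"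
    proof (rule bij_betw_imageI)
      show "inj_on (\<phi> I) ?K"
        using bij_betw_imp_inj_on[OF \<phi>(1)] by (rule inj_on_subset) blast
      show "\<phi> I ` ?K = {s \<in> str (sp N) I. wt (sp N) s = n}"
        using bij_betw_imp_surj_on[OF \<phi>(1)] \<phi>(2) by force
    qed
    fix s
    assume "s \<in> ?K"
    then have s: "s \<in> str (sp M) I"
      by simp
    note e = sequivD(3)[OF eq I s]
    have l: "finite (lb M s j) \<and> bij_betw (l I s j) (lb M s j) (lb N (\<phi> I s) (\<epsilon> I s j))" if "j \<in> ed M s" for j
      using is_shapeD(2)[OF M I s that] sequivD(4)[OF eq I s that] by blast
    show "bij_betw (epush (lsp L) M \<epsilon> l I s) (PiE (ed M s) (\<lambda>j. lstr L (lb M s j)))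
        (PiE (ed N (\<phi> I s)) (\<lambda>j. lstr L (lb N (\<phi> I s) j)))"
      using epush_bij[OF eq M F I s] by (simp add: decs_def)
    show "mlin (lscale L) (gscale H) (ed M s) (\<lambda>j. lstr L (lb M s j)) (\<lambda>d. f (epush (lsp L) M \<epsilon> l I s d))"
      if "mlin (lscale L) (gscale H) (ed N (\<phi> I s)) (\<lambda>j. lstr L (lb N (\<phi> I s) j)) f" for f
      unfolding epush_def by (rule mlin_push[OF L e l that])
    show "\<exists>c0\<in>mforms (lscale L) (ed N (\<phi> I s)) (\<lambda>j. lstr L (lb N (\<phi> I s) j)).
        \<forall>d\<in>PiE (ed M s) (\<lambda>j. lstr L (lb M s j)). c0 (epush (lsp L) M \<epsilon> l I s d) = c d"
      if "c \<in> mforms (lscale L) (ed M s) (\<lambda>j. lstr L (lb M s j))" for c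
      unfolding epush_def by (rule push_inverse[OF L e l that])
  qed
  fix \<sigma> :: "'a lab \<Rightarrow> 'a lab"
  assume \<sigma>: "inj_on \<sigma> I"
  show "linear_on (gscale H) (gscale H) (gstr H I n) (gtr H I n \<sigma>)"
    by (rule lrealisesD(3)[OF H I \<sigma>])
  fix s d
  assume s: "s \<in> str (sp M) I" "wt (sp M) s = n" and d: "d \<in> decs (lsp L) M s"
  have \<phi>s: "\<phi> I s \<in> str (sp N) I" "wt (sp N) (\<phi> I s) = n" and ed: "epush (lsp L) M \<epsilon> l I s d \<in> decs (lsp L) N (\<phi> I s)"
    using \<phi> epush_bij[OF eq M F I s(1)] s d by (auto dest: bij_betwE)
  show "gtr H I n \<sigma> (\<tau> I (\<phi> I s) (epush (lsp L) M \<epsilon> l I s d)) = \<tau> (\<sigma> ` I) (\<phi> (\<sigma> ` I) (tr (sp M) I \<sigma> s))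
      (epush (lsp L) M \<epsilon> l (\<sigma> ` I) (tr (sp M) I \<sigma> s) (dpush (lsp L) M I \<sigma> s d))"
    using lrealisesD(4)[OF H I \<sigma> \<phi>s ed] sequivD(5)[OF eq I s(1) \<sigma>]
      epush_dpush[OF eq M N F I s(1) \<sigma> d] by simp
qed

section \<open>Linear realisations of the operations\<close>

lemma model_zero:
  assumes "vector_space sc" "model lsc sc V K J U \<tau>"
  shows "0 \<in> V"
proof -
  interpret vector_space sc by fact
  show ?thesis
    using model_subspace[OF assms] by (rule subspace_0)
qed

lemma lrealisesI:
  assumes "vector_space (gscale G)"
    and "\<And>I n. finite I \<Longrightarrow> model (lscale L) (gscale G) (gstr G I n) {s \<in> str (sp M) I. wt (sp M) s = n} (ed M)
       (\<lambda>s j. lstr L (lb M s j)) (\<tau> I)"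
    and "\<And>I n \<sigma>. finite I \<Longrightarrow> inj_on \<sigma> I \<Longrightarrow> linear_on (gscale G) (gscale G) (gstr G I n) (gtr G I n \<sigma>)"
    and "\<And>I n \<sigma> s d. finite I \<Longrightarrow> inj_on \<sigma> I \<Longrightarrow> s \<in> str (sp M) I \<Longrightarrow> wt (sp M) s = n \<Longrightarrow>
      d \<in> decs (lsp L) M s \<Longrightarrow>
      gtr G I n \<sigma> (\<tau> I s d) = \<tau> (\<sigma> ` I) (tr (sp M) I \<sigma> s) (dpush (lsp L) M I \<sigma> s d)"
  shows "lrealises L G M \<tau>"
  unfolding lrealises_def using assms by simp

lemma lrealises_gshift:
  assumes "lrealises L G M \<tau>"
  shows "lrealises L (gshift k G) (sshift k M) \<tau>"
proof (rule lrealisesI)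
  show "vector_space (gscale (gshift k G))"
    using lrealisesD(1)[OF assms] by (simp add: gshift_def)
  fix I :: "'a lab set" and n
  assume I: "finite I"
  have "{s \<in> str (sp (sshift k M)) I. wt (sp (sshift k M)) s = n} = {s \<in> str (sp M) I. wt (sp M) s = n - k}"
    by (auto simp: sshift_def wshift_def)
  then show "model (lscale L) (gscale (gshift k G)) (gstr (gshift k G) I n)
      {s \<in> str (sp (sshift k M)) I. wt (sp (sshift k M)) s = n} (ed (sshift k M))
      (\<lambda>s j. lstr L (lb (sshift k M) s j)) (\<tau> I)"
    using lrealisesD(2)[OF assms I, of "n - k"] by (simp add: gshift_def) (simp add: sshift_def)
  fix \<sigma> :: "'a lab \<Rightarrow> 'a lab"
  assume \<sigma>: "inj_on \<sigma> I"
  show "linear_on (gscale (gshift k G)) (gscale (gshift k G)) (gstr (gshift k G) I n) (gtr (gshift k G) I n \<sigma>)"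
    using lrealisesD(3)[OF assms I \<sigma>] by (simp add: gshift_def)
  fix s d
  assume "s \<in> str (sp (sshift k M)) I" "wt (sp (sshift k M)) s = n" "d \<in> decs (lsp L) (sshift k M) s"
  then show "gtr (gshift k G) I n \<sigma> (\<tau> I s d) =
      \<tau> (\<sigma> ` I) (tr (sp (sshift k M)) I \<sigma> s) (dpush (lsp L) (sshift k M) I \<sigma> s d)"
    using lrealisesD(4)[OF assms I \<sigma>, of s "n - k" d]
    by (simp add: gshift_def sshift_def wshift_def decs_def dpush_def)
qed

lemma lrealises_gderiv:
  assumes "lrealises L G M \<tau>"
  shows "lrealises L (gderiv G) (sderiv M) (\<lambda>I. \<tau> (add_pt I))"
proof (rule lrealisesI)
  show "vector_space (gscale (gderiv G))"
    using lrealisesD(1)[OF assms] by (simp add: gderiv_def)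
  fix I :: "'a lab set" and n
  assume I: "finite I"
  then have I': "finite (add_pt I)"
    by (simp add: finite_add_pt)
  show "model (lscale L) (gscale (gderiv G)) (gstr (gderiv G) I n)
      {s \<in> str (sp (sderiv M)) I. wt (sp (sderiv M)) s = n} (ed (sderiv M))
      (\<lambda>s j. lstr L (lb (sderiv M) s j)) (\<tau> (add_pt I))"
    using lrealisesD(2)[OF assms I', of n] by (simp add: gderiv_def sderiv_def wderiv_def)
  fix \<sigma> :: "'a lab \<Rightarrow> 'a lab"
  assume \<sigma>: "inj_on \<sigma> I"
  note \<sigma>' = inj_on_ext_map[OF I \<sigma>]
  show "linear_on (gscale (gderiv G)) (gscale (gderiv G)) (gstr (gderiv G) I n) (gtr (gderiv G) I n \<sigma>)"
    using lrealisesD(3)[OF assms I' \<sigma>'] by (simp add: gderiv_def)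
  fix s d
  assume "s \<in> str (sp (sderiv M)) I" "wt (sp (sderiv M)) s = n" "d \<in> decs (lsp L) (sderiv M) s"
  then show "gtr (gderiv G) I n \<sigma> (\<tau> (add_pt I) s d) =
      \<tau> (add_pt (\<sigma> ` I)) (tr (sp (sderiv M)) I \<sigma> s) (dpush (lsp L) (sderiv M) I \<sigma> s d)"
    using lrealisesD(4)[OF assms I' \<sigma>', of s n d] ext_map_image[OF I]
    by (simp add: gderiv_def sderiv_def wderiv_def decs_def dpush_def)
qed

lemma lrealises_gsum:
  assumes L: "is_lspecies L" and M: "is_shape M" and N: "is_shape N"
    and G: "lrealises L G M \<tau>" and H: "lrealises L H N \<upsilon>"
  shows "lrealises L (G +\<^sub>g H) (ssum M N)
    (\<lambda>I s d. case s of Inl x \<Rightarrow> (\<tau> I x d, 0) | Inr y \<Rightarrow> (0, \<upsilon> I y d))"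
proof (rule lrealisesI)
  note V = lrealisesD(1)[OF G] and W = lrealisesD(1)[OF H]
  show "vector_space (gscale (G +\<^sub>g H))"
    using vector_space_map_prod[OF V W] by (simp add: gsum_def)
  fix I :: "'a lab set" and n
  assume I: "finite I"
  show "model (lscale L) (gscale (G +\<^sub>g H)) (gstr (G +\<^sub>g H) I n)
      {s \<in> str (sp (ssum M N)) I. wt (sp (ssum M N)) s = n} (ed (ssum M N))
      (\<lambda>s j. lstr L (lb (ssum M N) s j))
      (\<lambda>s d. case s of Inl x \<Rightarrow> (\<tau> I x d, 0) | Inr y \<Rightarrow> (0, \<upsilon> I y d))"
  proof -
    have eq: "{s \<in> str (sp (ssum M N)) I. wt (sp (ssum M N)) s = n} =
        {s \<in> str (sp M) I. wt (sp M) s = n} <+> {s \<in> str (sp N) I. wt (sp N) s = n}"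
      by (auto simp: ssum_def wsum_def)
    have "gstr (G +\<^sub>g H) I n = gstr G I n \<times> gstr H I n"
      "gscale (G +\<^sub>g H) = (\<lambda>c. map_prod (gscale G c) (gscale H c))"
      by (simp_all add: gsum_def)
    then show ?thesis
      unfolding eq
    proof (simp only:, intro model_reindex[OF model_prod[OF V W lrealisesD(2)[OF G I, of n] lrealisesD(2)[OF H I, of n]],
          where h = "\<lambda>s. s"], goal_cases)
      case (6 k j)
      then show ?case
        using is_shapeD(2)[OF M I] is_shapeD(2)[OF N I]
        by (intro lspecies_subspace[OF L]) (auto simp: ssum_def elim!: PlusE)
    qed (auto simp: ssum_def bij_betw_def lspecies_vector_space[OF L] elim!: PlusE split: sum.splits)
  qed
  fix \<sigma> :: "'a lab \<Rightarrow> 'a lab"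
  assume \<sigma>: "inj_on \<sigma> I"
  show "linear_on (gscale (G +\<^sub>g H)) (gscale (G +\<^sub>g H)) (gstr (G +\<^sub>g H) I n) (gtr (G +\<^sub>g H) I n \<sigma>)"
    using lrealisesD(3)[OF G I \<sigma>, of n] lrealisesD(3)[OF H I \<sigma>, of n]
    by (auto simp: gsum_def linear_on_def)
  \<comment> \<open>An elementary tensor of one summand has the component 0 in the other, and
    transport has to preserve this 0.\<close>
  have "linear_on (gscale G) (gscale G) (gstr G I n) (gtr G I n \<sigma>)" "0 \<in> gstr G I n"
    "linear_on (gscale H) (gscale H) (gstr H I n) (gtr H I n \<sigma>)" "0 \<in> gstr H I n"
    using lrealisesD(3)[OF G I \<sigma>, of n] lrealisesD(3)[OF H I \<sigma>, of n]
      model_zero[OF V lrealisesD(2)[OF G I, of n]] model_zero[OF W lrealisesD(2)[OF H I, of n]] by auto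
  then have zero: "gtr G I n \<sigma> 0 = 0" "gtr H I n \<sigma> 0 = 0"
    using linear_on_zero[OF V V] linear_on_zero[OF W W] by blast+
  fix s d
  assume s: "s \<in> str (sp (ssum M N)) I" "wt (sp (ssum M N)) s = n" and d: "d \<in> decs (lsp L) (ssum M N) s"
  show "gtr (G +\<^sub>g H) I n \<sigma> (case s of Inl x \<Rightarrow> (\<tau> I x d, 0) | Inr y \<Rightarrow> (0, \<upsilon> I y d)) =
      (case tr (sp (ssum M N)) I \<sigma> s of
        Inl x \<Rightarrow> (\<tau> (\<sigma> ` I) x (dpush (lsp L) (ssum M N) I \<sigma> s d), 0)
      | Inr y \<Rightarrow> (0, \<upsilon> (\<sigma> ` I) y (dpush (lsp L) (ssum M N) I \<sigma> s d)))"
  proof (cases s)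
    case (Inl x)
    then show ?thesis
      using s d zero lrealisesD(4)[OF G I \<sigma>, of x n d]
      by (auto simp: gsum_def ssum_def wsum_def decs_def dpush_def)
  next
    case (Inr y)
    then show ?thesis
      using s d zero lrealisesD(4)[OF H I \<sigma>, of y n d]
      by (auto simp: gsum_def ssum_def wsum_def decs_def dpush_def)
  qed
qed

text \<open>The pullback of a bilinear form along \<open>f\<close> and \<open>g\<close> is again a
  bilinear form, so \<open>elem2\<close> evaluates it and does not return its default value
  0.\<close>

lemma tensor2_map_elem2:
  assumes "linear_on s1 s1 V f" "f ` V \<subseteq> V'" "linear_on s2 s2 W g" "g ` W \<subseteq> W'" "v \<in> V" "w \<in> W"
  shows "tensor2_map s1 s2 V' W' f g (elem2 s1 s2 V W v w) = elem2 s1 s2 V' W' (f v) (g w)"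
proof
  fix m
  show "tensor2_map s1 s2 V' W' f g (elem2 s1 s2 V W v w) m = elem2 s1 s2 V' W' (f v) (g w) m"
  proof (cases "m \<in> bforms s1 s2 V' W'")
    case True
    then have m: "\<And>y. y \<in> W' \<Longrightarrow> linear_on s1 (*) V' (\<lambda>x. m x y)" "\<And>x. x \<in> V' \<Longrightarrow> linear_on s2 (*) W' (m x)"
      by (auto simp: bforms_def)
    have "(\<lambda>x y. m (f x) (g y)) \<in> bforms s1 s2 V W"
      unfolding bforms_def
    proof (intro CollectI conjI ballI)
      show "linear_on s1 (*) V (\<lambda>x. m (f x) (g y))" if "y \<in> W" for y
        using assms(2,4) that by (intro linear_on_comp[OF assms(1) m(1)]) auto
      show "linear_on s2 (*) W (\<lambda>y. m (f x) (g y))" if "x \<in> V" for x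
        using assms(2,4) that by (intro linear_on_comp[OF assms(3) m(2)]) auto
    qed
    then show ?thesis
      using True by (simp add: tensor2_map_def elem2_def)
  qed (simp add: tensor2_map_def elem2_def)
qed

text \<open>As for two factors, the pulled back form has to be multilinear. Each position
  \<open>j\<close> of the source corresponds to exactly one position \<open>i\<close> of the target,
  so varying the argument at \<open>j\<close> varies a single argument of \<open>m\<close>.\<close>

lemma tensor_map_elem:
  assumes \<rho>: "bij_betw \<rho> J' J" and h: "\<And>j. j \<in> J \<Longrightarrow> linear_on sc sc (V j) (h j)"
    "\<And>j'. j' \<in> J' \<Longrightarrow> h (\<rho> j') ` V (\<rho> j') \<subseteq> V' j'" and x: "x \<in> PiE J V"
  shows "tensor_map sc J' V' \<rho> h (elem sc J V x) = elem sc J' V' (\<lambda>j'\<in>J'. h (\<rho> j') (x (\<rho> j')))"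
proof
  fix m
  show "tensor_map sc J' V' \<rho> h (elem sc J V x) m = elem sc J' V' (\<lambda>j'\<in>J'. h (\<rho> j') (x (\<rho> j'))) m"
  proof (cases "m \<in> mforms sc J' V'")
    case True
    have "(\<lambda>x. m (\<lambda>j'\<in>J'. h (\<rho> j') (x (\<rho> j')))) \<in> mforms sc J V"
      unfolding mforms_def
    proof (intro CollectI ballI)
      fix j x
      assume "j \<in> J" and x: "x \<in> PiE J V"
      then obtain i where i: "i \<in> J'" "j = \<rho> i"
        using \<rho> by (auto simp: bij_betw_def)
      let ?y = "\<lambda>j'\<in>J'. h (\<rho> j') (x (\<rho> j'))"
      have eq: "(\<lambda>j'\<in>J'. h (\<rho> j') ((x(j := u)) (\<rho> j'))) = ?y(i := h j u)" for u
        using \<rho> i by (auto simp: fun_eq_iff bij_betw_def inj_on_def)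
      have "\<rho> j' \<in> J" if "j' \<in> J'" for j'
        using \<rho> that by (auto simp: bij_betw_def)
      then have "?y \<in> PiE J' V'"
        using h(2) PiE_mem[OF x] by fastforce
      then have "linear_on sc (*) (V' i) (\<lambda>u. m (?y(i := u)))"
        using True i by (simp add: mforms_def)
      from linear_on_comp[OF h(1)[OF \<open>j \<in> J\<close>] this]
      show "linear_on sc (*) (V j) (\<lambda>u. m (\<lambda>j'\<in>J'. h (\<rho> j') ((x(j := u)) (\<rho> j'))))"
        unfolding eq using h(2)[OF i(1)] i(2) by simp
    qed
    then show ?thesis
      using True by (simp add: tensor_map_def elem_def)
  qed (simp add: tensor_map_def elem_def)
qed

lemma tensor_map_in_tensor:
  fixes sc :: "'k::field \<Rightarrow> 'v::ab_group_add \<Rightarrow> 'v" and V :: "'j \<Rightarrow> 'v set"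
  assumes "bij_betw \<rho> J' J" "\<And>j. j \<in> J \<Longrightarrow> linear_on sc sc (V j) (h j)"
    "\<And>j'. j' \<in> J' \<Longrightarrow> h (\<rho> j') ` V (\<rho> j') \<subseteq> V' j'" and T: "T \<in> tensor sc J V"
  shows "tensor_map sc J' V' \<rho> h T \<in> tensor sc J' V'"
proof -
  have vs: "vector_space (scale_fun (*) :: 'k \<Rightarrow> ((('j \<Rightarrow> 'v) \<Rightarrow> 'k) \<Rightarrow> 'k) \<Rightarrow> ((('j \<Rightarrow> 'v) \<Rightarrow> 'k) \<Rightarrow> 'k))"
    by (intro vector_space_scale_fun vector_space_field)
  interpret vector_space "scale_fun (*) :: 'k \<Rightarrow> ((('j \<Rightarrow> 'v) \<Rightarrow> 'k) \<Rightarrow> 'k) \<Rightarrow> ((('j \<Rightarrow> 'v) \<Rightarrow> 'k) \<Rightarrow> 'k)"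
    by (rule vs)
  show ?thesis
  proof (rule linear_on_span_into[OF vs vs, of "elem sc J V ` PiE J V" "tensor_map sc J' V' \<rho> h"])
    show "linear_on (scale_fun (*)) (scale_fun (*)) (span (elem sc J V ` PiE J V)) (tensor_map sc J' V' \<rho> h)"
      by (auto simp: linear_on_def tensor_map_def scale_fun_def fun_eq_iff)
    show "subspace (tensor sc J' V')"
      by (simp add: tensor_elem)
    show "T \<in> span (elem sc J V ` PiE J V)"
      using T by (simp add: tensor_elem)
    fix b
    assume "b \<in> elem sc J V ` PiE J V"
    then obtain x where x: "x \<in> PiE J V" "b = elem sc J V x"
      by blast
    have "\<rho> j' \<in> J" if "j' \<in> J'" for j'
      using assms(1) that by (auto simp: bij_betw_def)
    then have "(\<lambda>j'\<in>J'. h (\<rho> j') (x (\<rho> j'))) \<in> PiE J' V'"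
      using assms(3) PiE_mem[OF x(1)] by fastforce
    then have "elem sc J' V' (\<lambda>j'\<in>J'. h (\<rho> j') (x (\<rho> j'))) \<in> tensor sc J' V'"
      unfolding tensor_elem by (intro span_base imageI)
    moreover have "tensor_map sc J' V' \<rho> h (elem sc J V x) = elem sc J' V' (\<lambda>j'\<in>J'. h (\<rho> j') (x (\<rho> j')))"
      by (rule tensor_map_elem[where sc = sc and V = V and V' = V', OF assms(1) _ _ x(1)]) (simp_all add: assms(2,3))
    ultimately show "tensor_map sc J' V' \<rho> h b \<in> tensor sc J' V'"
      by (simp only: x(2))
  qed
qed

text \<open>In products, composites and hypertrees alike, transport reads the coordinate at
  \<open>k\<close> from the coordinate at \<open>\<Phi> k\<close>. A vector supported at
  \<open>i\<close> is therefore sent to one supported at the only admissible index \<open>i'\<close>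
  above \<open>i\<close>.\<close>

lemma transport_single:
  assumes "i' \<in> T" "\<Phi> i' = i" "\<And>k. k \<in> T \<Longrightarrow> \<Phi> k = i \<Longrightarrow> k = i'" "\<And>k. R k 0 = 0" "R i' v = w"
    and "\<And>k. f k = (if k \<in> T then R k (single i v (\<Phi> k)) else 0)"
  shows "f = single i' w"
proof
  fix k
  show "f k = single i' w k"
  proof (cases "k \<in> T \<and> k \<noteq> i'")
    case True
    then have "\<Phi> k \<noteq> i"
      using assms(3) by blast
    then show ?thesis
      using assms(4)[of k] assms(6)[of k] True by (simp add: single_def)
  next
    case False
    then show ?thesis
      using assms(1,2,5) assms(6)[of k] by (cases "k = i'") (simp_all add: single_def)
  qed
qed

lemma mem_prod_idx: "(A, B, a, b) \<in> prod_idx I n \<longleftrightarrow> A \<union> B = I \<and> A \<inter> B = {} \<and> a + b = n"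
  by (simp add: prod_idx_def)

text \<open>A summand of \<open>gprod\<close> is indexed by two sets and two degrees. The models of
  the factors resolve it further into pairs of structures, and the degrees are then recovered as the
  weights of these structures.\<close>

lemma lrealises_gprod:
  assumes L: "is_lspecies L" and M: "is_shape M" and N: "is_shape N"
    and G: "lrealises L G M \<tau>" and H: "lrealises L H N \<upsilon>"
  shows "lrealises L (G \<times>\<^sub>g H) (sprod M N)
    (\<lambda>I (A, B, x, y) d. single (A, B, wt (sp M) x, wt (sp N) y)
       (elem2 (gscale G) (gscale H) (gstr G A (wt (sp M) x)) (gstr H B (wt (sp N) y))
          (\<tau> A x (\<lambda>j\<in>ed M x. d (Inl j))) (\<upsilon> B y (\<lambda>j\<in>ed N y. d (Inr j)))))"
    (is "lrealises _ _ _ ?\<tau>")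
proof (rule lrealisesI)
  note V = lrealisesD(1)[OF G] and W = lrealisesD(1)[OF H]
  note lsc = lspecies_vector_space[OF L]
  note F = lspecies_functorial[OF L]
  show "vector_space (gscale (G \<times>\<^sub>g H))"
    by (simp add: gprod_def vector_space_scale_fun vector_space_field)
  fix I :: "'a lab set" and n
  assume I: "finite I"
  let ?T = "\<lambda>(A, B, a, b). tensor2 (gscale G) (gscale H) (gstr G A a) (gstr H B b)"
  let ?K = "\<lambda>(A, B, a, b). {s \<in> str (sp M) A. wt (sp M) s = a} \<times> {s \<in> str (sp N) B. wt (sp N) s = b}"
  let ?J = "\<lambda>(x, y). ed M x <+> ed N y"
  let ?U = "\<lambda>(x, y). case_sum (\<lambda>j. lstr L (lb M x j)) (\<lambda>j. lstr L (lb N y j))"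
  let ?e = "\<lambda>(A, B, a, b) (x, y) d. elem2 (gscale G) (gscale H) (gstr G A a) (gstr H B b)
    (\<tau> A x (\<lambda>j\<in>ed M x. d (Inl j))) (\<upsilon> B y (\<lambda>j\<in>ed N y. d (Inr j)))"
  have "model (lscale L) (scale_fun (*)) (?T i) (?K i) ?J ?U (?e i)" if "i \<in> prod_idx I n" for i
  proof -
    obtain A B a b where i: "i = (A, B, a, b)"
      by (cases i)
    have fin: "finite A" "finite B"
      using that I by (auto simp: i mem_prod_idx)
    have "module.subspace (lscale L) (lstr L (lb N y j))"
      if "y \<in> {s \<in> str (sp N) B. wt (sp N) s = b}" "j \<in> ed N y" for y j
      using is_shapeD(2)[OF N fin(2), of y j] that by (intro lspecies_subspace[OF L]) auto
    from model_tensor2[OF V W lrealisesD(2)[OF G fin(1), of a] lrealisesD(2)[OF H fin(2), of b] this lsc]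
    show ?thesis
      by (simp only: i prod.case)
  qed
  from model_dsum[OF vector_space_scale_fun[OF vector_space_field] this]
  have m: "model (lscale L) (scale_fun (scale_fun (*))) (dsum (prod_idx I n) ?T) (SIGMA i:prod_idx I n. ?K i)
      (\<lambda>(i, k). ?J k) (\<lambda>(i, k). ?U k) (\<lambda>(i, k) d. single i (?e i k d))" .
  let ?S = "{s \<in> str (sp (sprod M N)) I. wt (sp (sprod M N)) s = n}"
  let ?h = "\<lambda>(A, B, x, y). ((A, B, wt (sp M) x, wt (sp N) y), (x, y))"
  have "model (lscale L) (scale_fun (scale_fun (*))) (dsum (prod_idx I n) ?T) ?S (ed (sprod M N))
      (\<lambda>s j. lstr L (lb (sprod M N) s j)) (?\<tau> I)"
  proof (rule model_reindex[OF m, where h = ?h])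
    show "bij_betw ?h ?S (SIGMA i:prod_idx I n. ?K i)"
      by (rule bij_betw_byWitness[where f' = "\<lambda>((A, B, a, b), (x, y)). (A, B, x, y)"])
        (auto simp: mem_str_sprod wt_sprod mem_prod_idx)
    show "vector_space (lscale L)"
      by (rule lsc)
    fix s
    assume "s \<in> ?S"
    then have s: "s \<in> str (sp (sprod M N)) I"
      by simp
    show "module.subspace (lscale L) (lstr L (lb (sprod M N) s j))" if "j \<in> ed (sprod M N) s" for j
      using is_shapeD(2)[OF is_shape_sprod[OF M N] I s that] by (rule lspecies_subspace[OF L])
  qed (auto simp: sprod_fields elim!: PlusE)
  then show "model (lscale L) (gscale (G \<times>\<^sub>g H)) (gstr (G \<times>\<^sub>g H) I n) ?S (ed (sprod M N))
      (\<lambda>s j. lstr L (lb (sprod M N) s j)) (?\<tau> I)"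
    by (simp add: gprod_def)
  fix \<sigma> :: "'a lab \<Rightarrow> 'a lab"
  assume \<sigma>: "inj_on \<sigma> I"
  show "linear_on (gscale (G \<times>\<^sub>g H)) (gscale (G \<times>\<^sub>g H)) (gstr (G \<times>\<^sub>g H) I n) (gtr (G \<times>\<^sub>g H) I n \<sigma>)"
    by (auto simp: gprod_def linear_on_def tensor2_map_def scale_fun_def fun_eq_iff Let_def)
  fix s d
  assume s: "s \<in> str (sp (sprod M N)) I" "wt (sp (sprod M N)) s = n" and d: "d \<in> decs (lsp L) (sprod M N) s"
  obtain A B x y where s_eq: "s = (A, B, x, y)"
    by (cases s)
  note AB = s(1)[unfolded s_eq mem_str_sprod]
  note dp = dpush_sprod[OF M N F I s(1)[unfolded s_eq] \<sigma> d[unfolded s_eq]]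
  have fA: "finite A" "finite B" "inj_on \<sigma> A" "inj_on \<sigma> B" "\<sigma> ` A \<inter> \<sigma> ` B = {}"
    by (rule sprod_parts[OF I \<sigma> AB[THEN conjunct1] AB[THEN conjunct2, THEN conjunct1]])+
  have x: "x \<in> str (sp M) A" and y: "y \<in> str (sp N) B"
    using AB by auto
  have dx: "(\<lambda>j\<in>ed M x. d (Inl j)) \<in> decs (lsp L) M x" and dy: "(\<lambda>j\<in>ed N y. d (Inr j)) \<in> decs (lsp L) N y"
    using restrict_Inl[OF d[unfolded s_eq decs_sprod]] restrict_Inr[OF d[unfolded s_eq decs_sprod]]
    by (simp_all add: decs_def)
  note wx = is_shapeD(4)[OF M fA(1) x fA(3)] and wy = is_shapeD(4)[OF N fA(2) y fA(4)]
  let ?a = "wt (sp M) x" and ?b = "wt (sp N) y"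
  let ?f = "gtr G A ?a \<sigma>" and ?g = "gtr H B ?b \<sigma>"
  have inv: "inv_into I \<sigma> ` \<sigma> ` A = A" "inv_into I \<sigma> ` \<sigma> ` B = B"
    using AB by (auto intro!: inv_into_image_cancel[OF \<sigma>])
  have "gtr (G \<times>\<^sub>g H) I n \<sigma> (?\<tau> I s d) = single (\<sigma> ` A, \<sigma> ` B, ?a, ?b)
      (elem2 (gscale G) (gscale H) (gstr G (\<sigma> ` A) ?a) (gstr H (\<sigma> ` B) ?b)
        (?f (\<tau> A x (\<lambda>j\<in>ed M x. d (Inl j)))) (?g (\<upsilon> B y (\<lambda>j\<in>ed N y. d (Inr j)))))"
  proof (rule transport_single[where T = "prod_idx (\<sigma> ` I) n"
        and \<Phi> = "\<lambda>(A', B', a, b). (inv_into I \<sigma> ` A', inv_into I \<sigma> ` B', a, b)" and i = "(A, B, ?a, ?b)"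
        and R = "\<lambda>(A', B', a, b). tensor2_map (gscale G) (gscale H) (gstr G A' a) (gstr H B' b)
          (gtr G (inv_into I \<sigma> ` A') a \<sigma>) (gtr H (inv_into I \<sigma> ` B') b \<sigma>)"])
    show "(\<sigma> ` A, \<sigma> ` B, ?a, ?b) \<in> prod_idx (\<sigma> ` I) n"
      using AB fA(5) s(2) by (auto simp: s_eq mem_prod_idx wt_sprod)
    show "(case (\<sigma> ` A, \<sigma> ` B, ?a, ?b) of (A', B', a, b) \<Rightarrow> (inv_into I \<sigma> ` A', inv_into I \<sigma> ` B', a, b)) = (A, B, ?a, ?b)"
      using inv by simp
    show "k = (\<sigma> ` A, \<sigma> ` B, ?a, ?b)" if "k \<in> prod_idx (\<sigma> ` I) n"
      "(case k of (A', B', a, b) \<Rightarrow> (inv_into I \<sigma> ` A', inv_into I \<sigma> ` B', a, b)) = (A, B, ?a, ?b)" for k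
    proof -
      obtain A' B' a b where k: "k = (A', B', a, b)"
        by (cases k)
      have "A' \<subseteq> \<sigma> ` I" "B' \<subseteq> \<sigma> ` I"
        using that(1) by (auto simp: k mem_prod_idx)
      then have "\<sigma> ` inv_into I \<sigma> ` A' = A'" "\<sigma> ` inv_into I \<sigma> ` B' = B'"
        by (simp_all add: image_inv_into_cancel[OF refl])
      then show ?thesis
        using that(2) by (auto simp: k)
    qed
    show "(case k of (A', B', a, b) \<Rightarrow> tensor2_map (gscale G) (gscale H) (gstr G A' a) (gstr H B' b)
          (gtr G (inv_into I \<sigma> ` A') a \<sigma>) (gtr H (inv_into I \<sigma> ` B') b \<sigma>)) 0 = 0" for k
      by (cases k) (simp add: tensor2_map_def fun_eq_iff)
    show "(case (\<sigma> ` A, \<sigma> ` B, ?a, ?b) of (A', B', a, b) \<Rightarrow> tensor2_map (gscale G) (gscale H) (gstr G A' a) (gstr H B' b)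
          (gtr G (inv_into I \<sigma> ` A') a \<sigma>) (gtr H (inv_into I \<sigma> ` B') b \<sigma>))
        (elem2 (gscale G) (gscale H) (gstr G A ?a) (gstr H B ?b)
          (\<tau> A x (\<lambda>j\<in>ed M x. d (Inl j))) (\<upsilon> B y (\<lambda>j\<in>ed N y. d (Inr j)))) =
      elem2 (gscale G) (gscale H) (gstr G (\<sigma> ` A) ?a) (gstr H (\<sigma> ` B) ?b)
        (?f (\<tau> A x (\<lambda>j\<in>ed M x. d (Inl j)))) (?g (\<upsilon> B y (\<lambda>j\<in>ed N y. d (Inr j))))"
      unfolding prod.case inv
    proof (rule tensor2_map_elem2)
      show "?f ` gstr G A ?a \<subseteq> gstr G (\<sigma> ` A) ?a"
        using lrealises_gtr[OF L M G fA(1,3)] by blast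
      show "?g ` gstr H B ?b \<subseteq> gstr H (\<sigma> ` B) ?b"
        using lrealises_gtr[OF L N H fA(2,4)] by blast
    qed (simp_all only: lrealisesD(3)[OF G fA(1,3)] lrealisesD(3)[OF H fA(2,4)]
        lrealises_mem[OF G fA(1) x refl dx] lrealises_mem[OF H fA(2) y refl dy])
    show "gtr (G \<times>\<^sub>g H) I n \<sigma> (?\<tau> I s d) k = (if k \<in> prod_idx (\<sigma> ` I) n
        then (case k of (A', B', a, b) \<Rightarrow> tensor2_map (gscale G) (gscale H) (gstr G A' a) (gstr H B' b)
          (gtr G (inv_into I \<sigma> ` A') a \<sigma>) (gtr H (inv_into I \<sigma> ` B') b \<sigma>))
          (single (A, B, ?a, ?b) (elem2 (gscale G) (gscale H) (gstr G A ?a) (gstr H B ?b)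
            (\<tau> A x (\<lambda>j\<in>ed M x. d (Inl j))) (\<upsilon> B y (\<lambda>j\<in>ed N y. d (Inr j))))
            (case k of (A', B', a, b) \<Rightarrow> (inv_into I \<sigma> ` A', inv_into I \<sigma> ` B', a, b)))
        else 0)" for k
      by (cases k) (simp add: gprod_def s_eq Let_def)
  qed
  also have "\<dots> = ?\<tau> (\<sigma> ` I) (tr (sp (sprod M N)) I \<sigma> s) (dpush (lsp L) (sprod M N) I \<sigma> s d)"
    unfolding s_eq tr_sprod prod.case wx wy dp[symmetric]
      lrealisesD(4)[OF G fA(1,3) x refl dx] lrealisesD(4)[OF H fA(2,4) y refl dy] ..
  finally show "gtr (G \<times>\<^sub>g H) I n \<sigma> (?\<tau> I s d) =
      ?\<tau> (\<sigma> ` I) (tr (sp (sprod M N)) I \<sigma> s) (dpush (lsp L) (sprod M N) I \<sigma> s d)" .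
qed

lemma mem_comp_idx:
  "(\<pi>, a, b) \<in> comp_idx I n \<longleftrightarrow> partition_on I \<pi> \<and> b \<in> PiE \<pi> (\<lambda>_. UNIV) \<and> a + (\<Sum>J\<in>\<pi>. b J) = n"
  by (simp add: comp_idx_def)

text \<open>Three results are nested: the tensor product over the blocks is expanded by
  \<open>model_multi_tensor\<close>, its product with the outer component by
  \<open>model_tensor2\<close>, and all indices are collected by \<open>model_dsum\<close>. The
  degrees in an index are again the weights of the structures.\<close>

lemma lrealises_gcomp:
  fixes L :: "('a, 'k::field, 'v::ab_group_add) lspecies"
    and M :: "('a, 's, 'e) shape" and N :: "('a, 'r, 'f) shape"
    and G :: "('a, 'k, 'w::ab_group_add) glspecies" and H :: "('a, 'k, 'u::ab_group_add) glspecies"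
  assumes L: "is_lspecies L" and M: "is_shape M" and N: "is_shape N"
    and G: "lrealises L G M \<tau>" and H: "lrealises L H N \<upsilon>"
  shows "lrealises L (G \<circ>\<^sub>g H) (scomp M N)
    (\<lambda>I (\<pi>, x, y) d. let a = wt (sp M) x; b = (\<lambda>J\<in>\<pi>. wt (sp N) (y J)); V = (\<lambda>J. gstr H J (b J)) in
       single (\<pi>, a, b) (elem2 (gscale G) (scale_fun (*)) (gstr G (blk ` \<pi>) a) (tensor (gscale H) \<pi> V)
          (\<tau> (blk ` \<pi>) x (\<lambda>j\<in>ed M x. d (Inl j)))
          (elem (gscale H) \<pi> V (\<lambda>J\<in>\<pi>. \<upsilon> J (y J) (\<lambda>f\<in>ed N (y J). d (Inr (J, f)))))))"
    (is "lrealises _ _ _ ?\<tau>")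
proof (rule lrealisesI)
  note V = lrealisesD(1)[OF G] and W = lrealisesD(1)[OF H]
  note lsc = lspecies_vector_space[OF L]
  note F = lspecies_functorial[OF L]
  let ?ts = "scale_fun (*) :: 'k \<Rightarrow> ((('a lab set \<Rightarrow> 'u) \<Rightarrow> 'k) \<Rightarrow> 'k) \<Rightarrow> ((('a lab set \<Rightarrow> 'u) \<Rightarrow> 'k) \<Rightarrow> 'k)"
  have TS: "vector_space ?ts"
    by (intro vector_space_scale_fun vector_space_field)
  show "vector_space (gscale (G \<circ>\<^sub>g H))"
    by (simp add: gcomp_def vector_space_scale_fun vector_space_field)
  fix I :: "'a lab set" and n
  assume I: "finite I"
  let ?T = "\<lambda>(\<pi>, a, b). tensor2 (gscale G) ?ts (gstr G (blk ` \<pi>) a) (tensor (gscale H) \<pi> (\<lambda>J. gstr H J (b J)))"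
  let ?K = "\<lambda>(\<pi>, a, b). {s \<in> str (sp M) (blk ` \<pi>). wt (sp M) s = a} \<times>
    PiE \<pi> (\<lambda>J. {s \<in> str (sp N) J. wt (sp N) s = b J})"
  let ?J = "\<lambda>\<pi> (x, y). ed M x <+> (SIGMA J:\<pi>. ed N (y J))"
  let ?U = "\<lambda>(x, y). case_sum (\<lambda>j. lstr L (lb M x j)) (\<lambda>(J, f). lstr L (lb N (y J) f))"
  let ?e = "\<lambda>(\<pi>, a, b) (x, y) d. elem2 (gscale G) ?ts (gstr G (blk ` \<pi>) a) (tensor (gscale H) \<pi> (\<lambda>J. gstr H J (b J)))
    (\<tau> (blk ` \<pi>) x (\<lambda>j\<in>ed M x. d (Inl j)))
    (elem (gscale H) \<pi> (\<lambda>J. gstr H J (b J)) (\<lambda>J\<in>\<pi>. \<upsilon> J (y J) (\<lambda>f\<in>ed N (y J). (\<lambda>j\<in>SIGMA J:\<pi>. ed N (y J). d (Inr j)) (J, f))))"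
  have "model (lscale L) (scale_fun (*)) (?T i) (?K i) (?J (fst i)) ?U (?e i)" if "i \<in> comp_idx I n" for i
  proof -
    obtain \<pi> a b where i: "i = (\<pi>, a, b)"
      by (cases i)
    have \<pi>: "partition_on I \<pi>"
      using that by (simp add: i mem_comp_idx)
    note p = partition_facts[OF \<pi> I]
    have fin: "finite (blk ` \<pi>)"
      using p(1) by simp
    have sub: "module.subspace (lscale L) (case j of (J, f) \<Rightarrow> lstr L (lb N (y J) f))"
      if yj: "y \<in> PiE \<pi> (\<lambda>J. {s \<in> str (sp N) J. wt (sp N) s = b J})" "j \<in> (SIGMA J:\<pi>. ed N (y J))" for y j
    proof -
      obtain J f where j: "j = (J, f)" "J \<in> \<pi>" "f \<in> ed N (y J)"
        using yj(2) by blast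
      have "y J \<in> str (sp N) J"
        using PiE_mem[OF yj(1) j(2)] by simp
      from lspecies_subspace[OF L is_shapeD(2)[OF N p(2)[OF j(2)] this j(3)]] show ?thesis
        by (simp add: j(1))
    qed
    note mt = model_multi_tensor[OF W p(1) lrealisesD(2)[OF H p(2)], of "\<lambda>J. J" b]
    from model_tensor2[OF V TS lrealisesD(2)[OF G fin, of a] mt sub lsc] show ?thesis
      by (simp only: i prod.case fst_conv)
  qed
  from model_dsum[OF vector_space_scale_fun[OF vector_space_field] this]
  have m: "model (lscale L) (scale_fun (scale_fun (*))) (dsum (comp_idx I n) ?T) (SIGMA i:comp_idx I n. ?K i)
      (\<lambda>(i, k). ?J (fst i) k) (\<lambda>(i, k). ?U k) (\<lambda>(i, k) d. single i (?e i k d))" .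
  let ?S = "{s \<in> str (sp (scomp M N)) I. wt (sp (scomp M N)) s = n}"
  \<comment> \<open>The weights of the inner structures are restricted to \<open>\<pi>\<close>,
    because the degree functions in \<open>comp_idx\<close> are extensional.\<close>
  let ?h = "\<lambda>(\<pi>, x, y). ((\<pi>, wt (sp M) x, \<lambda>J\<in>\<pi>. wt (sp N) (y J)), (x, y))"
  have "model (lscale L) (scale_fun (scale_fun (*))) (dsum (comp_idx I n) ?T) ?S (ed (scomp M N))
      (\<lambda>s j. lstr L (lb (scomp M N) s j)) (?\<tau> I)"
  proof (rule model_reindex[OF m, where h = ?h])
    show "bij_betw ?h ?S (SIGMA i:comp_idx I n. ?K i)"
    proof (rule bij_betw_byWitness[where f' = "\<lambda>((\<pi>, a, b), (x, y)). (\<pi>, x, y)"])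
      show "\<forall>s\<in>?S. (\<lambda>((\<pi>, a, b), (x, y)). (\<pi>, x, y)) (?h s) = s"
        by auto
      show "\<forall>k\<in>SIGMA i:comp_idx I n. ?K i. ?h ((\<lambda>((\<pi>, a, b), (x, y)). (\<pi>, x, y)) k) = k"
        by (auto simp: mem_comp_idx PiE_iff extensional_def fun_eq_iff)
      show "?h ` ?S \<subseteq> (SIGMA i:comp_idx I n. ?K i)"
      proof (rule image_subsetI)
        fix s
        assume s: "s \<in> ?S"
        obtain \<pi> x y where s_eq: "s = (\<pi>, x, y)"
          by (cases s)
        have y: "y \<in> PiE \<pi> (str (sp N))"
          using s by (simp add: s_eq mem_str_scomp)
        have "y \<in> PiE \<pi> (\<lambda>J. {z \<in> str (sp N) J. wt (sp N) z = (\<lambda>J\<in>\<pi>. wt (sp N) (y J)) J})"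
          by (rule PiE_I) (use PiE_mem[OF y] PiE_arb[OF y] in simp_all)
        then show "?h s \<in> (SIGMA i:comp_idx I n. ?K i)"
          using s by (simp add: s_eq mem_str_scomp wt_scomp mem_comp_idx)
      qed
      show "(\<lambda>((\<pi>, a, b), (x, y)). (\<pi>, x, y)) ` (SIGMA i:comp_idx I n. ?K i) \<subseteq> ?S"
        by (auto simp: mem_str_scomp wt_scomp mem_comp_idx PiE_iff intro!: sum.cong)
    qed
    show "vector_space (lscale L)"
      by (rule lsc)
    fix s
    assume "s \<in> ?S"
    then have s: "s \<in> str (sp (scomp M N)) I"
      by simp
    obtain \<pi> x y where s_eq: "s = (\<pi>, x, y)"
      by (cases s)
    show "module.subspace (lscale L) (lstr L (lb (scomp M N) s j))" if "j \<in> ed (scomp M N) s" for j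
      using is_shapeD(2)[OF is_shape_scomp[OF M N] I s that] by (rule lspecies_subspace[OF L])
    show "ed (scomp M N) s = (case ?h s of (i, k) \<Rightarrow> ?J (fst i) k)"
      by (simp add: s_eq scomp_fields)
    show "lstr L (lb (scomp M N) s j) = (case ?h s of (i, k) \<Rightarrow> ?U k) j" if "j \<in> ed (scomp M N) s" for j
      using that by (auto simp: s_eq scomp_fields elim!: PlusE)
    fix d :: "'e + 'a lab set \<times> 'f \<Rightarrow> 'v"
    \<comment> \<open>\<open>model_tensor2\<close> and \<open>model_multi_tensor\<close> each
      restrict their families; the inner one of the two nested restrictions is removed.\<close>
    have "(\<lambda>f\<in>ed N (y J). (\<lambda>j\<in>SIGMA J:\<pi>. ed N (y J). d (Inr j)) (J, f)) = (\<lambda>f\<in>ed N (y J). d (Inr (J, f)))"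
      if "J \<in> \<pi>" for J
      using that by (auto simp: fun_eq_iff)
    then have "(\<lambda>J\<in>\<pi>. \<upsilon> J (y J) (\<lambda>f\<in>ed N (y J). (\<lambda>j\<in>SIGMA J:\<pi>. ed N (y J). d (Inr j)) (J, f))) =
        (\<lambda>J\<in>\<pi>. \<upsilon> J (y J) (\<lambda>f\<in>ed N (y J). d (Inr (J, f))))"
      by (intro restrict_ext) (simp only:)
    then show "?\<tau> I s d = (case ?h s of (i, k) \<Rightarrow> \<lambda>d. single i (?e i k d)) d"
      by (simp only: s_eq prod.case Let_def)
  qed
  then show "model (lscale L) (gscale (G \<circ>\<^sub>g H)) (gstr (G \<circ>\<^sub>g H) I n) ?S (ed (scomp M N))
      (\<lambda>s j. lstr L (lb (scomp M N) s j)) (?\<tau> I)"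
    by (simp add: gcomp_def)
  fix \<sigma> :: "'a lab \<Rightarrow> 'a lab"
  assume \<sigma>: "inj_on \<sigma> I"
  show "linear_on (gscale (G \<circ>\<^sub>g H)) (gscale (G \<circ>\<^sub>g H)) (gstr (G \<circ>\<^sub>g H) I n) (gtr (G \<circ>\<^sub>g H) I n \<sigma>)"
    by (auto simp: gcomp_def linear_on_def tensor2_map_def scale_fun_def fun_eq_iff Let_def)
  fix s d
  assume s: "s \<in> str (sp (scomp M N)) I" "wt (sp (scomp M N)) s = n" and d: "d \<in> decs (lsp L) (scomp M N) s"
  obtain \<pi> x y where s_eq: "s = (\<pi>, x, y)"
    by (cases s)
  have \<pi>: "partition_on I \<pi>" and x: "x \<in> str (sp M) (blk ` \<pi>)" and y: "\<And>J. J \<in> \<pi> \<Longrightarrow> y J \<in> str (sp N) J"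
    using s(1) by (auto simp: s_eq mem_str_scomp)
  note p = partition_facts[OF \<pi> I] and q = partition_image[OF \<pi> I \<sigma>]
  note ds = decs_scomp_parts[OF d[unfolded s_eq]]
  note dp = dpush_scomp[OF M N F I s(1)[unfolded s_eq] \<sigma> d[unfolded s_eq]]
  note f = ftr_apply[OF \<pi> I \<sigma>, of _ "sp N" y]
  have fin: "finite (blk ` \<pi>)"
    using p(1) by simp
  let ?\<pi>' = "image \<sigma> ` \<pi>"
  let ?a = "wt (sp M) x" and ?b = "\<lambda>J\<in>\<pi>. wt (sp N) (y J)" and ?b' = "\<lambda>K\<in>?\<pi>'. wt (sp N) (ftr (sp N) I \<sigma> \<pi> y K)"
  let ?V = "\<lambda>J. gstr H J (?b J)" and ?V' = "\<lambda>K. gstr H K (?b' K)"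
  let ?u = "\<tau> (blk ` \<pi>) x (\<lambda>j\<in>ed M x. d (Inl j))"
  let ?w = "\<lambda>J\<in>\<pi>. \<upsilon> J (y J) (\<lambda>f\<in>ed N (y J). d (Inr (J, f)))"
  let ?i = "inv_into I \<sigma>"
  let ?f = "gtr G (blk ` \<pi>) ?a (blk_map \<sigma>)"
  let ?g = "tensor_map (gscale H) ?\<pi>' ?V' (image ?i) (\<lambda>J. gtr H J (?b J) \<sigma>)"
  \<comment> \<open>Transport preserves weights, so the degree function on the image partition is
    the old one moved along \<sigma>, and the index of the image summand pulls back to the given
    index.\<close>
  have wb: "?b' (\<sigma> ` J) = ?b J" if "J \<in> \<pi>" for J
    using that f[OF that] is_shapeD(4)[OF N p(2) y q(3)] by simp
  have inv\<pi>: "image ?i ` ?\<pi>' = \<pi>"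
    using q(4) by (force simp: image_image)
  have invb: "(\<lambda>J\<in>\<pi>. ?b' (\<sigma> ` J)) = ?b"
    using wb by (auto simp: fun_eq_iff)
  have \<rho>: "bij_betw (image ?i) ?\<pi>' \<pi>"
    using inv\<pi> q(4) by (intro bij_betw_byWitness[where f' = "image \<sigma>"]) auto
  have glin: "linear_on (gscale H) (gscale H) (?V J) (gtr H J (?b J) \<sigma>)" if "J \<in> \<pi>" for J
    using lrealisesD(3)[OF H p(2)[OF that] q(3)[OF that]] .
  have ginto: "gtr H (?i ` K) (?b (?i ` K)) \<sigma> ` ?V (?i ` K) \<subseteq> ?V' K" if K: "K \<in> ?\<pi>'" for K
  proof -
    obtain J where J: "J \<in> \<pi>" "K = \<sigma> ` J"
      using K by blast
    show ?thesis
      using lrealises_gtr[OF L N H p(2)[OF J(1)] q(3)[OF J(1)]] wb[OF J(1)] q(4)[OF J(1)] J(2) by auto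
  qed
  have w: "?w \<in> PiE \<pi> ?V"
    unfolding restrict_PiE_iff
    by (intro ballI lrealises_mem[OF H p(2) y _ ds(2)]) simp_all
  have g_elem: "?g (elem (gscale H) \<pi> ?V ?w) = elem (gscale H) ?\<pi>' ?V'
      (\<lambda>K\<in>?\<pi>'. gtr H (?i ` K) (?b (?i ` K)) \<sigma> (?w (?i ` K)))"
    by (rule tensor_map_elem[where sc = "gscale H" and V = ?V and V' = ?V', OF \<rho> glin ginto w])
  also have "(\<lambda>K\<in>?\<pi>'. gtr H (?i ` K) (?b (?i ` K)) \<sigma> (?w (?i ` K))) =
      (\<lambda>K\<in>?\<pi>'. \<upsilon> K (ftr (sp N) I \<sigma> \<pi> y K)
        (\<lambda>f\<in>ed N (ftr (sp N) I \<sigma> \<pi> y K). dpush (lsp L) (scomp M N) I \<sigma> (\<pi>, x, y) d (Inr (K, f))))"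
  proof (rule restrict_ext)
    fix K
    assume "K \<in> ?\<pi>'"
    then obtain J where J: "J \<in> \<pi>" "K = \<sigma> ` J"
      by blast
    have "gtr H J (wt (sp N) (y J)) \<sigma> (\<upsilon> J (y J) (\<lambda>f\<in>ed N (y J). d (Inr (J, f)))) =
        \<upsilon> K (ftr (sp N) I \<sigma> \<pi> y K) (dpush (lsp L) N J \<sigma> (y J) (\<lambda>f\<in>ed N (y J). d (Inr (J, f))))"
      unfolding J(2) f[OF J(1)]
      by (rule lrealisesD(4)[OF H p(2)[OF J(1)] q(3)[OF J(1)] y[OF J(1)] refl ds(2)[OF J(1)]])
    then show "gtr H (?i ` K) (?b (?i ` K)) \<sigma> (?w (?i ` K)) = \<upsilon> K (ftr (sp N) I \<sigma> \<pi> y K)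
        (\<lambda>f\<in>ed N (ftr (sp N) I \<sigma> \<pi> y K). dpush (lsp L) (scomp M N) I \<sigma> (\<pi>, x, y) d (Inr (K, f)))"
      unfolding dp(2)[OF J(1)] unfolding J(2) f[OF J(1)] q(4)[OF J(1)] using J(1) by (simp only: restrict_apply')
  qed
  finally have g_elem': "?g (elem (gscale H) \<pi> ?V ?w) = elem (gscale H) ?\<pi>' ?V' (\<lambda>K\<in>?\<pi>'. \<upsilon> K (ftr (sp N) I \<sigma> \<pi> y K)
        (\<lambda>f\<in>ed N (ftr (sp N) I \<sigma> \<pi> y K). dpush (lsp L) (scomp M N) I \<sigma> (\<pi>, x, y) d (Inr (K, f))))" .
  have f_u: "?f ?u = \<tau> (blk ` ?\<pi>') (tr (sp M) (blk ` \<pi>) (blk_map \<sigma>) x)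
      (\<lambda>j\<in>ed M (tr (sp M) (blk ` \<pi>) (blk_map \<sigma>) x). dpush (lsp L) (scomp M N) I \<sigma> (\<pi>, x, y) d (Inl j))"
    using lrealisesD(4)[OF G fin q(7) x refl ds(1)] unfolding q(6) dp(1) .
  let ?\<Phi> = "\<lambda>(\<pi>', a, b'). (image ?i ` \<pi>', a, \<lambda>J\<in>image ?i ` \<pi>'. b' (\<sigma> ` J))"
  let ?R = "\<lambda>(\<pi>', a, b'). tensor2_map (gscale G) ?ts (gstr G (blk ` \<pi>') a)
      (tensor (gscale H) \<pi>' (\<lambda>K. gstr H K (b' K))) (gtr G (blk ` image ?i ` \<pi>') a (blk_map \<sigma>))
      (tensor_map (gscale H) \<pi>' (\<lambda>K. gstr H K (b' K)) (image ?i)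
        (\<lambda>J. gtr H J ((\<lambda>J\<in>image ?i ` \<pi>'. b' (\<sigma> ` J)) J) \<sigma>))"
  have "gtr (G \<circ>\<^sub>g H) I n \<sigma> (?\<tau> I s d) = single (?\<pi>', ?a, ?b')
      (elem2 (gscale G) ?ts (gstr G (blk ` ?\<pi>') ?a) (tensor (gscale H) ?\<pi>' ?V') (?f ?u)
        (?g (elem (gscale H) \<pi> ?V ?w)))"
  proof (rule transport_single[where T = "comp_idx (\<sigma> ` I) n" and \<Phi> = ?\<Phi> and R = ?R and i = "(\<pi>, ?a, ?b)"])
    have "(\<Sum>K\<in>?\<pi>'. ?b' K) = (\<Sum>J\<in>\<pi>. wt (sp N) (y J))"
      unfolding sum.reindex[OF q(2)] using wb by (intro sum.cong refl) simp
    then show "(?\<pi>', ?a, ?b') \<in> comp_idx (\<sigma> ` I) n"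
      using q(1) s(2) by (simp add: s_eq mem_comp_idx wt_scomp)
    show "?\<Phi> (?\<pi>', ?a, ?b') = (\<pi>, ?a, ?b)"
      using inv\<pi> invb by (simp only: prod.case)
    show "k = (?\<pi>', ?a, ?b')" if k: "k \<in> comp_idx (\<sigma> ` I) n" "?\<Phi> k = (\<pi>, ?a, ?b)" for k
    proof -
      obtain \<pi>' a b' where k_eq: "k = (\<pi>', a, b')"
        by (cases k)
      have eq: "image ?i ` \<pi>' = \<pi>" "a = ?a" "(\<lambda>J\<in>\<pi>. b' (\<sigma> ` J)) = ?b"
        using k(2) by (auto simp: k_eq)
      have "K \<subseteq> \<sigma> ` I" if "K \<in> \<pi>'" for K
        using k(1) that by (auto simp: k_eq mem_comp_idx partition_on_def)
      then have "\<sigma> ` ?i ` K = K" if "K \<in> \<pi>'" for K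
        using that by (simp add: image_inv_into_cancel[OF refl])
      then have \<pi>': "\<pi>' = ?\<pi>'"
        unfolding eq(1)[symmetric] by (simp add: image_image)
      have "b' = ?b'"
      proof (rule extensionalityI[of _ ?\<pi>'])
        show "b' \<in> extensional ?\<pi>'"
          using k(1) \<pi>' by (simp add: k_eq mem_comp_idx PiE_iff)
        fix K
        assume "K \<in> ?\<pi>'"
        then obtain J where J: "J \<in> \<pi>" "K = \<sigma> ` J"
          by blast
        have "b' (\<sigma> ` J) = ?b J"
          using fun_cong[OF eq(3), of J] J(1) by simp
        then show "b' K = ?b' K"
          using wb[OF J(1)] J(2) by simp
      qed simp
      then show ?thesis
        using eq(2) \<pi>' by (simp add: k_eq)
    qed
    show "?R k 0 = 0" for k
      by (cases k) (simp add: tensor2_map_def fun_eq_iff)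
    show "?R (?\<pi>', ?a, ?b') (elem2 (gscale G) ?ts (gstr G (blk ` \<pi>) ?a) (tensor (gscale H) \<pi> ?V) ?u (elem (gscale H) \<pi> ?V ?w)) =
      elem2 (gscale G) ?ts (gstr G (blk ` ?\<pi>') ?a) (tensor (gscale H) ?\<pi>' ?V') (?f ?u) (?g (elem (gscale H) \<pi> ?V ?w))"
      unfolding prod.case inv\<pi> invb
    proof (rule tensor2_map_elem2)
      show "linear_on (gscale G) (gscale G) (gstr G (blk ` \<pi>) ?a) ?f"
        by (rule lrealisesD(3)[OF G fin q(7)])
      show "?f ` gstr G (blk ` \<pi>) ?a \<subseteq> gstr G (blk ` ?\<pi>') ?a"
        using lrealises_gtr[OF L M G fin q(7)] q(6) by auto
      show "linear_on ?ts ?ts (tensor (gscale H) \<pi> ?V) ?g"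
        by (auto simp: linear_on_def tensor_map_def scale_fun_def fun_eq_iff)
      show "?g ` tensor (gscale H) \<pi> ?V \<subseteq> tensor (gscale H) ?\<pi>' ?V'"
        by (rule image_subsetI)
          (rule tensor_map_in_tensor[where sc = "gscale H" and V = ?V and V' = ?V', OF \<rho> glin ginto])
      show "?u \<in> gstr G (blk ` \<pi>) ?a"
        by (rule lrealises_mem[OF G fin x refl ds(1)])
      interpret vector_space ?ts
        by (rule TS)
      show "elem (gscale H) \<pi> ?V ?w \<in> tensor (gscale H) \<pi> ?V"
        unfolding tensor_elem using w by (intro span_base imageI)
    qed
    show "gtr (G \<circ>\<^sub>g H) I n \<sigma> (?\<tau> I s d) k = (if k \<in> comp_idx (\<sigma> ` I) n then
        ?R k (single (\<pi>, ?a, ?b) (elem2 (gscale G) ?ts (gstr G (blk ` \<pi>) ?a) (tensor (gscale H) \<pi> ?V) ?u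
          (elem (gscale H) \<pi> ?V ?w)) (?\<Phi> k)) else 0)" for k
      by (cases k) (simp only: gcomp_def s_eq Let_def glspecies.simps prod.case)
  qed
  also have "\<dots> = ?\<tau> (\<sigma> ` I) (tr (sp (scomp M N)) I \<sigma> s) (dpush (lsp L) (scomp M N) I \<sigma> s d)"
    unfolding s_eq tr_scomp prod.case Let_def is_shapeD(4)[OF M fin x q(7)] f_u g_elem' ..
  finally show "gtr (G \<circ>\<^sub>g H) I n \<sigma> (?\<tau> I s d) =
      ?\<tau> (\<sigma> ` I) (tr (sp (scomp M N)) I \<sigma> s) (dpush (lsp L) (scomp M N) I \<sigma> s d)" .
qed

text \<open>\<open>K'\<close> is the index set tested by \<open>gtr\<close>, which may exceed the
  structures in \<open>K\<close>: hollow hypertrees inherit their transport from all hypertrees with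
  an added point. Hence \<open>inv'\<close> is demanded on \<open>K'\<close>, so that only one of
  its indices lies above a given structure.\<close>

lemma lrealises_hshape:
  fixes L :: "('a, 'k::field, 'v::ab_group_add) lspecies"
    and G :: "('a, 'k, 'a lab set set \<times> 'p \<Rightarrow> (('a lab set \<Rightarrow> 'v) \<Rightarrow> 'k) \<Rightarrow> 'k) glspecies"
  assumes L: "is_lspecies L" and ok: "hshape_ok K Y ex pm"
    and scale: "gscale G = scale_fun (scale_fun (*))"
    and str: "\<And>I n. finite I \<Longrightarrow>
      gstr G I n = dsum {(E, p). (E, p) \<in> K I \<and> int (card E) - 1 = n} (\<lambda>(E, p). tensor (lscale L) E (lstr L))"
    and tr: "\<And>I n \<sigma> f E' p'. finite I \<Longrightarrow> inj_on \<sigma> I \<Longrightarrow> gtr G I n \<sigma> f (E', p') =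
      (if (E', p') \<in> K' (\<sigma> ` I) n
       then let \<tau> = inv_into (Y I) (ex I \<sigma>)
            in tensor_map (lscale L) E' (lstr L) (image \<tau>) (\<lambda>e. ltr L e (ex I \<sigma>)) (f (image \<tau> ` E', pm \<tau> p'))
       else 0)"
    and K': "\<And>I E p. finite I \<Longrightarrow> (E, p) \<in> K I \<Longrightarrow> (E, p) \<in> K' I (int (card E) - 1)"
    and inv: "\<And>I \<sigma> E p. finite I \<Longrightarrow> inj_on \<sigma> I \<Longrightarrow> (E, p) \<in> K I \<Longrightarrow>
      pm (inv_into (Y I) (ex I \<sigma>)) (pm (ex I \<sigma>) p) = p"
    and inv': "\<And>I \<sigma> n E' p'. finite I \<Longrightarrow> inj_on \<sigma> I \<Longrightarrow> (E', p') \<in> K' (\<sigma> ` I) n \<Longrightarrow>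
      image (ex I \<sigma>) ` image (inv_into (Y I) (ex I \<sigma>)) ` E' = E' \<and>
      pm (ex I \<sigma>) (pm (inv_into (Y I) (ex I \<sigma>)) p') = p'"
  shows "lrealises L G (hshape K ex pm) (\<lambda>I (E, p) d. single (E, p) (elem (lscale L) E (lstr L) d))"
proof (rule lrealisesI)
  note F = lspecies_functorial[OF L]
  show "vector_space (gscale G)"
    unfolding scale by (intro vector_space_scale_fun vector_space_field)
  fix I :: "'a lab set" and n
  assume I: "finite I"
  let ?A = "{(E, p). (E, p) \<in> K I \<and> int (card E) - 1 = n}"
  let ?S = "{s \<in> str (sp (hshape K ex pm)) I. wt (sp (hshape K ex pm)) s = n}"
  have S: "?S = ?A"
    by (auto simp: hshape_def)
  have "model (lscale L) (scale_fun (*)) ((\<lambda>(E, p). tensor (lscale L) E (lstr L)) s) {()} (\<lambda>_. fst s)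
      (\<lambda>_. lstr L) (\<lambda>_. elem (lscale L) (fst s) (lstr L))" for s :: "'a lab set set \<times> 'p"
    using model_tensor[of "lscale L" "fst s" "lstr L" "()"] by (simp only: case_prod_unfold)
  from model_dsum[OF vector_space_scale_fun[OF vector_space_field] this]
  have m: "model (lscale L) (scale_fun (scale_fun (*))) (dsum ?A (\<lambda>(E, p). tensor (lscale L) E (lstr L)))
      (SIGMA i:?A. {()}) (\<lambda>(s, k). fst s) (\<lambda>(s, k). lstr L) (\<lambda>(s, k) x. single s (elem (lscale L) (fst s) (lstr L) x))" .
  show "model (lscale L) (gscale G) (gstr G I n) ?S (ed (hshape K ex pm))
      (\<lambda>s j. lstr L (lb (hshape K ex pm) s j)) (\<lambda>(E, p) d. single (E, p) (elem (lscale L) E (lstr L) d))"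
    unfolding scale str[OF I]
  proof (rule model_reindex[OF m, where h = "\<lambda>s. (s, ())"])
    show "bij_betw (\<lambda>s. (s, ())) ?S (SIGMA i:?A. {()})"
      unfolding S by (auto simp: bij_betw_def inj_on_def)
    show "vector_space (lscale L)"
      by (rule lspecies_vector_space[OF L])
    fix s j
    assume "s \<in> ?S" "j \<in> ed (hshape K ex pm) s"
    then show "module.subspace (lscale L) (lstr L (lb (hshape K ex pm) s j))"
      by (intro lspecies_subspace[OF L] is_shapeD(2)[OF is_shape_hshape[OF ok] I]) auto
  qed (auto simp: hshape_def)
  fix \<sigma> :: "'a lab \<Rightarrow> 'a lab"
  assume \<sigma>: "inj_on \<sigma> I"
  let ?x = "ex I \<sigma>" and ?i = "inv_into (Y I) (ex I \<sigma>)"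
  show "linear_on (gscale G) (gscale G) (gstr G I n) (gtr G I n \<sigma>)"
    unfolding scale by (auto simp: linear_on_def fun_eq_iff tr[OF I \<sigma>] scale_fun_def tensor_map_def Let_def)
  fix s and d :: "'a lab set \<Rightarrow> 'v"
  assume "s \<in> str (sp (hshape K ex pm)) I" "wt (sp (hshape K ex pm)) s = n"
    and d: "d \<in> decs (lsp L) (hshape K ex pm) s"
  moreover obtain E p where "s = (E, p)"
    by (cases s)
  ultimately have s: "s = (E, p)" "(E, p) \<in> K I" "int (card E) - 1 = n"
    by (auto simp: hshape_def)
  note ht = hshape_okD(1)[OF ok I s(2)] and inj = hshape_okD(2)[OF ok I \<sigma>]
  note he = hypertree_image_edges[OF ht inj]
  have dP: "d \<in> PiE E (lstr L)"
    using d by (simp add: s decs_hshape)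
  let ?R = "\<lambda>(E', p'). tensor_map (lscale L) E' (lstr L) (image ?i) (\<lambda>e. ltr L e ?x)"
  have "gtr G I n \<sigma> (single (E, p) (elem (lscale L) E (lstr L) d)) = single (image ?x ` E, pm ?x p)
      (elem (lscale L) (image ?x ` E) (lstr L) (\<lambda>e'\<in>image ?x ` E. ltr L (?i ` e') ?x (d (?i ` e'))))"
  proof (rule transport_single[where T = "K' (\<sigma> ` I) n" and \<Phi> = "\<lambda>(E', p'). (image ?i ` E', pm ?i p')"
        and R = ?R and i = "(E, p)"])
    have I': "finite (\<sigma> ` I)"
      using I by simp
    show "(image ?x ` E, pm ?x p) \<in> K' (\<sigma> ` I) n"
      using K'[OF I' hshape_okD(3)[OF ok I \<sigma> s(2)]] he(4) s(3) by simp
    show "(case (image ?x ` E, pm ?x p) of (E', p') \<Rightarrow> (image ?i ` E', pm ?i p')) = (E, p)"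
      using he(3) inv[OF I \<sigma> s(2)] by (force simp: image_image)
    show "k = (image ?x ` E, pm ?x p)"
      if "k \<in> K' (\<sigma> ` I) n" "(case k of (E', p') \<Rightarrow> (image ?i ` E', pm ?i p')) = (E, p)" for k
      using inv'[OF I \<sigma>, of "fst k" "snd k"] that by (cases k) auto
    show "?R k 0 = 0" for k
      by (cases k) (simp add: tensor_map_def fun_eq_iff)
    show "?R (image ?x ` E, pm ?x p) (elem (lscale L) E (lstr L) d) =
        elem (lscale L) (image ?x ` E) (lstr L) (\<lambda>e'\<in>image ?x ` E. ltr L (?i ` e') ?x (d (?i ` e')))"
      unfolding prod.case
    proof (rule tensor_map_elem[where V = "lstr L", OF _ _ _ dP])
      show "bij_betw (image ?i) (image ?x ` E) E"
        using he(3) by (intro bij_betw_byWitness[where f' = "image ?x"]) auto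
      show "linear_on (lscale L) (lscale L) (lstr L e) (ltr L e ?x)" if "e \<in> E" for e
        by (rule lspecies_linear[OF L hypertree_edge(3)[OF ht that] he(2)[OF that]])
      show "ltr L (?i ` e') ?x ` lstr L (?i ` e') \<subseteq> lstr L e'" if "e' \<in> image ?x ` E" for e'
      proof -
        from that obtain e where e: "e \<in> E" "e' = ?x ` e"
          by blast
        show ?thesis
          using functorial_in[OF F hypertree_edge(3)[OF ht e(1)] he(2)[OF e(1)]] he(3)[OF e(1)] e(2) by auto
      qed
    qed
    show "gtr G I n \<sigma> (single (E, p) (elem (lscale L) E (lstr L) d)) k = (if k \<in> K' (\<sigma> ` I) n then
        ?R k (single (E, p) (elem (lscale L) E (lstr L) d) (case k of (E', p') \<Rightarrow> (image ?i ` E', pm ?i p'))) else 0)" for k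
      by (cases k) (simp add: tr[OF I \<sigma>] Let_def)
  qed
  moreover have "dpush (lsp L) (hshape K ex pm) I \<sigma> (E, p) d = (\<lambda>e'\<in>image ?x ` E. ltr L (?i ` e') ?x (d (?i ` e')))"
    unfolding dpush_hshape[OF ok I s(2) \<sigma>] by (simp add: Let_def)
  ultimately show "gtr G I n \<sigma> ((case s of (E, p) \<Rightarrow> \<lambda>d. single (E, p) (elem (lscale L) E (lstr L) d)) d) =
      (case tr (sp (hshape K ex pm)) I \<sigma> s of (E, p) \<Rightarrow> \<lambda>d. single (E, p) (elem (lscale L) E (lstr L) d))
        (dpush (lsp L) (hshape K ex pm) I \<sigma> s d)"
    unfolding s(1) prod.case by (simp add: hshape_def)
qed

lemma lrealises_sHT:
  fixes L :: "('a, 'k::field, 'v::ab_group_add) lspecies"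
  assumes L: "is_lspecies L" and P: "equivariant P pm"
    and inv: "\<And>I \<sigma> E p. inj_on \<sigma> I \<Longrightarrow> hypertree I E \<Longrightarrow> p \<in> P I E \<Longrightarrow> pm (inv_into I \<sigma>) (pm \<sigma> p) = p"
    and inv': "\<And>I \<sigma> E p. hypertree (\<sigma> ` I) E \<Longrightarrow> p \<in> P (\<sigma> ` I) E \<Longrightarrow> pm \<sigma> (pm (inv_into I \<sigma>) p) = p"
  shows "lrealises L (gdecorated P pm L) (sHT P pm) (\<lambda>I (E, p) d. single (E, p) (elem (lscale L) E (lstr L) d))"
  unfolding sHT_def
proof (rule lrealises_hshape[OF L hshape_ok_sHT[OF P], where K' = "deco_idx P"], goal_cases)
  case (6 I \<sigma> n E' p')
  then have ht: "hypertree (\<sigma> ` I) E'" and p: "p' \<in> P (\<sigma> ` I) E'"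
    by (auto simp: deco_idx_def)
  have "\<sigma> ` inv_into I \<sigma> ` e = e" if "e \<in> E'" for e
    using hypertree_edge(1)[OF ht that] by (rule image_inv_into_cancel[OF refl])
  then show ?case
    using inv'[OF ht p] by (simp add: image_image)
qed (auto simp: gdecorated_def deco_idx_def inv)

text \<open>\<open>gHT_h\<close> is cut out of a derivative by a condition on supports; this turns
  it into a direct sum over the hollow hypertrees.\<close>

lemma dsum_restrict:
  assumes "\<And>i. i \<in> A \<Longrightarrow> 0 \<in> V i"
  shows "{f \<in> dsum A V. \<forall>i. f i \<noteq> 0 \<longrightarrow> Q i} = dsum {i \<in> A. Q i} V"
proof (rule set_eqI)
  fix f
  have "f i \<in> V i" if "i \<in> A" "Q i \<Longrightarrow> f i \<in> V i" "\<not> Q i \<Longrightarrow> f i = 0" for i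
    using that assms[of i] by (cases "Q i") auto
  then show "f \<in> {f \<in> dsum A V. \<forall>i. f i \<noteq> 0 \<longrightarrow> Q i} \<longleftrightarrow> f \<in> dsum {i \<in> A. Q i} V"
    unfolding dsum_def by blast
qed

lemma lrealises_sHTh:
  fixes L :: "('a, 'k::field, 'v::ab_group_add) lspecies"
  assumes L: "is_lspecies L"
  shows "lrealises L (gHT_h L) sHTh (\<lambda>I (E, p) d. single (E, p) (elem (lscale L) E (lstr L) d))"
  unfolding sHTh_def
proof (rule lrealises_hshape[OF L hshape_ok_hollow, where K' = "\<lambda>I. deco_idx (\<lambda>I E. {()}) (add_pt I)"], goal_cases)
  case (2 I n)
  have zero: "0 \<in> tensor (lscale L) E (lstr L)" for E
    by (rule model_zero[OF vector_space_scale_fun[OF vector_space_field] model_tensor])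
  show ?case
  proof -
    let ?A = "deco_idx (\<lambda>I E. {()}) (add_pt I) n" and ?T = "\<lambda>(E, p :: unit). tensor (lscale L) E (lstr L)"
    let ?Q = "\<lambda>(E, p :: unit). card {e \<in> E. blk I \<in> e} = 1"
    have "gstr (gHT_h L) I n = {f \<in> dsum ?A ?T. \<forall>s. f s \<noteq> 0 \<longrightarrow> ?Q s}"
      by (simp add: gHT_h_def gHT_def gderiv_def gdecorated_def)
    also have "\<dots> = dsum {s \<in> ?A. ?Q s} ?T"
      using zero by (intro dsum_restrict) auto
    also have "{s \<in> ?A. ?Q s} = {(E, p). (E, p) \<in> hollow I \<and> int (card E) - 1 = n}"
      by (auto simp: deco_idx_def hollow_def)
    finally show ?thesis .
  qed
next
  case (3 I n \<sigma> f E' p')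
  then show ?case
    using ext_map_image[of I \<sigma>] by (simp add: gHT_h_def gHT_def gderiv_def gdecorated_def)
next
  case (6 I \<sigma> n E' p')
  then have ht: "hypertree (add_pt (\<sigma> ` I)) E'"
    by (auto simp: deco_idx_def)
  have "ext_map I \<sigma> ` inv_into (add_pt I) (ext_map I \<sigma>) ` e = e" if "e \<in> E'" for e
    using hypertree_edge(1)[OF ht that] ext_map_image[OF 6(1)] by (simp add: image_inv_into_cancel)
  then show ?case
    by (simp add: image_image)
qed (auto simp: gHT_h_def gHT_def gderiv_def gdecorated_def deco_idx_def hollow_def)

text \<open>The ground field is the tensor product of the empty family, with 1 as its elementary
  tensor.\<close>

lemma model_field:
  fixes lsc :: "'k::field \<Rightarrow> 'u::ab_group_add \<Rightarrow> 'u" and U :: "unit \<Rightarrow> 'j \<Rightarrow> 'u set"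
  shows "model lsc (*) (UNIV :: 'k set) {()} (\<lambda>_. {}) U (\<lambda>_ _. 1)"
  unfolding model_def
proof (intro conjI allI impI)
  have g: "gens {()} (\<lambda>_. {}) U (\<lambda>_ _. 1) = {1 :: 'k}"
    by (simp add: gens_def)
  show "UNIV = module.span (*) (gens {()} (\<lambda>_. {}) U (\<lambda>_ _. 1 :: 'k))"
    unfolding g
  proof -
    interpret vector_space "(*) :: 'k \<Rightarrow> 'k \<Rightarrow> 'k"
      by (rule vector_space_field)
    have "x * 1 \<in> span {1}" for x :: 'k
      by (intro span_scale span_base) simp
    then show "UNIV = span {1 :: 'k}"
      unfolding mult_1_right by blast
  qed
  show "\<exists>f. linear_on (*) (*) UNIV f \<and> (\<forall>k\<in>{()}. \<forall>x\<in>PiE {} (U k). f 1 = c k x)"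
    for c :: "unit \<Rightarrow> ('j \<Rightarrow> 'u) \<Rightarrow> 'k"
    by (intro exI[of _ "\<lambda>x. x * c () (\<lambda>_. undefined)"]) (simp_all add: linear_on_def distrib_right mult.assoc)
qed (simp add: mlin_def)

text \<open>A structure without edges contributes a copy of the field, spanned by its basis vector.
  Transport in \<open>glin\<close> pulls functions back along the inverse bijection, hence the two
  hypotheses on \<open>inv_into\<close>.\<close>

lemma lrealises_glin:
  fixes L :: "('a, 'k::field, 'v::ab_group_add) lspecies" and F :: "('a, 's) wspecies"
  assumes L: "is_lspecies L" and sh: "is_shape (splain F :: ('a, 's, 'e) shape)"
    and inv: "\<And>I \<sigma> s. finite I \<Longrightarrow> inj_on \<sigma> I \<Longrightarrow> s \<in> str F I \<Longrightarrow> tr F (\<sigma> ` I) (inv_into I \<sigma>) (tr F I \<sigma> s) = s"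
    and inv': "\<And>I \<sigma> s. finite I \<Longrightarrow> inj_on \<sigma> I \<Longrightarrow> s \<in> str F (\<sigma> ` I) \<Longrightarrow> tr F I \<sigma> (tr F (\<sigma> ` I) (inv_into I \<sigma>) s) = s"
  shows "lrealises L (glin F :: ('a, 'k, _) glspecies) (splain F :: ('a, 's, 'e) shape) (\<lambda>I s d. single s 1)"
proof (rule lrealisesI)
  have sp: "sp (splain F :: ('a, 's, 'e) shape) = F" and ed: "ed (splain F :: ('a, 's, 'e) shape) = (\<lambda>_. {})"
    by (simp_all add: splain_def)
  show "vector_space (gscale (glin F :: ('a, 'k, _) glspecies))"
    by (simp add: glin_def vector_space_scale_fun vector_space_field)
  fix I :: "'a lab set" and n
  assume I: "finite I"
  let ?A = "{s \<in> str F I. wt F s = n}"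
  have m: "model (lscale L) (scale_fun (*)) (dsum ?A (\<lambda>_. UNIV :: 'k set)) (SIGMA s:?A. {()}) (\<lambda>(s, k). {})
      (\<lambda>(s, k). undefined) (\<lambda>(s, k) x. single s 1)"
    using model_dsum[OF vector_space_field model_field] .
  show "model (lscale L) (gscale (glin F :: ('a, 'k, _) glspecies)) (gstr (glin F) I n)
      {s \<in> str (sp (splain F :: ('a, 's, 'e) shape)) I. wt (sp (splain F :: ('a, 's, 'e) shape)) s = n} (ed (splain F :: ('a, 's, 'e) shape))
      (\<lambda>s j. lstr L (lb (splain F :: ('a, 's, 'e) shape) s j)) (\<lambda>s d. single s 1)"
    unfolding sp ed
    by (simp add: glin_def, rule model_reindex[OF m, where h = "\<lambda>s. (s, ())"])
      (auto simp: bij_betw_def inj_on_def lspecies_vector_space[OF L])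
  fix \<sigma> :: "'a lab \<Rightarrow> 'a lab"
  assume \<sigma>: "inj_on \<sigma> I"
  show "linear_on (gscale (glin F :: ('a, 'k, _) glspecies)) (gscale (glin F :: ('a, 'k, _) glspecies)) (gstr (glin F) I n) (gtr (glin F) I n \<sigma>)"
    by (auto simp: glin_def linear_on_def fun_eq_iff scale_fun_def)
  fix s and d :: "'e \<Rightarrow> 'v"
  assume s: "s \<in> str (sp (splain F :: ('a, 's, 'e) shape)) I" "wt (sp (splain F :: ('a, 's, 'e) shape)) s = n"
  have t: "tr F I \<sigma> s \<in> str F (\<sigma> ` I)" "wt F (tr F I \<sigma> s) = n"
    using is_shapeD(3,4)[OF sh I s(1) \<sigma>] s by (simp_all add: sp)
  have "gtr (glin F) I n \<sigma> (single s (1 :: 'k)) s' = single (tr F I \<sigma> s) 1 s'" for s'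
  proof (cases "s' = tr F I \<sigma> s")
    case True
    then show ?thesis
      using inv[OF I \<sigma>, of s] s(1) t by (simp add: sp glin_def single_def)
  next
    case False
    then have "tr F (\<sigma> ` I) (inv_into I \<sigma>) s' \<noteq> s" if "s' \<in> str F (\<sigma> ` I)"
      using inv'[OF I \<sigma> that] by auto
    then show ?thesis
      using False by (simp add: glin_def single_def)
  qed
  then show "gtr (glin F) I n \<sigma> (single s (1 :: 'k)) = single (tr (sp (splain F :: ('a, 's, 'e) shape)) I \<sigma> s) 1"
    unfolding sp by (rule ext)
qed

lemma lrealises_gX:
  assumes "is_lspecies L"
  shows "lrealises L gX (splain wX) (\<lambda>I s d. single s 1)"
  unfolding gX_def
  by (rule lrealises_glin[OF assms is_shape_splain_wX])
    (auto simp: wX_def inv_into_image_cancel image_inv_into_cancel split: if_splits)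

lemma lrealises_gComm:
  assumes "is_lspecies L"
  shows "lrealises L gComm (splain wComm) (\<lambda>I s d. single s 1)"
  unfolding gComm_def
  by (rule lrealises_glin[OF assms is_shape_splain_wComm])
    (auto simp: wComm_def inv_into_image_cancel image_inv_into_cancel split: if_splits)

lemma lrealises_gOne:
  assumes "is_lspecies L"
  shows "lrealises L gOne (splain wOne) (\<lambda>I s d. single s 1)"
  unfolding gOne_def by (rule lrealises_glin[OF assms is_shape_splain_wOne]) (auto simp: wOne_def)

section \<open>Vanishing on sets with at most one element\<close>

lemma card_lt_2_cases:
  assumes "finite I" "card I < 2"
  obtains "I = {}" | x where "I = {x}"
proof (cases "card I = 0")
  case True
  with assms that show ?thesis
    by simp
next
  case False
  with assms(2) have "card I = 1"
    by linarith
  with that show ?thesis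
    by (auto simp: card_1_singleton_iff)
qed

text \<open>The hypotheses on \<open>S\<close> name a single singleton \<open>{one}\<close>;
  functoriality carries them to all others.\<close>

lemma functorial_small:
  assumes "functorial F" "finite I" "card I < 2"
  shows "\<exists>f. bij_betw f (str F {}) (str F I) \<or> bij_betw f (str F {one}) (str F I)"
  using assms(2,3)
proof (cases rule: card_lt_2_cases)
  case 1
  then show ?thesis
    using bij_betw_id by auto
next
  case (2 x)
  then have "bij_betw (\<lambda>_. x) {one} I"
    by (simp add: bij_betw_def)
  with functorial_bij[OF assms(1), of "{one}"] show ?thesis
    by auto
qed

lemma species_small:
  assumes "is_species S" "card (str S {}) = 0" "card (str S {one}) = 0" "finite I" "card I < 2"
  shows "str S I = {}"
proof -
  \<comment> \<open>Finiteness excludes that a cardinality is 0 merely by the convention for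
    infinite sets.\<close>
  have "finite (str S {})" "finite (str S {one})"
    using assms(1)[unfolded is_species_def, THEN spec, THEN mp] by blast+
  then have "str S {} = {}" "str S {one} = {}"
    using assms(2,3) by simp_all
  then show ?thesis
    using functorial_small[OF is_species_functorial[OF assms(1)] assms(4,5), of one] by (auto simp: bij_betw_def)
qed

lemma lspecies_small:
  assumes "is_lspecies L" "lstr L {} = {0}" "lstr L {one} = {0}" "finite I" "card I < 2"
  shows "lstr L I = {0}"
proof -
  interpret vector_space "lscale L"
    by (rule lspecies_vector_space[OF assms(1)])
  have "0 \<in> lstr L I"
    using lspecies_subspace[OF assms(1,4)] by (rule subspace_0)
  moreover have "\<exists>w. {w} = lstr L I"
    using functorial_small[OF lspecies_functorial[OF assms(1)] assms(4,5), of one] assms(2,3)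
    by (auto simp: bij_betw_def)
  ultimately show ?thesis
    by (metis singletonD)
qed

text \<open>In degree 0 and on at least two elements, the space is a tensor product with one factor.
  In all other cases there is no structure of \<open>sset\<close>, and the space is zero.\<close>

lemma lrealises_sset:
  fixes L :: "('a, 'k::field, 'v::ab_group_add) lspecies"
  assumes L: "is_lspecies L" and small: "\<And>I. finite I \<Longrightarrow> card I < 2 \<Longrightarrow> lstr L I = {0}"
  shows "lrealises L (gweightless L) sset (\<lambda>I s d. d ())"
proof (rule lrealisesI)
  interpret vector_space "lscale L"
    by (rule lspecies_vector_space[OF L])
  show "vector_space (gscale (gweightless L))"
    by (simp add: gweightless_def vector_space_axioms)
  fix I :: "'a lab set" and n
  assume I: "finite I"
  let ?S = "{s \<in> str (sp sset) I. wt (sp sset) s = n}"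
  show "model (lscale L) (gscale (gweightless L)) (gstr (gweightless L) I n) ?S (ed sset)
      (\<lambda>s j. lstr L (lb sset s j)) (\<lambda>s d. d ())"
  proof (cases "n = 0 \<and> card I \<ge> 2")
    case True
    then have S: "?S = {I}"
      by (auto simp: sset_def)
    have "(\<lambda>d. d ()) ` PiE {()} (\<lambda>_. lstr L I) = lstr L I"
      by (auto simp: image_iff intro!: bexI[of _ "\<lambda>_\<in>{()}. _"])
    then have g: "gens {I} (\<lambda>_. {()}) (\<lambda>s j. lstr L s) (\<lambda>s d. d ()) = lstr L I"
      by (simp add: gens_def)
    have "model (lscale L) (lscale L) (lstr L I) {I} (\<lambda>_. {()}) (\<lambda>s j. lstr L s) (\<lambda>s d. d ())"
      unfolding model_def g
    proof (intro conjI allI impI)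
      show "lstr L I = span (lstr L I)"
        by (rule span_eq_iff[THEN iffD2, OF lspecies_subspace[OF L I], symmetric])
      show "\<forall>k\<in>{I}. mlin (lscale L) (lscale L) {()} (\<lambda>j. lstr L k) (\<lambda>d. d ())"
        by (simp add: mlin_def linear_on_def)
      fix c
      assume "\<forall>k\<in>{I}. c k \<in> mforms (lscale L) {()} (\<lambda>j. lstr L k)"
      then have "\<forall>x\<in>PiE {()} (\<lambda>j. lstr L I). linear_on (lscale L) (*) (lstr L I) (\<lambda>u. c I (x(() := u)))"
        by (simp add: mforms_def)
      \<comment> \<open>A form in one argument is a functional; to read it off, some family over the
        one position is needed, whose only entry is then overwritten.\<close>
      moreover have "(\<lambda>_\<in>{()}. 0) \<in> PiE {()} (\<lambda>j. lstr L I)"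
        using subspace_0[OF lspecies_subspace[OF L I]] by simp
      ultimately have "linear_on (lscale L) (*) (lstr L I) (\<lambda>u. c I ((\<lambda>_\<in>{()}. 0)(() := u)))"
        by blast
      moreover have "(\<lambda>_\<in>{()}. 0)(() := x ()) = x" for x :: "unit \<Rightarrow> 'v"
        by (auto simp: fun_eq_iff)
      ultimately show "\<exists>f. linear_on (lscale L) (*) (lstr L I) f \<and>
          (\<forall>k\<in>{I}. \<forall>x\<in>PiE {()} (\<lambda>j. lstr L k). f (x ()) = c k x)"
        by (intro exI[of _ "\<lambda>u. c I ((\<lambda>_\<in>{()}. 0)(() := u))"]) simp
    qed
    then show ?thesis
      unfolding S using True by (simp add: gweightless_def sset_def)
  next
    case False
    then have S: "?S = {}" and V: "gstr (gweightless L) I n = {0}"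
      using small[OF I] by (auto simp: sset_def gweightless_def)
    show ?thesis
      unfolding S V by (auto simp: model_def gens_def gweightless_def linear_on_def intro!: exI[of _ "\<lambda>_. 0"])
  qed
  fix \<sigma> :: "'a lab \<Rightarrow> 'a lab"
  assume \<sigma>: "inj_on \<sigma> I"
  show "linear_on (gscale (gweightless L)) (gscale (gweightless L)) (gstr (gweightless L) I n) (gtr (gweightless L) I n \<sigma>)"
    using lspecies_linear[OF L I \<sigma>] by (simp add: gweightless_def linear_on_def)
  fix s and d :: "unit \<Rightarrow> 'v"
  assume s: "s \<in> str (sp sset) I" "wt (sp sset) s = n" and "d \<in> decs (lsp L) sset s"
  have "dpush (lsp L) sset I \<sigma> s d () = ltr L I \<sigma> (d ())"
    using dpush_apply[OF is_shape_sset I s(1) \<sigma>, of "()" "lsp L" d] s(1) by (auto simp: sset_def split: if_splits)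
  then show "gtr (gweightless L) I n \<sigma> (d ()) = dpush (lsp L) sset I \<sigma> s d ()"
    using s(2) by (simp add: gweightless_def sset_def)
qed

section \<open>Cutting and gluing hypertrees\<close>

lemma hypertreeI:
  assumes "hypergraph V E" "v \<in> V" "\<And>u. u \<in> V \<Longrightarrow> conn E u v"
    and "\<And>f u w. f \<in> E \<Longrightarrow> u \<in> f \<Longrightarrow> w \<in> f \<Longrightarrow> conn (E - {f}) u w \<Longrightarrow> u = w"
  shows "hypertree V E"
proof -
  have "conn E u w" if "u \<in> V" "w \<in> V" for u w
    using assms(3)[OF that(1)] conn_sym[OF assms(3)[OF that(2)]] by (rule rtrancl_trans)
  moreover have "bridges E"
    unfolding bridges_def using assms(4) by blast
  ultimately show ?thesis
    unfolding hypertree_iff using assms(1,2) by blast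
qed

lemma hypertree_bridge:
  assumes "hypertree V E" "f \<in> E" "u \<in> f" "w \<in> f" "conn (E - {f}) u w"
  shows "u = w"
  using assms unfolding hypertree_iff bridges_def by blast

text \<open>An edge has a vertex other than \<open>v\<close>, and such a vertex lies in one piece
  only.\<close>

lemma glue_vertex_unique:
  assumes "hypertree (W i) (E i)" "e \<in> E i" "e \<subseteq> W j" "i \<noteq> j \<Longrightarrow> W i \<inter> W j \<subseteq> {v}"
  shows "i = j"
  using hypertree_edge(1)[OF assms(1,2)] hypertree_edge(4)[OF assms(1,2), of v] assms(3,4) by blast

lemma glue_vertex:
  assumes "finite A" and ht: "\<And>i. i \<in> A \<Longrightarrow> hypertree (W i) (E i)" and v: "\<And>i. i \<in> A \<Longrightarrow> v \<in> W i"
    and dis: "\<And>i j. i \<in> A \<Longrightarrow> j \<in> A \<Longrightarrow> i \<noteq> j \<Longrightarrow> W i \<inter> W j \<subseteq> {v}"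
  shows "hypertree (insert v (\<Union>i\<in>A. W i)) (\<Union>i\<in>A. E i)" (is "hypertree ?V ?E")
proof (rule hypertreeI[where v = v])
  show "hypergraph ?V ?E"
    unfolding hypergraph_def
  proof (intro conjI ballI)
    show "finite ?V"
      using assms(1) hypertree_finite(1)[OF ht] by simp
    show "e \<subseteq> ?V" "card e \<ge> 2" if "e \<in> ?E" for e
      using that hypertree_edge(1,2)[OF ht] by blast+
  qed
  show "conn ?E u v" if u: "u \<in> ?V" for u
  proof (cases "u = v")
    case False
    then obtain i where i: "i \<in> A" "u \<in> W i"
      using u by blast
    show ?thesis
      by (rule conn_mono[OF hypertree_conn[OF ht[OF i(1)] i(2) v[OF i(1)]]]) (use i in blast)
  qed simp
  fix f u w
  assume "f \<in> ?E" and uw: "u \<in> f" "w \<in> f" and c: "conn (?E - {f}) u w"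
  then obtain i where i: "i \<in> A" "f \<in> E i"
    by blast
  \<comment> \<open>The piece of \<open>f\<close> is kept and everything else is collapsed to
    \<open>v\<close>; a bypass of \<open>f\<close> in the union would thus give one inside the
    piece.\<close>
  let ?p = "\<lambda>x. if x \<in> W i then x else v"
  have "conn (E i - {f}) (?p u) (?p w)"
    using c
  proof (rule conn_retract)
    fix e x y
    assume "e \<in> ?E - {f}" and xy: "x \<in> e" "y \<in> e"
    then obtain j where j: "j \<in> A" "e \<in> E j" "e \<noteq> f"
      by blast
    have e: "e \<subseteq> W j"
      by (rule hypertree_edge(1)[OF ht[OF j(1)] j(2)])
    show "conn (E i - {f}) (?p x) (?p y)"
    proof (cases "j = i")
      case True
      then have "x \<in> W i" "y \<in> W i" "e \<in> E i - {f}"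
        using e xy j by auto
      then show ?thesis
        using xy by (simp add: conn_edge)
    next
      case False
      then have "?p x = v" "?p y = v"
        using dis[OF j(1) i(1)] e xy by auto
      then show ?thesis
        by simp
    qed
  qed
  moreover have "u \<in> W i" "w \<in> W i"
    using hypertree_edge(1)[OF ht[OF i(1)] i(2)] uw by auto
  ultimately show "u = w"
    using hypertree_bridge[OF ht[OF i(1)] i(2) uw] by simp
qed simp

text \<open>The vertex \<open>v\<close> is taken out of the edges, but the edges at \<open>v\<close>
  are kept: the other vertices of such an edge stay together. For \<open>x\<close> other than
  \<open>v\<close>, this is the vertex set, without \<open>v\<close>, of the piece of
  \<open>x\<close> when a hypertree is cut at \<open>v\<close>.\<close>

definition vclass :: "'v set set \<Rightarrow> 'v \<Rightarrow> 'v \<Rightarrow> 'v set" where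
  "vclass E v x = {w. conn ((\<lambda>f. f - {v}) ` E) x w}"

text \<open>Connections in the piece that pass through \<open>v\<close> can be rerouted: only the
  edge \<open>f0\<close> contains \<open>v\<close>, so \<open>v\<close> may be replaced by another
  vertex \<open>u0\<close> of \<open>f0\<close>. With several edges at \<open>v\<close> the piece
  would fall apart.\<close>

lemma vclass_eq:
  assumes ht: "hypertree (insert v J) F" and v: "v \<notin> J" and one: "card {f \<in> F. v \<in> f} = 1"
    and F: "F \<subseteq> E" and x: "x \<in> J" and other: "\<And>f. f \<in> E \<Longrightarrow> f \<notin> F \<Longrightarrow> f \<inter> J = {}"
  shows "vclass E v x = J"
proof
  have cl: "f - {v} \<subseteq> J" if "f \<in> E" "(f - {v}) \<inter> J \<noteq> {}" for f
    using hypertree_edge(1)[OF ht, of f] other[OF that(1)] that(2) by blast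
  show "vclass E v x \<subseteq> J"
    unfolding vclass_def using conn_closed[of x _ "(\<lambda>f. f - {v}) ` E" J] x cl by blast
  obtain f0 where f0: "{f \<in> F. v \<in> f} = {f0}"
    using one by (auto simp: card_1_singleton_iff)
  then have f0F: "f0 \<in> F"
    by blast
  obtain u0 where u0: "u0 \<in> f0" "u0 \<noteq> v"
    using hypertree_edge(4)[OF ht f0F] by blast
  let ?p = "\<lambda>x. if x = v then u0 else x"
  show "J \<subseteq> vclass E v x"
  proof
    fix w
    assume w: "w \<in> J"
    have "conn F x w"
      by (rule hypertree_conn[OF ht]) (use x w in blast)+
    then have "conn ((\<lambda>f. f - {v}) ` F) (?p x) (?p w)"
    proof (rule conn_retract)
      fix e a b
      assume e: "e \<in> F" "a \<in> e" "b \<in> e"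
      show "conn ((\<lambda>f. f - {v}) ` F) (?p a) (?p b)"
      proof (cases "v \<in> e")
        case True
        then have "e = f0"
          using e(1) f0 by blast
        then show ?thesis
          using e u0 by (intro conn_edge[of "e - {v}"]) auto
      next
        case False
        then show ?thesis
          using e by (intro conn_edge[of "e - {v}"]) auto
      qed
    qed
    moreover have "x \<noteq> v" "w \<noteq> v"
      using v x w by auto
    ultimately have "conn ((\<lambda>f. f - {v}) ` F) x w"
      by simp
    then have "conn ((\<lambda>f. f - {v}) ` E) x w"
      by (rule conn_mono) (use F in blast)
    then show "w \<in> vclass E v x"
      by (simp add: vclass_def)
  qed
qed

lemma class_partition:
  assumes "\<And>e. e \<in> E \<Longrightarrow> e \<subseteq> I"
  shows "partition_on I ((\<lambda>x. {w. conn E x w}) ` I)"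
proof (rule partition_onI)
  have sub: "w \<in> I" if "conn E x w" "x \<in> I" for x w
    using that(1) by (rule conn_closed) (use that(2) assms in auto)
  then show "\<Union> ((\<lambda>x. {w. conn E x w}) ` I) = I"
    by auto
  show "{} \<notin> (\<lambda>x. {w. conn E x w}) ` I"
    by auto
  fix p q
  assume "p \<in> (\<lambda>x. {w. conn E x w}) ` I" "q \<in> (\<lambda>x. {w. conn E x w}) ` I" "p \<noteq> q"
  then obtain x y where p: "p = {w. conn E x w}" and q: "q = {w. conn E y w}"
    by blast
  show "disjnt p q"
  proof (rule ccontr)
    assume "\<not> disjnt p q"
    then obtain z where z: "conn E x z" "conn E y z"
      by (auto simp: p q disjnt_iff)
    then have "conn E x y" "conn E y x"
      using conn_sym rtrancl_trans by metis+
    then have "p = q"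
      unfolding p q by (auto intro: rtrancl_trans)
    with \<open>p \<noteq> q\<close> show False ..
  qed
qed

lemma partition_eqI: "partition_on I \<pi> \<Longrightarrow> J \<in> \<pi> \<Longrightarrow> K \<in> \<pi> \<Longrightarrow> x \<in> J \<Longrightarrow> x \<in> K \<Longrightarrow> J = K"
  by (auto simp: partition_on_def disjoint_def)

context
  fixes V E v
  assumes ht: "hypertree V E" and v: "v \<in> V"
begin

lemma vclass_partition: "partition_on (V - {v}) (vclass E v ` (V - {v}))"
proof -
  have "vclass E v = (\<lambda>x. {w. conn ((\<lambda>f. f - {v}) ` E) x w})"
    by (simp add: vclass_def fun_eq_iff)
  then show ?thesis
    using class_partition[of "(\<lambda>f. f - {v}) ` E" "V - {v}"] hypertree_edge(1)[OF ht] by fastforce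
qed

lemma vclass_edge:
  assumes "J \<in> vclass E v ` (V - {v})" "f \<in> E" "x \<in> f" "x \<in> J"
  shows "f \<subseteq> insert v J"
proof
  fix y
  assume y: "y \<in> f"
  obtain z where J: "J = {w. conn ((\<lambda>f. f - {v}) ` E) z w}"
    using assms(1) by (auto simp: vclass_def)
  have "x \<noteq> v"
    using vclass_partition assms(1,4) by (auto simp: partition_on_def)
  show "y \<in> insert v J"
  proof (cases "y = v")
    case False
    then have "conn ((\<lambda>f. f - {v}) ` E) x y"
      using assms(2,3) y \<open>x \<noteq> v\<close> by (intro conn_edge[of "f - {v}"]) auto
    then show ?thesis
      using assms(4) by (auto simp: J intro: rtrancl_trans)
  qed simp
qed

lemma vclass_edge_ex:
  assumes "f \<in> E"
  shows "\<exists>J\<in>vclass E v ` (V - {v}). f \<subseteq> insert v J"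
proof -
  obtain x where x: "x \<in> f" "x \<noteq> v"
    using hypertree_edge(4)[OF ht assms] by blast
  then have xV: "x \<in> V - {v}"
    using hypertree_edge(1)[OF ht assms] by blast
  moreover have "x \<in> vclass E v x"
    by (simp add: vclass_def)
  ultimately show ?thesis
    using vclass_edge[of "vclass E v x" f x] assms x(1) by blast
qed

text \<open>Collapsing everything outside \<open>J\<close> to \<open>v\<close> shows that the piece
  is connected. If two edges \<open>f\<close> and \<open>g\<close> of the piece contained
  \<open>v\<close>, then \<open>g\<close> followed by a connection inside the class would lead from
  \<open>v\<close> to another vertex of \<open>f\<close> without using \<open>f\<close>.\<close>

lemma vclass_hypertree:
  assumes J: "J \<in> vclass E v ` (V - {v})"
  shows "hypertree (insert v J) {f \<in> E. f \<subseteq> insert v J}" (is "hypertree _ ?F")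
    and "card {f \<in> {f \<in> E. f \<subseteq> insert v J}. v \<in> f} = 1"
proof -
  have JV: "J \<subseteq> V - {v}" and "J \<noteq> {}"
    using vclass_partition J by (auto simp: partition_on_def)
  let ?p = "\<lambda>x. if x \<in> J then x else v"
  have conn: "conn ?F (?p x) (?p y)" if "conn E x y" for x y
    using that
  proof (rule conn_retract)
    fix e a b
    assume e: "e \<in> E" "a \<in> e" "b \<in> e"
    show "conn ?F (?p a) (?p b)"
    proof (cases "e \<subseteq> insert v J")
      case True
      then show ?thesis
        using e by (intro conn_edge[of e]) auto
    next
      case False
      then have "a \<notin> J" "b \<notin> J"
        using vclass_edge[OF J e(1)] e(2,3) by auto
      then show ?thesis
        by simp
    qed
  qed
  have vJ: "v \<notin> J"
    using JV by blast
  have cJ: "conn ?F u v" if "u \<in> J" for u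
    using conn[OF hypertree_conn[OF ht _ v, of u]] that JV vJ by auto
  show tree: "hypertree (insert v J) ?F"
  proof (rule hypertreeI[where v = v])
    show "hypergraph (insert v J) ?F"
      using hypertree_edge(2)[OF ht] finite_subset[OF JV] hypertree_finite(1)[OF ht] by (auto simp: hypergraph_def)
    show "conn ?F u v" if "u \<in> insert v J" for u
      using that cJ by auto
    fix f u w
    assume f: "f \<in> ?F" "u \<in> f" "w \<in> f" and c: "conn (?F - {f}) u w"
    have "conn (E - {f}) u w"
      using c by (rule conn_mono) blast
    then show "u = w"
      using hypertree_bridge[OF ht _ f(2,3)] f(1) by blast
  qed simp
  obtain x where x: "x \<in> J"
    using \<open>J \<noteq> {}\<close> by blast
  have "\<exists>f\<in>?F. v \<in> f"
    using conn_sym[OF cJ[OF x]] x vJ by (cases rule: converse_rtranclE) (auto simp: adj_def)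
  moreover have "f = g" if f: "f \<in> ?F" "v \<in> f" and g: "g \<in> ?F" "v \<in> g" for f g
  proof (rule ccontr)
    assume "f \<noteq> g"
    obtain u w where u: "u \<in> f" "u \<noteq> v" and w: "w \<in> g" "w \<noteq> v"
      using hypertree_edge(4)[OF tree f(1)] hypertree_edge(4)[OF tree g(1)] by blast
    let ?E = "(\<lambda>f. f - {v}) ` E"
    obtain z where z: "J = {w. conn ?E z w}"
      using J by (auto simp: vclass_def)
    have "u \<in> J" "w \<in> J"
      using f(1) g(1) u w by auto
    then have "conn ?E w u"
      unfolding z using conn_sym rtrancl_trans by (metis mem_Collect_eq)
    from conn_first_hit[OF this, of "f - {v}"] u obtain u' where u': "u' \<in> f - {v}" "conn (?E - {f - {v}}) w u'"
      by blast
    \<comment> \<open>A shortened edge different from \<open>f - {v}\<close> comes from an edge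
      different from \<open>f\<close>.\<close>
    have "conn (E - {f}) w u'"
      by (rule conn_retract[OF u'(2), where p = "\<lambda>x. x"]) (auto intro: conn_edge)
    moreover have "conn (E - {f}) v w"
      using g w \<open>f \<noteq> g\<close> by (intro conn_edge[of g]) auto
    ultimately have "conn (E - {f}) v u'"
      by (meson rtrancl_trans)
    then have "v = u'"
      using hypertree_bridge[OF ht] f u'(1) by blast
    then show False
      using u'(1) by blast
  qed
  ultimately have "\<exists>f. {f \<in> ?F. v \<in> f} = {f}"
    by blast
  then show "card {f \<in> ?F. v \<in> f} = 1"
    by (simp only: card_1_singleton_iff One_nat_def)
qed

end

section \<open>Gluing along an edge and removing an edge\<close>

lemma glue_edge:
  assumes \<pi>: "partition_on I \<pi>" and fin: "finite I" "finite Z" and Z: "Z \<inter> I = {}"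
    and ht: "\<And>J. J \<in> \<pi> \<Longrightarrow> hypertree J (F J)" and r: "\<And>J. J \<in> \<pi> \<Longrightarrow> r J \<in> J"
    and e: "e = r ` \<pi> \<union> Z" "card e \<ge> 2"
  shows "hypertree (I \<union> Z) (insert e (\<Union>J\<in>\<pi>. F J))" (is "hypertree ?V ?E")
    and "e \<notin> (\<Union>J\<in>\<pi>. F J)"
    and "J \<in> \<pi> \<Longrightarrow> e \<inter> J = {r J}"
    and "J \<in> \<pi> \<Longrightarrow> x \<in> J \<Longrightarrow> {w. conn (\<Union>J\<in>\<pi>. F J) x w} = J"
    and "J \<in> \<pi> \<Longrightarrow> {f \<in> \<Union>J\<in>\<pi>. F J. f \<subseteq> J} = F J"
\<comment> \<open>\<open>Z\<close> holds the vertices of the new edge that belong to no piece: it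
  will be empty for edge-pointed hypertrees and consist of the gap for hollow ones.\<close>
proof -
  have JI: "J \<subseteq> I" if "J \<in> \<pi>" for J
    using \<pi> that by (auto simp: partition_on_def)
  have eq: "J = K" if "J \<in> \<pi>" "K \<in> \<pi>" "x \<in> J" "x \<in> K" for J K x
    using partition_eqI[OF \<pi> that] .
  show eJ: "e \<inter> J = {r J}" if "J \<in> \<pi>" for J
  proof
    show "e \<inter> J \<subseteq> {r J}"
    proof
      fix x
      assume x: "x \<in> e \<inter> J"
      then have "x \<notin> Z"
        using Z JI[OF that] by blast
      then obtain K where "K \<in> \<pi>" "x = r K"
        using x e(1) by blast
      then show "x \<in> {r J}"
        using eq[OF _ that r, of K] x by auto
    qed
    show "{r J} \<subseteq> e \<inter> J"
      using that r e(1) by blast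
  qed
  have FJ: "f \<subseteq> J" if "J \<in> \<pi>" "f \<in> F J" for J f
    by (rule hypertree_edge(1)[OF ht[OF that(1)] that(2)])
  show eF: "e \<notin> (\<Union>J\<in>\<pi>. F J)"
  proof
    assume "e \<in> (\<Union>J\<in>\<pi>. F J)"
    then obtain J where J: "J \<in> \<pi>" "e \<in> F J"
      by blast
    then have "e = {r J}"
      using eJ FJ by blast
    then show False
      using e(2) by simp
  qed
  have cl: "f \<subseteq> J" if "J \<in> \<pi>" "f \<in> (\<Union>J\<in>\<pi>. F J)" "f \<inter> J \<noteq> {}" for J f
    using eq[OF that(1)] FJ that(2,3) by blast
  show "{w. conn (\<Union>J\<in>\<pi>. F J) x w} = J" if "J \<in> \<pi>" "x \<in> J" for J x
  proof (intro equalityI subsetI)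
    show "w \<in> J" if "w \<in> {w. conn (\<Union>J\<in>\<pi>. F J) x w}" for w
      using conn_closed[of x w "\<Union>J\<in>\<pi>. F J" J] that \<open>x \<in> J\<close> cl[OF \<open>J \<in> \<pi>\<close>] by blast
    fix w
    assume "w \<in> J"
    then have "conn (F J) x w"
      using hypertree_conn[OF ht] that by blast
    then have "conn (\<Union>J\<in>\<pi>. F J) x w"
      by (rule conn_mono) (use that in blast)
    then show "w \<in> {w. conn (\<Union>J\<in>\<pi>. F J) x w}"
      by simp
  qed
  show "{f \<in> \<Union>J\<in>\<pi>. F J. f \<subseteq> J} = F J" if J: "J \<in> \<pi>" for J
  proof (intro equalityI subsetI)
    fix f
    assume "f \<in> {f \<in> \<Union>J\<in>\<pi>. F J. f \<subseteq> J}"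
    then obtain K where K: "K \<in> \<pi>" "f \<in> F K" "f \<subseteq> J"
      by blast
    obtain x where "x \<in> f"
      using hypertree_edge(4)[OF ht[OF K(1)] K(2)] by blast
    then have "K = J"
      using eq[OF K(1) J] FJ[OF K(1,2)] K(3) by blast
    then show "f \<in> F J"
      using K(2) by blast
  qed (use J FJ in blast)
  obtain x where x: "x \<in> e"
    using e(2) by (cases "e = {}") auto
  have xV: "x \<in> ?V"
    using x e(1) r JI by blast
  show "hypertree ?V ?E"
  proof (rule hypertreeI[where v = x])
    show "hypergraph ?V ?E"
      unfolding hypergraph_def
    proof (intro conjI ballI)
      show "finite ?V"
        using fin by simp
      show "f \<subseteq> ?V" if "f \<in> ?E" for f
        using that FJ JI r e(1) by blast
      show "card f \<ge> 2" if "f \<in> ?E" for f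
        using that e(2) hypertree_edge(2)[OF ht] by auto
    qed
    have ex: "conn ?E y x" if "y \<in> e" for y
      using that x by (intro conn_edge[of e]) auto
    show "conn ?E u x" if u: "u \<in> ?V" for u
    proof (cases "u \<in> I")
      case True
      then obtain J where J: "J \<in> \<pi>" "u \<in> J"
        using \<pi> by (auto simp: partition_on_def)
      have "conn ?E u (r J)"
        by (rule conn_mono[OF hypertree_conn[OF ht[OF J(1)] J(2) r[OF J(1)]]]) (use J in blast)
      moreover have "conn ?E (r J) x"
        using ex e(1) J(1) by blast
      ultimately show ?thesis
        by (rule rtrancl_trans)
    next
      case False
      then show ?thesis
        using ex u e(1) by blast
    qed
    fix f u w
    assume f: "f \<in> ?E" and uw: "u \<in> f" "w \<in> f" and c: "conn (?E - {f}) u w"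
    show "u = w"
    \<comment> \<open>Without \<open>e\<close>, a vertex of \<open>Z\<close> is isolated and a root
      stays connected only to its own block, which contains no second vertex of
      \<open>e\<close>.\<close>
    proof (cases "f = e")
      case True
      then have c': "conn (\<Union>J\<in>\<pi>. F J) u w"
        using c by (elim conn_mono) blast
      show ?thesis
      proof (cases "u \<in> Z")
        case True
        have "w \<in> {u}"
          using c' by (rule conn_closed) (use True Z FJ JI in blast)+
        then show ?thesis
          by simp
      next
        case False
        then obtain J where J: "J \<in> \<pi>" "u = r J"
          using uw(1) \<open>f = e\<close> e(1) by blast
        have "w \<in> J"
          using c' by (rule conn_closed) (use J r cl in blast)+
        then show ?thesis
          using eJ[OF J(1)] J(2) IntI[of w e J] uw(2) \<open>f = e\<close> by simp
      qed
    next
      case False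
      then obtain J where J: "J \<in> \<pi>" "f \<in> F J"
        using f by blast
      \<comment> \<open>Everything outside \<open>J\<close> is collapsed to the root
        \<open>r J\<close>, the only vertex through which \<open>J\<close> is attached.\<close>
      let ?p = "\<lambda>x. if x \<in> J then x else r J"
      have "conn (F J - {f}) (?p u) (?p w)"
        using c
      proof (rule conn_retract)
        fix g a b
        assume g: "g \<in> ?E - {f}" "a \<in> g" "b \<in> g"
        show "conn (F J - {f}) (?p a) (?p b)"
        proof (cases "g \<in> F J")
          case True
          then show ?thesis
            using FJ[OF J(1) True] g by (auto intro: conn_edge)
        next
          case False
          have "?p x = r J" if "x \<in> g" for x
          proof (cases "g = e")
            case True
            then show ?thesis
              using eJ[OF J(1)] that by auto
          next
            case False
            then obtain K where K: "K \<in> \<pi>" "g \<in> F K"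
              using g(1) by blast
            then have "K \<noteq> J"
              using \<open>g \<notin> F J\<close> by blast
            then show ?thesis
              using eq[OF K(1) J(1)] FJ[OF K] that by auto
          qed
          then show ?thesis
            using g(2,3) by (simp only: rtrancl.rtrancl_refl)
        qed
      qed
      moreover have "u \<in> J" "w \<in> J"
        using FJ[OF J] uw by auto
      ultimately show ?thesis
        using hypertree_bridge[OF ht[OF J(1)] J(2) uw] by simp
    qed
  qed (rule xV)
qed

text \<open>The vertices in \<open>Z\<close> lie on \<open>e\<close> and on no other edge, so the
  classes left after removing \<open>e\<close> partition \<open>I\<close> alone.\<close>

context
  fixes I Z E e
  assumes ht: "hypertree (I \<union> Z) E" and e: "e \<in> E" "Z \<subseteq> e" and Z: "Z \<inter> I = {}"
    and off: "\<forall>f\<in>E - {e}. f \<inter> Z = {}"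
begin

lemma eclass_partition: "partition_on I ((\<lambda>x. {w. conn (E - {e}) x w}) ` I)"
proof (rule class_partition)
  show "f \<subseteq> I" if "f \<in> E - {e}" for f
    using hypertree_edge(1)[OF ht, of f] bspec[OF off that] that by blast
qed

lemma eclass_edge:
  assumes J: "J \<in> (\<lambda>x. {w. conn (E - {e}) x w}) ` I" and f: "f \<in> E - {e}" "f \<inter> J \<noteq> {}"
  shows "f \<subseteq> J"
proof
  fix y
  assume y: "y \<in> f"
  obtain z where z: "J = {w. conn (E - {e}) z w}"
    using J by blast
  obtain x where x: "x \<in> f" "x \<in> J"
    using f(2) by blast
  have "conn (E - {e}) x y"
    using f(1) x(1) y by (intro conn_edge[of f])
  then show "y \<in> J"
    using x(2) unfolding z by (auto intro: rtrancl_trans)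
qed

lemma eclass_edges: "E - {e} = (\<Union>J\<in>(\<lambda>x. {w. conn (E - {e}) x w}) ` I. {f \<in> E - {e}. f \<subseteq> J})"
proof (intro equalityI subsetI)
  fix f
  assume f: "f \<in> E - {e}"
  then obtain x where x: "x \<in> f"
    using hypertree_edge(4)[OF ht, of f] by blast
  have "x \<in> I"
    using x hypertree_edge(1)[OF ht, of f] bspec[OF off f] f by blast
  then have J: "{w. conn (E - {e}) x w} \<in> (\<lambda>x. {w. conn (E - {e}) x w}) ` I"
    by blast
  have "f \<subseteq> {w. conn (E - {e}) x w}"
    by (rule eclass_edge[OF J f]) (use x in auto)
  then show "f \<in> (\<Union>J\<in>(\<lambda>x. {w. conn (E - {e}) x w}) ` I. {f \<in> E - {e}. f \<subseteq> J})"
    using J f by blast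
qed blast

text \<open>A connection from a vertex of the class to \<open>e\<close>, stopped on arrival, ends at
  a vertex of \<open>e\<close> in the class. A second such vertex would be connected to the first
  without \<open>e\<close>.\<close>

lemma eclass_root:
  assumes J: "J \<in> (\<lambda>x. {w. conn (E - {e}) x w}) ` I"
  shows "\<exists>r. e \<inter> J = {r}"
proof -
  obtain z where z: "z \<in> I" "J = {w. conn (E - {e}) z w}"
    using J by blast
  obtain u where u: "u \<in> e"
    using hypertree_edge(4)[OF ht e(1)] by blast
  have "conn E z u"
    by (rule hypertree_conn[OF ht]) (use z hypertree_edge(1)[OF ht e(1)] u in auto)
  from conn_first_hit[OF this u] obtain r where r: "r \<in> e" "conn (E - {e}) z r"
    by blast
  have "y = r" if "y \<in> e \<inter> J" for y
  proof -
    have "conn (E - {e}) y r"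
      using that r(2) conn_sym[of z y "E - {e}"] unfolding z(2) by (auto intro: rtrancl_trans)
    then show ?thesis
      using hypertree_bridge[OF ht e(1)] that r(1) by blast
  qed
  with r show ?thesis
    unfolding z(2) by blast
qed

lemma eclass_hypertree:
  assumes J: "J \<in> (\<lambda>x. {w. conn (E - {e}) x w}) ` I"
  shows "hypertree J {f \<in> E - {e}. f \<subseteq> J}" (is "hypertree J ?F")
proof -
  obtain z where z: "z \<in> I" "J = {w. conn (E - {e}) z w}"
    using J by blast
  have zJ: "z \<in> J"
    by (simp add: z(2))
  have cl: "f \<subseteq> J" if "f \<in> E - {e}" "f \<inter> J \<noteq> {}" for f
    using eclass_edge[OF J that] .
  have JI: "J \<subseteq> I"
    using eclass_partition J by (auto simp: partition_on_def)
  show ?thesis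
  proof (rule hypertreeI[where v = z])
    show "hypergraph J ?F"
      using hypertree_edge(2)[OF ht] finite_subset[OF JI] hypertree_finite(1)[OF ht] by (auto simp: hypergraph_def)
    show "conn ?F u z" if "u \<in> J" for u
    proof (rule conn_sym)
      show "conn ?F z u"
        by (rule conn_restrict[OF _ zJ cl]) (use that z(2) in auto)
    qed
    fix f u w
    assume f: "f \<in> ?F" "u \<in> f" "w \<in> f" and c: "conn (?F - {f}) u w"
    have "conn (E - {f}) u w"
      using c by (rule conn_mono) blast
    then show "u = w"
      using hypertree_bridge[OF ht _ f(2,3)] f(1) by blast
  qed (rule zJ)
qed

lemma eclass_roots:
  assumes "\<And>J. J \<in> (\<lambda>x. {w. conn (E - {e}) x w}) ` I \<Longrightarrow> e \<inter> J = {r J}"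
  shows "e = r ` (\<lambda>x. {w. conn (E - {e}) x w}) ` I \<union> Z"
proof (intro equalityI subsetI)
  fix x
  assume x: "x \<in> e"
  show "x \<in> r ` (\<lambda>x. {w. conn (E - {e}) x w}) ` I \<union> Z"
  proof (cases "x \<in> Z")
    case False
    then have xI: "x \<in> I"
      using x hypertree_edge(1)[OF ht e(1)] by blast
    then have "x = r {w. conn (E - {e}) x w}"
      using assms[of "{w. conn (E - {e}) x w}"] x by blast
    then show ?thesis
      using xI by blast
  qed simp
qed (use assms e(2) in blast)

end

section \<open>Weights as numbers of edges\<close>

definition wconst :: "int \<Rightarrow> ('a, 's, 'e) shape \<Rightarrow> bool" where
  "wconst k M \<longleftrightarrow> (\<forall>I s. finite I \<and> s \<in> str (sp M) I \<longrightarrow> wt (sp M) s = int (card (ed M s)) + k)"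

lemma wconstD: "wconst k M \<Longrightarrow> finite I \<Longrightarrow> s \<in> str (sp M) I \<Longrightarrow> wt (sp M) s = int (card (ed M s)) + k"
  by (auto simp: wconst_def)

lemma wconst_hshape: "wconst (- 1) (hshape K ex pm)"
  by (auto simp: wconst_def hshape_def)

lemma wconst_sset: "wconst (- 1) sset"
  by (simp add: wconst_def sset_def)

lemma wconst_splain: "(\<And>s. wt G s = 0) \<Longrightarrow> wconst 0 (splain G)"
  by (simp add: wconst_def splain_def)

lemma wconst_sshift: "wconst k M \<Longrightarrow> wconst (k + j) (sshift j M)"
  by (simp add: wconst_def sshift_def wshift_def)

lemma wconst_sderiv:
  assumes "wconst k M"
  shows "wconst k (sderiv M)"
  unfolding wconst_def
proof (intro allI impI, elim conjE)
  fix I s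
  assume "finite I" and s: "s \<in> str (sp (sderiv M)) I"
  then have "finite (add_pt I)" "s \<in> str (sp M) (add_pt I)"
    by (simp_all add: finite_add_pt sderiv_def wderiv_def)
  from wconstD[OF assms this] show "wt (sp (sderiv M)) s = int (card (ed (sderiv M) s)) + k"
    by (simp add: sderiv_def wderiv_def)
qed

lemma wconst_ssum:
  assumes "wconst k M" "wconst k N"
  shows "wconst k (ssum M N)"
  using assms by (auto simp: wconst_def ssum_def wsum_def)

lemma wconst_sprod:
  assumes "is_shape M" "is_shape N" "wconst k M" "wconst j N"
  shows "wconst (k + j) (sprod M N)"
  unfolding wconst_def
proof (intro allI impI, elim conjE)
  fix I s
  assume I: "finite I" and s: "s \<in> str (sp (sprod M N)) I"
  obtain A B x y where s_eq: "s = (A, B, x, y)"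
    by (cases s)
  note m = s[unfolded s_eq mem_str_sprod]
  have "finite A" "finite B"
    using m I by auto
  then show "wt (sp (sprod M N)) s = int (card (ed (sprod M N) s)) + (k + j)"
    using m wconstD[OF assms(3), of A x] wconstD[OF assms(4), of B y] is_shapeD(1)[OF assms(1), of A x]
      is_shapeD(1)[OF assms(2), of B y] by (simp add: s_eq wt_sprod sprod_fields card_Plus)
qed

text \<open>The constant of the inner shape is counted once for every block, and the number of
  blocks varies; with the constant 0 only the edges are counted. Multiplying rooted and hollow
  hypertrees by \<open>t\<close> achieves this.\<close>

lemma wconst_scomp:
  assumes "is_shape M" "is_shape N" "wconst k M" "wconst 0 N"
  shows "wconst k (scomp M N)"
  unfolding wconst_def
proof (intro allI impI, elim conjE)
  fix I s
  assume I: "finite I" and s: "s \<in> str (sp (scomp M N)) I"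
  obtain \<pi> x y where s_eq: "s = (\<pi>, x, y)"
    by (cases s)
  have \<pi>: "partition_on I \<pi>" and x: "x \<in> str (sp M) (blk ` \<pi>)" and y: "\<And>J. J \<in> \<pi> \<Longrightarrow> y J \<in> str (sp N) J"
    using s by (auto simp: s_eq mem_str_scomp)
  note p = partition_facts[OF \<pi> I]
  have fin: "finite (blk ` \<pi>)"
    using p(1) by simp
  have fy: "finite (ed N (y J))" if "J \<in> \<pi>" for J
    using is_shapeD(1)[OF assms(2) p(2)[OF that] y[OF that]] .
  have "(\<Sum>J\<in>\<pi>. wt (sp N) (y J)) = (\<Sum>J\<in>\<pi>. int (card (ed N (y J))))"
    using wconstD[OF assms(4) p(2) y] by simp
  also have "\<dots> = int (card (SIGMA J:\<pi>. ed N (y J)))"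
    using p(1) fy by (simp add: card_SigmaI)
  finally show "wt (sp (scomp M N)) s = int (card (ed (scomp M N) s)) + k"
    using wconstD[OF assms(3) fin x] is_shapeD(1)[OF assms(1) fin x] p(1) fy
    by (simp add: s_eq wt_scomp scomp_fields card_Plus finite_SigmaI)
qed

text \<open>
  An edge of the composite structure is mapped to the set of the images of its labels, so an
  equivalence with a shape of hypertrees is given by the maps \<open>l\<close> on labels and the pointing \<open>pt\<close>.
\<close>

lemma sequiv_hshapeI:
  fixes M :: "('a, 's, 'e) shape"
  assumes M: "is_shape M" and w: "wconst c M" "wconst c (sshift k (hshape K ex pm))"
    and inj: "\<And>I s j. finite I \<Longrightarrow> s \<in> str (sp M) I \<Longrightarrow> j \<in> ed M s \<Longrightarrow> inj_on (l I s j) (lb M s j)"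
    and injE: "\<And>I s. finite I \<Longrightarrow> s \<in> str (sp M) I \<Longrightarrow> inj_on (\<lambda>j. l I s j ` lb M s j) (ed M s)"
    and bij: "\<And>I. finite I \<Longrightarrow> bij_betw (\<lambda>s. ((\<lambda>j. l I s j ` lb M s j) ` ed M s, pt I s)) (str (sp M) I) (K I)"
    and nat: "\<And>I s \<sigma> j x. finite I \<Longrightarrow> s \<in> str (sp M) I \<Longrightarrow> inj_on \<sigma> I \<Longrightarrow> j \<in> ed M s \<Longrightarrow> x \<in> lb M s j \<Longrightarrow>
      l (\<sigma> ` I) (tr (sp M) I \<sigma> s) (et M I \<sigma> s j) (lt M I \<sigma> s j x) = ex I \<sigma> (l I s j x)"
    and pt: "\<And>I s \<sigma>. finite I \<Longrightarrow> s \<in> str (sp M) I \<Longrightarrow> inj_on \<sigma> I \<Longrightarrow>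
      pt (\<sigma> ` I) (tr (sp M) I \<sigma> s) = pm (ex I \<sigma>) (pt I s)"
  shows "sequiv M (sshift k (hshape K ex pm)) (\<lambda>I s. ((\<lambda>j. l I s j ` lb M s j) ` ed M s, pt I s))
    (\<lambda>I s j. l I s j ` lb M s j) l"
    (is "sequiv M ?N ?\<phi> ?\<epsilon> l")
  unfolding sequiv_def
proof (intro allI impI conjI ballI)
  have N: "str (sp ?N) = K" "ed ?N = fst" "lb ?N s e = e" "et ?N I \<sigma> s = image (ex I \<sigma>)" "lt ?N I \<sigma> s e = ex I \<sigma>"
    "tr (sp ?N) I \<sigma> (E, p) = (image (ex I \<sigma>) ` E, pm (ex I \<sigma>) p)" for I \<sigma> s e E p
    by (simp_all add: sshift_def wshift_def hshape_def)
  fix I :: "'a lab set"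
  assume I: "finite I"
  show b: "bij_betw (?\<phi> I) (str (sp M) I) (str (sp ?N) I)"
    using bij[OF I] by (simp add: N)
  fix s
  assume s: "s \<in> str (sp M) I"
  show be: "bij_betw (?\<epsilon> I s) (ed M s) (ed ?N (?\<phi> I s))"
    using injE[OF I s] by (simp add: N bij_betw_def)
  have "?\<phi> I s \<in> str (sp ?N) I"
    using b s by (auto dest: bij_betwE)
  then show "wt (sp ?N) (?\<phi> I s) = wt (sp M) s"
    using wconstD[OF w(1) I s] wconstD[OF w(2) I] bij_betw_same_card[OF be] by simp
  show "bij_betw (l I s j) (lb M s j) (lb ?N (?\<phi> I s) (?\<epsilon> I s j))" if "j \<in> ed M s" for j
    using inj[OF I s that] by (simp add: N bij_betw_def)
  fix \<sigma> :: "'a lab \<Rightarrow> 'a lab"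
  assume \<sigma>: "inj_on \<sigma> I"
  note Md = is_shapeD[OF M I s]
  have \<epsilon>: "?\<epsilon> (\<sigma> ` I) (tr (sp M) I \<sigma> s) (et M I \<sigma> s j) = ex I \<sigma> ` ?\<epsilon> I s j" if j: "j \<in> ed M s" for j
  proof -
    have "lb M (tr (sp M) I \<sigma> s) (et M I \<sigma> s j) = lt M I \<sigma> s j ` lb M s j"
      using Md(6)[OF \<sigma> j] by (simp add: bij_betw_def)
    then show ?thesis
      using nat[OF I s \<sigma> j] by (simp add: image_image)
  qed
  show "?\<epsilon> (\<sigma> ` I) (tr (sp M) I \<sigma> s) (et M I \<sigma> s j) = et ?N I \<sigma> (?\<phi> I s) (?\<epsilon> I s j)" if "j \<in> ed M s" for j
    using \<epsilon>[OF that] by (simp add: N)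
  have "ed M (tr (sp M) I \<sigma> s) = et M I \<sigma> s ` ed M s"
    using Md(5)[OF \<sigma>] by (simp add: bij_betw_def)
  then have "?\<epsilon> (\<sigma> ` I) (tr (sp M) I \<sigma> s) ` ed M (tr (sp M) I \<sigma> s) = image (ex I \<sigma>) ` ?\<epsilon> I s ` ed M s"
    using \<epsilon> by (simp add: image_image)
  then show "?\<phi> (\<sigma> ` I) (tr (sp M) I \<sigma> s) = tr (sp ?N) I \<sigma> (?\<phi> I s)"
    using pt[OF I s \<sigma>] by (simp only: N)
  show "l (\<sigma> ` I) (tr (sp M) I \<sigma> s) (et M I \<sigma> s j) (lt M I \<sigma> s j x) =
      lt ?N I \<sigma> (?\<phi> I s) (?\<epsilon> I s j) (l I s j x)" if "j \<in> ed M s" "x \<in> lb M s j" for j x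
    using nat[OF I s \<sigma> that] by (simp only: N)
qed

section \<open>Hollow hypertrees glued at their gaps\<close>

definition kappa :: "'a lab set \<Rightarrow> 'a lab \<Rightarrow> 'a lab \<Rightarrow> 'a lab" where
  "kappa J v = (\<lambda>x. if x = blk J then v else x)"

lemma image_fixed: "(\<And>x. x \<in> A \<Longrightarrow> f x = x) \<Longrightarrow> f ` A = A"
  by simp

lemma kappa_facts:
  assumes "finite J" "v \<notin> J"
  shows "inj_on (kappa J v) (add_pt J)" "kappa J v ` add_pt J = insert v J"
    "f \<subseteq> add_pt J \<Longrightarrow> v \<in> kappa J v ` f \<longleftrightarrow> blk J \<in> f"
    "f \<subseteq> insert v J \<Longrightarrow> kappa J v ` (\<lambda>x. if x = v then blk J else x) ` f = f"
proof -
  have "blk J \<notin> J"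
    using blk_notin[OF assms(1)] .
  then show "inj_on (kappa J v) (add_pt J)" "kappa J v ` add_pt J = insert v J"
    "f \<subseteq> add_pt J \<Longrightarrow> v \<in> kappa J v ` f \<longleftrightarrow> blk J \<in> f"
    using assms(2) by (auto simp: kappa_def add_pt_def inj_on_def)
  show "kappa J v ` (\<lambda>x. if x = v then blk J else x) ` f = f" if "f \<subseteq> insert v J"
  proof -
    have "kappa J v (if x = v then blk J else x) = x" if "x \<in> f" for x
      using that \<open>f \<subseteq> insert v J\<close> \<open>blk J \<notin> J\<close> by (auto simp: kappa_def)
    then show ?thesis
      unfolding image_image by (rule image_fixed)
  qed
qed

text \<open>Renaming the gap to \<open>v\<close> commutes with transport because
  \<open>ext_map\<close> follows the gap while \<sigma> follows \<open>v\<close>.\<close>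

lemma kappa_natural:
  assumes "finite J" "x \<in> add_pt J"
  shows "kappa (\<sigma> ` J) (\<sigma> v) (ext_map J \<sigma> x) = \<sigma> (kappa J v x)"
  using assms blk_notin[of J] blk_notin[of "\<sigma> ` J"] imageI[of x J \<sigma>] ext_map_simps(1)[of J \<sigma>] ext_map_simps(2)[of J x \<sigma>]
  by (auto simp: kappa_def add_pt_def)

lemma hollow_kappa:
  assumes h: "h \<in> hollow J" and J: "finite J" and v: "v \<notin> J"
  shows "hypertree (insert v J) (image (kappa J v) ` fst h)"
    and "card {f \<in> image (kappa J v) ` fst h. v \<in> f} = 1"
    and "inj_on (image (kappa J v)) (fst h)"
    and "f \<in> fst h \<Longrightarrow> f \<subseteq> add_pt J"
    and "J \<noteq> {}"
proof -
  have ht: "hypertree (add_pt J) (fst h)" and one: "card {f \<in> fst h. blk J \<in> f} = 1"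
    using h by (auto simp: hollow_def)
  note k = kappa_facts[OF J v]
  show "hypertree (insert v J) (image (kappa J v) ` fst h)"
    using hypertree_image[OF ht k(1)] k(2) by simp
  show sub: "f \<subseteq> add_pt J" if "f \<in> fst h" for f
    by (rule hypertree_edge(1)[OF ht that])
  show inj: "inj_on (image (kappa J v)) (fst h)"
    by (rule hypertree_image_edges(1)[OF ht k(1)])
  have "{f \<in> image (kappa J v) ` fst h. v \<in> f} = image (kappa J v) ` {f \<in> fst h. blk J \<in> f}"
    using k(3) sub by auto
  then show "card {f \<in> image (kappa J v) ` fst h. v \<in> f} = 1"
    using one inj_on_subset[OF inj, of "{f \<in> fst h. blk J \<in> f}"] by (simp add: card_image)
  \<comment> \<open>The edge through the gap has a second vertex, and this one lies in
    \<open>J\<close>.\<close>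
  obtain f where f: "f \<in> fst h"
    using one by (auto simp: card_1_singleton_iff)
  then obtain x where "x \<in> f" "x \<noteq> blk J"
    using hypertree_edge(4)[OF ht f] by blast
  then show "J \<noteq> {}"
    using sub[OF f] by (auto simp: add_pt_def)
qed

text \<open>The converse renaming, of \<open>v\<close> to \<open>blk J\<close>, makes a hollow
  hypertree out of a piece at \<open>v\<close>: having one edge through \<open>v\<close> becomes the
  condition on the gap.\<close>

lemma hollow_kappa_inverse:
  assumes ht: "hypertree (insert v J) F" and one: "card {f \<in> F. v \<in> f} = 1" and J: "finite J" and v: "v \<notin> J"
  shows "\<exists>h\<in>hollow J. image (kappa J v) ` fst h = F"
proof -
  let ?m = "\<lambda>x. if x = v then blk J else x"
  note k = kappa_facts[OF J v]
  have inj: "inj_on ?m (insert v J)"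
    using blk_notin[OF J] v by (auto simp: inj_on_def)
  have "?m ` insert v J = add_pt J"
    using v by (auto simp: add_pt_def)
  then have ht': "hypertree (add_pt J) (image ?m ` F)"
    using hypertree_image[OF ht inj] by simp
  have sub: "f \<subseteq> insert v J" if "f \<in> F" for f
    by (rule hypertree_edge(1)[OF ht that])
  have F: "image (kappa J v) ` image ?m ` F = F"
    using k(4) sub by (force simp: image_image)
  have "blk J \<in> ?m ` f \<longleftrightarrow> v \<in> f" if "f \<in> F" for f
    using sub[OF that] blk_notin[OF J] by auto
  then have "{f \<in> image ?m ` F. blk J \<in> f} = image ?m ` {f \<in> F. v \<in> f}"
    by auto
  moreover have "inj_on (image ?m) {f \<in> F. v \<in> f}"
    using hypertree_image_edges(1)[OF ht inj] by (rule inj_on_subset) blast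
  ultimately have "card {f \<in> image ?m ` F. blk J \<in> f} = 1"
    using one by (simp only: card_image)
  with ht' F show ?thesis
    by (intro bexI[of _ "(image ?m ` F, ())"]) (auto simp: hollow_def)
qed

lemma hollow_eqI:
  assumes "h \<in> hollow J" "h' \<in> hollow J" "finite J" "v \<notin> J"
    "image (kappa J v) ` fst h = image (kappa J v) ` fst h'"
  shows "h = h'"
proof -
  have "fst h \<subseteq> Pow (add_pt J)" "fst h' \<subseteq> Pow (add_pt J)"
    using hollow_kappa(4)[OF assms(1,3,4)] hollow_kappa(4)[OF assms(2-4)] by blast+
  then have "fst h = fst h'"
    using inj_on_image_eq_iff[OF inj_on_image_Pow[OF kappa_facts(1)[OF assms(3,4)]], of "fst h" "fst h'"] assms(5)
    by simp
  then show ?thesis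
    by (simp add: prod_eq_iff)
qed

lemma image_classes:
  assumes "partition_on I \<pi>" "\<And>J x. J \<in> \<pi> \<Longrightarrow> x \<in> J \<Longrightarrow> C x = J"
  shows "C ` I = \<pi>"
proof (intro equalityI subsetI)
  fix J
  assume J: "J \<in> \<pi>"
  then have "J \<noteq> {}"
    using assms(1) by (auto simp: partition_on_def)
  then obtain x where x: "x \<in> J"
    by blast
  then have "x \<in> I"
    using assms(1) J by (auto simp: partition_on_def)
  then show "J \<in> C ` I"
    using assms(2)[OF J x] by blast
next
  fix J
  assume "J \<in> C ` I"
  then obtain x where x: "x \<in> I" "J = C x"
    by blast
  then obtain K where "K \<in> \<pi>" "x \<in> K"
    using assms(1) by (auto simp: partition_on_def)
  then show "J \<in> \<pi>"
    using assms(2) x(2) by simp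
qed

text \<open>The edges of the hypertree obtained by identifying the gaps of all pieces with
  \<open>v\<close>. For the empty partition there are none, and the hypertree is the single vertex
  \<open>v\<close>.\<close>

definition glueV where
  "glueV v \<pi> y = (\<Union>J\<in>\<pi>. image (kappa J v) ` fst (y J))"

context
  fixes I :: "'a lab set" and v \<pi> and y :: "'a lab set \<Rightarrow> 'a lab set set \<times> unit"
  assumes I: "finite I" and v: "v \<in> I" and \<pi>: "partition_on (I - {v}) \<pi>" and y: "y \<in> PiE \<pi> hollow"
begin

lemma glueV_part: "J \<in> \<pi> \<Longrightarrow> finite J" "J \<in> \<pi> \<Longrightarrow> v \<notin> J" "J \<in> \<pi> \<Longrightarrow> y J \<in> hollow J"
  using partition_facts(2,3)[OF \<pi>] I y by auto

lemma glueV_piece: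
  assumes "J \<in> \<pi>"
  shows "hypertree (insert v J) (image (kappa J v) ` fst (y J))"
    and "card {f \<in> image (kappa J v) ` fst (y J). v \<in> f} = 1"
    and "inj_on (image (kappa J v)) (fst (y J))"
    and "f \<in> fst (y J) \<Longrightarrow> f \<subseteq> add_pt J"
  using hollow_kappa[OF glueV_part(3)[OF assms] glueV_part(1,2)[OF assms]] by blast+

lemma glueV_disjoint: "J \<in> \<pi> \<Longrightarrow> K \<in> \<pi> \<Longrightarrow> J \<noteq> K \<Longrightarrow> insert v J \<inter> insert v K \<subseteq> {v}"
  using partition_eqI[OF \<pi>, of J K] by auto

lemma glueV_same:
  assumes "J \<in> \<pi>" "K \<in> \<pi>" "f \<in> image (kappa K v) ` fst (y K)" "f \<subseteq> insert v J"
  shows "K = J"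
  by (rule glue_vertex_unique[where W = "insert v" and E = "\<lambda>J. image (kappa J v) ` fst (y J)" and e = f and v = v])
    (use glueV_piece(1)[of K] glueV_disjoint[of K J] assms in auto)

lemma glueV_hypertree: "hypertree I (glueV v \<pi> y)"
proof -
  have "hypertree (insert v (\<Union>J\<in>\<pi>. insert v J)) (\<Union>J\<in>\<pi>. image (kappa J v) ` fst (y J))"
    using glueV_piece(1) glueV_disjoint partition_facts(1)[OF \<pi>] I by (intro glue_vertex) auto
  moreover have "insert v (\<Union>J\<in>\<pi>. insert v J) = I"
    using \<pi> v by (auto simp: partition_on_def)
  ultimately show ?thesis
    by (simp add: glueV_def)
qed

lemma glueV_restrict: "J \<in> \<pi> \<Longrightarrow> {f \<in> glueV v \<pi> y. f \<subseteq> insert v J} = image (kappa J v) ` fst (y J)"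
proof (intro equalityI subsetI)
  fix f
  assume J: "J \<in> \<pi>" and "f \<in> {f \<in> glueV v \<pi> y. f \<subseteq> insert v J}"
  then obtain K where K: "K \<in> \<pi>" "f \<in> image (kappa K v) ` fst (y K)" "f \<subseteq> insert v J"
    by (auto simp: glueV_def)
  with glueV_same[OF J K] show "f \<in> image (kappa J v) ` fst (y J)"
    by simp
next
  fix f
  assume J: "J \<in> \<pi>" and f: "f \<in> image (kappa J v) ` fst (y J)"
  with hypertree_edge(1)[OF glueV_piece(1)[OF J] f] show "f \<in> {f \<in> glueV v \<pi> y. f \<subseteq> insert v J}"
    by (auto simp: glueV_def)
qed

text \<open>Each piece satisfies the assumptions of \<open>vclass_eq\<close>, so cutting at
  \<open>v\<close> recovers the blocks that were glued.\<close>

lemma glueV_class: "J \<in> \<pi> \<Longrightarrow> x \<in> J \<Longrightarrow> vclass (glueV v \<pi> y) v x = J"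
proof (rule vclass_eq[OF glueV_piece(1) glueV_part(2) glueV_piece(2)])
  fix f
  assume J: "J \<in> \<pi>" and f: "f \<in> glueV v \<pi> y" "f \<notin> image (kappa J v) ` fst (y J)"
  then obtain K where K: "K \<in> \<pi>" "f \<in> image (kappa K v) ` fst (y K)" "K \<noteq> J"
    by (auto simp: glueV_def)
  have "f \<subseteq> insert v K"
    by (rule hypertree_edge(1)[OF glueV_piece(1)[OF K(1)] K(2)])
  then show "f \<inter> J = {}"
    using glueV_disjoint[OF K(1) J K(3)] glueV_part(2)[OF J] by blast
qed (auto simp: glueV_def)

lemma glueV_classes: "vclass (glueV v \<pi> y) v ` (I - {v}) = \<pi>"
  using \<pi> glueV_class by (rule image_classes)

text \<open>No edge arises twice: its vertices other than \<open>v\<close> determine the block, and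
  inside a block renaming the gap is injective.\<close>

lemma glueV_inj: "inj_on (\<lambda>(J, f). kappa J v ` f) (SIGMA J:\<pi>. fst (y J))"
proof (rule inj_onI, clarify)
  fix J f K g
  assume J: "J \<in> \<pi>" "f \<in> fst (y J)" and K: "K \<in> \<pi>" "g \<in> fst (y K)" and eq: "kappa J v ` f = kappa K v ` g"
  have "kappa K v ` g \<subseteq> insert v J"
    using hypertree_edge(1)[OF glueV_piece(1)[OF J(1)] imageI[OF J(2)]] eq by simp
  then have "K = J"
    using glueV_same[OF J(1) K(1) imageI[OF K(2)]] by simp
  then show "J = K \<and> f = g"
    using inj_onD[OF glueV_piece(3)[OF J(1)] _ J(2)] eq K(2) by auto
qed

end

text \<open>The blocks are the classes at \<open>v\<close>, and each hollow hypertree is recovered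
  from the edges inside its block and \<open>v\<close>.\<close>

lemma glueV_eqD:
  assumes "finite I" "v \<in> I" "partition_on (I - {v}) \<pi>" "y \<in> PiE \<pi> hollow"
    "partition_on (I - {v}) \<pi>'" "y' \<in> PiE \<pi>' hollow" "glueV v \<pi> y = glueV v \<pi>' y'"
  shows "\<pi> = \<pi>'" "y = y'"
proof -
  note g = glueV_classes[OF assms(1-4)] and g' = glueV_classes[OF assms(1,2,5,6)]
  show \<pi>: "\<pi> = \<pi>'"
    using g g' assms(7) by simp
  show "y = y'"
  proof (rule PiE_ext[OF assms(4)])
    show "y' \<in> PiE \<pi> hollow"
      using assms(6) \<pi> by simp
    fix J
    assume J: "J \<in> \<pi>"
    have J': "J \<in> \<pi>'"
      using J \<pi> by simp
    note p = glueV_part[OF assms(1-4) J] and p' = glueV_part[OF assms(1,2,5,6) J']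
    show "y J = y' J"
      using glueV_restrict[OF assms(1-4) J] glueV_restrict[OF assms(1,2,5,6) J'] assms(7)
      by (intro hollow_eqI[OF p(3) p'(3) p(1,2)]) simp
  qed
qed

text \<open>Every piece at \<open>v\<close> has exactly one edge through \<open>v\<close> and so
  comes from a hollow hypertree; every edge lies in one of the pieces.\<close>

lemma glueV_surj:
  assumes I: "finite I" and ht: "hypertree I E" and v: "v \<in> I"
  obtains \<pi> y where "partition_on (I - {v}) \<pi>" "y \<in> PiE \<pi> hollow" "E = glueV v \<pi> y"
proof -
  let ?\<pi> = "vclass E v ` (I - {v})"
  note \<pi> = vclass_partition[OF ht v]
  have "\<forall>J\<in>?\<pi>. \<exists>h. h \<in> hollow J \<and> image (kappa J v) ` fst h = {f \<in> E. f \<subseteq> insert v J}"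
  proof
    fix J
    assume J: "J \<in> ?\<pi>"
    have "finite J" "v \<notin> J"
      using partition_facts(2,3)[OF \<pi> _ J] I by auto
    from hollow_kappa_inverse[OF vclass_hypertree(1)[OF ht v J] vclass_hypertree(2)[OF ht v J] this]
    show "\<exists>h. h \<in> hollow J \<and> image (kappa J v) ` fst h = {f \<in> E. f \<subseteq> insert v J}"
      unfolding Bex_def .
  qed
  from bchoice[OF this] obtain y where yy:
    "\<forall>J\<in>?\<pi>. y J \<in> hollow J \<and> image (kappa J v) ` fst (y J) = {f \<in> E. f \<subseteq> insert v J}" ..
  have y: "y J \<in> hollow J" "image (kappa J v) ` fst (y J) = {f \<in> E. f \<subseteq> insert v J}" if "J \<in> ?\<pi>" for J
    by (rule bspec[OF yy that, THEN conjunct1], rule bspec[OF yy that, THEN conjunct2])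
  have "E = glueV v ?\<pi> (restrict y ?\<pi>)"
  proof (intro equalityI subsetI)
    fix f
    assume f: "f \<in> E"
    from vclass_edge_ex[OF ht v f] obtain J where J: "J \<in> ?\<pi>" "f \<subseteq> insert v J"
      by blast
    then have "f \<in> image (kappa J v) ` fst (restrict y ?\<pi> J)"
      using y(2)[OF J(1)] f by (simp only: restrict_apply' mem_Collect_eq simp_thms)
    then show "f \<in> glueV v ?\<pi> (restrict y ?\<pi>)"
      unfolding glueV_def using J(1) by blast
  next
    fix f
    assume "f \<in> glueV v ?\<pi> (restrict y ?\<pi>)"
    then obtain J where J: "J \<in> ?\<pi>" "f \<in> image (kappa J v) ` fst (restrict y ?\<pi> J)"
      unfolding glueV_def by blast
    then have J: "J \<in> ?\<pi>" "f \<in> image (kappa J v) ` fst (y J)"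
      by (simp_all only: restrict_apply')
    then show "f \<in> E"
      using y(2)[OF J(1)] by blast
  qed
  then show ?thesis
    using that[OF \<pi>, of "restrict y ?\<pi>"] y(1) by auto
qed

section \<open>Rooted hypertrees glued along an edge\<close>

definition rooted :: "'a lab set \<Rightarrow> ('a lab set set \<times> 'a lab) set" where
  "rooted J = {(E, r). hypertree J E \<and> r \<in> J}"

text \<open>Grafting of rooted hypertrees onto a common edge, the undecorated form of composing
  \<open>S\<close> or its derivative with rooted hypertrees.\<close>

definition glueE where
  "glueE Z \<pi> y = insert ((snd \<circ> y) ` \<pi> \<union> Z) (\<Union>J\<in>\<pi>. fst (y J))"

context
  fixes I Z :: "'a lab set" and \<pi> and y :: "'a lab set \<Rightarrow> 'a lab set set \<times> 'a lab"
  assumes I: "finite I" "finite Z" and Z: "Z \<inter> I = {}" and \<pi>: "partition_on I \<pi>" and y: "y \<in> PiE \<pi> rooted"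
begin

lemma glueE_part: "J \<in> \<pi> \<Longrightarrow> hypertree J (fst (y J))" "J \<in> \<pi> \<Longrightarrow> snd (y J) \<in> J"
  using PiE_mem[OF y] by (fastforce simp: rooted_def)+

lemma glueE_inj_root: "inj_on (snd \<circ> y) \<pi>"
  using partition_eqI[OF \<pi>] glueE_part(2) by (intro inj_onI) (metis comp_apply)

lemma glueE_card: "card ((snd \<circ> y) ` \<pi> \<union> Z) = card \<pi> + card Z"
proof -
  have "(snd \<circ> y) ` \<pi> \<inter> Z = {}"
    using glueE_part(2) partition_facts(3)[OF \<pi> I(1)] Z by fastforce
  then show ?thesis
    using card_image[OF glueE_inj_root] I(2) partition_facts(1)[OF \<pi> I(1)] by (simp add: card_Un_disjoint)
qed

text \<open>By \<open>glueE_card\<close>, the assumed bound says that the grafted edge has at least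
  two vertices.\<close>

lemma glueE_facts:
  assumes "card \<pi> + card Z \<ge> 2"
  shows "hypertree (I \<union> Z) (glueE Z \<pi> y)"
    and "(snd \<circ> y) ` \<pi> \<union> Z \<notin> (\<Union>J\<in>\<pi>. fst (y J))"
    and "J \<in> \<pi> \<Longrightarrow> ((snd \<circ> y) ` \<pi> \<union> Z) \<inter> J = {snd (y J)}"
    and "J \<in> \<pi> \<Longrightarrow> x \<in> J \<Longrightarrow> {w. conn (\<Union>J\<in>\<pi>. fst (y J)) x w} = J"
    and "J \<in> \<pi> \<Longrightarrow> {f \<in> \<Union>J\<in>\<pi>. fst (y J). f \<subseteq> J} = fst (y J)"
proof -
  have r: "\<And>J. J \<in> \<pi> \<Longrightarrow> (snd \<circ> y) J \<in> J"
    using glueE_part(2) by simp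
  have c: "card ((snd \<circ> y) ` \<pi> \<union> Z) \<ge> 2"
    using assms glueE_card by simp
  show "hypertree (I \<union> Z) (glueE Z \<pi> y)"
    unfolding glueE_def
    by (rule glue_edge(1)[where F = "\<lambda>J. fst (y J)" and r = "snd \<circ> y", OF \<pi> I Z _ _ refl c])
      (simp_all add: glueE_part)
  show "(snd \<circ> y) ` \<pi> \<union> Z \<notin> (\<Union>J\<in>\<pi>. fst (y J))"
    by (rule glue_edge(2)[where F = "\<lambda>J. fst (y J)" and r = "snd \<circ> y", OF \<pi> I Z _ _ refl c])
      (simp_all add: glueE_part)
  have "((snd \<circ> y) ` \<pi> \<union> Z) \<inter> J = {(snd \<circ> y) J}" if "J \<in> \<pi>"
    by (rule glue_edge(3)[where F = "\<lambda>J. fst (y J)" and r = "snd \<circ> y", OF \<pi> I Z _ _ refl c])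
      (simp_all add: glueE_part that)
  then show "((snd \<circ> y) ` \<pi> \<union> Z) \<inter> J = {snd (y J)}" if "J \<in> \<pi>"
    using that by simp
  show "{w. conn (\<Union>J\<in>\<pi>. fst (y J)) x w} = J" if "J \<in> \<pi>" "x \<in> J"
    by (rule glue_edge(4)[where F = "\<lambda>J. fst (y J)" and r = "snd \<circ> y", OF \<pi> I Z _ _ refl c])
      (simp_all add: glueE_part that)
  show "{f \<in> \<Union>J\<in>\<pi>. fst (y J). f \<subseteq> J} = fst (y J)" if "J \<in> \<pi>"
    by (rule glue_edge(5)[where F = "\<lambda>J. fst (y J)" and r = "snd \<circ> y", OF \<pi> I Z _ _ refl c])
      (simp_all add: glueE_part that)
qed

lemma glueE_classes:
  assumes "card \<pi> + card Z \<ge> 2"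
  shows "(\<lambda>x. {w. conn (\<Union>J\<in>\<pi>. fst (y J)) x w}) ` I = \<pi>"
  using \<pi> glueE_facts(4)[OF assms] by (rule image_classes)

lemma glueE_inj: "inj_on snd (SIGMA J:\<pi>. fst (y J))"
proof (rule inj_onI, clarsimp)
  fix J K f
  assume J: "J \<in> \<pi>" "f \<in> fst (y J)" and K: "K \<in> \<pi>" "f \<in> fst (y K)"
  obtain x where "x \<in> f"
    using hypertree_edge(4)[OF glueE_part(1)[OF J(1)] J(2)] by blast
  then show "J = K"
    using partition_eqI[OF \<pi> J(1) K(1)] hypertree_edge(1)[OF glueE_part(1)[OF J(1)] J(2)]
      hypertree_edge(1)[OF glueE_part(1)[OF K(1)] K(2)] by blast
qed

end

text \<open>Equality of the grafted edges is assumed, because for empty \<open>Z\<close> the edge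
  set alone does not tell which edge was grafted onto. Once this edge is removed, the classes are
  the blocks, and each root is the vertex in which the edge meets the block.\<close>

lemma glueE_eqD:
  assumes a: "finite I" "finite Z" "Z \<inter> I = {}"
    and y: "partition_on I \<pi>" "y \<in> PiE \<pi> rooted" "card \<pi> + card Z \<ge> 2"
    and y': "partition_on I \<pi>'" "y' \<in> PiE \<pi>' rooted" "card \<pi>' + card Z \<ge> 2"
    and eq: "glueE Z \<pi> y = glueE Z \<pi>' y'" "(snd \<circ> y) ` \<pi> \<union> Z = (snd \<circ> y') ` \<pi>' \<union> Z"
  shows "\<pi> = \<pi>'" "y = y'"
proof -
  note f = glueE_facts[OF a y] and f' = glueE_facts[OF a y']
  have U: "(\<Union>J\<in>\<pi>. fst (y J)) = (\<Union>J\<in>\<pi>'. fst (y' J))"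
    using eq(1) Diff_insert_absorb[OF f(2)] Diff_insert_absorb[OF f'(2)] eq(2) by (simp add: glueE_def)
  show \<pi>: "\<pi> = \<pi>'"
    using glueE_classes[OF a y] glueE_classes[OF a y'] U by simp
  show "y = y'"
  proof (rule PiE_ext[OF y(2)])
    show "y' \<in> PiE \<pi> rooted"
      using y'(2) \<pi> by simp
    fix J
    assume J: "J \<in> \<pi>"
    then have J': "J \<in> \<pi>'"
      using \<pi> by simp
    have "fst (y J) = fst (y' J)"
      using f(5)[OF J, symmetric] unfolding U f'(5)[OF J'] .
    moreover have "{snd (y J)} = {snd (y' J)}"
      using f(3)[OF J, symmetric] unfolding eq(2) f'(3)[OF J'] .
    ultimately show "y J = y' J"
      by (intro prod_eqI) simp_all
  qed
qed

lemma glueE_surj: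
  assumes ht: "hypertree (I \<union> Z) E" and e: "e \<in> E" "Z \<subseteq> e" and Z: "Z \<inter> I = {}"
    and off: "\<forall>f\<in>E - {e}. f \<inter> Z = {}"
  obtains \<pi> y where "partition_on I \<pi>" "y \<in> PiE \<pi> rooted" "E = glueE Z \<pi> y" "e = (snd \<circ> y) ` \<pi> \<union> Z"
    "card \<pi> + card Z \<ge> 2"
proof -
  let ?\<pi> = "(\<lambda>x. {w. conn (E - {e}) x w}) ` I"
  have fin: "finite I" "finite Z"
    using hypertree_finite(1)[OF ht] by auto
  note \<pi> = eclass_partition[OF ht e Z off]
  note root = eclass_root[OF ht e Z off] and tree = eclass_hypertree[OF ht e Z off]
  \<comment> \<open>By \<open>eclass_root\<close>, the edge \<open>e\<close> meets each class in one
    vertex, so \<open>the_elem\<close> picks the root.\<close>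
  define y where "y = (\<lambda>J\<in>?\<pi>. ({f \<in> E - {e}. f \<subseteq> J}, the_elem (e \<inter> J)))"
  have yJ: "fst (y J) = {f \<in> E - {e}. f \<subseteq> J}" "snd (y J) = the_elem (e \<inter> J)" if "J \<in> ?\<pi>" for J
    using that by (simp_all only: y_def restrict_apply' fst_conv snd_conv)
  have r: "e \<inter> J = {snd (y J)}" if J: "J \<in> ?\<pi>" for J
  proof -
    from root[OF J] obtain a where "e \<inter> J = {a}" ..
    then show ?thesis
      unfolding yJ(2)[OF J] by simp
  qed
  have y: "y \<in> PiE ?\<pi> rooted"
  proof (rule PiE_I)
    fix J
    assume J: "J \<in> ?\<pi>"
    have "snd (y J) \<in> J"
      using r[OF J] by blast
    then show "y J \<in> rooted J"
      using tree[OF J] yJ(1)[OF J] unfolding rooted_def by (cases "y J") simp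
  qed (simp only: y_def restrict_apply if_False)
  have eq: "e = (snd \<circ> y) ` ?\<pi> \<union> Z"
    using r by (intro eclass_roots[OF ht e Z off]) simp
  have "(\<Union>J\<in>?\<pi>. fst (y J)) = (\<Union>J\<in>?\<pi>. {f \<in> E - {e}. f \<subseteq> J})"
    by (intro SUP_cong refl yJ(1))
  also have "\<dots> = E - {e}"
    by (rule eclass_edges[OF ht e Z off, symmetric])
  finally have E: "E = glueE Z ?\<pi> y"
    unfolding glueE_def eq[symmetric] using insert_Diff[OF e(1)] by (simp only:)
  have "card e \<ge> 2"
    by (rule hypertree_edge(2)[OF ht e(1)])
  then have "card ?\<pi> + card Z \<ge> 2"
    using glueE_card[OF fin Z \<pi> y] eq by simp
  with \<pi> y E eq show ?thesis
    by (rule that)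
qed

lemma sshift_fields [simp]:
  "ed (sshift k M) = ed M" "lb (sshift k M) = lb M" "et (sshift k M) = et M" "lt (sshift k M) = lt M"
  "str (sp (sshift k M)) = str (sp M)" "tr (sp (sshift k M)) = tr (sp M)"
  by (simp_all add: sshift_def wshift_def)

lemma splain_fields [simp]: "ed (splain G) s = {}" "sp (splain G) = G"
  by (simp_all add: splain_def)

lemma hshape_fields [simp]:
  "ed (hshape K ex pm) = fst" "lb (hshape K ex pm) s e = e" "et (hshape K ex pm) I \<sigma> s = image (ex I \<sigma>)"
  "lt (hshape K ex pm) I \<sigma> s e = ex I \<sigma>" "str (sp (hshape K ex pm)) = K"
  "tr (sp (hshape K ex pm)) I \<sigma> (E, p) = (image (ex I \<sigma>) ` E, pm (ex I \<sigma>) p)"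
  by (simp_all add: hshape_def)

lemma sderiv_fields [simp]:
  "ed (sderiv M) = ed M" "lb (sderiv M) = lb M" "et (sderiv M) I \<sigma> = et M (add_pt I) (ext_map I \<sigma>)"
  "lt (sderiv M) I \<sigma> = lt M (add_pt I) (ext_map I \<sigma>)" "str (sp (sderiv M)) I = str (sp M) (add_pt I)"
  "tr (sp (sderiv M)) I \<sigma> = tr (sp M) (add_pt I) (ext_map I \<sigma>)"
  by (simp_all add: sderiv_def wderiv_def)

lemma sset_fields [simp]:
  "ed sset s = {()}" "lb sset s e = s" "et sset I \<sigma> s e = e" "lt sset I \<sigma> s e = \<sigma>"
  "str (sp sset) I = (if card I \<ge> 2 then {I} else {})" "tr (sp sset) I \<sigma> s = \<sigma> ` s"
  by (simp_all add: sset_def)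

lemma sshift_0: "sshift 0 M = M"
  by (cases M) (simp add: sshift_def wshift_def)

lemma str_wX: "x \<in> str wX A \<longleftrightarrow> (\<exists>v. A = {v} \<and> x = {v})"
  by (auto simp: wX_def card_1_singleton_iff)

lemma tr_wX [simp]: "tr wX I \<sigma> x = \<sigma> ` x"
  by (simp add: wX_def)

text \<open>Needed for the derivative: the point added to \<open>J\<close> is a vertex like any
  other there and may be renamed to \<open>v\<close>.\<close>

lemma kappa_trees:
  assumes J: "finite J" and v: "v \<notin> J"
  shows "bij_betw (image (image (kappa J v))) {E. hypertree (add_pt J) E} {E. hypertree (insert v J) E}"
proof (rule bij_betw_byWitness[where f' = "image (image (\<lambda>x. if x = v then blk J else x))"])
  let ?m = "\<lambda>x. if x = v then blk J else x"
  note k = kappa_facts[OF J v]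
  have inj: "inj_on ?m (insert v J)" and m: "?m ` insert v J = add_pt J"
    using blk_notin[OF J] v by (auto simp: inj_on_def add_pt_def)
  have mk: "?m (kappa J v x) = x" if "x \<in> add_pt J" for x
    using that v by (auto simp: kappa_def add_pt_def)
  have e: "?m ` kappa J v ` e = e" if "e \<subseteq> add_pt J" for e
    unfolding image_image by (rule image_fixed) (rule mk[OF subsetD[OF that]])
  show "\<forall>E\<in>{E. hypertree (add_pt J) E}. image ?m ` image (kappa J v) ` E = E"
    unfolding image_image[of "image ?m"] using e[OF hypertree_edge(1)] by (intro ballI image_fixed) blast
  show "\<forall>E\<in>{E. hypertree (insert v J) E}. image (kappa J v) ` image ?m ` E = E"
    unfolding image_image[of "image (kappa J v)"] using k(4)[OF hypertree_edge(1)] by (intro ballI image_fixed) blast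
  show "image (image (kappa J v)) ` {E. hypertree (add_pt J) E} \<subseteq> {E. hypertree (insert v J) E}"
    using hypertree_image[OF _ k(1)] k(2) by auto
  show "image (image ?m) ` {E. hypertree (insert v J) E} \<subseteq> {E. hypertree (add_pt J) E}"
    using hypertree_image[OF _ inj] m by auto
qed

section \<open>Decompositions of hypertrees\<close>

abbreviation sX :: "('a, 'a lab set, unit) shape" where "sX \<equiv> splain wX"
abbreviation sComm :: "('a, 'a lab set, unit) shape" where "sComm \<equiv> splain wComm"
abbreviation sOne :: "('a, unit, unit) shape" where "sOne \<equiv> splain wOne"
abbreviation sTree :: "('a, 'a lab set set \<times> unit, 'a lab set) shape" where
  "sTree \<equiv> sHT (\<lambda>I E. {()}) (\<lambda>\<sigma> p. p)"
abbreviation sRoot :: "('a, 'a lab set set \<times> 'a lab, 'a lab set) shape" where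
  "sRoot \<equiv> sHT (\<lambda>I E. I) (\<lambda>\<sigma> v. \<sigma> v)"
abbreviation sEdge :: "('a, 'a lab set set \<times> 'a lab set, 'a lab set) shape" where
  "sEdge \<equiv> sHT (\<lambda>I E. E) (\<lambda>\<sigma> e. \<sigma> ` e)"
abbreviation sEdgeRoot :: "('a, 'a lab set set \<times> 'a lab set \<times> 'a lab, 'a lab set) shape" where
  "sEdgeRoot \<equiv> sHT (\<lambda>I E. {(e, v). e \<in> E \<and> v \<in> e}) (\<lambda>\<sigma> (e, v). (\<sigma> ` e, \<sigma> v))"

lemma equivariant_pointings:
  "equivariant (\<lambda>I E. {()}) (\<lambda>\<sigma> p. p)" "equivariant (\<lambda>I E. I) (\<lambda>\<sigma> v. \<sigma> v)"
  "equivariant (\<lambda>I E. E) (\<lambda>\<sigma> e. \<sigma> ` e)"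
  "equivariant (\<lambda>I E. {(e, v). e \<in> E \<and> v \<in> e}) (\<lambda>\<sigma> (e, v). (\<sigma> ` e, \<sigma> v))"
  by (auto simp: equivariant_def)

lemmas is_shape_pointings = equivariant_pointings[THEN is_shape_sHT]

lemma sHT_fields [simp]:
  "ed (sHT P pm) = fst" "lb (sHT P pm) s e = e" "et (sHT P pm) I \<sigma> s = image \<sigma>"
  "lt (sHT P pm) I \<sigma> s e = \<sigma>" "str (sp (sHT P pm)) I = {(E, p). hypertree I E \<and> p \<in> P I E}"
  "tr (sp (sHT P pm)) I \<sigma> (E, p) = (image \<sigma> ` E, pm \<sigma> p)"
  by (simp_all add: sHT_def)

lemma sHTh_fields [simp]:
  "ed sHTh = fst" "lb sHTh s e = e" "et sHTh I \<sigma> s = image (ext_map I \<sigma>)"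
  "lt sHTh I \<sigma> s e = ext_map I \<sigma>" "str (sp sHTh) = hollow"
  "tr (sp sHTh) I \<sigma> s = (image (ext_map I \<sigma>) ` fst s, snd s)"
  by (simp_all add: sHTh_def hshape_def case_prod_unfold)

lemma ssum_fields [simp]:
  "ed (ssum M N) = case_sum (ed M) (ed N)" "lb (ssum M N) = case_sum (lb M) (lb N)"
  "et (ssum M N) I \<sigma> = case_sum (et M I \<sigma>) (et N I \<sigma>)" "lt (ssum M N) I \<sigma> = case_sum (lt M I \<sigma>) (lt N I \<sigma>)"
  "str (sp (ssum M N)) I = str (sp M) I <+> str (sp N) I"
  "tr (sp (ssum M N)) I \<sigma> = map_sum (tr (sp M) I \<sigma>) (tr (sp N) I \<sigma>)"
  by (simp_all add: ssum_def wsum_def)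

lemma ftr_sshift [simp]: "ftr (sp (sshift k M)) I \<sigma> \<pi> y = ftr (sp M) I \<sigma> \<pi> y"
  by (simp add: ftr_def)

lemma Plus_empty [simp]: "{} <+> B = Inr ` B" "A <+> {} = Inl ` A"
  by (auto simp: Plus_def)

lemma inj_on_Plus:
  assumes "inj_on (\<lambda>a. f (Inl a)) A" "inj_on (\<lambda>b. f (Inr b)) B"
    and "\<And>a b. a \<in> A \<Longrightarrow> b \<in> B \<Longrightarrow> f (Inl a) \<noteq> f (Inr b)"
  shows "inj_on f (A <+> B)"
  by (rule inj_onI) (auto elim!: PlusE dest: inj_onD[OF assms(1)] inj_onD[OF assms(2)]
      simp: assms(3) assms(3)[THEN not_sym])

lemma wconst_sHT: "wconst (- 1) (sHT P pm)"
  unfolding sHT_def by (rule wconst_hshape)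

lemma wconst_sHTh: "wconst (- 1) sHTh"
  unfolding sHTh_def by (rule wconst_hshape)

lemma wconst_units: "wconst 0 (splain wX)" "wconst 0 (splain wComm)" "wconst 0 (splain wOne)"
  by (intro wconst_splain; simp add: wX_def wComm_def wOne_def)+

lemma wconst_sshift_1: "wconst (- 1) M \<Longrightarrow> wconst 0 (sshift 1 M)"
  using wconst_sshift[of "- 1" M 1] by simp

lemma bijI:
  assumes "\<And>s. s \<in> A \<Longrightarrow> f s \<in> B" "\<And>s s'. s \<in> A \<Longrightarrow> s' \<in> A \<Longrightarrow> f s = f s' \<Longrightarrow> s = s'"
    and "\<And>b. b \<in> B \<Longrightarrow> \<exists>s\<in>A. f s = b"
  shows "bij_betw f A B"
proof (rule bij_betw_imageI)
  show "inj_on f A"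
    using assms(2) by (rule inj_onI)
  show "f ` A = B"
  proof (intro equalityI subsetI)
    fix b
    assume "b \<in> B"
    from assms(3)[OF this] show "b \<in> f ` A"
      by blast
  qed (use assms(1) in blast)
qed

text \<open>The form in which the equivalences are proved: an explicit edge set \<open>es\<close>
  replaces the image of all edges. The constant \<open>k - 1\<close> is the -1 of hypertrees after
  multiplication by \<open>t\<close> to the power \<open>k\<close>.\<close>

lemma sequiv_glueI:
  fixes M :: "('a, 's, 'e) shape"
  assumes M: "is_shape M" and w: "wconst (k - 1) M"
    and inj: "\<And>I s j. finite I \<Longrightarrow> s \<in> str (sp M) I \<Longrightarrow> j \<in> ed M s \<Longrightarrow> inj_on (l I s j) (lb M s j)"
    and injE: "\<And>I s. finite I \<Longrightarrow> s \<in> str (sp M) I \<Longrightarrow> inj_on (\<lambda>j. l I s j ` lb M s j) (ed M s)"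
    and img: "\<And>I s. finite I \<Longrightarrow> s \<in> str (sp M) I \<Longrightarrow> (\<lambda>j. l I s j ` lb M s j) ` ed M s = es I s"
    and bij: "\<And>I. finite I \<Longrightarrow> bij_betw (\<lambda>s. (es I s, pt I s)) (str (sp M) I) (K I)"
    and nat: "\<And>I s \<sigma> j x. finite I \<Longrightarrow> s \<in> str (sp M) I \<Longrightarrow> inj_on \<sigma> I \<Longrightarrow> j \<in> ed M s \<Longrightarrow> x \<in> lb M s j \<Longrightarrow>
      l (\<sigma> ` I) (tr (sp M) I \<sigma> s) (et M I \<sigma> s j) (lt M I \<sigma> s j x) = ex I \<sigma> (l I s j x)"
    and pt: "\<And>I s \<sigma>. finite I \<Longrightarrow> s \<in> str (sp M) I \<Longrightarrow> inj_on \<sigma> I \<Longrightarrow>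
      pt (\<sigma> ` I) (tr (sp M) I \<sigma> s) = pm (ex I \<sigma>) (pt I s)"
  shows "\<exists>\<phi> \<epsilon> l. sequiv M (sshift k (hshape K ex pm)) \<phi> \<epsilon> l"
proof -
  have "wconst (k - 1) (sshift k (hshape K ex pm))"
    using wconst_sshift[OF wconst_hshape, of k K ex pm] by simp
  moreover have "bij_betw (\<lambda>s. ((\<lambda>j. l I s j ` lb M s j) ` ed M s, pt I s)) (str (sp M) I) (K I)" if "finite I" for I
    using bij[OF that] img[OF that] by (simp cong: bij_betw_cong)
  ultimately have "sequiv M (sshift k (hshape K ex pm))
      (\<lambda>I s. ((\<lambda>j. l I s j ` lb M s j) ` ed M s, pt I s)) (\<lambda>I s j. l I s j ` lb M s j) l"
    by (intro sequiv_hshapeI[OF M w]) (simp_all add: inj injE nat pt)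
  then show ?thesis
    by blast
qed

lemmas sequiv_sHTI = sequiv_glueI[where K = "\<lambda>I. {(E, p). hypertree I E \<and> p \<in> P I E}" and ex = "\<lambda>I \<sigma>. \<sigma>",
    folded sHT_def] for P

lemmas sequiv_sHThI = sequiv_glueI[where K = hollow and ex = ext_map and pm = "\<lambda>\<sigma> p. p", folded sHTh_def]

lemma mem_sprod_sX:
  "s \<in> str (sp (sprod (sshift k sX) N)) I \<longleftrightarrow> (\<exists>v y. s = ({v}, I - {v}, {v}, y) \<and> v \<in> I \<and> y \<in> str (sp N) (I - {v}))"
  by (cases s) (auto simp: mem_str_sprod str_wX)

text \<open>The factor X singles out the root \<open>v\<close>, and the point that the derivative
  adds to the remaining vertices stands for it.\<close>

lemma sequiv_root: "\<exists>\<phi> \<epsilon> l. sequiv (sprod sX (sderiv sTree)) (sshift 0 sRoot) \<phi> \<epsilon> l"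
proof (rule sequiv_sHTI[where l = "\<lambda>I (A, B, x, y) j. kappa B (the_elem A)" and pt = "\<lambda>I (A, B, x, y). the_elem A"
      and es = "\<lambda>I (A, B, x, y). image (kappa B (the_elem A)) ` fst y"])
  let ?M = "sprod sX (sderiv sTree)"
  show "is_shape ?M"
    by (intro is_shape_sprod is_shape_splain_wX is_shape_sderiv is_shape_pointings)
  show "wconst (0 - 1) ?M"
    using wconst_sprod[OF is_shape_splain_wX is_shape_sderiv[OF is_shape_pointings(1)] wconst_units(1)
        wconst_sderiv[OF wconst_sHT]] by simp
  have form: "\<exists>v E. s = ({v}, I - {v}, {v}, (E, ())) \<and> v \<in> I \<and> hypertree (add_pt (I - {v})) E"
    if "s \<in> str (sp ?M) I" for s and I :: "'a lab set"
    using that mem_sprod_sX[of s 0 "sderiv sTree" I] by (auto simp: sshift_0)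
  fix I :: "'a lab set"
  assume I: "finite I"
  have fin: "finite (I - {v})" "v \<notin> I - {v}" for v
    using I by auto
  let ?f = "\<lambda>s. (case s of (A, B, x, y) \<Rightarrow> image (kappa B (the_elem A)) ` fst y, case s of (A, B, x, y) \<Rightarrow> the_elem A)"
  have f: "?f ({v}, I - {v}, {v}, (E, ())) = (image (kappa (I - {v}) v) ` E, v)" for v E
    by simp
  show "bij_betw ?f (str (sp ?M) I) {(E, p). hypertree I E \<and> p \<in> I}"
  proof (rule bijI)
    fix s
    assume "s \<in> str (sp ?M) I"
    from form[OF this] obtain v E where s: "s = ({v}, I - {v}, {v}, (E, ()))" and v: "v \<in> I" "hypertree (add_pt (I - {v})) E"
      by blast
    have "hypertree I (image (kappa (I - {v}) v) ` E)"
      using bij_betwE[OF kappa_trees[OF fin, of v]] v by (simp add: insert_absorb)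
    then show "?f s \<in> {(E, p). hypertree I E \<and> p \<in> I}"
      unfolding s f using v by simp
  next
    fix s s'
    assume "s \<in> str (sp ?M) I" "s' \<in> str (sp ?M) I" and eq: "?f s = ?f s'"
    from form[OF this(1)] form[OF this(2)] obtain v E v' E' where s: "s = ({v}, I - {v}, {v}, (E, ()))"
      "hypertree (add_pt (I - {v})) E" and s': "s' = ({v'}, I - {v'}, {v'}, (E', ()))" "hypertree (add_pt (I - {v'})) E'"
      by blast
    have "v = v'" "image (kappa (I - {v}) v) ` E = image (kappa (I - {v'}) v') ` E'"
      using eq unfolding s s' f by auto
    then show "s = s'"
      using inj_onD[OF bij_betw_imp_inj_on[OF kappa_trees[OF fin, of v]], of E E'] s s' by simp
  next
    fix b
    assume "b \<in> {(E, p). hypertree I E \<and> p \<in> I}"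
    then obtain F v where b: "b = (F, v)" "hypertree I F" "v \<in> I"
      by blast
    then have "F \<in> image (image (kappa (I - {v}) v)) ` {E. hypertree (add_pt (I - {v})) E}"
      using bij_betw_imp_surj_on[OF kappa_trees[OF fin, of v]] by (simp add: insert_absorb)
    then obtain E where E: "hypertree (add_pt (I - {v})) E" "F = image (kappa (I - {v}) v) ` E"
      by blast
    then have "({v}, I - {v}, {v}, (E, ())) \<in> str (sp ?M) I"
      using b mem_sprod_sX[of _ 0 "sderiv sTree" I] by (simp add: sshift_0)
    then show "\<exists>s\<in>str (sp ?M) I. ?f s = b"
      using E b by (intro bexI[of _ "({v}, I - {v}, {v}, (E, ()))"]) simp_all
  qed
  fix s
  assume "s \<in> str (sp ?M) I"
  from form[OF this] obtain v E where s: "s = ({v}, I - {v}, {v}, (E, ()))" and v: "v \<in> I" and ht: "hypertree (add_pt (I - {v})) E"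
    by blast
  note k = kappa_facts[OF fin(1) fin(2)[of v]]
  show "(\<lambda>j. (case s of (A, B, x, y) \<Rightarrow> \<lambda>j. kappa B (the_elem A)) j ` lb ?M s j) ` ed ?M s =
      (case s of (A, B, x, y) \<Rightarrow> image (kappa B (the_elem A)) ` fst y)"
    by (simp add: s sprod_fields image_image)
  show "inj_on ((case s of (A, B, x, y) \<Rightarrow> \<lambda>j. kappa B (the_elem A)) j) (lb ?M s j)" if "j \<in> ed ?M s" for j
    using that inj_on_subset[OF k(1) hypertree_edge(1)[OF ht]] by (auto simp: s sprod_fields)
  show "inj_on (\<lambda>j. (case s of (A, B, x, y) \<Rightarrow> \<lambda>j. kappa B (the_elem A)) j ` lb ?M s j) (ed ?M s)"
    using hypertree_image_edges(1)[OF ht k(1)] by (auto simp: s sprod_fields inj_on_def)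
  fix \<sigma> :: "'a lab \<Rightarrow> 'a lab"
  assume \<sigma>: "inj_on \<sigma> I"
  show "(case tr (sp ?M) I \<sigma> s of (A, B, x, y) \<Rightarrow> the_elem A) = \<sigma> (case s of (A, B, x, y) \<Rightarrow> the_elem A)"
    by (simp add: s tr_sprod)
  show "(case tr (sp ?M) I \<sigma> s of (A, B, x, y) \<Rightarrow> \<lambda>j. kappa B (the_elem A)) (et ?M I \<sigma> s j) (lt ?M I \<sigma> s j x) =
      \<sigma> ((case s of (A, B, x, y) \<Rightarrow> \<lambda>j. kappa B (the_elem A)) j x)" if j: "j \<in> ed ?M s" "x \<in> lb ?M s j" for j x
  proof -
    have "j \<in> Inr ` E"
      using j(1) by (simp add: s sprod_fields)
    then obtain e where e: "j = Inr e" "e \<in> E"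
      by (rule imageE)
    have "x \<in> e"
      using j(2) by (simp add: s sprod_fields e(1))
    with e(2) have "x \<in> add_pt (I - {v})"
      using hypertree_edge(1)[OF ht] by blast
    from kappa_natural[OF fin(1) this] show ?thesis
      by (simp add: s tr_sprod sprod_fields e(1))
  qed
qed

text \<open>The one edge of \<open>sset\<close> has the blocks of the partition as labels; replacing
  each block by the root of the hypertree on it gives the pointed edge. The other edges keep their
  labels.\<close>

lemma sequiv_edge: "\<exists>\<phi> \<epsilon> l. sequiv (scomp sset (sshift 1 sRoot)) (sshift 0 sEdge) \<phi> \<epsilon> l"
proof (rule sequiv_sHTI[where l = "\<lambda>I (\<pi>, x, y) j. case j of Inl u \<Rightarrow> (\<lambda>z. snd (y (unblk z))) | Inr q \<Rightarrow> (\<lambda>z. z)"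
      and pt = "\<lambda>I (\<pi>, x, y). (snd \<circ> y) ` \<pi>" and es = "\<lambda>I (\<pi>, x, y). glueE {} \<pi> y"])
  let ?M = "scomp sset (sshift 1 sRoot)"
  let ?l = "\<lambda>s. case s of (\<pi>, x, y) \<Rightarrow> \<lambda>j. case j of Inl u \<Rightarrow> (\<lambda>z. snd (y (unblk z))) | Inr q \<Rightarrow> (\<lambda>z. z)"
  show M: "is_shape ?M"
    by (intro is_shape_scomp is_shape_sset is_shape_sshift is_shape_pointings)
  show "wconst (0 - 1) ?M"
    using wconst_scomp[OF is_shape_sset is_shape_sshift[OF is_shape_pointings(2)] wconst_sset
        wconst_sshift_1[OF wconst_sHT]] by simp
  fix I :: "'a lab set"
  assume I: "finite I"
  have Z: "finite {}" "{} \<inter> I = {}"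
    by auto
  \<comment> \<open>The cardinality of the empty set \<open>Z\<close> is kept in the inequality to
    match the gluing lemmas; the bound itself is that of \<open>sset\<close>.\<close>
  have mem: "(\<pi>, x, y) \<in> str (sp ?M) I \<longleftrightarrow> partition_on I \<pi> \<and> x = blk ` \<pi> \<and> y \<in> PiE \<pi> rooted \<and> card \<pi> + card ({} :: 'a lab set) \<ge> 2"
    for \<pi> x and y :: "'a lab set \<Rightarrow> 'a lab set set \<times> 'a lab"
    using card_image[OF partition_facts(5)[OF _ I, of \<pi>]] by (auto simp: mem_str_scomp rooted_def split: if_splits)
  have root: "(\<lambda>z. snd (y (unblk z))) ` blk ` \<pi> = (snd \<circ> y) ` \<pi> \<union> {}" if "partition_on I \<pi>"
    for \<pi> and y :: "'a lab set \<Rightarrow> 'a lab set set \<times> 'a lab"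
    using partition_facts(6)[OF that I] by (auto simp: image_image)
  let ?f = "\<lambda>s. (case s of (\<pi>, x, y) \<Rightarrow> glueE {} \<pi> y, case s of (\<pi>, x, y) \<Rightarrow> (snd \<circ> y) ` \<pi>)"
  show "bij_betw ?f (str (sp ?M) I) {(E, p). hypertree I E \<and> p \<in> E}"
  proof (rule bijI)
    fix s
    assume s: "s \<in> str (sp ?M) I"
    obtain \<pi> x y where s_eq: "s = (\<pi>, x, y)"
      by (cases s)
    have m: "partition_on I \<pi>" "y \<in> PiE \<pi> rooted" "card \<pi> + card ({} :: 'a lab set) \<ge> 2"
      using s unfolding s_eq mem by auto
    have "(snd \<circ> y) ` \<pi> \<in> glueE {} \<pi> y"
      by (simp add: glueE_def)
    then show "?f s \<in> {(E, p). hypertree I E \<and> p \<in> E}"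
      using glueE_facts(1)[OF I Z m] by (simp add: s_eq)
  next
    fix s s'
    assume s: "s \<in> str (sp ?M) I" and s': "s' \<in> str (sp ?M) I" and eq: "?f s = ?f s'"
    obtain \<pi> x y \<pi>' x' y' where s_eq: "s = (\<pi>, x, y)" "s' = (\<pi>', x', y')"
      by (cases s, cases s')
    note m = s[unfolded s_eq mem] and m' = s'[unfolded s_eq mem]
    show "s = s'"
      using glueE_eqD[OF I Z, of \<pi> y \<pi>' y'] m m' eq by (simp add: s_eq)
  next
    fix b
    assume "b \<in> {(E, p). hypertree I E \<and> p \<in> E}"
    then obtain E e where b: "b = (E, e)" "hypertree (I \<union> {}) E" "e \<in> E"
      by auto
    obtain \<pi> y where "partition_on I \<pi>" "y \<in> PiE \<pi> rooted" "E = glueE {} \<pi> y" "e = (snd \<circ> y) ` \<pi> \<union> {}" "card \<pi> + card ({} :: 'a lab set) \<ge> 2"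
      by (rule glueE_surj[OF b(2,3)]) auto
    then show "\<exists>s\<in>str (sp ?M) I. ?f s = b"
      using mem[of \<pi> "blk ` \<pi>" y] b(1) by (intro bexI[of _ "(\<pi>, blk ` \<pi>, y)"]) simp_all
  qed
  fix s
  assume s: "s \<in> str (sp ?M) I"
  obtain \<pi> x y where s_eq: "s = (\<pi>, x, y)"
    by (cases s)
  have \<pi>: "partition_on I \<pi>" and x: "x = blk ` \<pi>" and y: "y \<in> PiE \<pi> rooted" and c: "card \<pi> + card ({} :: 'a lab set) \<ge> 2"
    using s[unfolded s_eq mem] by auto
  note p = partition_facts[OF \<pi> I]
  note facts = glueE_facts[OF I Z \<pi> y c]
  show "(\<lambda>j. ?l s j ` lb ?M s j) ` ed ?M s = (case s of (\<pi>, x, y) \<Rightarrow> glueE {} \<pi> y)"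
    using root[OF \<pi>, of y] by (auto simp: s_eq x scomp_fields glueE_def Plus_def image_Un image_image image_UN)
  show "inj_on (?l s j) (lb ?M s j)" if "j \<in> ed ?M s" for j
  proof (cases j)
    case (Inl u)
    have "inj_on (\<lambda>z. snd (y (unblk z))) (blk ` \<pi>)"
    proof (rule inj_on_imageI)
      show "inj_on ((\<lambda>z. snd (y (unblk z))) \<circ> blk) \<pi>"
        using glueE_inj_root[OF I Z \<pi> y] by (rule inj_on_cong[THEN iffD2, rotated]) (simp only: comp_apply p(6))
    qed
    then show ?thesis
      by (simp add: Inl s_eq x scomp_fields)
  qed (simp add: s_eq)
  show "inj_on (\<lambda>j. ?l s j ` lb ?M s j) (ed ?M s)"
    using glueE_inj[OF I Z \<pi> y] facts(2) root[OF \<pi>, of y]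
    by (fastforce simp: s_eq x scomp_fields inj_on_def image_iff)
  fix \<sigma> :: "'a lab \<Rightarrow> 'a lab"
  assume \<sigma>: "inj_on \<sigma> I"
  note q = partition_image[OF \<pi> I \<sigma>]
  have snd_ftr: "snd (ftr (sp sRoot) I \<sigma> \<pi> y (\<sigma> ` J)) = \<sigma> (snd (y J))" if "J \<in> \<pi>" for J
    using ftr_apply[OF \<pi> I \<sigma> that, of "sp sRoot" y] by (cases "y J") simp
  show "(case tr (sp ?M) I \<sigma> s of (\<pi>, x, y) \<Rightarrow> (snd \<circ> y) ` \<pi>) = \<sigma> ` (case s of (\<pi>, x, y) \<Rightarrow> (snd \<circ> y) ` \<pi>)"
    using snd_ftr by (simp add: s_eq tr_scomp image_image)
  show "?l (tr (sp ?M) I \<sigma> s) (et ?M I \<sigma> s j) (lt ?M I \<sigma> s j z) = \<sigma> (?l s j z)"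
    if jz: "j \<in> ed ?M s" "z \<in> lb ?M s j" for j z
  proof (cases j)
    case (Inl u)
    then obtain J where J: "J \<in> \<pi>" "z = blk J"
      using jz by (auto simp: s_eq x scomp_fields)
    then show ?thesis
      using q(5)[OF J(1)] p(6)[OF J(1)] snd_ftr[OF J(1)] unblk_blk[OF finite_imageI[OF p(2)[OF J(1)]], of \<sigma>]
      by (simp add: Inl s_eq tr_scomp scomp_fields)
  next
    case (Inr q)
    then show ?thesis
      using jz by (auto simp: s_eq tr_scomp scomp_fields)
  qed
qed

section \<open>Cutting rooted hypertrees at the root\<close>

lemma bij_betw_param:
  assumes g: "bij_betw g P T" and A: "A = mk ` P" and f: "\<And>p. p \<in> P \<Longrightarrow> f (mk p) = g p"
  shows "bij_betw f A T"
proof (rule bij_betw_imageI)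
  show "inj_on f A"
    unfolding A
  proof (rule inj_on_imageI)
    show "inj_on (f \<circ> mk) P"
      using bij_betw_imp_inj_on[OF g] f by (simp cong: inj_on_cong)
  qed
  show "f ` A = T"
    using bij_betw_imp_surj_on[OF g] f by (simp add: A image_image)
qed

text \<open>A rooted hypertree is determined by the hollow hypertrees into which it is cut at its root.\<close>

definition cuts :: "'a lab set \<Rightarrow> ('a lab \<times> 'a lab set set \<times> ('a lab set \<Rightarrow> 'a lab set set \<times> unit)) set" where
  "cuts I = {(v, \<pi>, y). v \<in> I \<and> partition_on (I - {v}) \<pi> \<and> y \<in> PiE \<pi> hollow}"

lemma bij_cuts:
  assumes I: "finite I"
  shows "bij_betw (\<lambda>(v, \<pi>, y). (glueV v \<pi> y, v)) (cuts I) {(E, v). hypertree I E \<and> v \<in> I}"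
proof (rule bijI)
  fix s
  assume "s \<in> cuts I"
  then obtain v \<pi> y where s: "s = (v, \<pi>, y)" "v \<in> I" "partition_on (I - {v}) \<pi>" "y \<in> PiE \<pi> hollow"
    by (auto simp: cuts_def)
  then show "(case s of (v, \<pi>, y) \<Rightarrow> (glueV v \<pi> y, v)) \<in> {(E, v). hypertree I E \<and> v \<in> I}"
    using glueV_hypertree[OF I s(2-4)] by simp
next
  fix s s'
  assume "s \<in> cuts I" "s' \<in> cuts I"
    and eq: "(case s of (v, \<pi>, y) \<Rightarrow> (glueV v \<pi> y, v)) = (case s' of (v, \<pi>, y) \<Rightarrow> (glueV v \<pi> y, v))"
  then obtain v \<pi> y v' \<pi>' y' where s: "s = (v, \<pi>, y)" "v \<in> I" "partition_on (I - {v}) \<pi>" "y \<in> PiE \<pi> hollow"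
    and s': "s' = (v', \<pi>', y')" "partition_on (I - {v'}) \<pi>'" "y' \<in> PiE \<pi>' hollow"
    by (auto simp: cuts_def)
  have v: "v' = v"
    using eq by (simp add: s(1) s'(1))
  have g: "glueV v \<pi> y = glueV v \<pi>' y'"
    using eq by (simp add: s(1) s'(1) v)
  from glueV_eqD[OF I s(2-4) s'(2,3)[unfolded v] g] show "s = s'"
    by (simp add: s(1) s'(1) v)
next
  fix b
  assume "b \<in> {(E, v). hypertree I E \<and> v \<in> I}"
  then obtain E v where b: "b = (E, v)" "hypertree I E" "v \<in> I"
    by blast
  obtain \<pi> y where y: "partition_on (I - {v}) \<pi>" "y \<in> PiE \<pi> hollow" "E = glueV v \<pi> y"
    by (rule glueV_surj[OF I b(2,3)])
  then show "\<exists>s\<in>cuts I. (case s of (v, \<pi>, y) \<Rightarrow> (glueV v \<pi> y, v)) = b"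
    using b by (intro bexI[of _ "(v, \<pi>, y)"]) (simp_all add: cuts_def)
qed

text \<open>The edge through the gap; in a hollow hypertree it is unique, so \<open>the_elem\<close>
  is meaningful.\<close>

definition hedge :: "'a lab set \<Rightarrow> 'a lab set set \<times> unit \<Rightarrow> 'a lab set" where
  "hedge J h = the_elem {f \<in> fst h. blk J \<in> f}"

lemma hedge:
  assumes "h \<in> hollow J"
  shows "{f \<in> fst h. blk J \<in> f} = {hedge J h}"
proof -
  have "card {f \<in> fst h. blk J \<in> f} = 1"
    using assms by (auto simp: hollow_def)
  then obtain f where "{f \<in> fst h. blk J \<in> f} = {f}"
    by (rule card_1_singletonE)
  then show ?thesis
    by (simp add: hedge_def)
qed

lemma hedge_mem:
  assumes "h \<in> hollow J"
  shows "hedge J h \<in> fst h" "blk J \<in> hedge J h" "f \<in> fst h \<Longrightarrow> blk J \<in> f \<Longrightarrow> f = hedge J h"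
  using hedge[OF assms] by blast+

lemma hedge_natural:
  assumes h: "h \<in> hollow J" and J: "finite J" and \<sigma>: "inj_on \<sigma> J"
  shows "hedge (\<sigma> ` J) (tr (sp sHTh) J \<sigma> h) = ext_map J \<sigma> ` hedge J h"
proof -
  have h': "tr (sp sHTh) J \<sigma> h \<in> hollow (\<sigma> ` J)"
    using is_shapeD(3)[OF is_shape_sHTh J _ \<sigma>, of h] h by simp
  have "blk (\<sigma> ` J) \<in> ext_map J \<sigma> ` hedge J h"
    using imageI[OF hedge_mem(2)[OF h], of "ext_map J \<sigma>"] by (simp only: ext_map_simps(1))
  moreover have "ext_map J \<sigma> ` hedge J h \<in> fst (tr (sp sHTh) J \<sigma> h)"
    using hedge_mem(1)[OF h] by simp
  ultimately show ?thesis
    using hedge_mem(3)[OF h'] by simp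
qed

text \<open>A pointed edge through the root \<open>v\<close> lies in one of the pieces at
  \<open>v\<close> and is the only edge of that piece through \<open>v\<close>. Pointing such an
  edge thus amounts to choosing a block.\<close>

lemma bij_cuts_edge:
  assumes I: "finite I"
  shows "bij_betw (\<lambda>((v, \<pi>, y), J). (glueV v \<pi> y, kappa J v ` hedge J (y J), v)) (SIGMA (v, \<pi>, y):cuts I. \<pi>)
    {(E, p). hypertree I E \<and> p \<in> {(e, v). e \<in> E \<and> v \<in> e}}" (is "bij_betw ?f _ _")
proof (rule bijI)
  have mem: "kappa J v ` hedge J (y J) \<in> image (kappa J v) ` fst (y J)" "v \<in> kappa J v ` hedge J (y J)"
    "kappa J v ` hedge J (y J) \<subseteq> insert v J"
    if "v \<in> I" "partition_on (I - {v}) \<pi>" "y \<in> PiE \<pi> hollow" "J \<in> \<pi>" for v J \<pi> and y :: "'a lab set \<Rightarrow> 'a lab set set \<times> unit"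
  proof -
    note p = glueV_part[OF I that(1-3) that(4)] and q = glueV_piece[OF I that(1-3) that(4)]
    show e: "kappa J v ` hedge J (y J) \<in> image (kappa J v) ` fst (y J)"
      using hedge_mem(1)[OF p(3)] by simp
    show "v \<in> kappa J v ` hedge J (y J)"
      using imageI[OF hedge_mem(2)[OF p(3)], of "kappa J v"] by (simp add: kappa_def)
    show "kappa J v ` hedge J (y J) \<subseteq> insert v J"
      by (rule hypertree_edge(1)[OF q(1) e])
  qed
  {
    fix s
    assume "s \<in> (SIGMA (v, \<pi>, y):cuts I. \<pi>)"
    then obtain v \<pi> y J where s: "s = ((v, \<pi>, y), J)" "v \<in> I" "partition_on (I - {v}) \<pi>" "y \<in> PiE \<pi> hollow" "J \<in> \<pi>"
      by (auto simp: cuts_def)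
    have "kappa J v ` hedge J (y J) \<in> glueV v \<pi> y"
      using mem(1)[OF s(2-5)] s(5) by (auto simp: glueV_def)
    then show "?f s \<in> {(E, p). hypertree I E \<and> p \<in> {(e, v). e \<in> E \<and> v \<in> e}}"
      using glueV_hypertree[OF I s(2-4)] mem(2)[OF s(2-5)] by (simp add: s(1))
  next
    fix s s'
    assume "s \<in> (SIGMA (v, \<pi>, y):cuts I. \<pi>)" "s' \<in> (SIGMA (v, \<pi>, y):cuts I. \<pi>)" and eq: "?f s = ?f s'"
    then obtain v \<pi> y J v' \<pi>' y' J' where
      s: "s = ((v, \<pi>, y), J)" "v \<in> I" "partition_on (I - {v}) \<pi>" "y \<in> PiE \<pi> hollow" "J \<in> \<pi>"
      and s': "s' = ((v', \<pi>', y'), J')" "partition_on (I - {v'}) \<pi>'" "y' \<in> PiE \<pi>' hollow" "J' \<in> \<pi>'"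
      by (auto simp: cuts_def)
    have v: "v' = v"
      using eq by (simp add: s(1) s'(1))
    have g: "glueV v \<pi> y = glueV v \<pi>' y'" and e: "kappa J' v ` hedge J' (y' J') = kappa J v ` hedge J (y J)"
      using eq by (simp_all add: s(1) s'(1) v)
    note \<pi>y = glueV_eqD[OF I s(2-4) s'(2,3)[unfolded v] g]
    have J': "J' \<in> \<pi>"
      using s'(4) \<pi>y(1) by simp
    have e': "kappa J' v ` hedge J' (y J') = kappa J v ` hedge J (y J)"
      using e unfolding \<pi>y(2)[symmetric] .
    have "J = J'"
      by (rule glueV_same[OF I s(2-4) J' s(5) mem(1)[OF s(2-5)] mem(3)[OF s(2-4) J', unfolded e']])
    then show "s = s'"
      using \<pi>y v by (simp add: s(1) s'(1))
  next
    fix b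
    assume "b \<in> {(E, p). hypertree I E \<and> p \<in> {(e, v). e \<in> E \<and> v \<in> e}}"
    then obtain E e v where b: "b = (E, e, v)" "hypertree I E" "e \<in> E" "v \<in> e"
      by blast
    have v: "v \<in> I"
      using hypertree_edge(1)[OF b(2,3)] b(4) by blast
    obtain \<pi> y where y: "partition_on (I - {v}) \<pi>" "y \<in> PiE \<pi> hollow" "E = glueV v \<pi> y"
      by (rule glueV_surj[OF I b(2) v])
    obtain J f where J: "J \<in> \<pi>" and f: "f \<in> fst (y J)" "e = kappa J v ` f"
      using b(3) by (auto simp: y(3) glueV_def)
    note p = glueV_part[OF I v y(1,2) J]
    have "blk J \<in> f"
      using kappa_facts(3)[OF p(1,2) glueV_piece(4)[OF I v y(1,2) J f(1)]] b(4) f(2) by simp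
    from hedge_mem(3)[OF p(3) f(1) this] have "e = kappa J v ` hedge J (y J)"
      by (simp add: f(2))
    then show "\<exists>s\<in>SIGMA (v, \<pi>, y):cuts I. \<pi>. ?f s = b"
      using b(1) v y J by (intro bexI[of _ "((v, \<pi>, y), J)"]) (simp_all add: cuts_def)
  }
qed

context
  fixes I :: "'a lab set" and v \<pi> and y :: "'a lab set \<Rightarrow> 'a lab set set \<times> unit"
  assumes I: "finite I" and cut: "(v, \<pi>, y) \<in> cuts I"
begin

lemma cutsD: "v \<in> I" "partition_on (I - {v}) \<pi>" "y \<in> PiE \<pi> hollow" "finite (I - {v})"
  using cut I by (auto simp: cuts_def)

lemma cuts_inj_edges: "inj_on (\<lambda>p. kappa (fst p) v ` snd p) (SIGMA J:\<pi>. fst (y J))"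
  using glueV_inj[OF I cutsD(1-3)] by (simp add: case_prod_unfold)

lemma cuts_image: "(\<lambda>p. kappa (fst p) v ` snd p) ` (SIGMA J:\<pi>. fst (y J)) = glueV v \<pi> y"
  by (auto simp: glueV_def image_iff) blast+

lemma cuts_inj:
  assumes "J \<in> \<pi>" "f \<in> fst (y J)"
  shows "inj_on (kappa J v) f"
  using kappa_facts(1)[OF glueV_part(1,2)[OF I cutsD(1-3) assms(1)]] glueV_piece(4)[OF I cutsD(1-3) assms]
  by (rule inj_on_subset)

lemma cuts_natural:
  assumes "J \<in> \<pi>" "f \<in> fst (y J)" "x \<in> f"
  shows "kappa (\<sigma> ` J) (\<sigma> v) (ext_map J \<sigma> x) = \<sigma> (kappa J v x)"
  using glueV_part(1)[OF I cutsD(1-3) assms(1)]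
    subsetD[OF glueV_piece(4)[OF I cutsD(1-3) assms(1,2)] assms(3)] by (rule kappa_natural)

end

lemma card_blk:
  assumes "partition_on I \<pi>" "finite I"
  shows "card (blk ` \<pi>) = card \<pi>"
  using card_image[OF partition_facts(5)[OF assms]] .

text \<open>\<open>Comm\<close> supplies only non-empty partitions. The remaining case, a root with
  nothing to cut off, is the one-vertex hypertree, and this is the separate summand X.\<close>

lemma sequiv_root_cut:
  "\<exists>\<phi> \<epsilon> l. sequiv (ssum (splain wX) (sprod sX (scomp sComm (sshift 1 sHTh)))) (sshift 1 sRoot) \<phi> \<epsilon> l"
\<comment> \<open>An edge over the block \<open>J\<close> has the form
  \<open>Inr (Inr (J, f))\<close> in the second summand, so \<open>fst (projr (projr j))\<close> is
  the block whose gap is renamed to the root.\<close>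
proof (rule sequiv_sHTI[where l = "\<lambda>I s j. case s of Inl A \<Rightarrow> (\<lambda>z. z) | Inr (A, B, x, y) \<Rightarrow> kappa (fst (projr (projr j))) (the_elem A)"
      and pt = "\<lambda>I s. case s of Inl A \<Rightarrow> the_elem A | Inr (A, B, x, y) \<Rightarrow> the_elem A"
      and es = "\<lambda>I s. case s of Inl A \<Rightarrow> {} | Inr (A, B, x, \<pi>, c, y) \<Rightarrow> glueV (the_elem A) \<pi> y"])
  let ?C = "scomp sComm (sshift 1 sHTh)"
  let ?M = "ssum (splain wX) (sprod sX ?C)"
  let ?l = "\<lambda>s j. case s of Inl A \<Rightarrow> (\<lambda>z. z) | Inr (A, B, x, y) \<Rightarrow> kappa (fst (projr (projr j))) (the_elem A)"
  have C: "is_shape ?C"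
    by (intro is_shape_scomp is_shape_splain_wComm is_shape_sshift is_shape_sHTh)
  show "is_shape ?M"
    by (intro is_shape_ssum is_shape_sprod C is_shape_splain_wX)
  \<comment> \<open>The one-vertex hypertree weighs \<open>t\<close> to the power -1; multiplied by
    \<open>t\<close>, it has the weight of X, which is \<open>t\<close> to the power 0.\<close>
  show "wconst (1 - 1) ?M"
    using wconst_ssum[OF wconst_units(1) wconst_sprod[OF is_shape_splain_wX C wconst_units(1)
      wconst_scomp[OF is_shape_splain_wComm is_shape_sshift[OF is_shape_sHTh] wconst_units(2)
        wconst_sshift_1[OF wconst_sHTh]], simplified]] by simp
  fix I :: "'a lab set"
  assume I: "finite I"
  \<comment> \<open>Both summands are enumerated by \<open>cuts\<close> at once: X corresponds to
    the empty partition, the product to the non-empty ones.\<close>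
  let ?mk = "\<lambda>(v, \<pi>, y). if \<pi> = {} then Inl {v} else Inr ({v}, I - {v}, {v}, \<pi>, blk ` \<pi>, y)"
  have comm: "c \<in> str wComm (blk ` \<pi>) \<longleftrightarrow> c = blk ` \<pi> \<and> \<pi> \<noteq> {}" if "partition_on K \<pi>" "finite K" for c K \<pi>
    using card_gt_0_iff[of "blk ` \<pi>"] partition_facts(1)[OF that] by (auto simp: wComm_def)
  have str: "str (sp ?M) I = ?mk ` cuts I"
  proof (intro equalityI subsetI)
    fix s
    assume s: "s \<in> str (sp ?M) I"
    show "s \<in> ?mk ` cuts I"
    proof (cases s)
      case (Inl A)
      then obtain v where "I = {v}" "A = {v}"
        using s by (auto simp: str_wX)
      then have "(v, {}, \<lambda>_. undefined) \<in> cuts I" "s = ?mk (v, {}, \<lambda>_. undefined)"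
        using Inl by (simp_all add: cuts_def partition_on_def)
      then show ?thesis
        by (rule rev_image_eqI)
    next
      case (Inr t)
      then have "t \<in> str (sp (sprod (sshift 0 sX) ?C)) I"
        using s by (auto simp: sshift_0)
      from this[unfolded mem_sprod_sX] obtain v w where v: "t = ({v}, I - {v}, {v}, w)" "v \<in> I" "w \<in> str (sp ?C) (I - {v})"
        by blast
      obtain \<pi> c y where w: "w = (\<pi>, c, y)"
        by (cases w)
      have m: "partition_on (I - {v}) \<pi>" "c \<in> str wComm (blk ` \<pi>)" "y \<in> PiE \<pi> hollow"
        using v(3) by (auto simp: w mem_str_scomp)
      then have "c = blk ` \<pi>" "\<pi> \<noteq> {}"
        using comm[OF m(1)] I by auto
      then have "(v, \<pi>, y) \<in> cuts I" "s = ?mk (v, \<pi>, y)"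
        using m v(2) by (simp_all add: cuts_def Inr v(1) w)
      then show ?thesis
        by (rule rev_image_eqI)
    qed
  next
    fix s
    assume "s \<in> ?mk ` cuts I"
    then obtain v \<pi> y where p: "(v, \<pi>, y) \<in> cuts I" and s: "s = ?mk (v, \<pi>, y)"
      by auto
    note d = cutsD[OF I p]
    show "s \<in> str (sp ?M) I"
    proof (cases "\<pi> = {}")
      case True
      then have "I = {v}"
        using d(1,2) by (auto simp: partition_on_def)
      then show ?thesis
        using True by (simp add: s str_wX InlI)
    next
      case False
      then have "(\<pi>, blk ` \<pi>, y) \<in> str (sp ?C) (I - {v})"
        using d comm[OF d(2,4)] by (simp add: mem_str_scomp)
      then have "({v}, I - {v}, {v}, \<pi>, blk ` \<pi>, y) \<in> str (sp (sprod (sshift 0 sX) ?C)) I"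
        unfolding mem_sprod_sX using d(1) by blast
      then show ?thesis
        using False by (simp add: s sshift_0 InrI)
    qed
  qed
  show "bij_betw (\<lambda>s. (case s of Inl A \<Rightarrow> {} | Inr (A, B, x, \<pi>, c, y) \<Rightarrow> glueV (the_elem A) \<pi> y,
      case s of Inl A \<Rightarrow> the_elem A | Inr (A, B, x, y) \<Rightarrow> the_elem A)) (str (sp ?M) I) {(E, p). hypertree I E \<and> p \<in> I}"
  proof (rule bij_betw_param[OF bij_cuts[OF I] str])
    fix p
    assume "p \<in> cuts I"
    obtain v \<pi> y where p: "p = (v, \<pi>, y)"
      by (cases p)
    show "(case ?mk p of Inl A \<Rightarrow> {} | Inr (A, B, x, \<pi>, c, y) \<Rightarrow> glueV (the_elem A) \<pi> y,
        case ?mk p of Inl A \<Rightarrow> the_elem A | Inr (A, B, x, y) \<Rightarrow> the_elem A) =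
        (case p of (v, \<pi>, y) \<Rightarrow> (glueV v \<pi> y, v))"
      by (cases "\<pi> = {}") (simp_all add: p glueV_def)
  qed
  fix s
  assume "s \<in> str (sp ?M) I"
  then obtain v \<pi> y where p: "(v, \<pi>, y) \<in> cuts I" and s: "s = ?mk (v, \<pi>, y)"
    unfolding str by auto
  have ed: "ed ?M s = (\<lambda>p. Inr (Inr p)) ` (SIGMA J:\<pi>. fst (y J))"
    by (cases "\<pi> = {}") (simp_all add: s sprod_fields scomp_fields image_image)
  have l: "?l s (Inr (Inr (J, f))) = kappa J v" "lb ?M s (Inr (Inr (J, f))) = f" if "J \<in> \<pi>" for J f
    using that by (auto simp: s sprod_fields scomp_fields)
  have ll: "?l s (Inr (Inr p)) ` lb ?M s (Inr (Inr p)) = kappa (fst p) v ` snd p" if pm: "p \<in> (SIGMA J:\<pi>. fst (y J))" for p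
  proof -
    obtain J f where q: "p = (J, f)" "J \<in> \<pi>"
      using pm by (rule SigmaE)
    show ?thesis
      unfolding q(1) l[OF q(2)] by simp
  qed
  show "(\<lambda>j. ?l s j ` lb ?M s j) ` ed ?M s =
      (case s of Inl A \<Rightarrow> {} | Inr (A, B, x, \<pi>, c, y) \<Rightarrow> glueV (the_elem A) \<pi> y)"
  proof -
    have "(\<lambda>j. ?l s j ` lb ?M s j) ` ed ?M s = (\<lambda>p. kappa (fst p) v ` snd p) ` (SIGMA J:\<pi>. fst (y J))"
      unfolding ed image_image using ll by (rule image_cong[OF refl])
    then show ?thesis
      unfolding cuts_image[OF I p] by (simp add: s glueV_def)
  qed
  show "inj_on (?l s j) (lb ?M s j)" if jed: "j \<in> ed ?M s" for j
  proof -
    obtain J f where j: "j = Inr (Inr (J, f))" "J \<in> \<pi>" "f \<in> fst (y J)"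
      using jed unfolding ed by auto
    show ?thesis
      unfolding j(1) l[OF j(2)] by (rule cuts_inj[OF I p j(2,3)])
  qed
  show "inj_on (\<lambda>j. ?l s j ` lb ?M s j) (ed ?M s)"
    unfolding ed
  proof (rule inj_on_imageI)
    show "inj_on ((\<lambda>j. ?l s j ` lb ?M s j) \<circ> (\<lambda>p. Inr (Inr p))) (SIGMA J:\<pi>. fst (y J))"
      unfolding comp_def by (rule inj_on_cong[THEN iffD2, OF _ cuts_inj_edges[OF I p]]) (rule ll)
  qed
  fix \<sigma> :: "'a lab \<Rightarrow> 'a lab"
  assume \<sigma>: "inj_on \<sigma> I"
  show "(case tr (sp ?M) I \<sigma> s of Inl A \<Rightarrow> the_elem A | Inr (A, B, x, y) \<Rightarrow> the_elem A) =
      \<sigma> (case s of Inl A \<Rightarrow> the_elem A | Inr (A, B, x, y) \<Rightarrow> the_elem A)"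
    by (simp add: s tr_sprod)
  show "?l (tr (sp ?M) I \<sigma> s) (et ?M I \<sigma> s j) (lt ?M I \<sigma> s j z) = \<sigma> (?l s j z)"
    if jz: "j \<in> ed ?M s" "z \<in> lb ?M s j" for j z
  proof -
    obtain J f where j: "j = Inr (Inr (J, f))" "J \<in> \<pi>" "f \<in> fst (y J)"
      using jz(1) unfolding ed by auto
    have "z \<in> f"
      using jz(2) l(2)[OF j(2)] by (simp only: j(1))
    from cuts_natural[OF I p j(2,3) this, of \<sigma>] show ?thesis
      using j(2) by (auto simp: s j(1) tr_sprod tr_scomp sprod_fields scomp_fields)
  qed
qed

text \<open>A structure of the derivative of \<open>sset\<close> on the set of blocks is one edge
  labelled by the blocks and an added point. The blocks become the roots, as for edge-pointed
  hypertrees, and the added point becomes the gap, which therefore lies on this edge only.\<close>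

lemma sequiv_hollow: "\<exists>\<phi> \<epsilon> l. sequiv (scomp (sderiv sset) (sshift 1 sRoot)) (sshift 0 sHTh) \<phi> \<epsilon> l"
\<comment> \<open>The point added to the set of blocks goes to the gap \<open>blk I\<close>; every
  other label of this edge is a block, read off by \<open>unblk\<close>.\<close>
proof (rule sequiv_sHThI[where l = "\<lambda>I (\<pi>, x, y) j. case j of
        Inl u \<Rightarrow> (\<lambda>z. if z = blk (blk ` \<pi>) then blk I else snd (y (unblk z))) | Inr q \<Rightarrow> (\<lambda>z. z)"
      and pt = "\<lambda>I s. ()" and es = "\<lambda>I (\<pi>, x, y). glueE {blk I} \<pi> y"])
  let ?M = "scomp (sderiv sset) (sshift 1 sRoot)"
  let ?l = "\<lambda>I s. case s of (\<pi>, x, y) \<Rightarrow> \<lambda>j. case j of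
    Inl u \<Rightarrow> (\<lambda>z. if z = blk (blk ` \<pi>) then blk I else snd (y (unblk z))) | Inr q \<Rightarrow> (\<lambda>z. z)"
  show M: "is_shape ?M"
    by (intro is_shape_scomp is_shape_sderiv is_shape_sset is_shape_sshift is_shape_pointings)
  show "wconst (0 - 1) ?M"
    using wconst_scomp[OF is_shape_sderiv[OF is_shape_sset] is_shape_sshift[OF is_shape_pointings(2)]
        wconst_sderiv[OF wconst_sset] wconst_sshift_1[OF wconst_sHT]] by simp
  fix I :: "'a lab set"
  assume I: "finite I"
  have nI: "blk I \<notin> I"
    using I by (rule blk_notin)
  then have Z: "finite {blk I}" "{blk I} \<inter> I = {}"
    by auto
  have gap: "blk (blk ` \<pi>) \<notin> blk ` \<pi>" if "partition_on I \<pi>" for \<pi>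
    using partition_facts(1)[OF that I] by (intro blk_notin) simp
  have mem: "(\<pi>, x, y) \<in> str (sp ?M) I \<longleftrightarrow>
      partition_on I \<pi> \<and> x = add_pt (blk ` \<pi>) \<and> y \<in> PiE \<pi> rooted \<and> card \<pi> + card {blk I} \<ge> 2"
    for \<pi> x and y :: "'a lab set \<Rightarrow> 'a lab set set \<times> 'a lab"
  proof (cases "partition_on I \<pi>")
    case True
    have "card (add_pt (blk ` \<pi>)) = card \<pi> + 1"
      using gap[OF True] partition_facts(1)[OF True I] card_blk[OF True I] by (simp add: add_pt_def)
    then show ?thesis
      by (auto simp: mem_str_scomp rooted_def split: if_splits)
  qed (simp add: mem_str_scomp)
  \<comment> \<open>The gap belongs to no block and so to no edge of a rooted piece; the grafted
    edge is the only one through it.\<close>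
  have one: "{e \<in> glueE {blk I} \<pi> y. blk I \<in> e} = {(snd \<circ> y) ` \<pi> \<union> {blk I}}"
    if "partition_on I \<pi>" "y \<in> PiE \<pi> rooted" for \<pi> and y :: "'a lab set \<Rightarrow> 'a lab set set \<times> 'a lab"
  proof -
    have "blk I \<notin> f" if "J \<in> \<pi>" "f \<in> fst (y J)" for J f
      using hypertree_edge(1)[OF glueE_part(1)[OF I Z(1,2) \<open>partition_on I \<pi>\<close> \<open>y \<in> PiE \<pi> rooted\<close> that(1)] that(2)]
        partition_facts(3)[OF \<open>partition_on I \<pi>\<close> I that(1)] nI by blast
    then show ?thesis
      by (auto simp: glueE_def)
  qed
  let ?f = "\<lambda>s. (case s of (\<pi>, x, y) \<Rightarrow> glueE {blk I} \<pi> y, ())"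
  show "bij_betw ?f (str (sp ?M) I) (hollow I)"
  proof (rule bijI)
    fix s
    assume s: "s \<in> str (sp ?M) I"
    obtain \<pi> x y where s_eq: "s = (\<pi>, x, y)"
      by (cases s)
    have m: "partition_on I \<pi>" "y \<in> PiE \<pi> rooted" "card \<pi> + card {blk I} \<ge> 2"
      using s unfolding s_eq mem by auto
    show "?f s \<in> hollow I"
      using glueE_facts(1)[OF I Z m] one[OF m(1,2)] by (simp add: s_eq hollow_def add_pt_def)
  next
    fix s s'
    assume s: "s \<in> str (sp ?M) I" and s': "s' \<in> str (sp ?M) I" and eq: "?f s = ?f s'"
    obtain \<pi> x y \<pi>' x' y' where s_eq: "s = (\<pi>, x, y)" "s' = (\<pi>', x', y')"
      by (cases s, cases s')
    have m: "partition_on I \<pi>" "y \<in> PiE \<pi> rooted" "card \<pi> + card {blk I} \<ge> 2" "x = add_pt (blk ` \<pi>)"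
      and m': "partition_on I \<pi>'" "y' \<in> PiE \<pi>' rooted" "card \<pi>' + card {blk I} \<ge> 2" "x' = add_pt (blk ` \<pi>')"
      using s s' unfolding s_eq mem by auto
    have g: "glueE {blk I} \<pi> y = glueE {blk I} \<pi>' y'"
      using eq by (simp add: s_eq)
    have "{(snd \<circ> y) ` \<pi> \<union> {blk I}} = {(snd \<circ> y') ` \<pi>' \<union> {blk I}}"
      using one[OF m(1,2)] one[OF m'(1,2)] unfolding g by (rule trans[OF sym])
    then have "(snd \<circ> y) ` \<pi> \<union> {blk I} = (snd \<circ> y') ` \<pi>' \<union> {blk I}"
      by (rule singleton_inject)
    from glueE_eqD[OF I Z m(1-3) m'(1-3) g this] show "s = s'"
      by (simp add: s_eq m(4) m'(4))
  next
    fix b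
    assume "b \<in> hollow I"
    then obtain E where b: "b = (E, ())" "hypertree (I \<union> {blk I}) E" "card {f \<in> E. blk I \<in> f} = 1"
      by (cases b) (auto simp: hollow_def add_pt_def)
    obtain e where e: "{f \<in> E. blk I \<in> f} = {e}"
      using b(3) by (rule card_1_singletonE)
    then have e': "e \<in> E" "{blk I} \<subseteq> e" "\<forall>f\<in>E - {e}. f \<inter> {blk I} = {}"
      by auto
    obtain \<pi> y where y: "partition_on I \<pi>" "y \<in> PiE \<pi> rooted" "E = glueE {blk I} \<pi> y" "card \<pi> + card {blk I} \<ge> 2"
      by (rule glueE_surj[OF b(2) e'(1,2) Z(2) e'(3)])
    then show "\<exists>s\<in>str (sp ?M) I. ?f s = b"
      using mem[of \<pi> "add_pt (blk ` \<pi>)" y] b(1) by (intro bexI[of _ "(\<pi>, add_pt (blk ` \<pi>), y)"]) simp_all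
  qed
  fix s
  assume s: "s \<in> str (sp ?M) I"
  obtain \<pi> x y where s_eq: "s = (\<pi>, x, y)"
    by (cases s)
  have \<pi>: "partition_on I \<pi>" and x: "x = add_pt (blk ` \<pi>)" and y: "y \<in> PiE \<pi> rooted" and c: "card \<pi> + card {blk I} \<ge> 2"
    using s[unfolded s_eq mem] by auto
  note p = partition_facts[OF \<pi> I]
  note facts = glueE_facts[OF I Z \<pi> y c] and part = glueE_part[OF I Z \<pi> y]
  have ed: "ed ?M s = insert (Inl ()) (Inr ` (SIGMA J:\<pi>. fst (y J)))"
    by (auto simp: s_eq scomp_fields)
  have lI: "?l I s (Inl ()) (blk (blk ` \<pi>)) = blk I" "J \<in> \<pi> \<Longrightarrow> ?l I s (Inl ()) (blk J) = snd (y J)" for J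
    using gap[OF \<pi>] p(6)[of J] by (auto simp: s_eq image_iff)
  have lr: "?l I s (Inr q) = (\<lambda>z. z)" "lb ?M s (Inr q) = snd q" "lb ?M s (Inl ()) = insert (blk (blk ` \<pi>)) (blk ` \<pi>)" for q
    by (simp_all add: s_eq scomp_fields x add_pt_def case_prod_unfold)
  have limg: "?l I s (Inl ()) ` blk ` \<pi> = (snd \<circ> y) ` \<pi>"
    unfolding image_image by (rule image_cong[OF refl]) (simp only: lI(2) comp_apply)
  have root: "?l I s (Inl ()) ` lb ?M s (Inl ()) = (snd \<circ> y) ` \<pi> \<union> {blk I}"
    unfolding lr image_insert lI(1) limg by simp
  have rest: "(\<lambda>j. ?l I s j ` lb ?M s j) ` Inr ` (SIGMA J:\<pi>. fst (y J)) = (\<Union>J\<in>\<pi>. fst (y J))"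
    unfolding image_image lr image_ident by force
  show "(\<lambda>j. ?l I s j ` lb ?M s j) ` ed ?M s = (case s of (\<pi>, x, y) \<Rightarrow> glueE {blk I} \<pi> y)"
    unfolding ed image_insert root rest by (simp add: s_eq glueE_def)
  have rI: "snd (y J) \<noteq> blk I" if "J \<in> \<pi>" for J
    using part(2)[OF that] p(3)[OF that] nI by auto
  show "inj_on (?l I s j) (lb ?M s j)" if "j \<in> ed ?M s" for j
  proof (cases j)
    case (Inl u)
    have "inj_on (?l I s (Inl ())) (blk ` \<pi>)"
    proof (rule inj_on_imageI)
      show "inj_on (?l I s (Inl ()) \<circ> blk) \<pi>"
        using glueE_inj_root[OF I Z \<pi> y] by (rule inj_on_cong[THEN iffD2, rotated]) (simp only: comp_apply lI(2))
    qed
    moreover have "blk I \<notin> (snd \<circ> y) ` \<pi>"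
    proof
      assume "blk I \<in> (snd \<circ> y) ` \<pi>"
      then obtain J where J: "J \<in> \<pi>" "blk I = snd (y J)"
        by auto
      show False
        using rI[OF J(1)] J(2) by simp
    qed
    moreover have "blk ` \<pi> - {blk (blk ` \<pi>)} = blk ` \<pi>"
      using gap[OF \<pi>] by simp
    ultimately have "inj_on (?l I s (Inl ())) (insert (blk (blk ` \<pi>)) (blk ` \<pi>))"
      by (simp only: inj_on_insert lI(1) limg simp_thms)
    moreover have "j = Inl ()"
      using Inl by simp
    ultimately show ?thesis
      by (simp only: lr(3))
  qed (simp add: lr)
  show "inj_on (\<lambda>j. ?l I s j ` lb ?M s j) (ed ?M s)"
    unfolding ed
  proof (rule inj_on_insert[THEN iffD2], intro conjI)
    show "inj_on (\<lambda>j. ?l I s j ` lb ?M s j) (Inr ` (SIGMA J:\<pi>. fst (y J)))"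
      using glueE_inj[OF I Z \<pi> y] by (intro inj_on_imageI) (simp only: comp_def lr image_ident)
    have "?l I s (Inl ()) ` lb ?M s (Inl ()) \<notin> (\<lambda>j. ?l I s j ` lb ?M s j) ` Inr ` (SIGMA J:\<pi>. fst (y J))"
      using facts(2) unfolding root rest .
    then show "?l I s (Inl ()) ` lb ?M s (Inl ()) \<notin>
        (\<lambda>j. ?l I s j ` lb ?M s j) ` (Inr ` (SIGMA J:\<pi>. fst (y J)) - {Inl ()})"
      by blast
  qed
  fix \<sigma> :: "'a lab \<Rightarrow> 'a lab"
  assume \<sigma>: "inj_on \<sigma> I"
  note q = partition_image[OF \<pi> I \<sigma>]
  have snd_ftr: "snd (ftr (sp sRoot) I \<sigma> \<pi> y (\<sigma> ` J)) = \<sigma> (snd (y J))" if "J \<in> \<pi>" for J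
    using ftr_apply[OF \<pi> I \<sigma> that, of "sp sRoot" y] by (cases "y J") simp
  \<comment> \<open>After transport, too, the label of a block must not be mistaken for the point
    added to the set of blocks.\<close>
  have gap': "blk (\<sigma> ` J) \<noteq> blk (blk ` image \<sigma> ` \<pi>)" if "J \<in> \<pi>" for J
    using blk_notin[of "blk ` image \<sigma> ` \<pi>"] p(1) that by (metis finite_imageI imageI)
  have ext: "ext_map I \<sigma> z = \<sigma> z" if "z \<in> J" "J \<in> \<pi>" for z J
    using ext_map_simps(2)[OF I] p(3)[OF that(2)] that(1) by blast
  show "?l (\<sigma> ` I) (tr (sp ?M) I \<sigma> s) (et ?M I \<sigma> s j) (lt ?M I \<sigma> s j z) = ext_map I \<sigma> (?l I s j z)"
    if jz: "j \<in> ed ?M s" "z \<in> lb ?M s j" for j z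
  proof (cases j)
    case (Inl u)
    have t: "?l (\<sigma> ` I) (tr (sp ?M) I \<sigma> s) (et ?M I \<sigma> s j) = (\<lambda>z. if z = blk (blk ` image \<sigma> ` \<pi>) then blk (\<sigma> ` I)
        else snd (ftr (sp sRoot) I \<sigma> \<pi> y (unblk z)))" "lt ?M I \<sigma> s j = ext_map (blk ` \<pi>) (blk_map \<sigma>)"
      by (simp_all add: Inl s_eq tr_scomp scomp_fields)
    have j: "j = Inl ()"
      using Inl by simp
    have z: "z = blk (blk ` \<pi>) \<or> (\<exists>J\<in>\<pi>. z = blk J)"
      using jz(2) unfolding j lr(3) by auto
    then show ?thesis
    proof
      assume z: "z = blk (blk ` \<pi>)"
      have "lt ?M I \<sigma> s j z = blk (blk ` image \<sigma> ` \<pi>)"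
        unfolding t(2) z ext_map_simps(1) q(6) ..
      moreover have "?l I s j z = blk I"
        using lI(1) by (simp add: Inl z)
      ultimately show ?thesis
        unfolding t(1) by (simp add: ext_map_simps(1))
    next
      assume "\<exists>J\<in>\<pi>. z = blk J"
      then obtain J where J: "J \<in> \<pi>" and z: "z = blk J"
        by blast
      have "lt ?M I \<sigma> s j z = blk (\<sigma> ` J)"
        unfolding t(2) z using ext_map_simps(2)[of "blk ` \<pi>" "blk J"] p(1) J q(5)[OF J] by simp
      moreover have "?l I s j z = snd (y J)"
        using lI(2)[OF J] by (simp add: Inl z)
      ultimately show ?thesis
        unfolding t(1) using gap'[OF J] snd_ftr[OF J] unblk_blk[OF finite_imageI[OF p(2)[OF J]], of \<sigma>] ext[OF part(2)[OF J] J]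
        by simp
    qed
  next
    case (Inr r)
    then obtain J f where r: "r = (J, f)" "J \<in> \<pi>" "f \<in> fst (y J)" "z \<in> f"
      using jz unfolding ed by (auto simp: lr)
    then have "z \<in> J"
      using hypertree_edge(1)[OF part(1)] by blast
    then show ?thesis
      using ext[OF _ r(2)] by (simp add: Inr s_eq tr_scomp scomp_fields r(1))
  qed
qed simp

lemma glueV_cong: "(\<And>J. J \<in> \<pi> \<Longrightarrow> y J = y' J) \<Longrightarrow> glueV v \<pi> y = glueV v \<pi> y'"
  by (simp add: glueV_def)

text \<open>The piece at the root that contains the pointed edge is the hollow factor. The remaining
  pieces form a hypertree with the same root on the complementary set, which is the rooted
  factor.\<close>

lemma sequiv_edge_root_prod: "\<exists>\<phi> \<epsilon> l. sequiv (sprod sHTh (sshift 1 sRoot)) (sshift 0 sEdgeRoot) \<phi> \<epsilon> l"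
proof (rule sequiv_sHTI[where l = "\<lambda>I s j. case s of (A, B, h, E, v) \<Rightarrow> (case j of Inl f \<Rightarrow> kappa A v | Inr f \<Rightarrow> (\<lambda>z. z))"
      and pt = "\<lambda>I (A, B, h, E, v). (kappa A v ` hedge A h, v)"
      and es = "\<lambda>I (A, B, h, E, v). image (kappa A v) ` fst h \<union> E"])
  let ?M = "sprod sHTh (sshift 1 sRoot)"
  let ?l = "\<lambda>s j. case s of (A, B, h, E, v) \<Rightarrow> (case j of Inl f \<Rightarrow> kappa A v | Inr f \<Rightarrow> (\<lambda>z. z))"
  show M: "is_shape ?M"
    by (intro is_shape_sprod is_shape_sHTh is_shape_sshift is_shape_pointings)
  show "wconst (0 - 1) ?M"
    using wconst_sprod[OF is_shape_sHTh is_shape_sshift[OF is_shape_pointings(2)] wconst_sHTh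
        wconst_sshift_1[OF wconst_sHT]] by simp
  fix I :: "'a lab set"
  assume I: "finite I"
  have mem: "(A, B, h, E, v) \<in> str (sp ?M) I \<longleftrightarrow>
      A \<union> B = I \<and> A \<inter> B = {} \<and> h \<in> hollow A \<and> hypertree B E \<and> v \<in> B" for A B h E v
    by (simp add: mem_str_sprod)
  \<comment> \<open>The distinguished block \<open>J\<close> is separated from a cut, and the other
    pieces are glued again to the rooted factor on \<open>I - J\<close>.\<close>
  let ?mk = "\<lambda>((v, \<pi>, y), J). (J, I - J, y J, glueV v (\<pi> - {J}) y, v)"
  have str: "str (sp ?M) I = ?mk ` (SIGMA (v, \<pi>, y):cuts I. \<pi>)"
  proof (intro equalityI subsetI)
    fix s
    assume s: "s \<in> str (sp ?M) I"
    obtain A B h E v where s_eq: "s = (A, B, h, E, v)"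
      by (cases s)
    note m = s[unfolded s_eq mem]
    have B: "finite B" "finite A" "v \<notin> A"
      using m I by auto
    obtain \<pi> y where y: "partition_on (B - {v}) \<pi>" "y \<in> PiE \<pi> hollow" "E = glueV v \<pi> y"
      using m by (auto intro: glueV_surj[OF B(1), of E v])
    have A: "A \<noteq> {}"
      using hollow_kappa(5)[of h A v] m B by blast
    have U: "\<Union>\<pi> = B - {v}"
      using y(1) by (simp add: partition_on_def)
    then have nA: "A \<notin> \<pi>"
      using A m by blast
    have "I - {v} - A = B - {v}"
      using m by blast
    \<comment> \<open>Conversely, the hollow factor is added as one more block to the cut of the
      rooted factor at its root.\<close>
    then have "partition_on (I - {v}) (insert A \<pi>)"
      using partition_on_insert[of A \<pi> "I - {v}"] y(1) A m U B(3) by (auto simp: disjnt_def)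
    moreover have "y(A := h) \<in> PiE (insert A \<pi>) hollow"
      using m y(2) by (intro PiE_fun_upd) auto
    ultimately have "((v, insert A \<pi>, y(A := h)), A) \<in> (SIGMA (v, \<pi>, y):cuts I. \<pi>)"
      using m by (auto simp: cuts_def)
    moreover have "s = ?mk ((v, insert A \<pi>, y(A := h)), A)"
    proof -
      have "glueV v \<pi> (y(A := h)) = E"
        unfolding y(3) using nA by (intro glueV_cong) auto
      moreover have "I - A = B"
        using m by blast
      ultimately show ?thesis
        using nA by (simp add: s_eq)
    qed
    ultimately show "s \<in> ?mk ` (SIGMA (v, \<pi>, y):cuts I. \<pi>)"
      by (rule rev_image_eqI)
  next
    fix s
    assume "s \<in> ?mk ` (SIGMA (v, \<pi>, y):cuts I. \<pi>)"
    then obtain v \<pi> y J where p: "(v, \<pi>, y) \<in> cuts I" and J: "J \<in> \<pi>" and s: "s = ?mk ((v, \<pi>, y), J)"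
      by auto
    note d = cutsD[OF I p]
    note P = glueV_part[OF I d(1-3) J]
    have JI: "J \<subseteq> I - {v}"
      using partition_facts(3)[OF d(2,4) J] .
    have "disjnt J (\<Union>(\<pi> - {J}))"
      using partition_eqI[OF d(2) J] by (fastforce simp: disjnt_def)
    from partition_on_insert[OF this, of "I - {v}"] have "partition_on (I - {v} - J) (\<pi> - {J})"
      using d(2) J by (simp add: insert_absorb)
    moreover have "I - J - {v} = I - {v} - J"
      by blast
    ultimately have \<pi>': "partition_on (I - J - {v}) (\<pi> - {J})"
      by simp
    have "restrict y (\<pi> - {J}) \<in> PiE (\<pi> - {J}) hollow"
      using d(3) by auto
    from glueV_hypertree[OF _ _ \<pi>' this] have "hypertree (I - J) (glueV v (\<pi> - {J}) (restrict y (\<pi> - {J})))"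
      using I d(1) JI by blast
    then have "hypertree (I - J) (glueV v (\<pi> - {J}) y)"
      using glueV_cong[of "\<pi> - {J}" "restrict y (\<pi> - {J})" y v] by simp
    then show "s \<in> str (sp ?M) I"
      using P(3) JI d(1) by (auto simp: s mem)
  qed
  show "bij_betw (\<lambda>s. (case s of (A, B, h, E, v) \<Rightarrow> image (kappa A v) ` fst h \<union> E,
      case s of (A, B, h, E, v) \<Rightarrow> (kappa A v ` hedge A h, v))) (str (sp ?M) I)
      {(E, p). hypertree I E \<and> p \<in> {(e, v). e \<in> E \<and> v \<in> e}}"
  proof -
    have glue: "image (kappa J v) ` fst (y J) \<union> glueV v (\<pi> - {J}) y = glueV v \<pi> y" if "J \<in> \<pi>"
      for J v \<pi> and y :: "'a lab set \<Rightarrow> 'a lab set set \<times> unit"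
      using that by (auto simp: glueV_def)
    have f: "(case ?mk p of (A, B, h, E, v) \<Rightarrow> image (kappa A v) ` fst h \<union> E,
        case ?mk p of (A, B, h, E, v) \<Rightarrow> (kappa A v ` hedge A h, v)) =
        (\<lambda>((v, \<pi>, y), J). (glueV v \<pi> y, kappa J v ` hedge J (y J), v)) p"
      if pm: "p \<in> (SIGMA (v, \<pi>, y):cuts I. \<pi>)" for p
    proof -
      obtain v \<pi> y J where p: "p = ((v, \<pi>, y), J)" "J \<in> \<pi>"
        using pm by auto
      show ?thesis
        using glue[OF p(2)] by (simp add: p(1))
    qed
    show ?thesis
      by (rule bij_betw_param[OF bij_cuts_edge[OF I] str]) (rule f)
  qed
  fix s
  assume s: "s \<in> str (sp ?M) I"
  obtain A B h E v where s_eq: "s = (A, B, h, E, v)"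
    by (cases s)
  note m = s[unfolded s_eq mem]
  have A: "finite A" "v \<notin> A" and h: "h \<in> hollow A" and ht: "hypertree B E"
    using m I by auto
  note k = kappa_facts[OF A] and hk = hollow_kappa[OF h A]
  show "(\<lambda>j. ?l s j ` lb ?M s j) ` ed ?M s = (case s of (A, B, h, E, v) \<Rightarrow> image (kappa A v) ` fst h \<union> E)"
    by (simp add: s_eq sprod_fields Plus_def image_Un image_image)
  show "inj_on (?l s j) (lb ?M s j)" if "j \<in> ed ?M s" for j
    using that inj_on_subset[OF k(1) hk(4)] by (auto simp: s_eq sprod_fields)
  \<comment> \<open>The two parts meet only in \<open>v\<close>, and an edge has a second vertex, so
    no edge arises from both.\<close>
  have cross: "kappa A v ` f \<noteq> g" if "f \<in> fst h" "g \<in> E" for f g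
    using hypertree_edge(4)[OF ht that(2), of v] hypertree_edge(1)[OF ht that(2)]
      hypertree_edge(1)[OF hk(1) imageI[OF that(1)]] m by blast
  show "inj_on (\<lambda>j. ?l s j ` lb ?M s j) (ed ?M s)"
  proof -
    have l: "?l s (Inl f) ` lb ?M s (Inl f) = kappa A v ` f" "?l s (Inr f) ` lb ?M s (Inr f) = f" for f
      by (simp_all add: s_eq sprod_fields)
    have ed: "ed ?M s = fst h <+> E"
      by (simp add: s_eq sprod_fields)
    show ?thesis
      unfolding ed
    proof (rule inj_on_Plus)
      show "inj_on (\<lambda>f. ?l s (Inl f) ` lb ?M s (Inl f)) (fst h)"
        unfolding l by (rule hk(3))
      show "inj_on (\<lambda>f. ?l s (Inr f) ` lb ?M s (Inr f)) E"
        unfolding l by (rule inj_on_id2)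
      show "?l s (Inl f) ` lb ?M s (Inl f) \<noteq> ?l s (Inr g) ` lb ?M s (Inr g)" if "f \<in> fst h" "g \<in> E" for f g
        unfolding l by (rule cross[OF that])
    qed
  qed
  fix \<sigma> :: "'a lab \<Rightarrow> 'a lab"
  assume \<sigma>: "inj_on \<sigma> I"
  have \<sigma>A: "inj_on \<sigma> A"
    using \<sigma> m by (auto intro: inj_on_subset)
  have "kappa (\<sigma> ` A) (\<sigma> v) ` ext_map A \<sigma> ` hedge A h = \<sigma> ` kappa A v ` hedge A h"
    unfolding image_image using kappa_natural[OF A(1)] hk(4)[OF hedge_mem(1)[OF h]] by (intro image_cong) auto
  then show "(case tr (sp ?M) I \<sigma> s of (A, B, h, E, v) \<Rightarrow> (kappa A v ` hedge A h, v)) =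
      (case case s of (A, B, h, E, v) \<Rightarrow> (kappa A v ` hedge A h, v) of (e, v) \<Rightarrow> (\<sigma> ` e, \<sigma> v))"
    using hedge_natural[OF h A(1) \<sigma>A] by (simp add: s_eq tr_sprod del: sHTh_fields)
  show "?l (tr (sp ?M) I \<sigma> s) (et ?M I \<sigma> s j) (lt ?M I \<sigma> s j z) = \<sigma> (?l s j z)"
    if jz: "j \<in> ed ?M s" "z \<in> lb ?M s j" for j z
  proof (cases j)
    case (Inl f)
    then have "f \<in> fst h" "z \<in> f"
      using jz by (auto simp: s_eq sprod_fields)
    then have "z \<in> add_pt A"
      using hk(4) by blast
    from kappa_natural[OF A(1) this] show ?thesis
      by (simp add: Inl s_eq tr_sprod sprod_fields)
  qed (simp add: s_eq tr_sprod sprod_fields)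
qed

text \<open>The outer X is the root. A structure of the product of X and the sum of 1 and
  \<open>Comm\<close> on the set of blocks is a block together with the set of all others, and the
  summand 1 allows this set to be empty. The distinguished block is the one with the pointed
  edge.\<close>

lemma sequiv_edge_root_cut:
  "\<exists>\<phi> \<epsilon> l. sequiv (sprod (sshift (- 1) sX) (scomp (sprod sX (ssum sOne sComm)) (sshift 1 sHTh)))
     (sshift 0 sEdgeRoot) \<phi> \<epsilon> l"
\<comment> \<open>\<open>P\<close> contains just the label of the distinguished block, so
  \<open>unblk (the_elem P)\<close> is this block.\<close>
proof (rule sequiv_sHTI[where l = "\<lambda>I s j. case s of (A, B, a, t) \<Rightarrow> kappa (fst (projr (projr j))) (the_elem A)"
      and pt = "\<lambda>I s. case s of (A, B, a, \<pi>, (P, x), y) \<Rightarrow> (kappa (unblk (the_elem P)) (the_elem A) `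
        hedge (unblk (the_elem P)) (y (unblk (the_elem P))), the_elem A)"
      and es = "\<lambda>I (A, B, a, \<pi>, x, y). glueV (the_elem A) \<pi> y"])
  let ?D = "sprod sX (ssum sOne sComm)"
  let ?C = "scomp ?D (sshift 1 sHTh)"
  let ?M = "sprod (sshift (- 1) sX) ?C"
  let ?l = "\<lambda>s j. case s of (A, B, a, t) \<Rightarrow> kappa (fst (projr (projr j))) (the_elem A)"
  let ?pt = "\<lambda>s. case s of (A, B, a, \<pi>, (P, x), y) \<Rightarrow> (kappa (unblk (the_elem P)) (the_elem A) `
        hedge (unblk (the_elem P)) (y (unblk (the_elem P))), the_elem A)"
  have D: "is_shape ?D"
    by (intro is_shape_sprod is_shape_ssum is_shape_splain_wX is_shape_splain_wOne is_shape_splain_wComm)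
  have wD: "wconst 0 ?D"
    using wconst_sprod[OF is_shape_splain_wX is_shape_ssum[OF is_shape_splain_wOne is_shape_splain_wComm]
        wconst_units(1) wconst_ssum[OF wconst_units(3,2)]] by simp
  have C: "is_shape ?C"
    by (intro is_shape_scomp D is_shape_sshift is_shape_sHTh)
  show "is_shape ?M"
    by (intro is_shape_sprod C is_shape_sshift is_shape_splain_wX)
  \<comment> \<open>The pieces contribute their numbers of edges, and the shift by -1 on the outer X
    supplies the constant of hypertrees.\<close>
  show "wconst (0 - 1) ?M"
    using wconst_sprod[OF is_shape_sshift[OF is_shape_splain_wX] C wconst_sshift[OF wconst_units(1)]
      wconst_scomp[OF D is_shape_sshift[OF is_shape_sHTh] wD wconst_sshift_1[OF wconst_sHTh]], of "- 1"] by simp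
  fix I :: "'a lab set"
  assume I: "finite I"
  \<comment> \<open>On every finite set the sum of 1 and \<open>Comm\<close> has exactly one
    structure, named here.\<close>
  let ?cc = "\<lambda>Q. if Q = {} then Inl () else Inr Q"
  let ?x = "\<lambda>\<pi> J. ({blk J}, blk ` \<pi> - {blk J}, {blk J}, ?cc (blk ` \<pi> - {blk J}))"
  let ?mk = "\<lambda>((v, \<pi>, y), J). ({v}, I - {v}, {v}, \<pi>, ?x \<pi> J, y)"
  have cc: "c \<in> str (sp (ssum sOne sComm)) Q \<longleftrightarrow> c = ?cc Q" if "finite Q" for c and Q :: "'a lab set"
    using card_gt_0_iff[of Q] that by (auto simp: wOne_def wComm_def Suc_le_eq split: if_splits)
  have memD: "x \<in> str (sp ?D) (blk ` \<pi>) \<longleftrightarrow> (\<exists>J\<in>\<pi>. x = ?x \<pi> J)" if "finite \<pi>" for x and \<pi> :: "'a lab set set"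
  proof -
    have fin: "finite (blk ` \<pi> - {v})" for v
      using that by simp
    show ?thesis
      unfolding mem_sprod_sX[of x 0 "ssum sOne sComm" "blk ` \<pi>", unfolded sshift_0] cc[OF fin] by blast
  qed
  have str: "str (sp ?M) I = ?mk ` (SIGMA (v, \<pi>, y):cuts I. \<pi>)"
  proof (intro equalityI subsetI)
    fix s
    assume "s \<in> str (sp ?M) I"
    from this[unfolded mem_sprod_sX] obtain v w where v: "s = ({v}, I - {v}, {v}, w)" "v \<in> I" "w \<in> str (sp ?C) (I - {v})"
      by blast
    obtain \<pi> x y where w: "w = (\<pi>, x, y)"
      by (cases w)
    have m: "partition_on (I - {v}) \<pi>" "x \<in> str (sp ?D) (blk ` \<pi>)" "y \<in> PiE \<pi> hollow"
      using v(3) unfolding w mem_str_scomp by simp_all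
    have "finite \<pi>"
      using partition_facts(1)[OF m(1)] I by simp
    then obtain J where J: "J \<in> \<pi>" "x = ?x \<pi> J"
      using m(2) memD by blast
    then have "((v, \<pi>, y), J) \<in> (SIGMA (v, \<pi>, y):cuts I. \<pi>)" "s = ?mk ((v, \<pi>, y), J)"
      using m v(2) by (simp_all add: cuts_def v(1) w)
    then show "s \<in> ?mk ` (SIGMA (v, \<pi>, y):cuts I. \<pi>)"
      by (rule rev_image_eqI)
  next
    fix s
    assume "s \<in> ?mk ` (SIGMA (v, \<pi>, y):cuts I. \<pi>)"
    then obtain v \<pi> y J where p: "(v, \<pi>, y) \<in> cuts I" and J: "J \<in> \<pi>" and s: "s = ?mk ((v, \<pi>, y), J)"
      by auto
    note d = cutsD[OF I p]
    have "?x \<pi> J \<in> str (sp ?D) (blk ` \<pi>)"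
      using memD[OF partition_facts(1)[OF d(2,4)]] J by blast
    then have "(\<pi>, ?x \<pi> J, y) \<in> str (sp ?C) (I - {v})"
      using d unfolding mem_str_scomp by simp
    then show "s \<in> str (sp ?M) I"
      unfolding mem_sprod_sX s using d(1) by simp
  qed
  show "bij_betw (\<lambda>s. (case s of (A, B, a, \<pi>, x, y) \<Rightarrow> glueV (the_elem A) \<pi> y, ?pt s)) (str (sp ?M) I)
      {(E, p). hypertree I E \<and> p \<in> {(e, v). e \<in> E \<and> v \<in> e}}"
  proof (rule bij_betw_param[OF bij_cuts_edge[OF I] str])
    fix p
    assume "p \<in> (SIGMA (v, \<pi>, y):cuts I. \<pi>)"
    then obtain v \<pi> y J where p: "p = ((v, \<pi>, y), J)" "(v, \<pi>, y) \<in> cuts I" "J \<in> \<pi>"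
      by auto
    have "unblk (blk J) = J"
      using partition_facts(6)[OF cutsD(2,4)[OF I p(2)] p(3)] .
    then show "(case ?mk p of (A, B, a, \<pi>, x, y) \<Rightarrow> glueV (the_elem A) \<pi> y, ?pt (?mk p)) =
        (\<lambda>((v, \<pi>, y), J). (glueV v \<pi> y, kappa J v ` hedge J (y J), v)) p"
      by (simp add: p(1))
  qed
  fix s
  assume "s \<in> str (sp ?M) I"
  then obtain v \<pi> y J0 where p: "(v, \<pi>, y) \<in> cuts I" and J0: "J0 \<in> \<pi>" and s: "s = ({v}, I - {v}, {v}, \<pi>, ?x \<pi> J0, y)"
    unfolding str by auto
  note d = cutsD[OF I p]
  have edD: "ed ?D (?x \<pi> J0) = {}"
    by (simp add: sprod_fields)
  have ed: "ed ?M s = (\<lambda>p. Inr (Inr p)) ` (SIGMA J:\<pi>. fst (y J))"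
    unfolding s sprod_fields scomp_fields edD by (simp add: image_image)
  have l: "?l s (Inr (Inr (J, f))) = kappa J v" "lb ?M s (Inr (Inr (J, f))) = f" for J f
    unfolding s sprod_fields scomp_fields by simp_all
  have ll: "?l s (Inr (Inr p)) ` lb ?M s (Inr (Inr p)) = kappa (fst p) v ` snd p" for p
  proof -
    obtain J f where q: "p = (J, f)"
      by (rule prod.exhaust)
    show ?thesis
      unfolding q l by simp
  qed
  show "(\<lambda>j. ?l s j ` lb ?M s j) ` ed ?M s = (case s of (A, B, a, \<pi>, x, y) \<Rightarrow> glueV (the_elem A) \<pi> y)"
    unfolding ed image_image ll cuts_image[OF I p] by (simp add: s)
  show "inj_on (?l s j) (lb ?M s j)" if jed: "j \<in> ed ?M s" for j
  proof -
    obtain J f where j: "j = Inr (Inr (J, f))" "J \<in> \<pi>" "f \<in> fst (y J)"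
      using jed unfolding ed by auto
    show ?thesis
      unfolding j(1) l by (rule cuts_inj[OF I p j(2,3)])
  qed
  show "inj_on (\<lambda>j. ?l s j ` lb ?M s j) (ed ?M s)"
    unfolding ed using cuts_inj_edges[OF I p] by (intro inj_on_imageI) (simp only: comp_def ll)
  fix \<sigma> :: "'a lab \<Rightarrow> 'a lab"
  assume \<sigma>: "inj_on \<sigma> I"
  have \<sigma>': "inj_on \<sigma> (I - {v})"
    using \<sigma> by (rule inj_on_subset) blast
  note P = glueV_part[OF I d(1-3) J0] and q = partition_image[OF d(2,4) \<sigma>']
  show "?pt (tr (sp ?M) I \<sigma> s) = (case ?pt s of (e, v) \<Rightarrow> (\<sigma> ` e, \<sigma> v))"
  proof -
    have b: "unblk (blk J0) = J0" "unblk (blk (\<sigma> ` J0)) = \<sigma> ` J0"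
      using unblk_blk[OF P(1)] unblk_blk[OF finite_imageI[OF P(1)], of \<sigma>] .
    have h: "hedge (\<sigma> ` J0) (ftr (sp sHTh) (I - {v}) \<sigma> \<pi> y (\<sigma> ` J0)) = ext_map J0 \<sigma> ` hedge J0 (y J0)"
      unfolding ftr_apply[OF d(2,4) \<sigma>' J0] by (rule hedge_natural[OF P(3,1) q(3)[OF J0]])
    have k: "kappa (\<sigma> ` J0) (\<sigma> v) ` ext_map J0 \<sigma> ` hedge J0 (y J0) = \<sigma> ` kappa J0 v ` hedge J0 (y J0)"
      unfolding image_image using kappa_natural[OF P(1)] glueV_piece(4)[OF I d(1-3) J0 hedge_mem(1)[OF P(3)]]
      by (intro image_cong) auto
    show ?thesis
      by (simp add: s tr_sprod tr_scomp q(5)[OF J0] b h k)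
  qed
  show "?l (tr (sp ?M) I \<sigma> s) (et ?M I \<sigma> s j) (lt ?M I \<sigma> s j z) = \<sigma> (?l s j z)"
    if jz: "j \<in> ed ?M s" "z \<in> lb ?M s j" for j z
  proof -
    obtain J f where j: "j = Inr (Inr (J, f))" "J \<in> \<pi>" "f \<in> fst (y J)"
      using jz(1) unfolding ed by auto
    have "z \<in> f"
      using jz(2) l(2) by (simp only: j(1))
    from cuts_natural[OF I p j(2,3) this, of \<sigma>] show ?thesis
      by (simp add: s j(1) tr_sprod tr_scomp sprod_fields scomp_fields)
  qed
qed

section \<open>Isomorphisms of species from equivalences of shapes\<close>

lemmas is_shape_intros = is_shape_sprod is_shape_scomp is_shape_ssum is_shape_sderiv is_shape_sshift is_shape_sset
  is_shape_sHTh is_shape_splain_wX is_shape_splain_wComm is_shape_splain_wOne is_shape_pointings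

lemma wiso_sequiv:
  assumes "\<exists>\<phi> \<epsilon> l. sequiv M N \<phi> \<epsilon> l" "is_shape M" "is_shape N" "functorial F"
    and "realises F G N \<beta>" "realises F H M \<gamma>"
  shows "G \<cong>\<^sub>w H"
proof -
  obtain \<phi> \<epsilon> l where "sequiv M N \<phi> \<epsilon> l"
    using assms(1) by blast
  from realises_sequiv[OF this assms(2-5)] show ?thesis
    by (rule realises_iso[OF assms(2,4) _ assms(6)])
qed

lemma giso_sequiv:
  assumes "\<exists>\<phi> \<epsilon> l. sequiv M N \<phi> \<epsilon> l" "is_shape M" "is_shape N" "is_lspecies L"
    and "lrealises L G N \<tau>" "lrealises L H M \<upsilon>"
  shows "G \<cong>\<^sub>g H"
proof -
  obtain \<phi> \<epsilon> l where "sequiv M N \<phi> \<epsilon> l"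
    using assms(1) by blast
  from lrealises_sequiv[OF assms(4) this assms(2,3,5)] show ?thesis
    by (rule lrealises_iso[OF assms(4,2) _ assms(6)])
qed

text \<open>For the last equation, both sides of which are isomorphic to \<open>HT_re S\<close>. The
  inverse of the first isomorphism is natural because transport stays within the structures of
  \<open>F\<close>.\<close>

lemma wiso_common:
  assumes tr: "\<And>I \<sigma> s. finite I \<Longrightarrow> inj_on \<sigma> I \<Longrightarrow> s \<in> str F I \<Longrightarrow> tr F I \<sigma> s \<in> str F (\<sigma> ` I)"
    and G: "F \<cong>\<^sub>w G" and H: "F \<cong>\<^sub>w H"
  shows "G \<cong>\<^sub>w H"
proof -
  obtain \<phi> where \<phi>: "\<forall>I. finite I \<longrightarrow> bij_betw (\<phi> I) (str F I) (str G I) \<and> (\<forall>s\<in>str F I. wt G (\<phi> I s) = wt F s) \<and>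
      (\<forall>\<sigma>. inj_on \<sigma> I \<longrightarrow> (\<forall>s\<in>str F I. \<phi> (\<sigma> ` I) (tr F I \<sigma> s) = tr G I \<sigma> (\<phi> I s)))"
    using G unfolding wiso_def by blast
  obtain \<psi> where \<psi>: "\<forall>I. finite I \<longrightarrow> bij_betw (\<psi> I) (str F I) (str H I) \<and> (\<forall>s\<in>str F I. wt H (\<psi> I s) = wt F s) \<and>
      (\<forall>\<sigma>. inj_on \<sigma> I \<longrightarrow> (\<forall>s\<in>str F I. \<psi> (\<sigma> ` I) (tr F I \<sigma> s) = tr H I \<sigma> (\<psi> I s)))"
    using H unfolding wiso_def by blast
  let ?\<chi> = "\<lambda>I g. \<psi> I (inv_into (str F I) (\<phi> I) g)"
  have \<chi>: "?\<chi> I (\<phi> I s) = \<psi> I s" if "finite I" "s \<in> str F I" for I s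
    using \<phi> that by (simp add: bij_betw_def)
  have "bij_betw (?\<chi> I) (str G I) (str H I) \<and> (\<forall>g\<in>str G I. wt H (?\<chi> I g) = wt G g) \<and>
      (\<forall>\<sigma>. inj_on \<sigma> I \<longrightarrow> (\<forall>g\<in>str G I. ?\<chi> (\<sigma> ` I) (tr G I \<sigma> g) = tr H I \<sigma> (?\<chi> I g)))" if I: "finite I" for I
  proof -
    note p = \<phi>[rule_format, OF I] and q = \<psi>[rule_format, OF I]
    have img: "str G I = \<phi> I ` str F I"
      using p by (simp add: bij_betw_def)
    have "bij_betw (\<psi> I \<circ> inv_into (str F I) (\<phi> I)) (str G I) (str H I)"
      by (rule bij_betw_trans[OF bij_betw_inv_into[OF p[THEN conjunct1]] q[THEN conjunct1]])
    then have b: "bij_betw (?\<chi> I) (str G I) (str H I)"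
      by (simp only: comp_def)
    have w: "wt H (?\<chi> I (\<phi> I s)) = wt G (\<phi> I s)" if "s \<in> str F I" for s
      unfolding \<chi>[OF I that] using p q that by simp
    have n: "?\<chi> (\<sigma> ` I) (tr G I \<sigma> (\<phi> I s)) = tr H I \<sigma> (?\<chi> I (\<phi> I s))" if \<sigma>: "inj_on \<sigma> I" and s: "s \<in> str F I" for \<sigma> s
    proof -
      have "tr G I \<sigma> (\<phi> I s) = \<phi> (\<sigma> ` I) (tr F I \<sigma> s)"
        using p \<sigma> s by simp
      then have "?\<chi> (\<sigma> ` I) (tr G I \<sigma> (\<phi> I s)) = \<psi> (\<sigma> ` I) (tr F I \<sigma> s)"
        using \<chi>[OF finite_imageI[OF I] tr[OF I \<sigma> s]] by simp
      also have "\<dots> = tr H I \<sigma> (\<psi> I s)"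
        using q \<sigma> s by simp
      finally show ?thesis
        unfolding \<chi>[OF I s] .
    qed
    show ?thesis
    proof (intro conjI ballI allI impI b)
      fix g
      assume "g \<in> str G I"
      then obtain s where s: "s \<in> str F I" "g = \<phi> I s"
        unfolding img by blast
      show "wt H (?\<chi> I g) = wt G g"
        unfolding s(2) by (rule w[OF s(1)])
      show "?\<chi> (\<sigma> ` I) (tr G I \<sigma> g) = tr H I \<sigma> (?\<chi> I g)" if "inj_on \<sigma> I" for \<sigma>
        unfolding s(2) by (rule n[OF that s(1)])
    qed
  qed
  then show ?thesis
    unfolding wiso_def by (intro exI[of _ ?\<chi>]) blast
qed

text \<open>Linearity and naturality of the inverse isomorphism use that sums, multiples and
  transports stay within the spaces of \<open>F\<close>.\<close>

lemma giso_common: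
  assumes add: "\<And>I n x y. finite I \<Longrightarrow> x \<in> gstr F I n \<Longrightarrow> y \<in> gstr F I n \<Longrightarrow> x + y \<in> gstr F I n"
    and scale: "\<And>I n c x. finite I \<Longrightarrow> x \<in> gstr F I n \<Longrightarrow> gscale F c x \<in> gstr F I n"
    and tr: "\<And>I n \<sigma> x. finite I \<Longrightarrow> inj_on \<sigma> I \<Longrightarrow> x \<in> gstr F I n \<Longrightarrow> gtr F I n \<sigma> x \<in> gstr F (\<sigma> ` I) n"
    and G: "F \<cong>\<^sub>g G" and H: "F \<cong>\<^sub>g H"
  shows "G \<cong>\<^sub>g H"
proof -
  obtain \<phi> where \<phi>: "\<forall>I n. finite I \<longrightarrow> bij_betw (\<phi> I n) (gstr F I n) (gstr G I n) \<and>
      linear_on (gscale F) (gscale G) (gstr F I n) (\<phi> I n) \<and>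
      (\<forall>\<sigma>. inj_on \<sigma> I \<longrightarrow> (\<forall>v\<in>gstr F I n. \<phi> (\<sigma> ` I) n (gtr F I n \<sigma> v) = gtr G I n \<sigma> (\<phi> I n v)))"
    using G unfolding giso_def by blast
  obtain \<psi> where \<psi>: "\<forall>I n. finite I \<longrightarrow> bij_betw (\<psi> I n) (gstr F I n) (gstr H I n) \<and>
      linear_on (gscale F) (gscale H) (gstr F I n) (\<psi> I n) \<and>
      (\<forall>\<sigma>. inj_on \<sigma> I \<longrightarrow> (\<forall>v\<in>gstr F I n. \<psi> (\<sigma> ` I) n (gtr F I n \<sigma> v) = gtr H I n \<sigma> (\<psi> I n v)))"
    using H unfolding giso_def by blast
  let ?\<chi> = "\<lambda>I n g. \<psi> I n (inv_into (gstr F I n) (\<phi> I n) g)"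
  have \<chi>: "?\<chi> I n (\<phi> I n s) = \<psi> I n s" if "finite I" "s \<in> gstr F I n" for I n s
    using \<phi> that by (simp add: bij_betw_def)
  have "bij_betw (?\<chi> I n) (gstr G I n) (gstr H I n) \<and> linear_on (gscale G) (gscale H) (gstr G I n) (?\<chi> I n) \<and>
      (\<forall>\<sigma>. inj_on \<sigma> I \<longrightarrow> (\<forall>g\<in>gstr G I n. ?\<chi> (\<sigma> ` I) n (gtr G I n \<sigma> g) = gtr H I n \<sigma> (?\<chi> I n g)))"
    if I: "finite I" for I n
  proof -
    note p = \<phi>[rule_format, OF I, of n] and q = \<psi>[rule_format, OF I, of n]
    have img: "gstr G I n = \<phi> I n ` gstr F I n"
      using p by (simp add: bij_betw_def)
    have "bij_betw (\<psi> I n \<circ> inv_into (gstr F I n) (\<phi> I n)) (gstr G I n) (gstr H I n)"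
      by (rule bij_betw_trans[OF bij_betw_inv_into[OF p[THEN conjunct1]] q[THEN conjunct1]])
    then have b: "bij_betw (?\<chi> I n) (gstr G I n) (gstr H I n)"
      by (simp only: comp_def)
    have a: "?\<chi> I n (\<phi> I n x + \<phi> I n y) = ?\<chi> I n (\<phi> I n x) + ?\<chi> I n (\<phi> I n y)"
      if x: "x \<in> gstr F I n" and y: "y \<in> gstr F I n" for x y
    proof -
      have "\<phi> I n x + \<phi> I n y = \<phi> I n (x + y)" "\<psi> I n (x + y) = \<psi> I n x + \<psi> I n y"
        using p q x y by (simp_all add: linear_on_def)
      then show ?thesis
        using \<chi>[OF I add[OF I x y]] \<chi>[OF I x] \<chi>[OF I y] by simp
    qed
    have c: "?\<chi> I n (gscale G c (\<phi> I n x)) = gscale H c (?\<chi> I n (\<phi> I n x))" if x: "x \<in> gstr F I n" for c x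
    proof -
      have "gscale G c (\<phi> I n x) = \<phi> I n (gscale F c x)" "\<psi> I n (gscale F c x) = gscale H c (\<psi> I n x)"
        using p q x by (simp_all add: linear_on_def)
      then show ?thesis
        using \<chi>[OF I scale[OF I x]] \<chi>[OF I x] by simp
    qed
    have t: "?\<chi> (\<sigma> ` I) n (gtr G I n \<sigma> (\<phi> I n x)) = gtr H I n \<sigma> (?\<chi> I n (\<phi> I n x))"
      if \<sigma>: "inj_on \<sigma> I" and x: "x \<in> gstr F I n" for \<sigma> x
    proof -
      have "gtr G I n \<sigma> (\<phi> I n x) = \<phi> (\<sigma> ` I) n (gtr F I n \<sigma> x)"
        using p \<sigma> x by simp
      then have "?\<chi> (\<sigma> ` I) n (gtr G I n \<sigma> (\<phi> I n x)) = \<psi> (\<sigma> ` I) n (gtr F I n \<sigma> x)"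
        using \<chi>[OF finite_imageI[OF I] tr[OF I \<sigma> x]] by simp
      also have "\<dots> = gtr H I n \<sigma> (\<psi> I n x)"
        using q \<sigma> x by simp
      finally show ?thesis
        unfolding \<chi>[OF I x] .
    qed
    show ?thesis
      unfolding linear_on_def
    proof (intro conjI ballI allI impI b)
      fix g
      assume "g \<in> gstr G I n"
      then obtain x where x: "x \<in> gstr F I n" "g = \<phi> I n x"
        unfolding img by blast
      show "?\<chi> I n (gscale G r g) = gscale H r (?\<chi> I n g)" for r
        unfolding x(2) by (rule c[OF x(1)])
      show "?\<chi> (\<sigma> ` I) n (gtr G I n \<sigma> g) = gtr H I n \<sigma> (?\<chi> I n g)" if "inj_on \<sigma> I" for \<sigma>
        unfolding x(2) by (rule t[OF that x(1)])
      fix h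
      assume "h \<in> gstr G I n"
      then obtain y where y: "y \<in> gstr F I n" "h = \<phi> I n y"
        unfolding img by blast
      show "?\<chi> I n (g + h) = ?\<chi> I n g + ?\<chi> I n h"
        unfolding x(2) y(2) by (rule a[OF x(1) y(1)])
    qed
  qed
  then show ?thesis
    unfolding giso_def by (intro exI[of _ ?\<chi>]) blast
qed

lemma lrealises_closed:
  assumes "lrealises L G M \<tau>" "finite I"
  shows "x \<in> gstr G I n \<Longrightarrow> y \<in> gstr G I n \<Longrightarrow> x + y \<in> gstr G I n"
    and "x \<in> gstr G I n \<Longrightarrow> gscale G c x \<in> gstr G I n"
proof -
  interpret vector_space "gscale G"
    by (rule lrealisesD(1)[OF assms(1)])
  obtain X where "gstr G I n = span X"
    using lrealisesD(2)[OF assms, of n] unfolding model_def by blast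
  then have sub: "subspace (gstr G I n)"
    by (simp add: subspace_span)
  show "x \<in> gstr G I n \<Longrightarrow> y \<in> gstr G I n \<Longrightarrow> x + y \<in> gstr G I n"
    by (rule subspace_add[OF sub])
  show "x \<in> gstr G I n \<Longrightarrow> gscale G c x \<in> gstr G I n"
    by (rule subspace_scale[OF sub])
qed

lemma realises_tr:
  assumes M: "is_shape M" and F: "functorial F" and G: "realises F G M \<beta>" and I: "finite I" "inj_on \<sigma> I"
    and g: "g \<in> str G I"
  shows "tr G I \<sigma> g \<in> str G (\<sigma> ` I)"
proof -
  obtain s d where s: "s \<in> str (sp M) I" "d \<in> decs F M s" "g = \<beta> I s d"
    using realises_surj[OF G I(1) g] by blast
  show ?thesis
    unfolding s(3) realisesD(3)[OF G I(1) s(1,2) I(2)]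
    using realises_in[OF G finite_imageI[OF I(1)] is_shapeD(3)[OF M I(1) s(1) I(2)] dpush_in[OF M F I(1) s(1) I(2) s(2)]] .
qed

text \<open>Each isomorphism combines one equivalence of shapes with a realisation of either side;
  the realisation of the right-hand side is assembled along its expression.\<close>

lemma wiso_hypertrees:
  fixes S :: "('a, 's) species" and one :: "'a lab"
  assumes S: "is_species S" "card (str S {}) = 0" "card (str S {one}) = 0"
  shows "HT_r S \<cong>\<^sub>w wX \<times>\<^sub>w wderiv (HT S)"
    and "wshift 1 (HT_r S) \<cong>\<^sub>w wX +\<^sub>w wX \<times>\<^sub>w wComm \<circ>\<^sub>w wshift 1 (HT_h S)"
    and "HT_h S \<cong>\<^sub>w wderiv (weightless S) \<circ>\<^sub>w wshift 1 (HT_r S)"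
    and "HT_e S \<cong>\<^sub>w weightless S \<circ>\<^sub>w wshift 1 (HT_r S)"
    and "HT_re S \<cong>\<^sub>w HT_h S \<times>\<^sub>w wshift 1 (HT_r S)"
    and "HT_h S \<times>\<^sub>w wshift 1 (HT_r S) \<cong>\<^sub>w
      wshift (- 1) wX \<times>\<^sub>w (wX \<times>\<^sub>w (wOne +\<^sub>w wComm)) \<circ>\<^sub>w wshift 1 (HT_h S)"
proof -
  note F = is_species_functorial[OF S(1)] and P = equivariant_pointings and sh = is_shape_pointings
  note T = realises_sHT[OF P(1), of S, folded HT_def] and R = realises_sHT[OF P(2), of S, folded HT_r_def]
    and E = realises_sHT[OF P(3), of S, folded HT_e_def] and ER = realises_sHT[OF P(4), of S, folded HT_re_def]
    and H = realises_sHTh[of S]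
  note R1 = realises_sshift[OF R, of 1] and H1 = realises_sshift[OF H, of 1]
    and shR1 = is_shape_sshift[OF sh(2), of 1] and shH1 = is_shape_sshift[OF is_shape_sHTh, of 1]
  note X = realises_splain[of S wX] and C = realises_splain[of S wComm] and O = realises_splain[of S wOne]
  have W: "realises S (weightless S) sset (\<lambda>I s d. d ())"
    by (rule realises_sset[OF F species_small[OF S]])
  note CH = realises_scomp[OF is_shape_splain_wComm shH1 F C H1]
  show "HT_r S \<cong>\<^sub>w wX \<times>\<^sub>w wderiv (HT S)"
    by (rule wiso_sequiv[OF sequiv_root[unfolded sshift_0] _ sh(2) F R
          realises_sprod[OF is_shape_splain_wX is_shape_sderiv[OF sh(1)] F X realises_sderiv[OF T]]])
      (intro is_shape_intros)
  show "wshift 1 (HT_r S) \<cong>\<^sub>w wX +\<^sub>w wX \<times>\<^sub>w wComm \<circ>\<^sub>w wshift 1 (HT_h S)"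
    by (rule wiso_sequiv[OF sequiv_root_cut _ shR1 F R1 realises_ssum[OF X
          realises_sprod[OF is_shape_splain_wX is_shape_scomp[OF is_shape_splain_wComm shH1] F X CH]]])
      (intro is_shape_intros)
  show "HT_h S \<cong>\<^sub>w wderiv (weightless S) \<circ>\<^sub>w wshift 1 (HT_r S)"
    by (rule wiso_sequiv[OF sequiv_hollow[unfolded sshift_0] _ is_shape_sHTh F H
          realises_scomp[OF is_shape_sderiv[OF is_shape_sset] shR1 F realises_sderiv[OF W] R1]])
      (intro is_shape_intros)
  show "HT_e S \<cong>\<^sub>w weightless S \<circ>\<^sub>w wshift 1 (HT_r S)"
    by (rule wiso_sequiv[OF sequiv_edge[unfolded sshift_0] _ sh(3) F E realises_scomp[OF is_shape_sset shR1 F W R1]])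
      (intro is_shape_intros)
  show re: "HT_re S \<cong>\<^sub>w HT_h S \<times>\<^sub>w wshift 1 (HT_r S)"
    by (rule wiso_sequiv[OF sequiv_edge_root_prod[unfolded sshift_0] _ sh(4) F ER
          realises_sprod[OF is_shape_sHTh shR1 F H R1]])
      (intro is_shape_intros)
  have cut: "HT_re S \<cong>\<^sub>w wshift (- 1) wX \<times>\<^sub>w (wX \<times>\<^sub>w (wOne +\<^sub>w wComm)) \<circ>\<^sub>w wshift 1 (HT_h S)"
    by (rule wiso_sequiv[OF sequiv_edge_root_cut[unfolded sshift_0] _ sh(4) F ER
          realises_sprod[OF _ _ F realises_sshift[OF X] realises_scomp[OF _ shH1 F
            realises_sprod[OF is_shape_splain_wX _ F X realises_ssum[OF O C]] H1]]])
      (intro is_shape_intros)+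
  show "HT_h S \<times>\<^sub>w wshift 1 (HT_r S) \<cong>\<^sub>w
      wshift (- 1) wX \<times>\<^sub>w (wX \<times>\<^sub>w (wOne +\<^sub>w wComm)) \<circ>\<^sub>w wshift 1 (HT_h S)"
    by (rule wiso_common[OF _ re cut]) (rule realises_tr[OF sh(4) F ER])
qed

lemma lrealises_pointings:
  fixes L :: "('a, 'k::field, 'v::ab_group_add) lspecies"
  assumes L: "is_lspecies L"
  shows "lrealises L (gHT L) sTree (\<lambda>I (E, p) d. single (E, p) (elem (lscale L) E (lstr L) d))"
    and "lrealises L (gHT_r L) sRoot (\<lambda>I (E, p) d. single (E, p) (elem (lscale L) E (lstr L) d))"
    and "lrealises L (gHT_e L) sEdge (\<lambda>I (E, p) d. single (E, p) (elem (lscale L) E (lstr L) d))"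
    and "lrealises L (gHT_re L) sEdgeRoot (\<lambda>I (E, p) d. single (E, p) (elem (lscale L) E (lstr L) d))"
proof -
  have e: "inv_into I \<sigma> ` \<sigma> ` e = e" if "inj_on \<sigma> I" "hypertree I E" "e \<in> E" for I E e and \<sigma> :: "'a lab \<Rightarrow> 'a lab"
    by (rule inv_into_image_cancel[OF that(1) hypertree_edge(1)[OF that(2,3)]])
  have e': "\<sigma> ` inv_into I \<sigma> ` e = e" if "hypertree (\<sigma> ` I) E" "e \<in> E" for I E e and \<sigma> :: "'a lab \<Rightarrow> 'a lab"
    by (rule image_inv_into_cancel[OF refl hypertree_edge(1)[OF that]])
  have v: "v \<in> I" if "hypertree I E" "e \<in> E" "v \<in> e" for I E e and v :: "'a lab"
    using hypertree_edge(1)[OF that(1,2)] that(3) by blast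
  show "lrealises L (gHT L) sTree (\<lambda>I (E, p) d. single (E, p) (elem (lscale L) E (lstr L) d))"
    unfolding gHT_def by (rule lrealises_sHT[OF L equivariant_pointings(1)]) simp_all
  show "lrealises L (gHT_r L) sRoot (\<lambda>I (E, p) d. single (E, p) (elem (lscale L) E (lstr L) d))"
    unfolding gHT_r_def by (rule lrealises_sHT[OF L equivariant_pointings(2)]) (simp_all add: f_inv_into_f)
  show "lrealises L (gHT_e L) sEdge (\<lambda>I (E, p) d. single (E, p) (elem (lscale L) E (lstr L) d))"
    unfolding gHT_e_def by (rule lrealises_sHT[OF L equivariant_pointings(3)]) (rule e e'; assumption)+
  show "lrealises L (gHT_re L) sEdgeRoot (\<lambda>I (E, p) d. single (E, p) (elem (lscale L) E (lstr L) d))"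
    unfolding gHT_re_def
  proof (rule lrealises_sHT[OF L equivariant_pointings(4)], goal_cases)
    case (1 I \<sigma> E p)
    then obtain f u where p: "p = (f, u)" "f \<in> E" "u \<in> f"
      by blast
    show ?case
      using e[OF 1(1,2) p(2)] inv_into_f_f[OF 1(1) v[OF 1(2) p(2,3)]] by (simp add: p(1))
  next
    case (2 \<sigma> I E p)
    then obtain f u where p: "p = (f, u)" "f \<in> E" "u \<in> f"
      by blast
    show ?case
      using e'[OF 2(1) p(2)] f_inv_into_f[OF v[OF 2(1) p(2,3)]] by (simp add: p(1))
  qed
qed

text \<open>The same six equivalences of shapes serve again, with models in place of the set-valued
  realisations.\<close>

lemma giso_hypertrees:
  fixes L :: "('a, 'k::field, 'v::ab_group_add) lspecies" and one :: "'a lab"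
  assumes L: "is_lspecies L" "lstr L {} = {0}" "lstr L {one} = {0}"
  shows "gHT_r L \<cong>\<^sub>g gX \<times>\<^sub>g gderiv (gHT L)"
    and "gshift 1 (gHT_r L) \<cong>\<^sub>g gX +\<^sub>g gX \<times>\<^sub>g gComm \<circ>\<^sub>g gshift 1 (gHT_h L)"
    and "gHT_h L \<cong>\<^sub>g gderiv (gweightless L) \<circ>\<^sub>g gshift 1 (gHT_r L)"
    and "gHT_e L \<cong>\<^sub>g gweightless L \<circ>\<^sub>g gshift 1 (gHT_r L)"
    and "gHT_re L \<cong>\<^sub>g gHT_h L \<times>\<^sub>g gshift 1 (gHT_r L)"
    and "gHT_h L \<times>\<^sub>g gshift 1 (gHT_r L) \<cong>\<^sub>g
      gshift (- 1) gX \<times>\<^sub>g (gX \<times>\<^sub>g (gOne +\<^sub>g gComm)) \<circ>\<^sub>g gshift 1 (gHT_h L)"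
proof -
  note F = L(1) and sh = is_shape_pointings
  note T = lrealises_pointings(1)[OF F] and R = lrealises_pointings(2)[OF F]
    and E = lrealises_pointings(3)[OF F] and ER = lrealises_pointings(4)[OF F] and H = lrealises_sHTh[OF F]
  note R1 = lrealises_gshift[OF R, of 1] and H1 = lrealises_gshift[OF H, of 1]
    and shR1 = is_shape_sshift[OF sh(2), of 1] and shH1 = is_shape_sshift[OF is_shape_sHTh, of 1]
  note X = lrealises_gX[OF F] and C = lrealises_gComm[OF F] and O = lrealises_gOne[OF F]
  have W: "lrealises L (gweightless L) sset (\<lambda>I s d. d ())"
    by (rule lrealises_sset[OF F lspecies_small[OF L]])
  note CH = lrealises_gcomp[OF F is_shape_splain_wComm shH1 C H1]
  show "gHT_r L \<cong>\<^sub>g gX \<times>\<^sub>g gderiv (gHT L)"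
    by (rule giso_sequiv[OF sequiv_root[unfolded sshift_0] _ sh(2) F R
          lrealises_gprod[OF F is_shape_splain_wX is_shape_sderiv[OF sh(1)] X lrealises_gderiv[OF T]]])
      (intro is_shape_intros)
  show "gshift 1 (gHT_r L) \<cong>\<^sub>g gX +\<^sub>g gX \<times>\<^sub>g gComm \<circ>\<^sub>g gshift 1 (gHT_h L)"
    by (rule giso_sequiv[OF sequiv_root_cut _ shR1 F R1 lrealises_gsum[OF F is_shape_splain_wX _ X
          lrealises_gprod[OF F is_shape_splain_wX is_shape_scomp[OF is_shape_splain_wComm shH1] X CH]]])
      (intro is_shape_intros)+
  show "gHT_h L \<cong>\<^sub>g gderiv (gweightless L) \<circ>\<^sub>g gshift 1 (gHT_r L)"
    by (rule giso_sequiv[OF sequiv_hollow[unfolded sshift_0] _ is_shape_sHTh F H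
          lrealises_gcomp[OF F is_shape_sderiv[OF is_shape_sset] shR1 lrealises_gderiv[OF W] R1]])
      (intro is_shape_intros)
  show "gHT_e L \<cong>\<^sub>g gweightless L \<circ>\<^sub>g gshift 1 (gHT_r L)"
    by (rule giso_sequiv[OF sequiv_edge[unfolded sshift_0] _ sh(3) F E lrealises_gcomp[OF F is_shape_sset shR1 W R1]])
      (intro is_shape_intros)
  show re: "gHT_re L \<cong>\<^sub>g gHT_h L \<times>\<^sub>g gshift 1 (gHT_r L)"
    by (rule giso_sequiv[OF sequiv_edge_root_prod[unfolded sshift_0] _ sh(4) F ER
          lrealises_gprod[OF F is_shape_sHTh shR1 H R1]])
      (intro is_shape_intros)
  have cut: "gHT_re L \<cong>\<^sub>g gshift (- 1) gX \<times>\<^sub>g (gX \<times>\<^sub>g (gOne +\<^sub>g gComm)) \<circ>\<^sub>g gshift 1 (gHT_h L)"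
    by (rule giso_sequiv[OF sequiv_edge_root_cut[unfolded sshift_0] _ sh(4) F ER
          lrealises_gprod[OF F _ _ lrealises_gshift[OF X] lrealises_gcomp[OF F _ shH1
            lrealises_gprod[OF F is_shape_splain_wX _ X
              lrealises_gsum[OF F is_shape_splain_wOne is_shape_splain_wComm O C]] H1]]])
      (intro is_shape_intros)+
  show "gHT_h L \<times>\<^sub>g gshift 1 (gHT_r L) \<cong>\<^sub>g
      gshift (- 1) gX \<times>\<^sub>g (gX \<times>\<^sub>g (gOne +\<^sub>g gComm)) \<circ>\<^sub>g gshift 1 (gHT_h L)"
    by (rule giso_common[OF _ _ _ re cut])
      (rule lrealises_closed[OF ER] lrealises_gtr[OF F sh(4) ER]; assumption)+
qed

theorem proposition1p29:
  fixes S :: "('a, 's) species"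
    and L :: "('a, 'k::field, 'v::ab_group_add) lspecies"
    and one :: "'a lab"
  shows
    "(is_species S \<and> card (str S {}) = 0 \<and> card (str S {one}) = 0 \<longrightarrow>
        HT_r S \<cong>\<^sub>w wX \<times>\<^sub>w wderiv (HT S) \<and>
        wshift 1 (HT_r S) \<cong>\<^sub>w wX +\<^sub>w wX \<times>\<^sub>w wComm \<circ>\<^sub>w wshift 1 (HT_h S) \<and>
        HT_h S \<cong>\<^sub>w wderiv (weightless S) \<circ>\<^sub>w wshift 1 (HT_r S) \<and>
        HT_e S \<cong>\<^sub>w weightless S \<circ>\<^sub>w wshift 1 (HT_r S) \<and>
        HT_re S \<cong>\<^sub>w HT_h S \<times>\<^sub>w wshift 1 (HT_r S) \<and>
        HT_h S \<times>\<^sub>w wshift 1 (HT_r S) \<cong>\<^sub>w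
          wshift (- 1) wX \<times>\<^sub>w (wX \<times>\<^sub>w (wOne +\<^sub>w wComm)) \<circ>\<^sub>w wshift 1 (HT_h S))
     \<and>
     (is_lspecies L \<and> lstr L {} = {0} \<and> lstr L {one} = {0} \<longrightarrow>
        gHT_r L \<cong>\<^sub>g gX \<times>\<^sub>g gderiv (gHT L) \<and>
        gshift 1 (gHT_r L) \<cong>\<^sub>g gX +\<^sub>g gX \<times>\<^sub>g gComm \<circ>\<^sub>g gshift 1 (gHT_h L) \<and>
        gHT_h L \<cong>\<^sub>g gderiv (gweightless L) \<circ>\<^sub>g gshift 1 (gHT_r L) \<and>
        gHT_e L \<cong>\<^sub>g gweightless L \<circ>\<^sub>g gshift 1 (gHT_r L) \<and>
        gHT_re L \<cong>\<^sub>g gHT_h L \<times>\<^sub>g gshift 1 (gHT_r L) \<and>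
        gHT_h L \<times>\<^sub>g gshift 1 (gHT_r L) \<cong>\<^sub>g
          gshift (- 1) gX \<times>\<^sub>g (gX \<times>\<^sub>g (gOne +\<^sub>g gComm)) \<circ>\<^sub>g gshift 1 (gHT_h L))"
  by (intro conjI impI; elim conjE; rule wiso_hypertrees giso_hypertrees; assumption)

end
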